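(* Let $\mathfrak{g}$ be a $Q$-good Lie algebra (with respect to $\pi: Q\to\mathbb{Z}$), let $\varphi:\mathfrak{n}\to\mathbb{C}$ be a homomorphism of Lie algebras, and suppose $(\mathfrak{g},\pi)$ is nonsingular with respect to $\varphi$. For any maximal ideal $\mathfrak{m}$ of $S(Z'')$, the $\mathfrak{g}$-module $L_{\varphi,\mathfrak{m}}=M_\varphi/\mathfrak{m}M_\varphi$ is simple, and every simple Whittaker module of type $\varphi$ is of this form (i.e. isomorphic to $L_{\varphi,\mathfrak{m}}$ for some maximal ideal $\mathfrak{m}$ of $S(Z'')$).
   Context: Setting. $Q$ is a free abelian group with a total order $\leq$ compatible with its group structure, and $\pi:Q\to\mathbb{Z}$ is a homomorphism of abelian groups that preserves the ordering ($\alpha\le\beta$ implies $\pi(\alpha)\le\pi(\beta)$). $\mathfrak{g}=\bigoplus_{\alpha\in Q}\mathfrak{g}_\alpha$ is a $Q$-graded Lie algebra over $\mathbb{C}$, i.e. $[\mathfrak{g}_\alpha,\mathfrak{g}_\beta]\subseteq\mathfrak{g}_{\alpha+\beta}$. $Z$ is the center of $\mathfrak{g}$; it is a graded ideal. Put $Q'=\{\alpha\in Q:\pi(\alpha)>0\}$, $Q''=\{\alpha\in Q:\pi(\alpha)\le 0\}$, $\mathfrak{n}=\bigoplus_{\alpha\in Q'}\mathfrak{g}_\alpha$, $\mathfrak{b}_-=\bigoplus_{\alpha\in Q''}\mathfrak{g}_\alpha$, so $\mathfrak{g}=\mathfrak{b}_-\oplus\mathfrak{n}$; write $\mathfrak{n}_\alpha=\mathfrak{g}_\alpha$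 for $\alpha\in Q'$. $\mathfrak{g}$ is called $Q$-good if $\dim\mathfrak{g}_\alpha\le 1$ for all $\alpha\in Q'$ and $\dim(\mathfrak{g}/Z)_\alpha\le 1$ for all $\alpha\in Q''$. Notation. $K=\{\alpha\in Q:\mathfrak{g}_\alpha\ne 0\}$, $K'=K\cap Q'$, $K''=K\cap Q''$, $R''=\{\alpha\in K'' : Z\cap\mathfrak{g}_\alpha=\mathfrak{g}_\alpha\}$, $Z''=Z\cap\mathfrak{b}_-$. For each $\alpha\in K\setminus R''$ fix a nonzero $x_\alpha\in\mathfrak{g}_\alpha$ with $x_\alpha\notin Z''$. $U(\cdot)$ is the universal enveloping algebra, and $S(Z'')$ is the symmetric algebra of $Z''$, viewed as the (central) subalgebra $U(Z'')$ of $U(\mathfrak{g})$. Whittaker modules. A vector $v$ in a $\mathfrak{g}$-module $V$ is a Whittaker vector of type $\varphi$ if $xv=\varphi(x)v$ for all $x\in\mathfrak{n}$. $V$ is a Whittaker module of type $\varphi$ if it is generated by some Whittaker vector of type $\varphi$. $\mathbb{C}_\varphi$ is the one-dimensional $\mathfrak{n}$-module with $xa=\varphi(x)a$, and $M_\varphi=U(\mathfrak{g})\otimes_{U(\mathfrak{n})}\mathbb{C}_\varphi$. Nonsingularity. $(\mathfrak{g},\pi)$ is nonsingular with respect to $\varphi$ if (1) the set $\{\alpha\in K':\varphi(x_\alpha)\ne 0\}$ admits a unique maximal element, denoted $\alpha_\varphi$; and (2) for every $\beta\in K''\setminus R''$ there exists $y\in\mathfrak{n}_{\alpha_\varphi-\beta}$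 such that $\varphi([y,x_\beta])\ne 0$. *)

theory Defs
  imports
    Complex_Main
    "HOL-Algebra.Algebraic_Closure_Type"
    "HOL-Algebra.Free_Abelian_Groups"
    "HOL-Algebra.Generated_Groups"
    "HOL-Algebra.QuotRing"
    "Jordan_Normal_Form.Missing_VectorSpace"
begin

section \<open>Lie algebras and their modules\<close>

abbreviation complex_ring :: "complex ring" where
  "complex_ring \<equiv> ring_of_type_algebra"

text \<open>
  The record type of modules extends that of rings; its fields for a ring multiplication and a unit
  are not used for vector spaces, Lie algebras and modules below.
\<close>

record 'a lie_algebra = "(complex, 'a) module" +
  bracket :: "'a \<Rightarrow> 'a \<Rightarrow> 'a"

locale lie_algebra = vectorspace complex_ring L
  for L :: "('a, 'c) lie_algebra_scheme" (structure) +
  assumes bracket_closed: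
      "\<lbrakk>x \<in> carrier L; y \<in> carrier L\<rbrakk> \<Longrightarrow> bracket L x y \<in> carrier L"
    and bracket_add_left:
      "\<lbrakk>x \<in> carrier L; y \<in> carrier L; z \<in> carrier L\<rbrakk>
        \<Longrightarrow> bracket L (x \<oplus> y) z = bracket L x z \<oplus> bracket L y z"
    and bracket_add_right:
      "\<lbrakk>x \<in> carrier L; y \<in> carrier L; z \<in> carrier L\<rbrakk>
        \<Longrightarrow> bracket L x (y \<oplus> z) = bracket L x y \<oplus> bracket L x z"
    and bracket_smult_left:
      "\<lbrakk>x \<in> carrier L; y \<in> carrier L\<rbrakk> \<Longrightarrow> bracket L (c \<odot> x) y = c \<odot> bracket L x y"
    and bracket_smult_right:
      "\<lbrakk>x \<in> carrier L; y \<in> carrier L\<rbrakk> \<Longrightarrow> bracket L x (c \<odot> y) = c \<odot> bracket L x y"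
    and bracket_self: "x \<in> carrier L \<Longrightarrow> bracket L x x = \<zero>"
    and jacobi:
      "\<lbrakk>x \<in> carrier L; y \<in> carrier L; z \<in> carrier L\<rbrakk>
        \<Longrightarrow> bracket L x (bracket L y z) \<oplus> bracket L y (bracket L z x)
              \<oplus> bracket L z (bracket L x y) = \<zero>"

definition lie_hom ::
  "('a, 'c) lie_algebra_scheme \<Rightarrow> ('b, 'd) lie_algebra_scheme \<Rightarrow> ('a \<Rightarrow> 'b) set" where
  "lie_hom L M = {f \<in> module_hom complex_ring L M.
     \<forall>x\<in>carrier L. \<forall>y\<in>carrier L. f (bracket L x y) = bracket M (f x) (f y)}"

definition complex_lie :: "complex lie_algebra" where
  "complex_lie = \<lparr>carrier = UNIV, monoid.mult = (*), one = 1, ring.zero = 0, add = (+),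
     module.smult = (*), bracket = (\<lambda>_ _. 0)\<rparr>"

definition lie_center :: "('a, 'c) lie_algebra_scheme \<Rightarrow> 'a set" where
  "lie_center L = {z \<in> carrier L. \<forall>x\<in>carrier L. bracket L z x = \<zero>\<^bsub>L\<^esub>}"

record ('g, 'v) lie_module = "(complex, 'v) module" +
  lact :: "'g \<Rightarrow> 'v \<Rightarrow> 'v"

locale lie_module = L?: lie_algebra L + V?: vectorspace complex_ring V
  for L :: "('g, 'c) lie_algebra_scheme" and V :: "('g, 'v, 'd) lie_module_scheme" +
  assumes lact_closed:
      "\<lbrakk>x \<in> carrier L; v \<in> carrier V\<rbrakk> \<Longrightarrow> lact V x v \<in> carrier V"
    and lact_add_left:
      "\<lbrakk>x \<in> carrier L; y \<in> carrier L; v \<in> carrier V\<rbrakk>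
        \<Longrightarrow> lact V (x \<oplus>\<^bsub>L\<^esub> y) v = lact V x v \<oplus>\<^bsub>V\<^esub> lact V y v"
    and lact_add_right:
      "\<lbrakk>x \<in> carrier L; v \<in> carrier V; w \<in> carrier V\<rbrakk>
        \<Longrightarrow> lact V x (v \<oplus>\<^bsub>V\<^esub> w) = lact V x v \<oplus>\<^bsub>V\<^esub> lact V x w"
    and lact_smult_left:
      "\<lbrakk>x \<in> carrier L; v \<in> carrier V\<rbrakk> \<Longrightarrow> lact V (c \<odot>\<^bsub>L\<^esub> x) v = c \<odot>\<^bsub>V\<^esub> lact V x v"
    and lact_smult_right:
      "\<lbrakk>x \<in> carrier L; v \<in> carrier V\<rbrakk> \<Longrightarrow> lact V x (c \<odot>\<^bsub>V\<^esub> v) = c \<odot>\<^bsub>V\<^esub> lact V x v"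
    and lact_bracket:
      "\<lbrakk>x \<in> carrier L; y \<in> carrier L; v \<in> carrier V\<rbrakk>
        \<Longrightarrow> lact V (bracket L x y) v = lact V x (lact V y v) \<ominus>\<^bsub>V\<^esub> lact V y (lact V x v)"

definition lie_submodule ::
  "('g, 'c) lie_algebra_scheme \<Rightarrow> 'v set \<Rightarrow> ('g, 'v, 'd) lie_module_scheme \<Rightarrow> bool" where
  "lie_submodule L W V \<longleftrightarrow>
     submodule complex_ring W V \<and> (\<forall>x\<in>carrier L. \<forall>w\<in>W. lact V x w \<in> W)"

definition simple_lie_module ::
  "('g, 'c) lie_algebra_scheme \<Rightarrow> ('g, 'v, 'd) lie_module_scheme \<Rightarrow> bool" where
  "simple_lie_module L V \<longleftrightarrow> lie_module L V \<and> carrier V \<noteq> {\<zero>\<^bsub>V\<^esub>} \<and>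
     (\<forall>W. lie_submodule L W V \<longrightarrow> W = {\<zero>\<^bsub>V\<^esub>} \<or> W = carrier V)"

definition lie_module_iso ::
  "('g, 'c) lie_algebra_scheme \<Rightarrow> ('g, 'v, 'd) lie_module_scheme
     \<Rightarrow> ('g, 'w, 'e) lie_module_scheme \<Rightarrow> bool" where
  "lie_module_iso L V W \<longleftrightarrow> (\<exists>f \<in> module_hom complex_ring V W.
     bij_betw f (carrier V) (carrier W) \<and>
     (\<forall>x\<in>carrier L. \<forall>v\<in>carrier V. f (lact V x v) = lact W x (f v)))"


section \<open>Quotient modules and extension of scalars\<close>

definition quot_module :: "('r, 'a, 'c) module_scheme \<Rightarrow> 'a set \<Rightarrow> ('r, 'a set) module" where
  "quot_module M N = \<lparr>carrier = a_rcosets\<^bsub>M\<^esub> N, monoid.mult = undefined, one = undefined,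
     ring.zero = N, add = set_add M,
     module.smult = (\<lambda>r C. \<Union>x\<in>C. N +>\<^bsub>M\<^esub> (r \<odot>\<^bsub>M\<^esub> x))\<rparr>"

definition ideal_smult :: "'r set \<Rightarrow> ('r, 'a, 'c) module_scheme \<Rightarrow> 'a set" where
  "ideal_smult I M = generate (add_monoid M) {r \<odot>\<^bsub>M\<^esub> x | r x. r \<in> I \<and> x \<in> carrier M}"

text \<open>
  For a homomorphism \<open>h\<close> from \<open>R\<close> to \<open>S\<close> and a left \<open>R\<close>-module \<open>B\<close>, the left \<open>S\<close>-module given by
  the tensor product over \<open>R\<close> of \<open>S\<close> (a right \<open>R\<close>-module through \<open>h\<close>) and \<open>B\<close>: the free abelian
  group on pairs, modulo the subgroup of the balanced bilinear relations. The rings need not be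
  commutative.
\<close>

definition tensor_relations ::
  "('r, 'm) ring_scheme \<Rightarrow> ('s, 'n) ring_scheme \<Rightarrow> ('r \<Rightarrow> 's) \<Rightarrow> ('r, 'b, 'c) module_scheme
     \<Rightarrow> ('s \<times> 'b \<Rightarrow>\<^sub>0 int) set" where
  "tensor_relations R S h B =
     {frag_of (s \<oplus>\<^bsub>S\<^esub> s', b) - frag_of (s, b) - frag_of (s', b) | s s' b.
        s \<in> carrier S \<and> s' \<in> carrier S \<and> b \<in> carrier B}
   \<union> {frag_of (s, b \<oplus>\<^bsub>B\<^esub> b') - frag_of (s, b) - frag_of (s, b') | s b b'.
        s \<in> carrier S \<and> b \<in> carrier B \<and> b' \<in> carrier B}
   \<union> {frag_of (s \<otimes>\<^bsub>S\<^esub> h r, b) - frag_of (s, r \<odot>\<^bsub>B\<^esub> b) | s r b.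
        s \<in> carrier S \<and> r \<in> carrier R \<and> b \<in> carrier B}"

definition extend_scalars ::
  "('r, 'm) ring_scheme \<Rightarrow> ('s, 'n) ring_scheme \<Rightarrow> ('r \<Rightarrow> 's) \<Rightarrow> ('r, 'b, 'c) module_scheme
     \<Rightarrow> ('s, ('s \<times> 'b \<Rightarrow>\<^sub>0 int) set) module" where
  "extend_scalars R S h B =
     (let F = free_Abelian_group (carrier S \<times> carrier B);
          N = generate F (tensor_relations R S h B)
      in \<lparr>carrier = carrier (F Mod N), monoid.mult = undefined, one = undefined,
          ring.zero = \<one>\<^bsub>F Mod N\<^esub>, add = monoid.mult (F Mod N),
          module.smult = (\<lambda>s C. \<Union>t\<in>C. N #>\<^bsub>F\<^esub> frag_extend (\<lambda>(s', b). frag_of (s \<otimes>\<^bsub>S\<^esub> s', b)) t)\<rparr>)"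


section \<open>Universal enveloping algebras\<close>

text \<open>
  The free associative unital complex algebra on a set: finitely supported coefficient functions on
  words, multiplied by convolution along concatenation.
\<close>

definition free_algebra :: "'a set \<Rightarrow> ('a list \<Rightarrow> complex) ring" where
  "free_algebra S =
     \<lparr>carrier = {f. finite {w. f w \<noteq> 0} \<and> (\<forall>w. f w \<noteq> 0 \<longrightarrow> set w \<subseteq> S)},
      monoid.mult = (\<lambda>f g w. \<Sum>i\<le>length w. f (take i w) * g (drop i w)),
      one = (\<lambda>w. if w = [] then 1 else 0),
      ring.zero = (\<lambda>_. 0),
      add = (\<lambda>f g w. f w + g w)\<rparr>"

definition word_monom :: "complex \<Rightarrow> 'a list \<Rightarrow> 'a list \<Rightarrow> complex" where
  "word_monom c w = (\<lambda>w'. if w' = w then c else 0)"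

text \<open>
  The first two sets of relations make the generators depend linearly on the elements of the Lie
  algebra, so that dividing by them gives its tensor algebra.
\<close>

definition env_relations :: "('a, 'c) lie_algebra_scheme \<Rightarrow> ('a list \<Rightarrow> complex) set" where
  "env_relations L =
     (let F = free_algebra (carrier L); g = (\<lambda>x. word_monom 1 [x]) in
       {(g x \<oplus>\<^bsub>F\<^esub> g y) \<ominus>\<^bsub>F\<^esub> g (x \<oplus>\<^bsub>L\<^esub> y) | x y. x \<in> carrier L \<and> y \<in> carrier L}
     \<union> {word_monom c [x] \<ominus>\<^bsub>F\<^esub> g (c \<odot>\<^bsub>L\<^esub> x) | c x. x \<in> carrier L}
     \<union> {(g x \<otimes>\<^bsub>F\<^esub> g y \<ominus>\<^bsub>F\<^esub> g y \<otimes>\<^bsub>F\<^esub> g x) \<ominus>\<^bsub>F\<^esub> g (bracket L x y) | x y.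
          x \<in> carrier L \<and> y \<in> carrier L})"

definition env_ideal :: "('a, 'c) lie_algebra_scheme \<Rightarrow> ('a list \<Rightarrow> complex) set" where
  "env_ideal L = Idl\<^bsub>free_algebra (carrier L)\<^esub> (env_relations L)"

definition env :: "('a, 'c) lie_algebra_scheme \<Rightarrow> ('a list \<Rightarrow> complex) set ring" where
  "env L = free_algebra (carrier L) Quot env_ideal L"

definition env_class ::
  "('a, 'c) lie_algebra_scheme \<Rightarrow> ('a list \<Rightarrow> complex) \<Rightarrow> ('a list \<Rightarrow> complex) set" where
  "env_class L f = env_ideal L +>\<^bsub>free_algebra (carrier L)\<^esub> f"

text \<open>
  The homomorphism of enveloping algebras induced by the inclusion of a subalgebra \<open>H\<close> of \<open>L\<close>, and
  its image, which is how the enveloping algebra of \<open>H\<close> is viewed as a subalgebra of that of \<open>L\<close>.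
\<close>

definition env_incl ::
  "('a, 'c) lie_algebra_scheme \<Rightarrow> ('a, 'd) lie_algebra_scheme
     \<Rightarrow> ('a list \<Rightarrow> complex) set \<Rightarrow> ('a list \<Rightarrow> complex) set" where
  "env_incl H L C = (\<Union>f\<in>C. env_class L f)"

definition sub_env ::
  "('a, 'c) lie_algebra_scheme \<Rightarrow> ('a, 'd) lie_algebra_scheme
     \<Rightarrow> ('a list \<Rightarrow> complex) set ring" where
  "sub_env H L = (env L)\<lparr>carrier := env_incl H L ` carrier (env H)\<rparr>"

text \<open>
  A module over a Lie algebra as a module over the enveloping algebra: a word acts by the successive
  actions of its letters, the last letter first. A class acts by the common action of its elements.
\<close>

definition word_act ::
  "('g, 'v, 'c) lie_module_scheme \<Rightarrow> ('g list \<Rightarrow> complex) \<Rightarrow> 'v \<Rightarrow> 'v" where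
  "word_act V f v = (\<Oplus>\<^bsub>V\<^esub>w\<in>{w. f w \<noteq> 0}. f w \<odot>\<^bsub>V\<^esub> foldr (lact V) w v)"

definition env_module ::
  "('g, 'v, 'c) lie_module_scheme \<Rightarrow> (('g list \<Rightarrow> complex) set, 'v) module" where
  "env_module V = \<lparr>carrier = carrier V, monoid.mult = undefined, one = undefined,
     ring.zero = \<zero>\<^bsub>V\<^esub>, add = add V, module.smult = (\<lambda>C v. the_elem ((\<lambda>f. word_act V f v) ` C))\<rparr>"

definition lie_module_of_env ::
  "('g, 'c) lie_algebra_scheme \<Rightarrow> (('g list \<Rightarrow> complex) set, 'v, 'd) module_scheme
     \<Rightarrow> ('g, 'v) lie_module" where
  "lie_module_of_env L M = \<lparr>carrier = carrier M, monoid.mult = undefined, one = undefined,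
     ring.zero = \<zero>\<^bsub>M\<^esub>, add = add M,
     module.smult = (\<lambda>c v. env_class L (word_monom c []) \<odot>\<^bsub>M\<^esub> v),
     lact = (\<lambda>x v. env_class L (word_monom 1 [x]) \<odot>\<^bsub>M\<^esub> v)\<rparr>"


section \<open>Graded Lie algebras\<close>

definition additive_group :: "'q::ab_group_add monoid" where
  "additive_group = \<lparr>carrier = UNIV, monoid.mult = (+), one = 0\<rparr>"

locale graded_lie_algebra = lie_algebra L for L :: "('a, 'c) lie_algebra_scheme" (structure) +
  fixes gr :: "'q::ab_group_add \<Rightarrow> 'a set"
  assumes gr_subspace: "subspace complex_ring (gr \<alpha>) L"
    and gr_direct_sum: "x \<in> carrier L \<Longrightarrow>
      \<exists>!f. (\<forall>\<alpha>. f \<alpha> \<in> gr \<alpha>) \<and> finite {\<alpha>. f \<alpha> \<noteq> \<zero>} \<and> x = (\<Oplus>\<alpha>\<in>{\<alpha>. f \<alpha> \<noteq> \<zero>}. f \<alpha>)"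
    and gr_bracket: "\<lbrakk>x \<in> gr \<alpha>; y \<in> gr \<beta>\<rbrakk> \<Longrightarrow> bracket L x y \<in> gr (\<alpha> + \<beta>)"

definition graded_part :: "('a, 'c) ring_scheme \<Rightarrow> ('q \<Rightarrow> 'a set) \<Rightarrow> 'q set \<Rightarrow> 'a set" where
  "graded_part L gr A = {\<Oplus>\<^bsub>L\<^esub>\<alpha>\<in>F. f \<alpha> | F f. finite F \<and> F \<subseteq> A \<and> (\<forall>\<alpha>\<in>F. f \<alpha> \<in> gr \<alpha>)}"

definition lie_n ::
  "'a lie_algebra \<Rightarrow> ('q \<Rightarrow> 'a set) \<Rightarrow> ('q \<Rightarrow> int) \<Rightarrow> 'a lie_algebra" where
  "lie_n L gr \<pi> = L\<lparr>carrier := graded_part L gr {\<alpha>. \<pi> \<alpha> > 0}\<rparr>"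

definition lie_b_minus ::
  "'a lie_algebra \<Rightarrow> ('q \<Rightarrow> 'a set) \<Rightarrow> ('q \<Rightarrow> int) \<Rightarrow> 'a lie_algebra" where
  "lie_b_minus L gr \<pi> = L\<lparr>carrier := graded_part L gr {\<alpha>. \<pi> \<alpha> \<le> 0}\<rparr>"

definition lie_Z_minus ::
  "'a lie_algebra \<Rightarrow> ('q \<Rightarrow> 'a set) \<Rightarrow> ('q \<Rightarrow> int) \<Rightarrow> 'a lie_algebra" where
  "lie_Z_minus L gr \<pi> = L\<lparr>carrier := lie_center L \<inter> carrier (lie_b_minus L gr \<pi>)\<rparr>"

text \<open>Finite-dimensionality is required separately, the library's dimension being a natural number.\<close>

definition dim_at_most :: "nat \<Rightarrow> (complex, 'a, 'c) module_scheme \<Rightarrow> bool" where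
  "dim_at_most n V \<longleftrightarrow>
     vectorspace.fin_dim complex_ring V \<and> vectorspace.dim complex_ring V \<le> n"

definition center_quot_gr ::
  "'a lie_algebra \<Rightarrow> ('q \<Rightarrow> 'a set) \<Rightarrow> 'q \<Rightarrow> (complex, 'a set) module" where
  "center_quot_gr L gr \<alpha> =
     (quot_module L (lie_center L))\<lparr>carrier := (\<lambda>x. lie_center L +>\<^bsub>L\<^esub> x) ` gr \<alpha>\<rparr>"

definition Q_good :: "'a lie_algebra \<Rightarrow> ('q \<Rightarrow> 'a set) \<Rightarrow> ('q \<Rightarrow> int) \<Rightarrow> bool" where
  "Q_good L gr \<pi> \<longleftrightarrow>
     (\<forall>\<alpha>. \<pi> \<alpha> > 0 \<longrightarrow> dim_at_most 1 (L\<lparr>carrier := gr \<alpha>\<rparr>)) \<and>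
     (\<forall>\<alpha>. \<pi> \<alpha> \<le> 0 \<longrightarrow> dim_at_most 1 (center_quot_gr L gr \<alpha>))"

definition gr_support :: "'a lie_algebra \<Rightarrow> ('q \<Rightarrow> 'a set) \<Rightarrow> 'q set" where
  "gr_support L gr = {\<alpha>. gr \<alpha> \<noteq> {\<zero>\<^bsub>L\<^esub>}}"

definition central_degrees ::
  "'a lie_algebra \<Rightarrow> ('q \<Rightarrow> 'a set) \<Rightarrow> ('q \<Rightarrow> int) \<Rightarrow> 'q set" where
  "central_degrees L gr \<pi> =
     {\<alpha> \<in> gr_support L gr. \<pi> \<alpha> \<le> 0 \<and> lie_center L \<inter> gr \<alpha> = gr \<alpha>}"


section \<open>Whittaker modules\<close>

definition whittaker_vector ::
  "('g, 'c) lie_algebra_scheme \<Rightarrow> ('g \<Rightarrow> complex) \<Rightarrow> ('g, 'v, 'd) lie_module_scheme \<Rightarrow> 'v \<Rightarrow> bool"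
  where
  "whittaker_vector N \<phi> V v \<longleftrightarrow>
     v \<in> carrier V \<and> (\<forall>x\<in>carrier N. lact V x v = \<phi> x \<odot>\<^bsub>V\<^esub> v)"

definition whittaker_module ::
  "('g, 'c) lie_algebra_scheme \<Rightarrow> ('g, 'c') lie_algebra_scheme \<Rightarrow> ('g \<Rightarrow> complex)
     \<Rightarrow> ('g, 'v, 'd) lie_module_scheme \<Rightarrow> bool" where
  "whittaker_module L N \<phi> V \<longleftrightarrow> lie_module L V \<and>
     (\<exists>v. whittaker_vector N \<phi> V v \<and>
          (\<forall>W. lie_submodule L W V \<and> v \<in> W \<longrightarrow> W = carrier V))"

definition one_dim_module :: "('g \<Rightarrow> complex) \<Rightarrow> ('g, complex) lie_module" where
  "one_dim_module \<phi> = \<lparr>carrier = UNIV, monoid.mult = (*), one = 1, ring.zero = 0, add = (+),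
     module.smult = (*), lact = (\<lambda>x a. \<phi> x * a)\<rparr>"

text \<open>
  The first module is over the enveloping algebra, so that ideals of its subalgebras act on it; the
  second is over the Lie algebra.
\<close>

definition whittaker_M ::
  "'g lie_algebra \<Rightarrow> 'g lie_algebra \<Rightarrow> ('g \<Rightarrow> complex) \<Rightarrow>
    (('g list \<Rightarrow> complex) set, (('g list \<Rightarrow> complex) set \<times> complex \<Rightarrow>\<^sub>0 int) set) module" where
  "whittaker_M L N \<phi> =
     extend_scalars (env N) (env L) (env_incl N L) (env_module (one_dim_module \<phi>))"

definition whittaker_L ::
  "'g lie_algebra \<Rightarrow> 'g lie_algebra \<Rightarrow> ('g \<Rightarrow> complex) \<Rightarrow> ('g list \<Rightarrow> complex) set set \<Rightarrow>
    ('g, (('g list \<Rightarrow> complex) set \<times> complex \<Rightarrow>\<^sub>0 int) set set) lie_module" where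
  "whittaker_L L N \<phi> m =
     (let M = whittaker_M L N \<phi> in lie_module_of_env L (quot_module M (ideal_smult m M)))"

definition maximal_in :: "'q::order set \<Rightarrow> 'q \<Rightarrow> bool" where
  "maximal_in A a \<longleftrightarrow> a \<in> A \<and> (\<forall>b\<in>A. \<not> a < b)"

text \<open>The degree \<open>\<alpha>\<^sub>\<phi> - \<beta>\<close> is always one of those spanned by the subalgebra on which \<open>\<phi>\<close> is given.\<close>

definition nonsingular ::
  "'g lie_algebra \<Rightarrow> ('q::linordered_ab_group_add \<Rightarrow> 'g set) \<Rightarrow> ('q \<Rightarrow> int) \<Rightarrow> ('q \<Rightarrow> 'g)
     \<Rightarrow> ('g \<Rightarrow> complex) \<Rightarrow> bool" where
  "nonsingular L gr \<pi> x \<phi> \<longleftrightarrow>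
     (let A = {\<alpha> \<in> gr_support L gr. \<pi> \<alpha> > 0 \<and> \<phi> (x \<alpha>) \<noteq> 0};
          \<alpha>\<^sub>\<phi> = (THE \<alpha>. maximal_in A \<alpha>)
      in (\<exists>!\<alpha>. maximal_in A \<alpha>) \<and>
         (\<forall>\<beta> \<in> gr_support L gr. \<pi> \<beta> \<le> 0 \<and> \<beta> \<notin> central_degrees L gr \<pi> \<longrightarrow>
            (\<exists>y \<in> gr (\<alpha>\<^sub>\<phi> - \<beta>). \<phi> (bracket L y (x \<beta>)) \<noteq> 0)))"

end

(*
  A functional on A = U(Z'') that vanishes on m but not at 1 extends to U(g): straighten a word in
  the x_alpha into sorted form, then apply phi to the letters of positive degree. The
  Jacobi identity makes this consistent, and the functional so obtained generates, inside the dual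
  of U(g), a Whittaker module killed by m. Hence M_phi / m M_phi is nonzero.

  A module V generated by a Whittaker vector w is filtered over A by the words in the x_beta with
  beta in K'' - R'', where x_beta has weight pi(alpha_phi) - pi(beta) > 0. Modulo lower terms the
  letters commute, and y - phi(y), for y in n of degree alpha_phi - beta with beta the least letter
  that occurs, acts on the leading part as phi([y, x_beta]) times the derivative along x_beta; here
  nonsingularity enters. So every nonzero vector is moved by U(g) to some nonzero c w with c in A,
  and the Whittaker vectors of V are exactly the c w. If V = L_{phi,m}, then c is invertible modulo
  m, which proves simplicity. If V is simple, every a in A that does not kill w acts bijectively; the
  preimage of w is a Whittaker vector, thus equal to c w, so the annihilator m of w in A is maximal,
  and V is isomorphic to the simple module L_{phi,m}.
*)
theory Submission
  imports Defs
begin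

section \<open>The free algebra\<close>

text \<open>Write h for pi(alpha_phi), so that x_beta weighs h - pi(beta). The bracket of two
  letters carries the sum of their degrees, so its weight falls short of the sum of the weights by
  h, and a central remainder, of weight 0, lies no higher. For y in n of degree gamma the operator y
  - phi(y) kills w; bracketing y into a letter of degree delta leaves an element that raises weights
  by at most h - pi(gamma + delta), a net loss of pi(gamma). For gamma = alpha_phi - beta this loss
  is exactly the weight of x_beta, so on leading parts the operator can only strike out one letter.
  With a letter delta > beta the bracket has degree above alpha_phi, where phi vanishes; this is why
  beta must be the least letter. Every letter weighs at least h > 0, so the descent ends at weight
  0, in A w. The order on Q has a second use. As pi is monotone, the letters of positive degree come
  last in a sorted word, next to the Whittaker vector, and phi can be applied to them there. That a
  tensor product modulo m is nonzero is hard to see directly; in the dual of U(g) the nonvanishing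
  is read off from one value, at the empty word.\<close>

lemma free_algebra_carrier:
  "f \<in> carrier (free_algebra S) \<longleftrightarrow> finite {w. f w \<noteq> 0} \<and> (\<forall>w. f w \<noteq> 0 \<longrightarrow> set w \<subseteq> S)"
  by (simp add: free_algebra_def)

lemma free_algebra_add: "f \<oplus>\<^bsub>free_algebra S\<^esub> g = (\<lambda>w. f w + g w)"
  by (simp add: free_algebra_def)

lemma free_algebra_zero: "\<zero>\<^bsub>free_algebra S\<^esub> = (\<lambda>_. 0)"
  by (simp add: free_algebra_def)

lemma free_algebra_one: "\<one>\<^bsub>free_algebra S\<^esub> = word_monom 1 []"
  by (auto simp: free_algebra_def word_monom_def)

lemma free_algebra_mult:
  "f \<otimes>\<^bsub>free_algebra S\<^esub> g = (\<lambda>w. \<Sum>i\<le>length w. f (take i w) * g (drop i w))"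
  by (simp add: free_algebra_def)

text \<open>A finite support is emptied one word at a time. Additive statements about the free
  algebra thereby reduce to single words, where multiplication is concatenation.\<close>

lemma free_algebra_induct [consumes 1, case_names zero add]:
  assumes f: "f \<in> carrier (free_algebra S)"
    and z: "P (\<lambda>_. 0)"
    and a: "\<And>f c w. \<lbrakk>f \<in> carrier (free_algebra S); P f; set w \<subseteq> S\<rbrakk> \<Longrightarrow>
      P (\<lambda>v. word_monom c w v + f v)"
  shows "P f"
proof -
  \<comment> \<open>The induction runs over a finite set containing the support, with
    \<open>f\<close> arbitrary, because the step passes to another function.\<close>
  have "\<And>f. {w. f w \<noteq> 0} \<subseteq> F \<Longrightarrow> \<forall>w. f w \<noteq> 0 \<longrightarrow> set w \<subseteq> S \<Longrightarrow> P f"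
    if "finite F" for F :: "'a list set"
    using that
  proof (induction F)
    case empty
    then have "f = (\<lambda>_. 0)" by auto
    with z show ?case by simp
  next
    case (insert w F)
    show ?case
    proof (cases "f w = 0")
      case True
      then show ?thesis using insert by (intro insert.IH) auto
    next
      case False
      let ?g = "f(w := 0)"
      have g: "{v. ?g v \<noteq> 0} \<subseteq> F" "\<forall>v. ?g v \<noteq> 0 \<longrightarrow> set v \<subseteq> S"
        using insert.prems by auto
      have "finite {v. ?g v \<noteq> 0}" using g(1) insert.hyps(1) finite_subset by blast
      then have "?g \<in> carrier (free_algebra S)" using g(2) by (simp add: free_algebra_carrier)
      from a[OF this insert.IH[OF g], of w "f w"] False insert.prems(2)
      have "P (\<lambda>v. word_monom (f w) w v + ?g v)" by blast
      moreover have "(\<lambda>v. word_monom (f w) w v + ?g v) = f"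
        by (auto simp: word_monom_def)
      ultimately show ?thesis by simp
    qed
  qed
  from this[of "{w. f w \<noteq> 0}" f] show ?thesis using f by (simp add: free_algebra_carrier)
qed

lemma word_monom_closed: "set w \<subseteq> S \<Longrightarrow> word_monom c w \<in> carrier (free_algebra S)"
  by (auto simp: free_algebra_carrier word_monom_def)

lemma free_algebra_add_closed:
  assumes "f \<in> carrier (free_algebra S)" "g \<in> carrier (free_algebra S)"
  shows "(\<lambda>w. f w + g w) \<in> carrier (free_algebra S)"
proof -
  have "{w. f w + g w \<noteq> 0} \<subseteq> {w. f w \<noteq> 0} \<union> {w. g w \<noteq> 0}" by auto
  then have "finite {w. f w + g w \<noteq> 0}"
    using assms by (auto simp: free_algebra_carrier intro: finite_subset)
  then show ?thesis using assms unfolding free_algebra_carrier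
    by (metis add.left_neutral)
qed

lemma word_monom_mult:
  "word_monom c u \<otimes>\<^bsub>free_algebra S\<^esub> word_monom d v = word_monom (c * d) (u @ v)"
proof
  fix w
  \<comment> \<open>At most one cut of \<open>w\<close> contributes: the one at
    \<open>length u\<close>, and only if \<open>w\<close> is \<open>u @ v\<close>.\<close>
  have "(\<Sum>i\<le>length w. word_monom c u (take i w) * word_monom d v (drop i w))
    = (\<Sum>i\<le>length w. if i = length u then (if w = u @ v then c * d else 0) else 0)"
  proof (rule sum.cong)
    fix i assume "i \<in> {..length w}"
    then have "take i w = u \<and> drop i w = v \<longleftrightarrow> i = length u \<and> w = u @ v"
      by (metis append_eq_conv_conj atMost_iff length_take min.absorb2)
    moreover have "word_monom c u (take i w) * word_monom d v (drop i w) =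
      (if take i w = u \<and> drop i w = v then c * d else 0)"
      by (simp add: word_monom_def)
    ultimately show "word_monom c u (take i w) * word_monom d v (drop i w) =
      (if i = length u then (if w = u @ v then c * d else 0) else 0)"
      by auto
  qed simp
  also have "\<dots> = word_monom (c * d) (u @ v) w"
    by (auto simp: word_monom_def)
  finally show "(word_monom c u \<otimes>\<^bsub>free_algebra S\<^esub> word_monom d v) w = word_monom (c * d) (u @ v) w"
    by (simp add: free_algebra_mult)
qed

lemma free_algebra_mult_distrib:
  "(\<lambda>w. f w + g w) \<otimes>\<^bsub>free_algebra S\<^esub> h =
     (\<lambda>w. (f \<otimes>\<^bsub>free_algebra S\<^esub> h) w + (g \<otimes>\<^bsub>free_algebra S\<^esub> h) w)"
  "h \<otimes>\<^bsub>free_algebra S\<^esub> (\<lambda>w. f w + g w) =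
     (\<lambda>w. (h \<otimes>\<^bsub>free_algebra S\<^esub> f) w + (h \<otimes>\<^bsub>free_algebra S\<^esub> g) w)"
  by (auto simp: free_algebra_mult algebra_simps sum.distrib)

lemma free_algebra_mult_zero:
  "(\<lambda>_. 0) \<otimes>\<^bsub>free_algebra S\<^esub> h = (\<lambda>_. 0)" "h \<otimes>\<^bsub>free_algebra S\<^esub> (\<lambda>_. 0) = (\<lambda>_. 0)"
  by (auto simp: free_algebra_mult)

lemma zero_free_algebra_closed: "(\<lambda>_. 0) \<in> carrier (free_algebra S)"
  by (simp add: free_algebra_carrier)

lemma free_algebra_mult_closed:
  assumes f: "f \<in> carrier (free_algebra S)" and g: "g \<in> carrier (free_algebra S)"
  shows "f \<otimes>\<^bsub>free_algebra S\<^esub> g \<in> carrier (free_algebra S)"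
  using f
proof (induction f rule: free_algebra_induct)
  case (add f c u)
  from g have "word_monom c u \<otimes>\<^bsub>free_algebra S\<^esub> g \<in> carrier (free_algebra S)"
    by (induction g rule: free_algebra_induct)
      (use add.hyps in \<open>auto simp: free_algebra_mult_zero zero_free_algebra_closed word_monom_mult
        free_algebra_mult_distrib intro!: free_algebra_add_closed word_monom_closed\<close>)
  then show ?case using add by (simp add: free_algebra_mult_distrib free_algebra_add_closed)
qed (simp_all add: free_algebra_mult_zero zero_free_algebra_closed)

text \<open>Three nested inductions reduce the claim to three words, where it is associativity of
  concatenation.\<close>

lemma free_algebra_mult_assoc:
  assumes f: "f \<in> carrier (free_algebra S)" and g: "g \<in> carrier (free_algebra S)"
    and h: "h \<in> carrier (free_algebra S)"
  shows "(f \<otimes>\<^bsub>free_algebra S\<^esub> g) \<otimes>\<^bsub>free_algebra S\<^esub> h = f \<otimes>\<^bsub>free_algebra S\<^esub> (g \<otimes>\<^bsub>free_algebra S\<^esub> h)"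
  using f
proof (induction f rule: free_algebra_induct)
  case (add f c u)
  from g have "(word_monom c u \<otimes>\<^bsub>free_algebra S\<^esub> g) \<otimes>\<^bsub>free_algebra S\<^esub> h
      = word_monom c u \<otimes>\<^bsub>free_algebra S\<^esub> (g \<otimes>\<^bsub>free_algebra S\<^esub> h)"
  proof (induction g rule: free_algebra_induct)
    case (add g d v)
    from h have "(word_monom c u \<otimes>\<^bsub>free_algebra S\<^esub> word_monom d v) \<otimes>\<^bsub>free_algebra S\<^esub> h
      = word_monom c u \<otimes>\<^bsub>free_algebra S\<^esub> (word_monom d v \<otimes>\<^bsub>free_algebra S\<^esub> h)"
      by (induction h rule: free_algebra_induct)
        (simp_all add: free_algebra_mult_zero free_algebra_mult_distrib word_monom_mult algebra_simps)
    then show ?case using add by (simp add: free_algebra_mult_distrib)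
  qed (simp add: free_algebra_mult_zero)
  then show ?case using add by (simp add: free_algebra_mult_distrib)
qed (simp add: free_algebra_mult_zero)

lemma free_algebra_mult_one:
  "word_monom 1 [] \<otimes>\<^bsub>free_algebra S\<^esub> f = f" "f \<otimes>\<^bsub>free_algebra S\<^esub> word_monom 1 [] = f"
proof -
  show "word_monom 1 [] \<otimes>\<^bsub>free_algebra S\<^esub> f = f"
  proof
    fix w
    have "(\<Sum>i\<le>length w. word_monom 1 [] (take i w) * f (drop i w))
      = (\<Sum>i\<le>length w. if i = 0 then f w else 0)"
      by (rule sum.cong) (auto simp: word_monom_def)
    then show "(word_monom 1 [] \<otimes>\<^bsub>free_algebra S\<^esub> f) w = f w" by (simp add: free_algebra_mult)
  qed
  show "f \<otimes>\<^bsub>free_algebra S\<^esub> word_monom 1 [] = f"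
  proof
    fix w
    have "(\<Sum>i\<le>length w. f (take i w) * word_monom 1 [] (drop i w))
      = (\<Sum>i\<le>length w. if i = length w then f w else 0)"
      by (rule sum.cong) (auto simp: word_monom_def)
    then show "(f \<otimes>\<^bsub>free_algebra S\<^esub> word_monom 1 []) w = f w" by (simp add: free_algebra_mult)
  qed
qed

lemma ring_free_algebra: "ring (free_algebra S)"
proof (rule ringI)
  show "abelian_group (free_algebra S)"
  proof (rule abelian_groupI)
    fix f assume f: "f \<in> carrier (free_algebra S)"
    have "(\<lambda>w. - f w) \<in> carrier (free_algebra S)" using f by (simp add: free_algebra_carrier)
    then show "\<exists>g\<in>carrier (free_algebra S). g \<oplus>\<^bsub>free_algebra S\<^esub> f = \<zero>\<^bsub>free_algebra S\<^esub>"
      by (intro bexI[of _ "\<lambda>w. - f w"]) (simp_all add: free_algebra_add free_algebra_zero)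
  qed (simp_all add: free_algebra_add free_algebra_zero zero_free_algebra_closed
      free_algebra_add_closed algebra_simps)
  show "monoid (free_algebra S)"
    by (rule monoidI) (simp_all add: free_algebra_mult_closed free_algebra_one word_monom_closed
        free_algebra_mult_assoc free_algebra_mult_one)
qed (simp_all add: free_algebra_add free_algebra_mult_distrib)

interpretation FA: ring "free_algebra S" for S
  by (rule ring_free_algebra)

lemma free_algebra_uminus:
  assumes "f \<in> carrier (free_algebra S)"
  shows "\<ominus>\<^bsub>free_algebra S\<^esub> f = (\<lambda>w. - f w)"
proof (rule FA.minus_equality)
  show "(\<lambda>w. - f w) \<in> carrier (free_algebra S)" using assms by (simp add: free_algebra_carrier)
qed (use assms in \<open>auto simp: free_algebra_add free_algebra_zero\<close>)

lemma free_algebra_minus: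
  assumes "g \<in> carrier (free_algebra S)"
  shows "f \<ominus>\<^bsub>free_algebra S\<^esub> g = (\<lambda>w. f w - g w)"
  using assms by (simp add: a_minus_def free_algebra_uminus free_algebra_add)

section \<open>Complex scalars and vector spaces\<close>

lemma complex_ring_simps [simp]:
  "carrier complex_ring = (UNIV :: complex set)"
  "add complex_ring = ((+) :: complex \<Rightarrow> _)"
  "monoid.mult complex_ring = ((*) :: complex \<Rightarrow> _)"
  "one complex_ring = (1 :: complex)" "ring.zero complex_ring = (0 :: complex)"
  by (simp_all add: ring_of_type_algebra_def)

lemma field_complex_ring: "field (complex_ring :: complex ring)"
  by (rule field_from_type_algebra)

lemma cring_complex_ring: "cring (complex_ring :: complex ring)"
  by (rule cring_from_type_algebra)

text \<open>Scalars are written with the operations of the type \<open>complex\<close>, so that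
  later calculations are freed from the record \<open>complex_ring\<close>.\<close>

lemma complex_vectorspaceI:
  fixes V :: "(complex, 'v, 'b) module_scheme"
  assumes "abelian_group V"
    and "\<And>c v. v \<in> carrier V \<Longrightarrow> c \<odot>\<^bsub>V\<^esub> v \<in> carrier V"
    and "\<And>c d v. v \<in> carrier V \<Longrightarrow> (c + d) \<odot>\<^bsub>V\<^esub> v = c \<odot>\<^bsub>V\<^esub> v \<oplus>\<^bsub>V\<^esub> d \<odot>\<^bsub>V\<^esub> v"
    and "\<And>c v w. \<lbrakk>v \<in> carrier V; w \<in> carrier V\<rbrakk> \<Longrightarrow>
      c \<odot>\<^bsub>V\<^esub> (v \<oplus>\<^bsub>V\<^esub> w) = c \<odot>\<^bsub>V\<^esub> v \<oplus>\<^bsub>V\<^esub> c \<odot>\<^bsub>V\<^esub> w"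
    and "\<And>c d v. v \<in> carrier V \<Longrightarrow> (c * d) \<odot>\<^bsub>V\<^esub> v = c \<odot>\<^bsub>V\<^esub> (d \<odot>\<^bsub>V\<^esub> v)"
    and "\<And>v. v \<in> carrier V \<Longrightarrow> 1 \<odot>\<^bsub>V\<^esub> v = v"
  shows "vectorspace complex_ring V"
  unfolding vectorspace_def
  by (intro conjI moduleI field_complex_ring cring_complex_ring) (use assms in auto)

lemma complex_vectorspaceD:
  fixes V :: "(complex, 'v, 'b) module_scheme"
  assumes "vectorspace complex_ring V"
  shows "abelian_group V"
    and "\<And>c v. v \<in> carrier V \<Longrightarrow> c \<odot>\<^bsub>V\<^esub> v \<in> carrier V"
    and "\<And>c d v. v \<in> carrier V \<Longrightarrow> (c + d) \<odot>\<^bsub>V\<^esub> v = c \<odot>\<^bsub>V\<^esub> v \<oplus>\<^bsub>V\<^esub> d \<odot>\<^bsub>V\<^esub> v"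
    and "\<And>c v w. \<lbrakk>v \<in> carrier V; w \<in> carrier V\<rbrakk> \<Longrightarrow>
      c \<odot>\<^bsub>V\<^esub> (v \<oplus>\<^bsub>V\<^esub> w) = c \<odot>\<^bsub>V\<^esub> v \<oplus>\<^bsub>V\<^esub> c \<odot>\<^bsub>V\<^esub> w"
    and "\<And>c d v. v \<in> carrier V \<Longrightarrow> (c * d) \<odot>\<^bsub>V\<^esub> v = c \<odot>\<^bsub>V\<^esub> (d \<odot>\<^bsub>V\<^esub> v)"
    and "\<And>v. v \<in> carrier V \<Longrightarrow> 1 \<odot>\<^bsub>V\<^esub> v = v"
    and "\<And>v. v \<in> carrier V \<Longrightarrow> 0 \<odot>\<^bsub>V\<^esub> v = \<zero>\<^bsub>V\<^esub>"
    and "\<And>c. c \<odot>\<^bsub>V\<^esub> \<zero>\<^bsub>V\<^esub> = \<zero>\<^bsub>V\<^esub>"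
    and "\<And>v. v \<in> carrier V \<Longrightarrow> (-1) \<odot>\<^bsub>V\<^esub> v = \<ominus>\<^bsub>V\<^esub> v"
proof -
  interpret vectorspace complex_ring V by fact
  show ag: "abelian_group V" ..
  interpret A: abelian_group V by fact
  show cl: "\<And>c v. v \<in> carrier V \<Longrightarrow> c \<odot>\<^bsub>V\<^esub> v \<in> carrier V" using module.smult_closed by simp
  show ld: "\<And>c d v. v \<in> carrier V \<Longrightarrow> (c + d) \<odot>\<^bsub>V\<^esub> v = c \<odot>\<^bsub>V\<^esub> v \<oplus>\<^bsub>V\<^esub> d \<odot>\<^bsub>V\<^esub> v"
    using module.smult_l_distr by simp
  show rd: "\<And>c v w. \<lbrakk>v \<in> carrier V; w \<in> carrier V\<rbrakk> \<Longrightarrow>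
      c \<odot>\<^bsub>V\<^esub> (v \<oplus>\<^bsub>V\<^esub> w) = c \<odot>\<^bsub>V\<^esub> v \<oplus>\<^bsub>V\<^esub> c \<odot>\<^bsub>V\<^esub> w"
    using module.smult_r_distr by simp
  show "\<And>c d v. v \<in> carrier V \<Longrightarrow> (c * d) \<odot>\<^bsub>V\<^esub> v = c \<odot>\<^bsub>V\<^esub> (d \<odot>\<^bsub>V\<^esub> v)"
    using module.smult_assoc1 by simp
  show o: "\<And>v. v \<in> carrier V \<Longrightarrow> 1 \<odot>\<^bsub>V\<^esub> v = v"
    using module.smult_one by simp
  show z: "0 \<odot>\<^bsub>V\<^esub> v = \<zero>\<^bsub>V\<^esub>" if "v \<in> carrier V" for v
    using ld[OF that, of 0 0] cl[OF that, of 0] by simp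
  show "c \<odot>\<^bsub>V\<^esub> \<zero>\<^bsub>V\<^esub> = \<zero>\<^bsub>V\<^esub>" for c
    using rd[of "\<zero>\<^bsub>V\<^esub>" "\<zero>\<^bsub>V\<^esub>" c] cl[of "\<zero>\<^bsub>V\<^esub>" c] by simp
  show "(-1) \<odot>\<^bsub>V\<^esub> v = \<ominus>\<^bsub>V\<^esub> v" if v: "v \<in> carrier V" for v
    using ld[OF v, of "-1" 1] cl[OF v] z[OF v] o[OF v] v
    by (intro abelian_group.minus_equality[OF ag, symmetric]) simp_all
qed

section \<open>The enveloping algebra\<close>

abbreviation env_gen :: "('a, 'c) lie_algebra_scheme \<Rightarrow> 'a \<Rightarrow> ('a list \<Rightarrow> complex) set" where
  "env_gen L x \<equiv> env_class L (word_monom 1 [x])"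

abbreviation env_scal :: "('a, 'c) lie_algebra_scheme \<Rightarrow> complex \<Rightarrow> ('a list \<Rightarrow> complex) set" where
  "env_scal L c \<equiv> env_class L (word_monom c [])"

context lie_algebra
begin

lemmas L_vs = complex_vectorspaceD[OF vectorspace_axioms]

text \<open>As explicit coefficient functions, the relations visibly pass unchanged from a
  subalgebra to the whole algebra, and their action on a module can be computed word by
  word.\<close>

lemma env_relations_iff:
  "r \<in> env_relations L \<longleftrightarrow>
     (\<exists>x\<in>carrier L. \<exists>y\<in>carrier L. r = (\<lambda>w. word_monom 1 [x] w + word_monom 1 [y] w - word_monom 1 [x \<oplus> y] w))
   \<or> (\<exists>c. \<exists>x\<in>carrier L. r = (\<lambda>w. word_monom c [x] w - word_monom 1 [c \<odot> x] w))
   \<or> (\<exists>x\<in>carrier L. \<exists>y\<in>carrier L. r = (\<lambda>w. word_monom 1 [x, y] w - word_monom 1 [y, x] w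
        - word_monom 1 [bracket L x y] w))" (is "_ \<longleftrightarrow> ?A \<or> ?B \<or> ?C")
proof -
  let ?F = "free_algebra (carrier L)"
  let ?g = "\<lambda>x. word_monom 1 [x] :: 'a list \<Rightarrow> complex"
  have 1: "(?g x \<oplus>\<^bsub>?F\<^esub> ?g y) \<ominus>\<^bsub>?F\<^esub> ?g (x \<oplus> y) =
    (\<lambda>w. word_monom 1 [x] w + word_monom 1 [y] w - word_monom 1 [x \<oplus> y] w)"
    if "x \<in> carrier L" "y \<in> carrier L" for x y
    using that by (simp add: free_algebra_minus free_algebra_add word_monom_closed)
  have 2: "word_monom c [x] \<ominus>\<^bsub>?F\<^esub> ?g (c \<odot> x) = (\<lambda>w. word_monom c [x] w - word_monom 1 [c \<odot> x] w)"
    if "x \<in> carrier L" for c x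
    using that by (simp add: free_algebra_minus word_monom_closed L_vs)
  have 3: "(?g x \<otimes>\<^bsub>?F\<^esub> ?g y \<ominus>\<^bsub>?F\<^esub> ?g y \<otimes>\<^bsub>?F\<^esub> ?g x) \<ominus>\<^bsub>?F\<^esub> ?g (bracket L x y) =
    (\<lambda>w. word_monom 1 [x, y] w - word_monom 1 [y, x] w - word_monom 1 [bracket L x y] w)"
    if "x \<in> carrier L" "y \<in> carrier L" for x y
    using that by (simp add: free_algebra_minus word_monom_mult word_monom_closed bracket_closed)
  have "r \<in> env_relations L \<longleftrightarrow>
      (\<exists>x\<in>carrier L. \<exists>y\<in>carrier L. r = (?g x \<oplus>\<^bsub>?F\<^esub> ?g y) \<ominus>\<^bsub>?F\<^esub> ?g (x \<oplus> y))
    \<or> (\<exists>c. \<exists>x\<in>carrier L. r = word_monom c [x] \<ominus>\<^bsub>?F\<^esub> ?g (c \<odot> x))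
    \<or> (\<exists>x\<in>carrier L. \<exists>y\<in>carrier L.
        r = (?g x \<otimes>\<^bsub>?F\<^esub> ?g y \<ominus>\<^bsub>?F\<^esub> ?g y \<otimes>\<^bsub>?F\<^esub> ?g x) \<ominus>\<^bsub>?F\<^esub> ?g (bracket L x y))"
    unfolding env_relations_def Let_def by blast
  then show ?thesis by (simp add: 1 2 3 cong: bex_cong)
qed

lemma free_algebra_diff_closed:
  assumes "f \<in> carrier (free_algebra S)" "g \<in> carrier (free_algebra S)"
  shows "(\<lambda>w. f w - g w) \<in> carrier (free_algebra S)"
  using assms FA.minus_closed[of f S g] by (simp add: free_algebra_minus)

lemma env_relations_closed: "env_relations L \<subseteq> carrier (free_algebra (carrier L))"
  unfolding env_relations_iff subset_iff
  by (auto intro!: free_algebra_diff_closed free_algebra_add_closed word_monom_closed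
      simp: L_vs bracket_closed)

lemma ideal_env_ideal: "ideal (env_ideal L) (free_algebra (carrier L))"
  unfolding env_ideal_def by (rule FA.genideal_ideal[OF env_relations_closed])

lemma env_ideal_minimal:
  assumes "ideal I (free_algebra (carrier L))" "env_relations L \<subseteq> I"
  shows "env_ideal L \<subseteq> I"
  unfolding env_ideal_def by (rule FA.genideal_minimal[OF assms])

lemma env_relations_in_env_ideal: "r \<in> env_relations L \<Longrightarrow> r \<in> env_ideal L"
  unfolding env_ideal_def using FA.genideal_self[OF env_relations_closed] by blast

lemma ring_env: "ring (env L)"
  unfolding env_def by (rule ideal.quotient_is_ring[OF ideal_env_ideal])

lemma env_class_ring_hom: "env_class L \<in> ring_hom (free_algebra (carrier L)) (env L)"
  using ideal.rcos_ring_hom[OF ideal_env_ideal]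
  by (simp add: env_def env_class_def[abs_def])

lemma env_class_closed: "f \<in> carrier (free_algebra (carrier L)) \<Longrightarrow> env_class L f \<in> carrier (env L)"
  using ring_hom_closed[OF env_class_ring_hom] .

lemma env_carrierE:
  assumes "C \<in> carrier (env L)"
  obtains f where "f \<in> carrier (free_algebra (carrier L))" "C = env_class L f"
  using assms unfolding env_def FactRing_def A_RCOSETS_def' env_class_def by auto

lemma env_class_add:
  assumes "f \<in> carrier (free_algebra (carrier L))" "g \<in> carrier (free_algebra (carrier L))"
  shows "env_class L (\<lambda>w. f w + g w) = env_class L f \<oplus>\<^bsub>env L\<^esub> env_class L g"
  using ring_hom_add[OF env_class_ring_hom assms] by (simp add: free_algebra_add)

lemma env_class_mult:
  assumes "f \<in> carrier (free_algebra (carrier L))" "g \<in> carrier (free_algebra (carrier L))"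
  shows "env_class L (f \<otimes>\<^bsub>free_algebra (carrier L)\<^esub> g) = env_class L f \<otimes>\<^bsub>env L\<^esub> env_class L g"
  using ring_hom_mult[OF env_class_ring_hom assms] .

lemma env_class_one: "env_class L (word_monom 1 []) = \<one>\<^bsub>env L\<^esub>"
  using ring_hom_one[OF env_class_ring_hom] by (simp add: free_algebra_one)

lemma env_class_zero: "env_class L (\<lambda>_. 0) = \<zero>\<^bsub>env L\<^esub>"
  using ring_hom_zero[OF env_class_ring_hom ring_free_algebra ring_env] by (simp add: free_algebra_zero)

lemma env_class_diff:
  assumes "f \<in> carrier (free_algebra (carrier L))" "g \<in> carrier (free_algebra (carrier L))"
  shows "env_class L (\<lambda>w. f w - g w) = env_class L f \<ominus>\<^bsub>env L\<^esub> env_class L g"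
proof -
  interpret U: ring "env L" by (rule ring_env)
  have d: "(\<lambda>w. f w - g w) \<in> carrier (free_algebra (carrier L))"
    using assms by (rule free_algebra_diff_closed)
  have "env_class L f = env_class L (\<lambda>w. f w - g w) \<oplus>\<^bsub>env L\<^esub> env_class L g"
    using env_class_add[OF d assms(2)] by simp
  then show ?thesis
    using env_class_closed[OF d] env_class_closed[OF assms(2)]
    by (simp add: a_minus_def U.a_assoc U.r_neg)
qed

lemma env_class_eq_iff:
  assumes "f \<in> carrier (free_algebra (carrier L))" "g \<in> carrier (free_algebra (carrier L))"
  shows "env_class L f = env_class L g \<longleftrightarrow> (\<lambda>w. f w - g w) \<in> env_ideal L"
  using FA.quotient_eq_iff_same_a_r_cos[OF ideal_env_ideal assms(1) assms(2)] assms(2)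
  by (simp add: env_class_def free_algebra_minus)

lemma env_class_self: "f \<in> carrier (free_algebra (carrier L)) \<Longrightarrow> f \<in> env_class L f"
  unfolding env_class_def
  using abelian_subgroup.a_rcos_self[OF ideal.axioms(1)[OF ideal_env_ideal, THEN abelian_subgroupI3]]
    ring.is_abelian_group[OF ring_free_algebra] by blast

lemma env_class_memD:
  assumes "f \<in> carrier (free_algebra (carrier L))" "g \<in> env_class L f"
  shows "g \<in> carrier (free_algebra (carrier L))" "env_class L g = env_class L f"
proof -
  interpret I: ideal "env_ideal L" "free_algebra (carrier L)" by (rule ideal_env_ideal)
  show *: "g \<in> carrier (free_algebra (carrier L))"
    using assms I.a_elemrcos_carrier unfolding env_class_def by blast
  show "env_class L g = env_class L f"
    using assms I.a_repr_independence' unfolding env_class_def by metis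
qed

lemma env_gen_closed [simp]: "x \<in> carrier L \<Longrightarrow> env_gen L x \<in> carrier (env L)"
  by (simp add: env_class_closed word_monom_closed)

lemma env_scal_closed [simp]: "env_scal L c \<in> carrier (env L)"
  by (simp add: env_class_closed word_monom_closed)

lemma env_class_eqI:
  assumes "f \<in> carrier (free_algebra (carrier L))" "g \<in> carrier (free_algebra (carrier L))"
    "(\<lambda>w. f w - g w) \<in> env_relations L"
  shows "env_class L f = env_class L g"
  using assms env_relations_in_env_ideal by (simp add: env_class_eq_iff)

lemma env_gen_add:
  assumes "x \<in> carrier L" "y \<in> carrier L"
  shows "env_gen L (x \<oplus> y) = env_gen L x \<oplus>\<^bsub>env L\<^esub> env_gen L y"
proof -
  have "env_class L (\<lambda>w. word_monom 1 [x] w + word_monom 1 [y] w) = env_gen L (x \<oplus> y)"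
    using assms by (intro env_class_eqI free_algebra_add_closed word_monom_closed)
      (auto simp: env_relations_iff)
  then show ?thesis using assms by (simp add: env_class_add word_monom_closed)
qed

lemma env_class_Cons:
  assumes "x \<in> carrier L" "set w \<subseteq> carrier L"
  shows "env_class L (word_monom c (x # w)) = env_gen L x \<otimes>\<^bsub>env L\<^esub> env_class L (word_monom c w)"
  using assms env_class_mult[of "word_monom 1 [x]" "word_monom c w"]
  by (simp add: word_monom_closed word_monom_mult)

lemma env_gen_smult:
  assumes "x \<in> carrier L"
  shows "env_gen L (c \<odot> x) = env_scal L c \<otimes>\<^bsub>env L\<^esub> env_gen L x"
proof -
  have "env_class L (word_monom c [x]) = env_gen L (c \<odot> x)"
    using assms by (intro env_class_eqI word_monom_closed) (auto simp: env_relations_iff L_vs)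
  moreover have "env_class L (word_monom c [x]) = env_scal L c \<otimes>\<^bsub>env L\<^esub> env_gen L x"
    using assms env_class_mult[of "word_monom c []" "word_monom 1 [x]"]
    by (simp add: word_monom_closed word_monom_mult)
  ultimately show ?thesis by simp
qed

lemma env_gen_bracket:
  assumes "x \<in> carrier L" "y \<in> carrier L"
  shows "env_gen L (bracket L x y) =
    env_gen L x \<otimes>\<^bsub>env L\<^esub> env_gen L y \<ominus>\<^bsub>env L\<^esub> env_gen L y \<otimes>\<^bsub>env L\<^esub> env_gen L x"
proof -
  have "env_class L (\<lambda>w. word_monom 1 [x, y] w - word_monom 1 [y, x] w) = env_gen L (bracket L x y)"
    using assms by (intro env_class_eqI free_algebra_diff_closed word_monom_closed)
      (auto simp: env_relations_iff bracket_closed)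
  then show ?thesis using assms
    by (simp add: env_class_diff word_monom_closed env_class_Cons[of x "[y]"] env_class_Cons[of y "[x]"])
qed

lemma env_scal_add: "env_scal L (c + d) = env_scal L c \<oplus>\<^bsub>env L\<^esub> env_scal L d"
proof -
  have "word_monom (c + d) [] = (\<lambda>w :: 'a list. word_monom c [] w + word_monom d [] w)"
    by (auto simp: word_monom_def)
  then show ?thesis using env_class_add[of "word_monom c []" "word_monom d []"]
    by (simp add: word_monom_closed)
qed

lemma env_scal_mult: "env_scal L (c * d) = env_scal L c \<otimes>\<^bsub>env L\<^esub> env_scal L d"
  using env_class_mult[of "word_monom c []" "word_monom d []"]
  by (simp add: word_monom_closed word_monom_mult)

lemma env_scal_zero: "env_scal L 0 = \<zero>\<^bsub>env L\<^esub>"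
proof -
  have "word_monom 0 [] = (\<lambda>_ :: 'a list. 0)" by (auto simp: word_monom_def)
  then show ?thesis using env_class_zero by simp
qed

text \<open>Representatives split into words, and words are peeled from the left. The generator
  stands on the left, so that in statements about a module it acts on a vector that has already been
  treated.\<close>

lemma env_induct [consumes 1, case_names scal add gen]:
  assumes C: "C \<in> carrier (env L)"
    and s: "\<And>c. P (env_scal L c)"
    and a: "\<And>C D. \<lbrakk>C \<in> carrier (env L); D \<in> carrier (env L); P C; P D\<rbrakk> \<Longrightarrow> P (C \<oplus>\<^bsub>env L\<^esub> D)"
    and g: "\<And>x C. \<lbrakk>x \<in> carrier L; C \<in> carrier (env L); P C\<rbrakk> \<Longrightarrow> P (env_gen L x \<otimes>\<^bsub>env L\<^esub> C)"
  shows "P C"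
proof -
  obtain f where f: "f \<in> carrier (free_algebra (carrier L))" "C = env_class L f"
    using env_carrierE[OF C] .
  have w: "P (env_class L (word_monom c w))" if "set w \<subseteq> carrier L" for c w
    using that
  proof (induction w)
    case (Cons x w)
    then show ?case by (simp add: env_class_Cons[of x w] g env_class_closed word_monom_closed)
  qed (simp add: s)
  from f(1) have "P (env_class L f)"
  proof (induction f rule: free_algebra_induct)
    case zero
    then show ?case using s[of 0] env_class_zero env_scal_zero by simp
  next
    case (add f c u)
    then show ?case by (simp add: env_class_add word_monom_closed a w env_class_closed)
  qed
  then show ?thesis using f by simp
qed

text \<open>True already in the free algebra, where a scalar is a multiple of the empty
  word.\<close>

lemma env_scal_central:
  assumes "C \<in> carrier (env L)"
  shows "env_scal L c \<otimes>\<^bsub>env L\<^esub> C = C \<otimes>\<^bsub>env L\<^esub> env_scal L c"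
proof -
  obtain f where f: "f \<in> carrier (free_algebra (carrier L))" "C = env_class L f"
    using env_carrierE[OF assms] .
  have "word_monom c [] \<otimes>\<^bsub>free_algebra (carrier L)\<^esub> f = f \<otimes>\<^bsub>free_algebra (carrier L)\<^esub> word_monom c []"
    using f(1)
    by (induction f rule: free_algebra_induct)
      (simp_all add: free_algebra_mult_zero free_algebra_mult_distrib word_monom_mult mult.commute)
  then show ?thesis using f env_class_mult[of "word_monom c []" f] env_class_mult[of f "word_monom c []"]
    by (simp add: word_monom_closed)
qed

lemma env_commute_center:
  assumes z: "z \<in> lie_center L" and C: "C \<in> carrier (env L)"
  shows "env_gen L z \<otimes>\<^bsub>env L\<^esub> C = C \<otimes>\<^bsub>env L\<^esub> env_gen L z"
proof -
  interpret U: ring "env L" by (rule ring_env)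
  have zc: "z \<in> carrier L" using z by (simp add: lie_center_def)
  from C show ?thesis
  proof (induction C rule: env_induct)
    case (scal c)
    then show ?case using zc by (simp add: env_scal_central)
  next
    case (add C D)
    then show ?case using zc by (simp add: U.r_distr U.l_distr)
  next
    case (gen x C)
    \<comment> \<open>The zero of \<open>L\<close> is written \<open>0 \<odot> z\<close>, so that
      \<open>env_gen_smult\<close> turns its class into a multiple of \<open>env_scal L 0\<close>,
      which is zero.\<close>
    have "env_gen L z \<otimes>\<^bsub>env L\<^esub> env_gen L x \<ominus>\<^bsub>env L\<^esub> env_gen L x \<otimes>\<^bsub>env L\<^esub> env_gen L z = env_gen L (0 \<odot> z)"
      using env_gen_bracket[OF zc gen(1)] z gen(1) zc by (simp add: lie_center_def L_vs)
    also have "\<dots> = \<zero>\<^bsub>env L\<^esub>" using zc by (simp add: env_gen_smult[OF zc] env_scal_zero)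
    finally have c: "env_gen L z \<otimes>\<^bsub>env L\<^esub> env_gen L x = env_gen L x \<otimes>\<^bsub>env L\<^esub> env_gen L z"
      using zc gen(1) by (simp add: U.r_right_minus_eq)
    have "env_gen L z \<otimes>\<^bsub>env L\<^esub> (env_gen L x \<otimes>\<^bsub>env L\<^esub> C) = env_gen L x \<otimes>\<^bsub>env L\<^esub> (env_gen L z \<otimes>\<^bsub>env L\<^esub> C)"
      using c zc gen(1,2) by (metis U.m_assoc env_gen_closed)
    then show ?case using zc gen by (simp add: U.m_assoc)
  qed
qed

end

section \<open>Modules over the enveloping algebra\<close>

text \<open>The library's \<open>module\<close> asks for a commutative ring.\<close>

locale left_module = R: ring R + M: abelian_group M
  for R :: "('r, 'm) ring_scheme" and M :: "('r, 'a, 'c) module_scheme" +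
  assumes smult_closed: "\<lbrakk>a \<in> carrier R; x \<in> carrier M\<rbrakk> \<Longrightarrow> a \<odot>\<^bsub>M\<^esub> x \<in> carrier M"
    and smult_l_distr: "\<lbrakk>a \<in> carrier R; b \<in> carrier R; x \<in> carrier M\<rbrakk> \<Longrightarrow>
      (a \<oplus>\<^bsub>R\<^esub> b) \<odot>\<^bsub>M\<^esub> x = a \<odot>\<^bsub>M\<^esub> x \<oplus>\<^bsub>M\<^esub> b \<odot>\<^bsub>M\<^esub> x"
    and smult_r_distr: "\<lbrakk>a \<in> carrier R; x \<in> carrier M; y \<in> carrier M\<rbrakk> \<Longrightarrow>
      a \<odot>\<^bsub>M\<^esub> (x \<oplus>\<^bsub>M\<^esub> y) = a \<odot>\<^bsub>M\<^esub> x \<oplus>\<^bsub>M\<^esub> a \<odot>\<^bsub>M\<^esub> y"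
    and smult_assoc: "\<lbrakk>a \<in> carrier R; b \<in> carrier R; x \<in> carrier M\<rbrakk> \<Longrightarrow>
      (a \<otimes>\<^bsub>R\<^esub> b) \<odot>\<^bsub>M\<^esub> x = a \<odot>\<^bsub>M\<^esub> (b \<odot>\<^bsub>M\<^esub> x)"
    and smult_one: "x \<in> carrier M \<Longrightarrow> \<one>\<^bsub>R\<^esub> \<odot>\<^bsub>M\<^esub> x = x"
begin

lemma smult_l_zero: "x \<in> carrier M \<Longrightarrow> \<zero>\<^bsub>R\<^esub> \<odot>\<^bsub>M\<^esub> x = \<zero>\<^bsub>M\<^esub>"
  using smult_l_distr[of "\<zero>\<^bsub>R\<^esub>" "\<zero>\<^bsub>R\<^esub>" x] smult_closed[of "\<zero>\<^bsub>R\<^esub>" x] by simp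

lemma smult_r_zero: "a \<in> carrier R \<Longrightarrow> a \<odot>\<^bsub>M\<^esub> \<zero>\<^bsub>M\<^esub> = \<zero>\<^bsub>M\<^esub>"
  using smult_r_distr[of a "\<zero>\<^bsub>M\<^esub>" "\<zero>\<^bsub>M\<^esub>"] smult_closed[of a "\<zero>\<^bsub>M\<^esub>"] by simp

lemma smult_l_minus:
  assumes "a \<in> carrier R" "x \<in> carrier M"
  shows "(\<ominus>\<^bsub>R\<^esub> a) \<odot>\<^bsub>M\<^esub> x = \<ominus>\<^bsub>M\<^esub> (a \<odot>\<^bsub>M\<^esub> x)"
  using smult_l_distr[of "\<ominus>\<^bsub>R\<^esub> a" a x] assms smult_closed
  by (intro M.minus_equality[symmetric]) (simp_all add: R.l_neg smult_l_zero)

lemma smult_r_minus: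
  assumes "a \<in> carrier R" "x \<in> carrier M"
  shows "a \<odot>\<^bsub>M\<^esub> (\<ominus>\<^bsub>M\<^esub> x) = \<ominus>\<^bsub>M\<^esub> (a \<odot>\<^bsub>M\<^esub> x)"
  using smult_r_distr[of a "\<ominus>\<^bsub>M\<^esub> x" x] assms smult_closed
  by (intro M.minus_equality[symmetric]) (simp_all add: M.l_neg smult_r_zero)

lemma smult_l_diff:
  assumes "a \<in> carrier R" "b \<in> carrier R" "x \<in> carrier M"
  shows "(a \<ominus>\<^bsub>R\<^esub> b) \<odot>\<^bsub>M\<^esub> x = a \<odot>\<^bsub>M\<^esub> x \<ominus>\<^bsub>M\<^esub> b \<odot>\<^bsub>M\<^esub> x"
  using assms by (simp add: a_minus_def smult_l_distr smult_l_minus)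

lemma smult_r_diff:
  assumes "a \<in> carrier R" "x \<in> carrier M" "y \<in> carrier M"
  shows "a \<odot>\<^bsub>M\<^esub> (x \<ominus>\<^bsub>M\<^esub> y) = a \<odot>\<^bsub>M\<^esub> x \<ominus>\<^bsub>M\<^esub> a \<odot>\<^bsub>M\<^esub> y"
  using assms by (simp add: a_minus_def smult_r_distr smult_r_minus)

end

lemma abelian_group_cong:
  fixes G :: "('a, 'b) ring_scheme" and H :: "('a, 'c) ring_scheme"
  assumes "abelian_group G" "carrier H = carrier G" "add H = add G" "\<zero>\<^bsub>H\<^esub> = \<zero>\<^bsub>G\<^esub>"
  shows "abelian_group H"
proof -
  interpret abelian_group G by fact
  show ?thesis
    by (rule abelian_groupI) (use assms a_ac l_neg in auto)
qed

lemma (in abelian_group) minus_eq_zero_iff: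
  assumes "a \<in> carrier G" "b \<in> carrier G"
  shows "a \<ominus> b = \<zero> \<longleftrightarrow> a = b"
  using assms by (metis a_minus_def add.inv_solve_right' local.minus_minus minus_equality r_neg a_inv_closed l_zero)

section \<open>Lie modules as modules over the enveloping algebra\<close>

context lie_module
begin

lemmas V_vs = complex_vectorspaceD[OF V.vectorspace_axioms]

lemma abelian_group_V: "abelian_group V"
  by (rule V_vs(1))

lemma foldr_lact_closed:
  "\<lbrakk>set w \<subseteq> carrier L; v \<in> carrier V\<rbrakk> \<Longrightarrow> foldr (lact V) w v \<in> carrier V"
  by (induction w) (simp_all add: lact_closed)

text \<open>Words outside the support contribute zero. The freedom in the index set is what lets
  sums be added: the support of \<open>f + g\<close> can be smaller than the union of the two
  supports.\<close>

lemma word_act_superset: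
  assumes f: "f \<in> carrier (free_algebra (carrier L))" and v: "v \<in> carrier V"
    and W: "finite W" "{w. f w \<noteq> 0} \<subseteq> W" "\<And>w. w \<in> W \<Longrightarrow> set w \<subseteq> carrier L"
  shows "word_act V f v = (\<Oplus>\<^bsub>V\<^esub>w\<in>W. f w \<odot>\<^bsub>V\<^esub> foldr (lact V) w v)"
proof -
  show ?thesis
    unfolding word_act_def
    by (rule V.module.M.add.finprod_mono_neutral_cong_left)
      (use W v in \<open>auto simp: V_vs foldr_lact_closed\<close>)
qed

lemma word_act_closed:
  assumes f: "f \<in> carrier (free_algebra (carrier L))" and v: "v \<in> carrier V"
  shows "word_act V f v \<in> carrier V"
proof -
  show ?thesis unfolding word_act_def
    by (rule V.module.M.finsum_closed) (use f v in \<open>auto simp: V_vs foldr_lact_closed free_algebra_carrier\<close>)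
qed

lemma word_act_add:
  assumes f: "f \<in> carrier (free_algebra (carrier L))" and g: "g \<in> carrier (free_algebra (carrier L))"
    and v: "v \<in> carrier V"
  shows "word_act V (\<lambda>w. f w + g w) v = word_act V f v \<oplus>\<^bsub>V\<^esub> word_act V g v"
proof -
  let ?W = "{w. f w \<noteq> 0} \<union> {w. g w \<noteq> 0}"
  have W: "finite ?W" "\<And>w. w \<in> ?W \<Longrightarrow> set w \<subseteq> carrier L"
    using f g by (auto simp: free_algebra_carrier)
  have "word_act V (\<lambda>w. f w + g w) v = (\<Oplus>\<^bsub>V\<^esub>w\<in>?W. (f w + g w) \<odot>\<^bsub>V\<^esub> foldr (lact V) w v)"
    by (rule word_act_superset) (use f g v W in \<open>auto intro: free_algebra_add_closed\<close>)
  also have "\<dots> = (\<Oplus>\<^bsub>V\<^esub>w\<in>?W. f w \<odot>\<^bsub>V\<^esub> foldr (lact V) w v \<oplus>\<^bsub>V\<^esub> g w \<odot>\<^bsub>V\<^esub> foldr (lact V) w v)"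
    by (rule V.module.M.finsum_cong') (use W v in \<open>auto simp: V_vs foldr_lact_closed\<close>)
  also have "\<dots> = (\<Oplus>\<^bsub>V\<^esub>w\<in>?W. f w \<odot>\<^bsub>V\<^esub> foldr (lact V) w v) \<oplus>\<^bsub>V\<^esub>
      (\<Oplus>\<^bsub>V\<^esub>w\<in>?W. g w \<odot>\<^bsub>V\<^esub> foldr (lact V) w v)"
    by (rule V.module.M.finsum_addf) (use W v in \<open>auto simp: V_vs foldr_lact_closed\<close>)
  also have "\<dots> = word_act V f v \<oplus>\<^bsub>V\<^esub> word_act V g v"
    using word_act_superset[OF f v W(1) _ W(2)] word_act_superset[OF g v W(1) _ W(2)] by simp
  finally show ?thesis .
qed

lemma word_act_monom:
  assumes "set w \<subseteq> carrier L" "v \<in> carrier V"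
  shows "word_act V (word_monom c w) v = c \<odot>\<^bsub>V\<^esub> foldr (lact V) w v"
proof -
  have "word_act V (word_monom c w) v = (\<Oplus>\<^bsub>V\<^esub>u\<in>{w}. word_monom c w u \<odot>\<^bsub>V\<^esub> foldr (lact V) u v)"
    by (rule word_act_superset) (use assms in \<open>auto simp: word_monom_def word_monom_closed[unfolded word_monom_def] split: if_splits\<close>)
  also have "\<dots> = c \<odot>\<^bsub>V\<^esub> foldr (lact V) w v"
    using assms by (subst V.module.M.finsum_insert) (auto simp: word_monom_def V_vs foldr_lact_closed)
  finally show ?thesis .
qed

lemma word_act_zero: "word_act V (\<lambda>_. 0) v = \<zero>\<^bsub>V\<^esub>"
proof -
  show ?thesis by (simp add: word_act_def)
qed

lemma foldr_lact_linear:
  assumes "set u \<subseteq> carrier L"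
  shows "\<lbrakk>v \<in> carrier V; w \<in> carrier V\<rbrakk> \<Longrightarrow>
      foldr (lact V) u (v \<oplus>\<^bsub>V\<^esub> w) = foldr (lact V) u v \<oplus>\<^bsub>V\<^esub> foldr (lact V) u w"
    and "v \<in> carrier V \<Longrightarrow> foldr (lact V) u (c \<odot>\<^bsub>V\<^esub> v) = c \<odot>\<^bsub>V\<^esub> foldr (lact V) u v"
    and "foldr (lact V) u \<zero>\<^bsub>V\<^esub> = \<zero>\<^bsub>V\<^esub>"
proof -
  show "\<lbrakk>v \<in> carrier V; w \<in> carrier V\<rbrakk> \<Longrightarrow>
      foldr (lact V) u (v \<oplus>\<^bsub>V\<^esub> w) = foldr (lact V) u v \<oplus>\<^bsub>V\<^esub> foldr (lact V) u w"
    using assms by (induction u) (simp_all add: lact_add_right foldr_lact_closed)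
  show h: "v \<in> carrier V \<Longrightarrow> foldr (lact V) u (c \<odot>\<^bsub>V\<^esub> v) = c \<odot>\<^bsub>V\<^esub> foldr (lact V) u v" for c v
    using assms by (induction u) (simp_all add: lact_smult_right foldr_lact_closed)
  show "foldr (lact V) u \<zero>\<^bsub>V\<^esub> = \<zero>\<^bsub>V\<^esub>"
    using h[of "\<zero>\<^bsub>V\<^esub>" 0] foldr_lact_closed[OF assms, of "\<zero>\<^bsub>V\<^esub>"] by (simp add: V_vs)
qed

lemma word_act_linear:
  assumes f: "f \<in> carrier (free_algebra (carrier L))"
  shows "\<lbrakk>v \<in> carrier V; w \<in> carrier V\<rbrakk> \<Longrightarrow> word_act V f (v \<oplus>\<^bsub>V\<^esub> w) = word_act V f v \<oplus>\<^bsub>V\<^esub> word_act V f w"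
    and "v \<in> carrier V \<Longrightarrow> word_act V f (c \<odot>\<^bsub>V\<^esub> v) = c \<odot>\<^bsub>V\<^esub> word_act V f v"
proof -
  show "word_act V f (v \<oplus>\<^bsub>V\<^esub> w) = word_act V f v \<oplus>\<^bsub>V\<^esub> word_act V f w"
    if v: "v \<in> carrier V" "w \<in> carrier V"
    using f
  proof (induction f rule: free_algebra_induct)
    case (add f c u)
    then show ?case using v
      by (simp add: word_act_add word_act_monom word_monom_closed foldr_lact_linear V_vs
          foldr_lact_closed word_act_closed V.module.M.a_ac)
  qed (simp add: word_act_zero)
  show "word_act V f (c \<odot>\<^bsub>V\<^esub> v) = c \<odot>\<^bsub>V\<^esub> word_act V f v" if v: "v \<in> carrier V"
    using f
  proof (induction f rule: free_algebra_induct)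
    case (add f d u)
    have "d \<odot>\<^bsub>V\<^esub> (c \<odot>\<^bsub>V\<^esub> foldr (lact V) u v) = c \<odot>\<^bsub>V\<^esub> (d \<odot>\<^bsub>V\<^esub> foldr (lact V) u v)"
      using v add.hyps V_vs(5)[of "foldr (lact V) u v"] by (simp add: foldr_lact_closed mult.commute flip: V_vs(5))
    with add v show ?case
      by (simp add: word_act_add word_act_monom word_monom_closed foldr_lact_linear V_vs(2,4)
          foldr_lact_closed word_act_closed)
  qed (simp add: word_act_zero V_vs)
qed

lemma word_act_on_zero:
  "f \<in> carrier (free_algebra (carrier L)) \<Longrightarrow> word_act V f \<zero>\<^bsub>V\<^esub> = \<zero>\<^bsub>V\<^esub>"
  using word_act_linear(2)[of f "\<zero>\<^bsub>V\<^esub>" 0] word_act_closed[of f "\<zero>\<^bsub>V\<^esub>"] by (simp add: V_vs)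

text \<open>On words this is \<open>foldr\<close> over a concatenation: the right factor acts first.
  Bilinearity does the rest.\<close>

lemma word_act_mult:
  assumes f: "f \<in> carrier (free_algebra (carrier L))" and g: "g \<in> carrier (free_algebra (carrier L))"
    and v: "v \<in> carrier V"
  shows "word_act V (f \<otimes>\<^bsub>free_algebra (carrier L)\<^esub> g) v = word_act V f (word_act V g v)"
proof -
  from f show ?thesis
  proof (induction f rule: free_algebra_induct)
    case (add f c u)
    from g have "word_act V (word_monom c u \<otimes>\<^bsub>free_algebra (carrier L)\<^esub> g) v =
        c \<odot>\<^bsub>V\<^esub> foldr (lact V) u (word_act V g v)"
    proof (induction g rule: free_algebra_induct)
      case (add g d u')
      then show ?case using \<open>set u \<subseteq> carrier L\<close> v
        by (simp add: free_algebra_mult_distrib word_monom_mult word_act_add word_act_monom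
            word_monom_closed free_algebra_mult_closed foldr_lact_linear V_vs foldr_lact_closed word_act_closed)
    qed (use add.hyps in \<open>simp add: free_algebra_mult_zero word_act_zero foldr_lact_linear V_vs\<close>)
    then show ?case using add g v
      by (simp add: free_algebra_mult_distrib word_act_add word_act_monom word_act_closed
          word_monom_closed free_algebra_mult_closed)
  qed (simp add: free_algebra_mult_zero word_act_zero)
qed

lemma word_act_diff:
  assumes f: "f \<in> carrier (free_algebra (carrier L))" and g: "g \<in> carrier (free_algebra (carrier L))"
    and v: "v \<in> carrier V"
  shows "word_act V (\<lambda>w. f w - g w) v = word_act V f v \<ominus>\<^bsub>V\<^esub> word_act V g v"
proof -
  have d: "(\<lambda>w. f w - g w) \<in> carrier (free_algebra (carrier L))"
    by (rule free_algebra_diff_closed[OF f g])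
  have "word_act V f v = word_act V (\<lambda>w. f w - g w) v \<oplus>\<^bsub>V\<^esub> word_act V g v"
    using word_act_add[OF d g v] by simp
  then show ?thesis using word_act_closed[OF d v] word_act_closed[OF g v]
    by (simp add: a_minus_def V.module.M.a_assoc V.module.M.r_neg)
qed

text \<open>The elements of the free algebra that act as zero on all of \<open>V\<close> form a
  two-sided ideal, and the module axioms put the three kinds of relations into it.\<close>

lemma word_act_env_ideal:
  assumes "f \<in> env_ideal L" "v \<in> carrier V"
  shows "word_act V f v = \<zero>\<^bsub>V\<^esub>"
proof -
  let ?F = "free_algebra (carrier L)"
  let ?I = "{f \<in> carrier ?F. \<forall>v\<in>carrier V. word_act V f v = \<zero>\<^bsub>V\<^esub>}"
  have "ideal ?I ?F"
  proof (rule idealI[OF ring_free_algebra])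
    show "subgroup ?I (add_monoid ?F)"
    proof (rule group.subgroupI)
      show "group (add_monoid ?F)" by (rule FA.a_group)
      show "?I \<noteq> {}" using zero_free_algebra_closed word_act_zero by blast
      fix a assume a: "a \<in> ?I"
      \<comment> \<open>The negative is written as a difference from zero, so that
        \<open>word_act_diff\<close> covers it.\<close>
      have "\<ominus>\<^bsub>?F\<^esub> a = (\<lambda>w. 0 - a w)" using a by (simp add: free_algebra_uminus)
      then have "\<ominus>\<^bsub>?F\<^esub> a \<in> ?I" using a
        by (simp add: word_act_diff word_act_zero zero_free_algebra_closed free_algebra_diff_closed
            del: diff_0)
      then show "inv\<^bsub>add_monoid ?F\<^esub> a \<in> ?I" by (simp add: a_inv_def)
    qed (auto simp: free_algebra_add free_algebra_add_closed word_act_add)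
  qed (auto simp: free_algebra_mult_closed word_act_mult word_act_closed
      word_act_on_zero)
  moreover have "env_relations L \<subseteq> ?I"
  proof
    fix r assume r: "r \<in> env_relations L"
    then have "r \<in> carrier ?F" using env_relations_closed by blast
    moreover have "word_act V r v = \<zero>\<^bsub>V\<^esub>" if "v \<in> carrier V" for v
      using r that unfolding env_relations_iff
      by (auto simp: word_act_diff word_act_add word_act_monom word_monom_closed free_algebra_add_closed
          free_algebra_diff_closed L_vs V_vs bracket_closed lact_closed lact_add_left lact_smult_left
          lact_bracket V.module.M.r_neg a_minus_def)
    ultimately show "r \<in> ?I" by blast
  qed
  ultimately show ?thesis using env_ideal_minimal assms by blast
qed

lemma env_module_simps [simp]:
  "carrier (env_module V) = carrier V" "add (env_module V) = add V" "ring.zero (env_module V) = \<zero>\<^bsub>V\<^esub>"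
  by (simp_all add: env_module_def)

text \<open>\<open>env_module\<close> takes \<open>the_elem\<close> of the values over a whole
  class. Two representatives differ by an element of \<open>env_ideal L\<close>, which acts as zero,
  so the set of values is a singleton.\<close>

lemma env_module_smult:
  assumes f: "f \<in> carrier (free_algebra (carrier L))" and v: "v \<in> carrier V"
  shows "env_class L f \<odot>\<^bsub>env_module V\<^esub> v = word_act V f v"
proof -
  have "word_act V g v = word_act V f v" if "g \<in> env_class L f" for g
  proof -
    have g: "g \<in> carrier (free_algebra (carrier L))" "env_class L g = env_class L f"
      using env_class_memD[OF f that] by auto
    then have "(\<lambda>w. g w - f w) \<in> env_ideal L" using f by (simp add: env_class_eq_iff)
    then show ?thesis using word_act_env_ideal[OF _ v] word_act_diff[OF g(1) f v]
        word_act_closed[OF g(1) v] word_act_closed[OF f v] by (metis V.module.M.minus_eq_zero_iff)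
  qed
  then have "(\<lambda>f. word_act V f v) ` env_class L f = {word_act V f v}"
    using env_class_self[OF f] by blast
  then show ?thesis by (simp add: env_module_def)
qed

lemma left_module_env_module: "left_module (env L) (env_module V)"
proof (intro left_module.intro left_module_axioms.intro)
  show "ring (env L)" by (rule ring_env)
  show "abelian_group (env_module V)"
    by (rule abelian_group_cong[OF abelian_group_V]) simp_all
  note s = env_module_smult word_act_closed free_algebra_add_closed free_algebra_mult_closed
  fix a assume "a \<in> carrier (env L)"
  then obtain f where f: "f \<in> carrier (free_algebra (carrier L))" "a = env_class L f"
    by (rule env_carrierE)
  fix v assume v: "v \<in> carrier (env_module V)"
  show "a \<odot>\<^bsub>env_module V\<^esub> v \<in> carrier (env_module V)" using f v by (simp add: s)
  show "a \<odot>\<^bsub>env_module V\<^esub> (v \<oplus>\<^bsub>env_module V\<^esub> w) =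
    a \<odot>\<^bsub>env_module V\<^esub> v \<oplus>\<^bsub>env_module V\<^esub> a \<odot>\<^bsub>env_module V\<^esub> w"
    if "w \<in> carrier (env_module V)" for w
    using f v that by (simp add: s word_act_linear)
  fix b assume "b \<in> carrier (env L)"
  then obtain g where g: "g \<in> carrier (free_algebra (carrier L))" "b = env_class L g"
    by (rule env_carrierE)
  show "(a \<oplus>\<^bsub>env L\<^esub> b) \<odot>\<^bsub>env_module V\<^esub> v =
    a \<odot>\<^bsub>env_module V\<^esub> v \<oplus>\<^bsub>env_module V\<^esub> b \<odot>\<^bsub>env_module V\<^esub> v"
    using f g v by (simp add: s word_act_add flip: env_class_add)
  show "(a \<otimes>\<^bsub>env L\<^esub> b) \<odot>\<^bsub>env_module V\<^esub> v =
    a \<odot>\<^bsub>env_module V\<^esub> (b \<odot>\<^bsub>env_module V\<^esub> v)"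
    using f g v by (simp add: s word_act_mult flip: env_class_mult)
next
  fix v assume "v \<in> carrier (env_module V)"
  then show "\<one>\<^bsub>env L\<^esub> \<odot>\<^bsub>env_module V\<^esub> v = v"
    using env_module_smult[of "word_monom 1 []" v]
    by (simp add: env_class_one word_monom_closed word_act_monom V_vs)
qed

lemma env_gen_smult_module:
  "\<lbrakk>x \<in> carrier L; v \<in> carrier V\<rbrakk> \<Longrightarrow> env_gen L x \<odot>\<^bsub>env_module V\<^esub> v = lact V x v"
  by (simp add: env_module_smult word_monom_closed word_act_monom V_vs lact_closed)

lemma env_scal_smult_module:
  "v \<in> carrier V \<Longrightarrow> env_scal L c \<odot>\<^bsub>env_module V\<^esub> v = c \<odot>\<^bsub>V\<^esub> v"
  by (simp add: env_module_smult word_monom_closed word_act_monom)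

end

section \<open>Extension of scalars and quotient modules\<close>

text \<open>Both \<open>extend_scalars\<close> and \<open>quot_module\<close> define the action of a
  scalar on a coset as a union over its elements. If the endomorphism preserves the subgroup, all
  members of the union are the same coset, namely that of the image of any representative.\<close>

lemma (in normal) Union_rcos_endo:
  assumes T: "\<And>x y. \<lbrakk>x \<in> carrier G; y \<in> carrier G\<rbrakk> \<Longrightarrow> T (x \<otimes> y) = T x \<otimes> T y"
    "\<And>x. x \<in> carrier G \<Longrightarrow> T x \<in> carrier G"
    and N: "\<And>x. x \<in> H \<Longrightarrow> T x \<in> H" and u: "u \<in> carrier G"
  shows "(\<Union>t\<in>H #> u. H #> T t) = H #> T u"
proof -
  have "H #> T t = H #> T u" if t: "t \<in> H #> u" for t
  proof -
    from t obtain n where n: "n \<in> H" "t = n \<otimes> u" by (auto simp: r_coset_def)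
    then have "T t = T n \<otimes> T u" using T u subset by blast
    then have "T t \<in> H #> T u" using N n by (auto simp: r_coset_def)
    then show ?thesis using repr_independence T(2)[OF u] is_subgroup by blast
  qed
  moreover have "u \<in> H #> u" using rcos_self u is_subgroup by blast
  ultimately show ?thesis by blast
qed

lemma abelian_group_of_comm_group:
  fixes M :: "('a, 'b) ring_scheme" and G :: "('a, 'c) monoid_scheme"
  assumes "comm_group G" "carrier M = carrier G" "add M = monoid.mult G" "\<zero>\<^bsub>M\<^esub> = \<one>\<^bsub>G\<^esub>"
  shows "abelian_group M"
proof -
  interpret comm_group G by fact
  show ?thesis
    by (rule abelian_groupI) (use assms m_ac l_inv in auto)
qed

lemma (in abelian_group) add_minus_minus:
  assumes "x \<in> carrier G" "y \<in> carrier G"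
  shows "(x \<oplus> y) \<ominus> x \<ominus> y = \<zero>"
  using assms by (simp add: a_minus_def a_comm[of x y] a_assoc r_neg)

text \<open>The assumptions keep the tensor relations inside the free abelian group; the action of
  \<open>S\<close> is left multiplication on the first factor.\<close>

locale scalar_extension = S: ring S
  for R :: "('r, 'm) ring_scheme" and S :: "('s, 'n) ring_scheme" and h :: "'r \<Rightarrow> 's"
    and B :: "('r, 'b, 'c) module_scheme" +
  assumes h_closed: "r \<in> carrier R \<Longrightarrow> h r \<in> carrier S"
    and B_add_closed: "\<lbrakk>b \<in> carrier B; b' \<in> carrier B\<rbrakk> \<Longrightarrow> b \<oplus>\<^bsub>B\<^esub> b' \<in> carrier B"
    and B_smult_closed: "\<lbrakk>r \<in> carrier R; b \<in> carrier B\<rbrakk> \<Longrightarrow> r \<odot>\<^bsub>B\<^esub> b \<in> carrier B"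
begin

abbreviation "F \<equiv> free_Abelian_group (carrier S \<times> carrier B)"
abbreviation "N \<equiv> generate F (tensor_relations R S h B)"
abbreviation "tensor s b \<equiv> N #>\<^bsub>F\<^esub> frag_of (s, b)"
abbreviation "mul s \<equiv> frag_extend (\<lambda>(s', b). frag_of (s \<otimes>\<^bsub>S\<^esub> s', b))"

interpretation F: comm_group F
  by (rule abelian_free_Abelian_group)

lemma keys_diff_subset: "\<lbrakk>Poly_Mapping.keys x \<subseteq> A; Poly_Mapping.keys y \<subseteq> A\<rbrakk> \<Longrightarrow> Poly_Mapping.keys (x - y) \<subseteq> A"
  for x y :: "'z \<Rightarrow>\<^sub>0 int"
  using keys_diff[of x y] by blast

lemma relations_closed: "tensor_relations R S h B \<subseteq> carrier F"
proof
  fix t assume "t \<in> tensor_relations R S h B"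
  then show "t \<in> carrier F"
    unfolding tensor_relations_def carrier_free_Abelian_group_iff
    by (elim UnE CollectE exE conjE; hypsubst; intro keys_diff_subset)
      (simp_all add: h_closed B_add_closed B_smult_closed)
qed

lemma subgroup_N: "subgroup N F"
  by (rule F.generate_is_subgroup[OF relations_closed])

interpretation N: normal N F
  by (rule F.subgroup_imp_normal[OF subgroup_N])

lemma mul_closed: "s \<in> carrier S \<Longrightarrow> t \<in> carrier F \<Longrightarrow> mul s t \<in> carrier F"
  using keys_frag_extend[of "\<lambda>(s', b). frag_of (s \<otimes>\<^bsub>S\<^esub> s', b)" t] by force

text \<open>Each relation goes to one of the same kind with all first factors multiplied by
  \<open>s\<close>; for the balanced relation this is associativity in \<open>S\<close>.\<close>

lemma mul_relation:
  assumes s: "s \<in> carrier S" and t: "t \<in> tensor_relations R S h B"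
  shows "mul s t \<in> tensor_relations R S h B"
  using t unfolding tensor_relations_def
proof (elim UnE CollectE exE conjE, goal_cases)
  case (1 s1 s2 b)
  then have "mul s t = frag_of (s \<otimes>\<^bsub>S\<^esub> s1 \<oplus>\<^bsub>S\<^esub> s \<otimes>\<^bsub>S\<^esub> s2, b) - frag_of (s \<otimes>\<^bsub>S\<^esub> s1, b) - frag_of (s \<otimes>\<^bsub>S\<^esub> s2, b)"
    using s by (simp add: frag_extend_diff S.r_distr)
  then show ?case using 1 s by blast
next
  case (2 s1 b b')
  then have "mul s t = frag_of (s \<otimes>\<^bsub>S\<^esub> s1, b \<oplus>\<^bsub>B\<^esub> b') - frag_of (s \<otimes>\<^bsub>S\<^esub> s1, b) - frag_of (s \<otimes>\<^bsub>S\<^esub> s1, b')"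
    by (simp add: frag_extend_diff)
  then show ?case using 2 s by blast
next
  case (3 s1 r b)
  then have "mul s t = frag_of ((s \<otimes>\<^bsub>S\<^esub> s1) \<otimes>\<^bsub>S\<^esub> h r, b) - frag_of (s \<otimes>\<^bsub>S\<^esub> s1, r \<odot>\<^bsub>B\<^esub> b)"
    using s by (simp add: frag_extend_diff S.m_assoc h_closed)
  then show ?case using 3 s by blast
qed

lemma mul_N:
  assumes s: "s \<in> carrier S" and t: "t \<in> N"
  shows "mul s t \<in> N"
  using t
proof induction
  case (inv t)
  then have "t \<in> carrier F" using relations_closed by blast
  then have "mul s (inv\<^bsub>F\<^esub> t) = inv\<^bsub>F\<^esub> (mul s t)"
    using mul_closed[OF s, of t] by (simp add: frag_extend_minus)
  then show ?case using generate.inv[OF mul_relation[OF s inv], of F] by simp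
next
  case (eng t t')
  then show ?case using generate.eng[of "mul s t" F _ "mul s t'"] by (simp add: frag_extend_add)
qed (use generate.one[of F] generate.incl[OF mul_relation[OF s]] in auto)

lemma extend_scalars_simps:
  "carrier (extend_scalars R S h B) = rcosets\<^bsub>F\<^esub> N"
  "\<zero>\<^bsub>extend_scalars R S h B\<^esub> = N"
  "add (extend_scalars R S h B) = set_mult F"
  by (simp_all add: extend_scalars_def Let_def FactGroup_def)

lemma extend_scalars_smult:
  assumes "s \<in> carrier S" "t \<in> carrier F"
  shows "s \<odot>\<^bsub>extend_scalars R S h B\<^esub> (N #>\<^bsub>F\<^esub> t) = N #>\<^bsub>F\<^esub> mul s t"
proof -
  have "(\<Union>t\<in>N #>\<^bsub>F\<^esub> t. N #>\<^bsub>F\<^esub> mul s t) = N #>\<^bsub>F\<^esub> mul s t"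
    by (rule N.Union_rcos_endo)
      (use assms mul_closed mul_N in \<open>auto simp: frag_extend_add simp del: carrier_free_Abelian_group_iff\<close>)
  then show ?thesis by (simp add: extend_scalars_def Let_def)
qed

lemma coset_add:
  "\<lbrakk>t \<in> carrier F; t' \<in> carrier F\<rbrakk> \<Longrightarrow>
    (N #>\<^bsub>F\<^esub> t) \<oplus>\<^bsub>extend_scalars R S h B\<^esub> (N #>\<^bsub>F\<^esub> t') = N #>\<^bsub>F\<^esub> (t + t')"
  using N.rcos_sum by (simp add: extend_scalars_simps del: carrier_free_Abelian_group_iff)

lemma coset_closed: "t \<in> carrier F \<Longrightarrow> N #>\<^bsub>F\<^esub> t \<in> carrier (extend_scalars R S h B)"
  by (auto simp: extend_scalars_simps RCOSETS_def)

lemma coset_cases: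
  assumes "C \<in> carrier (extend_scalars R S h B)"
  obtains t where "t \<in> carrier F" "C = N #>\<^bsub>F\<^esub> t"
  using assms by (auto simp: extend_scalars_simps RCOSETS_def)

lemma coset_eq_iff: "\<lbrakk>t \<in> carrier F; t' \<in> carrier F\<rbrakk> \<Longrightarrow> N #>\<^bsub>F\<^esub> t = N #>\<^bsub>F\<^esub> t' \<longleftrightarrow> t - t' \<in> N"
  (is "\<lbrakk>?c t; ?c t'\<rbrakk> \<Longrightarrow> ?L \<longleftrightarrow> ?R")
proof
  assume c: "?c t" "?c t'"
  show ?R if ?L
  proof -
    have "t \<in> N #>\<^bsub>F\<^esub> t'" using that F.rcos_self[OF c(1) subgroup_N] by simp
    then obtain n where "n \<in> N" "t = n + t'" by (auto simp: r_coset_def)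
    then show ?R by simp
  qed
  show ?L if ?R
  proof -
    have "t \<in> N #>\<^bsub>F\<^esub> t'" using that by (auto simp: r_coset_def intro!: bexI[of _ "t - t'"])
    then show ?L using F.repr_independence[OF _ c(2) subgroup_N] by blast
  qed
qed

lemma abelian_group_extend_scalars: "abelian_group (extend_scalars R S h B)"
proof (rule abelian_group_of_comm_group)
  show "comm_group (F Mod N)"
    using F.abelian_FactGroup[OF subgroup_N] .
qed (simp_all add: extend_scalars_def Let_def)

text \<open>On a generator the defect is itself a relation, that of additivity in the first factor.
  Distributivity therefore holds modulo \<open>N\<close>, which is all that cosets see.\<close>

lemma mul_distrib:
  assumes s: "s \<in> carrier S" "s' \<in> carrier S" and t: "Poly_Mapping.keys t \<subseteq> carrier S \<times> carrier B"
  shows "mul (s \<oplus>\<^bsub>S\<^esub> s') t - (mul s t + mul s' t) \<in> N"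
  using t
proof (rule free_Abelian_group_induct, goal_cases)
  case (2 x y)
  have "mul (s \<oplus>\<^bsub>S\<^esub> s') (x - y) - (mul s (x - y) + mul s' (x - y)) =
    (mul (s \<oplus>\<^bsub>S\<^esub> s') x - (mul s x + mul s' x)) - (mul (s \<oplus>\<^bsub>S\<^esub> s') y - (mul s y + mul s' y))"
    by (simp add: frag_extend_diff)
  moreover have "a - b \<in> N" if "a \<in> N" "b \<in> N" for a b
  proof -
    have "b \<in> carrier F" using that N.subset by blast
    then show ?thesis using N.m_closed[OF that(1) N.m_inv_closed[OF that(2)]] by simp
  qed
  ultimately show ?case using 2 by simp
next
  case (3 p)
  obtain s1 b where p: "p = (s1, b)" by (cases p)
  have "frag_of (s \<otimes>\<^bsub>S\<^esub> s1 \<oplus>\<^bsub>S\<^esub> s' \<otimes>\<^bsub>S\<^esub> s1, b) - frag_of (s \<otimes>\<^bsub>S\<^esub> s1, b) - frag_of (s' \<otimes>\<^bsub>S\<^esub> s1, b)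
    \<in> tensor_relations R S h B"
    using 3 s p unfolding tensor_relations_def by blast
  then show ?case using 3 s p by (auto simp: S.l_distr diff_diff_eq intro: generate.incl)
qed (use generate.one[of F] in simp)

lemma left_module_extend_scalars: "left_module S (extend_scalars R S h B)"
proof (intro left_module.intro left_module_axioms.intro)
  show "ring S" ..
  show "abelian_group (extend_scalars R S h B)" by (rule abelian_group_extend_scalars)
  fix a x assume a: "a \<in> carrier S" and "x \<in> carrier (extend_scalars R S h B)"
  then obtain t where t: "t \<in> carrier F" "x = N #>\<^bsub>F\<^esub> t" by (auto elim: coset_cases)
  note s = extend_scalars_smult mul_closed coset_closed coset_add F.m_closed
  show "a \<odot>\<^bsub>extend_scalars R S h B\<^esub> x \<in> carrier (extend_scalars R S h B)"
    using a t by (simp add: s del: carrier_free_Abelian_group_iff)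
  show "a \<odot>\<^bsub>extend_scalars R S h B\<^esub> (x \<oplus>\<^bsub>extend_scalars R S h B\<^esub> y) =
    a \<odot>\<^bsub>extend_scalars R S h B\<^esub> x \<oplus>\<^bsub>extend_scalars R S h B\<^esub> a \<odot>\<^bsub>extend_scalars R S h B\<^esub> y"
    if y: "y \<in> carrier (extend_scalars R S h B)" for y
  proof -
    obtain t' where t': "t' \<in> carrier F" "y = N #>\<^bsub>F\<^esub> t'" using coset_cases[OF y] by blast
    then have "t + t' \<in> carrier F" using F.m_closed[OF t(1) t'(1)] by simp
    then show ?thesis
      using a t t' by (simp add: s frag_extend_add del: carrier_free_Abelian_group_iff)
  qed
  fix b assume b: "b \<in> carrier S"
  have c: "mul a t + mul b t \<in> carrier F"
    using F.m_closed[OF mul_closed[OF a t(1)] mul_closed[OF b t(1)]] by simp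
  show "(a \<oplus>\<^bsub>S\<^esub> b) \<odot>\<^bsub>extend_scalars R S h B\<^esub> x =
    a \<odot>\<^bsub>extend_scalars R S h B\<^esub> x \<oplus>\<^bsub>extend_scalars R S h B\<^esub> b \<odot>\<^bsub>extend_scalars R S h B\<^esub> x"
    using a b t c mul_distrib[OF a b, of t] coset_eq_iff[OF mul_closed[of "a \<oplus>\<^bsub>S\<^esub> b" t] c]
    by (simp add: s del: carrier_free_Abelian_group_iff) simp
  have "mul (a \<otimes>\<^bsub>S\<^esub> b) t = mul a (mul b t)"
    using t(1)[unfolded carrier_free_Abelian_group_iff]
    by (rule free_Abelian_group_induct) (use a b in \<open>auto simp: frag_extend_diff S.m_assoc\<close>)
  then show "(a \<otimes>\<^bsub>S\<^esub> b) \<odot>\<^bsub>extend_scalars R S h B\<^esub> x =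
    a \<odot>\<^bsub>extend_scalars R S h B\<^esub> (b \<odot>\<^bsub>extend_scalars R S h B\<^esub> x)"
    using a b t by (simp add: s del: carrier_free_Abelian_group_iff)
next
  fix x assume "x \<in> carrier (extend_scalars R S h B)"
  then obtain t where t: "t \<in> carrier F" "x = N #>\<^bsub>F\<^esub> t" by (auto elim: coset_cases)
  have "mul \<one>\<^bsub>S\<^esub> t = t"
    using t(1)[unfolded carrier_free_Abelian_group_iff]
    by (rule free_Abelian_group_induct) (auto simp: frag_extend_diff)
  then show "\<one>\<^bsub>S\<^esub> \<odot>\<^bsub>extend_scalars R S h B\<^esub> x = x"
    using t by (simp add: extend_scalars_smult del: carrier_free_Abelian_group_iff)
qed

lemma tensor_closed:
  "\<lbrakk>s \<in> carrier S; b \<in> carrier B\<rbrakk> \<Longrightarrow> tensor s b \<in> carrier (extend_scalars R S h B)"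
  by (simp add: coset_closed)

lemma smult_tensor:
  "\<lbrakk>s \<in> carrier S; s' \<in> carrier S; b \<in> carrier B\<rbrakk> \<Longrightarrow>
    s \<odot>\<^bsub>extend_scalars R S h B\<^esub> tensor s' b = tensor (s \<otimes>\<^bsub>S\<^esub> s') b"
  by (simp add: extend_scalars_smult)

lemma tensor_balanced:
  assumes "s \<in> carrier S" "r \<in> carrier R" "b \<in> carrier B"
  shows "tensor (s \<otimes>\<^bsub>S\<^esub> h r) b = tensor s (r \<odot>\<^bsub>B\<^esub> b)"
proof -
  have "frag_of (s \<otimes>\<^bsub>S\<^esub> h r, b) - frag_of (s, r \<odot>\<^bsub>B\<^esub> b) \<in> tensor_relations R S h B"
    using assms unfolding tensor_relations_def by blast
  then have "frag_of (s \<otimes>\<^bsub>S\<^esub> h r, b) - frag_of (s, r \<odot>\<^bsub>B\<^esub> b) \<in> N" by (rule generate.incl)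
  then show ?thesis using assms by (subst coset_eq_iff) (auto simp: h_closed B_smult_closed)
qed

text \<open>Differences in place of sums, because the free abelian group has integer coefficients
  and negatives must be reached too.\<close>

lemma tensor_induct [consumes 1, case_names tensor zero diff]:
  assumes C: "C \<in> carrier (extend_scalars R S h B)"
    and t: "\<And>s b. \<lbrakk>s \<in> carrier S; b \<in> carrier B\<rbrakk> \<Longrightarrow> P (tensor s b)"
    and z: "P \<zero>\<^bsub>extend_scalars R S h B\<^esub>"
    and d: "\<And>C D. \<lbrakk>C \<in> carrier (extend_scalars R S h B); D \<in> carrier (extend_scalars R S h B); P C; P D\<rbrakk>
      \<Longrightarrow> P (C \<ominus>\<^bsub>extend_scalars R S h B\<^esub> D)"
  shows "P C"
proof -
  interpret M: left_module S "extend_scalars R S h B" by (rule left_module_extend_scalars)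
  obtain u where u: "u \<in> carrier F" "C = N #>\<^bsub>F\<^esub> u" using C by (rule coset_cases)
  have "P (N #>\<^bsub>F\<^esub> u)"
    using u(1)[unfolded carrier_free_Abelian_group_iff]
  proof (rule free_Abelian_group_induct, goal_cases)
    case 1
    have "N #>\<^bsub>F\<^esub> 0 = N" using F.coset_mult_one[OF N.subset] by simp
    then show ?case using z by (simp add: extend_scalars_simps)
  next
    case (2 x y)
    have c: "x \<in> carrier F" "y \<in> carrier F" "x - y \<in> carrier F"
      using 2 keys_diff[of x y] by auto
    have "N #>\<^bsub>F\<^esub> x = (N #>\<^bsub>F\<^esub> (x - y)) \<oplus>\<^bsub>extend_scalars R S h B\<^esub> (N #>\<^bsub>F\<^esub> y)"
      using coset_add[OF c(3,2)] by simp
    then have "N #>\<^bsub>F\<^esub> (x - y) = (N #>\<^bsub>F\<^esub> x) \<ominus>\<^bsub>extend_scalars R S h B\<^esub> (N #>\<^bsub>F\<^esub> y)"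
      using coset_closed[OF c(2)] coset_closed[OF c(3)] by (simp add: a_minus_def M.M.a_assoc M.M.r_neg)
    then show ?case using d[OF coset_closed[OF c(1)] coset_closed[OF c(2)] 2(3,4)] by simp
  next
    case (3 p)
    then show ?case using t by (cases p) simp
  qed
  then show ?thesis using u by simp
qed

text \<open>The free abelian group extends \<open>f\<close> to a homomorphism \<open>g\<close> that
  kills the relations, hence \<open>N\<close>. This is the universal property of the tensor product
  in the form used later: a balanced biadditive function depends only on the pure tensor.\<close>

lemma tensor_lift:
  fixes V :: "('v, 'w) ring_scheme"
  assumes V: "abelian_group V"
    and f: "\<And>s b. \<lbrakk>s \<in> carrier S; b \<in> carrier B\<rbrakk> \<Longrightarrow> f s b \<in> carrier V"
    and l: "\<And>s s' b. \<lbrakk>s \<in> carrier S; s' \<in> carrier S; b \<in> carrier B\<rbrakk> \<Longrightarrow> f (s \<oplus>\<^bsub>S\<^esub> s') b = f s b \<oplus>\<^bsub>V\<^esub> f s' b"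
    and r: "\<And>s b b'. \<lbrakk>s \<in> carrier S; b \<in> carrier B; b' \<in> carrier B\<rbrakk> \<Longrightarrow> f s (b \<oplus>\<^bsub>B\<^esub> b') = f s b \<oplus>\<^bsub>V\<^esub> f s b'"
    and bal: "\<And>s r b. \<lbrakk>s \<in> carrier S; r \<in> carrier R; b \<in> carrier B\<rbrakk> \<Longrightarrow> f (s \<otimes>\<^bsub>S\<^esub> h r) b = f s (r \<odot>\<^bsub>B\<^esub> b)"
    and eq: "tensor s b = tensor s' b'"
    and sb: "s \<in> carrier S" "b \<in> carrier B" "s' \<in> carrier S" "b' \<in> carrier B"
  shows "f s b = f s' b'"
proof -
  interpret V: abelian_group V by fact
  interpret VG: comm_group "add_monoid V" by (rule V.a_comm_group)
  obtain g where g: "g \<in> hom F (add_monoid V)" "\<And>x. x \<in> carrier S \<times> carrier B \<Longrightarrow> g (frag_of x) = (\<lambda>(s, b). f s b) x"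
    by (rule comm_group.free_Abelian_group_universal[OF V.a_comm_group, of "\<lambda>(s, b). f s b" "carrier S \<times> carrier B"]) (use f in auto)
  interpret g: group_hom F "add_monoid V" g
    using g(1) by unfold_locales
  have gd: "g (x - y) = g x \<ominus>\<^bsub>V\<^esub> g y" if "x \<in> carrier F" "y \<in> carrier F" for x y
    using g.hom_mult[OF that(1) F.inv_closed[OF that(2)]] g.hom_inv[OF that(2)] that
    by (simp add: a_minus_def a_inv_def)
  have gc: "g x \<in> carrier V" if "x \<in> carrier F" for x using g.hom_closed[OF that] by simp
  have rel: "g t = \<zero>\<^bsub>V\<^esub>" if "t \<in> tensor_relations R S h B" for t
    using that unfolding tensor_relations_def
  proof (elim UnE CollectE exE conjE, goal_cases)
    case (1 s1 s2 b)
    then have c: "frag_of (s1 \<oplus>\<^bsub>S\<^esub> s2, b) \<in> carrier F" "frag_of (s1, b) \<in> carrier F"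
      "frag_of (s2, b) \<in> carrier F" by simp_all
    have "frag_of (s1 \<oplus>\<^bsub>S\<^esub> s2, b) - frag_of (s1, b) \<in> carrier F"
      using c by (simp add: keys_diff_subset)
    then have "g t = f (s1 \<oplus>\<^bsub>S\<^esub> s2) b \<ominus>\<^bsub>V\<^esub> f s1 b \<ominus>\<^bsub>V\<^esub> f s2 b"
      using 1 c by (simp add: gd g(2) del: carrier_free_Abelian_group_iff)
    also have "\<dots> = (f s1 b \<oplus>\<^bsub>V\<^esub> f s2 b) \<ominus>\<^bsub>V\<^esub> f s1 b \<ominus>\<^bsub>V\<^esub> f s2 b"
      using 1 l by simp
    finally show ?case using 1 f by (simp add: V.add_minus_minus)
  next
    case (2 s1 b b')
    then have c: "frag_of (s1, b \<oplus>\<^bsub>B\<^esub> b') \<in> carrier F" "frag_of (s1, b) \<in> carrier F"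
      "frag_of (s1, b') \<in> carrier F" by (simp_all add: B_add_closed)
    have "frag_of (s1, b \<oplus>\<^bsub>B\<^esub> b') - frag_of (s1, b) \<in> carrier F"
      using c by (simp add: keys_diff_subset)
    then have "g t = f s1 (b \<oplus>\<^bsub>B\<^esub> b') \<ominus>\<^bsub>V\<^esub> f s1 b \<ominus>\<^bsub>V\<^esub> f s1 b'"
      using 2 c by (simp add: gd g(2) B_add_closed del: carrier_free_Abelian_group_iff)
    also have "\<dots> = (f s1 b \<oplus>\<^bsub>V\<^esub> f s1 b') \<ominus>\<^bsub>V\<^esub> f s1 b \<ominus>\<^bsub>V\<^esub> f s1 b'"
      using 2 r by simp
    finally show ?case using 2 f by (simp add: V.add_minus_minus)
  next
    case (3 s1 r1 b)
    then have "g t = f (s1 \<otimes>\<^bsub>S\<^esub> h r1) b \<ominus>\<^bsub>V\<^esub> f s1 (r1 \<odot>\<^bsub>B\<^esub> b)"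
      by (simp add: gd g(2) h_closed B_smult_closed)
    then show ?case using 3 bal f by (simp add: V.minus_eq_zero_iff B_smult_closed)
  qed
  have "g t = \<zero>\<^bsub>V\<^esub>" if "t \<in> N" for t
    using that
  proof induction
    case one
    then show ?case using g.hom_one by simp
  next
    case (incl t)
    then show ?case by (rule rel)
  next
    case (inv t)
    then have "t \<in> carrier F" using relations_closed by blast
    then show ?case using gd[of 0 t] rel[OF inv] g.hom_one V.minus_eq_zero_iff[of "\<zero>\<^bsub>V\<^esub>" "\<zero>\<^bsub>V\<^esub>"] by simp
  next
    case (eng t t')
    then have "t \<in> carrier F" "t' \<in> carrier F" using N.subset by blast+
    then show ?case using g.hom_mult[of t t'] eng by simp
  qed
  moreover have "frag_of (s, b) - frag_of (s', b') \<in> N"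
    using eq sb by (subst coset_eq_iff[symmetric]) auto
  ultimately have "g (frag_of (s, b) - frag_of (s', b')) = \<zero>\<^bsub>V\<^esub>" by blast
  then have "g (frag_of (s, b)) \<ominus>\<^bsub>V\<^esub> g (frag_of (s', b')) = \<zero>\<^bsub>V\<^esub>" using sb gd by simp
  then show ?thesis using sb g(2) f V.minus_eq_zero_iff by auto
qed

end

section \<open>Quotient modules\<close>

lemma quot_module_simps [simp]:
  "carrier (quot_module M N) = a_rcosets\<^bsub>M\<^esub> N" "\<zero>\<^bsub>quot_module M N\<^esub> = N"
  "add (quot_module M N) = set_add M"
  by (simp_all add: quot_module_def)

lemma abelian_group_quot_module:
  fixes M :: "('r, 'a, 'c) module_scheme"
  assumes "abelian_group M" "subgroup N (add_monoid M)"
  shows "abelian_group (quot_module M N)"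
proof (rule abelian_group_of_comm_group)
  interpret M: abelian_group M by fact
  show "comm_group (add_monoid M Mod N)"
    using comm_group.abelian_FactGroup[OF M.a_comm_group assms(2)] .
qed (simp_all add: FactGroup_def set_add_def[abs_def] A_RCOSETS_def)

context
  fixes M :: "('r, 'a, 'c) module_scheme" and N
  assumes M: "abelian_group M" and N: "subgroup N (add_monoid M)"
begin

interpretation M: abelian_group M by (rule M)

interpretation N: normal N "add_monoid M"
  by (rule comm_group.subgroup_imp_normal[OF M.a_comm_group N])

lemma quot_class_add:
  "\<lbrakk>x \<in> carrier M; y \<in> carrier M\<rbrakk> \<Longrightarrow> (N +>\<^bsub>M\<^esub> x) \<oplus>\<^bsub>quot_module M N\<^esub> (N +>\<^bsub>M\<^esub> y) = N +>\<^bsub>M\<^esub> (x \<oplus>\<^bsub>M\<^esub> y)"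
  using N.rcos_sum[of x y] by (simp add: a_r_coset_def set_add_def)

lemma quot_class_closed: "x \<in> carrier M \<Longrightarrow> N +>\<^bsub>M\<^esub> x \<in> carrier (quot_module M N)"
  using M.a_rcosetsI[of N x] subgroup.subset[OF N] by simp

lemma quot_class_cases:
  assumes "C \<in> carrier (quot_module M N)"
  obtains x where "x \<in> carrier M" "C = N +>\<^bsub>M\<^esub> x"
  using assms by (auto simp: A_RCOSETS_def' )

lemma quot_class_eq_zero: "x \<in> carrier M \<Longrightarrow> N +>\<^bsub>M\<^esub> x = N \<longleftrightarrow> x \<in> N"
  using M.a_coset_join2[OF _ N] group.rcos_self[OF M.a_group _ N, of x] by (auto simp: a_r_coset_def)

lemma quot_class_smult:
  assumes r: "\<And>x y. \<lbrakk>x \<in> carrier M; y \<in> carrier M\<rbrakk> \<Longrightarrow> r \<odot>\<^bsub>M\<^esub> (x \<oplus>\<^bsub>M\<^esub> y) = r \<odot>\<^bsub>M\<^esub> x \<oplus>\<^bsub>M\<^esub> r \<odot>\<^bsub>M\<^esub> y"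
    "\<And>x. x \<in> carrier M \<Longrightarrow> r \<odot>\<^bsub>M\<^esub> x \<in> carrier M"
    "\<And>x. x \<in> N \<Longrightarrow> r \<odot>\<^bsub>M\<^esub> x \<in> N"
    and u: "u \<in> carrier M"
  shows "r \<odot>\<^bsub>quot_module M N\<^esub> (N +>\<^bsub>M\<^esub> u) = N +>\<^bsub>M\<^esub> (r \<odot>\<^bsub>M\<^esub> u)"
  using N.Union_rcos_endo[of "\<lambda>x. r \<odot>\<^bsub>M\<^esub> x" u] assms
  by (simp add: quot_module_def a_r_coset_def)

end

lemma (in left_module) left_module_quot_module:
  assumes N: "subgroup N (add_monoid M)" "\<And>r x. \<lbrakk>r \<in> carrier R; x \<in> N\<rbrakk> \<Longrightarrow> r \<odot>\<^bsub>M\<^esub> x \<in> N"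
  shows "left_module R (quot_module M N)"
proof (intro left_module.intro left_module_axioms.intro)
  have M: "abelian_group M" ..
  show "ring R" ..
  show "abelian_group (quot_module M N)" by (rule abelian_group_quot_module[OF M N(1)])
  have s: "r \<odot>\<^bsub>quot_module M N\<^esub> (N +>\<^bsub>M\<^esub> u) = N +>\<^bsub>M\<^esub> (r \<odot>\<^bsub>M\<^esub> u)"
    if "r \<in> carrier R" "u \<in> carrier M" for r u
    by (rule quot_class_smult[OF M N(1)]) (use that N(2) smult_r_distr smult_closed in auto)
  note q = s quot_class_add[OF M N(1)] smult_closed quot_class_closed[OF M N(1)]
  fix a C assume a: "a \<in> carrier R" and "C \<in> carrier (quot_module M N)"
  then obtain x where x: "x \<in> carrier M" "C = N +>\<^bsub>M\<^esub> x" using quot_class_cases[OF M N(1)] by blast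
  show "a \<odot>\<^bsub>quot_module M N\<^esub> C \<in> carrier (quot_module M N)" using a x q by (simp del: quot_module_simps)
  show "a \<odot>\<^bsub>quot_module M N\<^esub> (C \<oplus>\<^bsub>quot_module M N\<^esub> D) =
    a \<odot>\<^bsub>quot_module M N\<^esub> C \<oplus>\<^bsub>quot_module M N\<^esub> a \<odot>\<^bsub>quot_module M N\<^esub> D"
    if D: "D \<in> carrier (quot_module M N)" for D
  proof -
    obtain y where y: "y \<in> carrier M" "D = N +>\<^bsub>M\<^esub> y" using quot_class_cases[OF M N(1) D] by blast
    show ?thesis using a x y by (simp add: q smult_r_distr del: quot_module_simps)
  qed
  fix b assume b: "b \<in> carrier R"
  show "(a \<oplus>\<^bsub>R\<^esub> b) \<odot>\<^bsub>quot_module M N\<^esub> C =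
    a \<odot>\<^bsub>quot_module M N\<^esub> C \<oplus>\<^bsub>quot_module M N\<^esub> b \<odot>\<^bsub>quot_module M N\<^esub> C"
    using a b x by (simp add: q smult_l_distr del: quot_module_simps)
  show "(a \<otimes>\<^bsub>R\<^esub> b) \<odot>\<^bsub>quot_module M N\<^esub> C =
    a \<odot>\<^bsub>quot_module M N\<^esub> (b \<odot>\<^bsub>quot_module M N\<^esub> C)"
    using a b x by (simp add: q smult_assoc del: quot_module_simps)
next
  have M: "abelian_group M" ..
  fix C assume "C \<in> carrier (quot_module M N)"
  then obtain x where x: "x \<in> carrier M" "C = N +>\<^bsub>M\<^esub> x" using quot_class_cases[OF M N(1)] by blast
  have "\<one>\<^bsub>R\<^esub> \<odot>\<^bsub>quot_module M N\<^esub> (N +>\<^bsub>M\<^esub> x) = N +>\<^bsub>M\<^esub> (\<one>\<^bsub>R\<^esub> \<odot>\<^bsub>M\<^esub> x)"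
    by (rule quot_class_smult[OF M N(1)]) (use x N(2) smult_r_distr smult_closed in auto)
  then show "\<one>\<^bsub>R\<^esub> \<odot>\<^bsub>quot_module M N\<^esub> C = C" using x by (simp add: smult_one)
qed

section \<open>Subalgebras and the module \<open>M\<^sub>\<phi>\<close>\<close>

lemma lie_algebra_subalgebra:
  assumes L: "lie_algebra L" and S: "subspace complex_ring S L"
    and br: "\<And>x y. \<lbrakk>x \<in> S; y \<in> S\<rbrakk> \<Longrightarrow> bracket L x y \<in> S"
  shows "lie_algebra (L\<lparr>carrier := S\<rparr>)"
proof -
  interpret lie_algebra L by fact
  have S_sub: "\<And>x. x \<in> S \<Longrightarrow> x \<in> carrier L"
    using S unfolding subspace_def submodule_def by blast
  show ?thesis
    by (intro lie_algebra.intro lie_algebra_axioms.intro subspace_is_vs S)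
      (simp_all add: br S_sub bracket_add_left bracket_add_right bracket_smult_left bracket_smult_right
        bracket_self jacobi)
qed

text \<open>The subalgebra is a record of its own, since \<open>env H\<close> and its relations are
  formed from a record; the operations are required to agree as functions.\<close>

locale lie_subalgebra = L: lie_algebra L + H: lie_algebra H
  for L :: "('a, 'c) lie_algebra_scheme" and H :: "('a, 'd) lie_algebra_scheme" +
  assumes carrier_subset: "carrier H \<subseteq> carrier L"
    and add_H: "add H = add L" and smult_H: "module.smult H = module.smult L"
    and bracket_H: "bracket H = bracket L"
begin

lemma free_algebra_mono: "f \<in> carrier (free_algebra (carrier H)) \<Longrightarrow> f \<in> carrier (free_algebra (carrier L))"
  using carrier_subset by (auto simp: free_algebra_carrier)

text \<open>The elements of \<open>env_ideal L\<close> supported on words over \<open>H\<close> form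
  an ideal of the smaller free algebra that contains its relations. This makes the inclusion of
  words descend to \<open>env_incl\<close>.\<close>

lemma env_ideal_mono: "env_ideal H \<subseteq> env_ideal L"
proof -
  let ?F = "free_algebra (carrier H)"
  interpret I: ideal "env_ideal L" "free_algebra (carrier L)" by (rule L.ideal_env_ideal)
  let ?I = "{f \<in> carrier ?F. f \<in> env_ideal L}"
  \<comment> \<open>Convolution does not refer to the set of letters, so products may be computed in
    either free algebra.\<close>
  have m: "f \<otimes>\<^bsub>?F\<^esub> g = f \<otimes>\<^bsub>free_algebra (carrier L)\<^esub> g" for f g :: "'a list \<Rightarrow> complex"
    by (simp add: free_algebra_mult)
  have "ideal ?I ?F"
  proof (rule idealI[OF ring_free_algebra])
    show "subgroup ?I (add_monoid ?F)"
    proof (rule group.subgroupI)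
      show "group (add_monoid ?F)" by (rule FA.a_group)
      show "?I \<noteq> {}" using zero_free_algebra_closed I.zero_closed by (auto simp: free_algebra_zero)
      fix a assume a: "a \<in> ?I"
      have "\<ominus>\<^bsub>free_algebra (carrier L)\<^esub> a \<in> env_ideal L" using a I.a_inv_closed by simp
      then have "\<ominus>\<^bsub>?F\<^esub> a \<in> ?I" using a free_algebra_mono[of a] FA.a_inv_closed[of a "carrier H"]
        by (simp add: free_algebra_uminus)
      then show "inv\<^bsub>add_monoid ?F\<^esub> a \<in> ?I" by (simp add: a_inv_def)
    qed (use I.a_closed in \<open>auto simp: free_algebra_add free_algebra_add_closed\<close>)
  qed (use I.I_l_closed I.I_r_closed free_algebra_mono in
      \<open>auto simp: free_algebra_mult_closed simp flip: m\<close>)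
  moreover have "env_relations H \<subseteq> ?I"
  proof
    fix r assume r: "r \<in> env_relations H"
    then have "r \<in> env_relations L"
      unfolding H.env_relations_iff L.env_relations_iff add_H smult_H bracket_H
      using carrier_subset by blast
    then show "r \<in> ?I" using r H.env_relations_closed L.env_relations_in_env_ideal by blast
  qed
  ultimately show ?thesis using H.env_ideal_minimal by blast
qed

lemma env_incl_class:
  assumes f: "f \<in> carrier (free_algebra (carrier H))"
  shows "env_incl H L (env_class H f) = env_class L f"
proof -
  have "env_class L g = env_class L f" if "g \<in> env_class H f" for g
    using H.env_class_memD[OF f that] H.env_class_eq_iff[of g f] f env_ideal_mono
      L.env_class_eq_iff[OF free_algebra_mono free_algebra_mono, of g f] by blast
  then show ?thesis using H.env_class_self[OF f] unfolding env_incl_def by blast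
qed

lemma env_incl_closed: "C \<in> carrier (env H) \<Longrightarrow> env_incl H L C \<in> carrier (env L)"
  by (erule H.env_carrierE) (simp add: env_incl_class L.env_class_closed free_algebra_mono)

lemma env_incl_hom: "env_incl H L \<in> ring_hom (env H) (env L)"
proof (rule ring_hom_memI)
  show "C \<in> carrier (env H) \<Longrightarrow> env_incl H L C \<in> carrier (env L)" for C by (rule env_incl_closed)
  fix C D assume "C \<in> carrier (env H)" "D \<in> carrier (env H)"
  then obtain f g where fg: "f \<in> carrier (free_algebra (carrier H))" "C = env_class H f"
    "g \<in> carrier (free_algebra (carrier H))" "D = env_class H g"
    by (auto elim!: H.env_carrierE)
  show "env_incl H L (C \<oplus>\<^bsub>env H\<^esub> D) = env_incl H L C \<oplus>\<^bsub>env L\<^esub> env_incl H L D"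
    using fg by (simp add: env_incl_class free_algebra_mono free_algebra_add_closed
        flip: H.env_class_add L.env_class_add)
  have "env_class H (f \<otimes>\<^bsub>free_algebra (carrier H)\<^esub> g) = C \<otimes>\<^bsub>env H\<^esub> D"
    using fg by (simp add: H.env_class_mult)
  moreover have "env_class L (f \<otimes>\<^bsub>free_algebra (carrier H)\<^esub> g) = env_class L f \<otimes>\<^bsub>env L\<^esub> env_class L g"
    using fg by (simp add: free_algebra_mono free_algebra_mult flip: L.env_class_mult)
  ultimately show "env_incl H L (C \<otimes>\<^bsub>env H\<^esub> D) = env_incl H L C \<otimes>\<^bsub>env L\<^esub> env_incl H L D"
    using fg env_incl_class[of "f \<otimes>\<^bsub>free_algebra (carrier H)\<^esub> g"]
    by (simp add: env_incl_class free_algebra_mult_closed)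
next
  show "env_incl H L \<one>\<^bsub>env H\<^esub> = \<one>\<^bsub>env L\<^esub>"
    using env_incl_class[of "word_monom 1 []"]
    by (simp add: word_monom_closed H.env_class_one L.env_class_one)
qed

lemma env_incl_gen: "x \<in> carrier H \<Longrightarrow> env_incl H L (env_gen H x) = env_gen L x"
  by (simp add: env_incl_class word_monom_closed)

lemma env_incl_scal: "env_incl H L (env_scal H c) = env_scal L c"
  by (simp add: env_incl_class word_monom_closed)

lemma sub_env_simps [simp]:
  "carrier (sub_env H L) = env_incl H L ` carrier (env H)" "add (sub_env H L) = add (env L)"
  "monoid.mult (sub_env H L) = monoid.mult (env L)" "\<one>\<^bsub>sub_env H L\<^esub> = \<one>\<^bsub>env L\<^esub>"
  "\<zero>\<^bsub>sub_env H L\<^esub> = \<zero>\<^bsub>env L\<^esub>"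
  by (simp_all add: sub_env_def)

lemma ring_sub_env: "ring (sub_env H L)"
proof -
  interpret h: ring_hom_ring "env H" "env L" "env_incl H L"
    by (rule ring_hom_ringI2[OF H.ring_env L.ring_env env_incl_hom])
  show ?thesis
    unfolding sub_env_def
    by (rule ring.subring_is_ring[OF L.ring_env])
      (use h.img_is_subring[OF ring.carrier_is_subring[OF H.ring_env]] in simp)
qed

lemma sub_env_closed: "C \<in> carrier (sub_env H L) \<Longrightarrow> C \<in> carrier (env L)"
  by (auto intro: env_incl_closed)

lemma env_scal_sub_env: "env_scal L c \<in> carrier (sub_env H L)"
  using env_incl_scal[of c] H.env_scal_closed[of c] by (metis imageI sub_env_simps(1))

lemma env_gen_sub_env: "x \<in> carrier H \<Longrightarrow> env_gen L x \<in> carrier (sub_env H L)"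
  using env_incl_gen[of x] H.env_gen_closed[of x] by (metis imageI sub_env_simps(1))

lemma sub_env_induct [consumes 1, case_names scal add gen]:
  assumes C: "C \<in> carrier (sub_env H L)"
    and s: "\<And>c. P (env_scal L c)"
    and a: "\<And>C D. \<lbrakk>C \<in> carrier (sub_env H L); D \<in> carrier (sub_env H L); P C; P D\<rbrakk> \<Longrightarrow> P (C \<oplus>\<^bsub>env L\<^esub> D)"
    and g: "\<And>x C. \<lbrakk>x \<in> carrier H; C \<in> carrier (sub_env H L); P C\<rbrakk> \<Longrightarrow> P (env_gen L x \<otimes>\<^bsub>env L\<^esub> C)"
  shows "P C"
proof -
  have "P (env_incl H L D)" if "D \<in> carrier (env H)" for D
    using that
  proof (induction D rule: H.env_induct)
    case (scal c)
    then show ?case using s by (simp add: env_incl_scal)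
  next
    case (add C D)
    then show ?case using a[of "env_incl H L C" "env_incl H L D"] ring_hom_add[OF env_incl_hom, of C D] by simp
  next
    case (gen x C)
    then show ?case using g[of x "env_incl H L C"] ring_hom_mult[OF env_incl_hom, of "env_gen H x" C]
      by (simp add: env_incl_gen)
  qed
  then show ?thesis using C by auto
qed

end

section \<open>The one-dimensional module and the universal Whittaker module\<close>

lemma one_dim_module_simps [simp]:
  "carrier (one_dim_module \<phi>) = UNIV" "add (one_dim_module \<phi>) = (+)" "\<zero>\<^bsub>one_dim_module \<phi>\<^esub> = 0"
  "module.smult (one_dim_module \<phi>) = (*)" "lact (one_dim_module \<phi>) = (\<lambda>x a. \<phi> x * a)"
  by (simp_all add: one_dim_module_def)

lemma vectorspace_one_dim_module: "vectorspace complex_ring (one_dim_module \<phi>)"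
proof (rule complex_vectorspaceI)
  show "abelian_group (one_dim_module \<phi>)"
    by (rule abelian_groupI) (auto simp: algebra_simps intro: exI[of _ "- x" for x])
qed (auto simp: algebra_simps)

lemma one_dim_module_minus: "a \<ominus>\<^bsub>one_dim_module \<phi>\<^esub> b = a - b"
proof -
  interpret V: abelian_group "one_dim_module \<phi>"
    by (rule complex_vectorspaceD(1)[OF vectorspace_one_dim_module])
  have "\<ominus>\<^bsub>one_dim_module \<phi>\<^esub> b = - b" by (rule V.minus_equality) simp_all
  then show ?thesis by (simp add: a_minus_def)
qed

locale lie_character = lie_subalgebra L N
  for L :: "'a lie_algebra" and N :: "'a lie_algebra" +
  fixes \<phi> :: "'a \<Rightarrow> complex"
  assumes phi_add: "\<lbrakk>x \<in> carrier N; y \<in> carrier N\<rbrakk> \<Longrightarrow> \<phi> (x \<oplus>\<^bsub>L\<^esub> y) = \<phi> x + \<phi> y"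
    and phi_smult: "x \<in> carrier N \<Longrightarrow> \<phi> (c \<odot>\<^bsub>L\<^esub> x) = c * \<phi> x"
    and phi_bracket: "\<lbrakk>x \<in> carrier N; y \<in> carrier N\<rbrakk> \<Longrightarrow> \<phi> (bracket L x y) = 0"
begin

lemma lie_module_one_dim: "lie_module N (one_dim_module \<phi>)"
  by (intro lie_module.intro lie_module_axioms.intro H.lie_algebra_axioms vectorspace_one_dim_module)
    (simp_all add: add_H smult_H bracket_H phi_add phi_smult phi_bracket one_dim_module_minus algebra_simps)

abbreviation "B \<equiv> env_module (one_dim_module \<phi>)"
abbreviation "M \<equiv> whittaker_M L N \<phi>"

lemma B_simps: "carrier B = UNIV" "add B = (+)"
  by (simp_all add: env_module_def)

lemma scalar_extension: "scalar_extension (env N) (env L) (env_incl N L) B"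
proof -
  interpret B: left_module "env N" B
    by (rule lie_module.left_module_env_module[OF lie_module_one_dim])
  show ?thesis
    by (intro scalar_extension.intro scalar_extension_axioms.intro L.ring_env env_incl_closed
        B.M.a_closed B.smult_closed)
qed

interpretation E: scalar_extension "env N" "env L" "env_incl N L" B
  by (rule scalar_extension)

definition whittaker_gen where "whittaker_gen = E.tensor \<one>\<^bsub>env L\<^esub> 1"

lemma left_module_whittaker_M: "left_module (env L) M"
  unfolding whittaker_M_def by (rule E.left_module_extend_scalars)

lemma whittaker_gen_closed: "whittaker_gen \<in> carrier M"
  unfolding whittaker_gen_def whittaker_M_def by (rule E.tensor_closed) (simp_all add: B_simps)

lemma smult_whittaker_gen:
  "u \<in> carrier (env L) \<Longrightarrow> u \<odot>\<^bsub>M\<^esub> whittaker_gen = E.tensor u 1"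
  unfolding whittaker_gen_def whittaker_M_def by (subst E.smult_tensor) (simp_all add: B_simps)

text \<open>The second factor \<open>b\<close> is \<open>env_scal N b\<close> acting on 1, and this
  scalar moves across the tensor sign.\<close>

lemma tensor_scal:
  assumes s: "s \<in> carrier (env L)"
  shows "E.tensor s b = E.tensor (s \<otimes>\<^bsub>env L\<^esub> env_scal L b) 1"
  using E.tensor_balanced[of s "env_scal N b" 1] s
  by (simp add: B_simps env_incl_scal lie_module.env_scal_smult_module[OF lie_module_one_dim])

text \<open>Pure tensors are multiples of the generator by \<open>tensor_scal\<close>, and the
  multiples of the generator are closed under differences.\<close>

lemma whittaker_M_cyclic:
  assumes "v \<in> carrier M"
  obtains u where "u \<in> carrier (env L)" "v = u \<odot>\<^bsub>M\<^esub> whittaker_gen"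
proof -
  interpret M: left_module "env L" M by (rule left_module_whittaker_M)
  from assms have "\<exists>u\<in>carrier (env L). v = u \<odot>\<^bsub>M\<^esub> whittaker_gen"
    unfolding whittaker_M_def
  proof (induction v rule: E.tensor_induct)
    case (tensor s b)
    have "E.tensor s b = (s \<otimes>\<^bsub>env L\<^esub> env_scal L b) \<odot>\<^bsub>M\<^esub> whittaker_gen"
      by (rule trans[OF tensor_scal[OF tensor(1)] smult_whittaker_gen[symmetric]]) (intro E.S.m_closed tensor(1) L.env_scal_closed)
    then show ?case unfolding whittaker_M_def
      by (intro bexI[of _ "s \<otimes>\<^bsub>env L\<^esub> env_scal L b"] E.S.m_closed tensor(1) L.env_scal_closed)
  next
    case zero
    show ?case using M.smult_l_zero[OF whittaker_gen_closed] unfolding whittaker_M_def by (metis E.S.zero_closed)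
  next
    case (diff C D)
    then obtain u v where uv: "u \<in> carrier (env L)" "v \<in> carrier (env L)"
      "C = u \<odot>\<^bsub>M\<^esub> whittaker_gen" "D = v \<odot>\<^bsub>M\<^esub> whittaker_gen" unfolding whittaker_M_def by blast
    then have "C \<ominus>\<^bsub>M\<^esub> D = (u \<ominus>\<^bsub>env L\<^esub> v) \<odot>\<^bsub>M\<^esub> whittaker_gen"
      by (simp add: M.smult_l_diff whittaker_gen_closed)
    then show ?case using E.S.minus_closed[OF uv(1,2)] unfolding whittaker_M_def by blast
  qed
  then show ?thesis using that by blast
qed

text \<open>The element \<open>x\<close> of \<open>N\<close> moves across the tensor sign, acts on 1
  as the number \<open>\<phi> x\<close>, and this number moves back by
  \<open>tensor_scal\<close>.\<close>

lemma whittaker_gen_vector: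
  assumes x: "x \<in> carrier N"
  shows "env_gen L x \<odot>\<^bsub>M\<^esub> whittaker_gen = env_scal L (\<phi> x) \<odot>\<^bsub>M\<^esub> whittaker_gen"
proof -
  have xL: "x \<in> carrier L" using x carrier_subset by blast
  have "E.tensor (env_gen L x) 1 = E.tensor \<one>\<^bsub>env L\<^esub> (\<phi> x)"
    using E.tensor_balanced[of "\<one>\<^bsub>env L\<^esub>" "env_gen N x" 1] x xL
    by (simp add: B_simps env_incl_gen lie_module.env_gen_smult_module[OF lie_module_one_dim])
  also have "\<dots> = E.tensor (env_scal L (\<phi> x)) 1"
    using tensor_scal[of "\<one>\<^bsub>env L\<^esub>" "\<phi> x"] by simp
  finally show ?thesis using xL by (simp add: smult_whittaker_gen)
qed

text \<open>Frobenius reciprocity in terms of elements. The map sending a tensor of \<open>s\<close>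
  and \<open>b\<close> to \<open>s\<close> applied to \<open>b v\<close> is balanced, because the
  line through \<open>v\<close> is a quotient of the one-dimensional module; hence what
  \<open>u\<close> does to \<open>v\<close> is determined by what it does to the generator.\<close>

lemma whittaker_M_universal:
  assumes V: "lie_module L V" and v: "whittaker_vector N \<phi> V v"
    and u: "u \<in> carrier (env L)" "u' \<in> carrier (env L)"
    and eq: "u \<odot>\<^bsub>M\<^esub> whittaker_gen = u' \<odot>\<^bsub>M\<^esub> whittaker_gen"
  shows "u \<odot>\<^bsub>env_module V\<^esub> v = u' \<odot>\<^bsub>env_module V\<^esub> v"
proof -
  interpret V: lie_module L V by fact
  interpret E': left_module "env L" "env_module V" by (rule V.left_module_env_module)
  interpret B: lie_module N "one_dim_module \<phi>" by (rule lie_module_one_dim)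
  interpret B': left_module "env N" B by (rule B.left_module_env_module)
  note vs = V.V_vs
  have vc: "v \<in> carrier V" using v by (simp add: whittaker_vector_def)
  have wv: "lact V x v = \<phi> x \<odot>\<^bsub>V\<^esub> v" if "x \<in> carrier N" for x
    using v that by (simp add: whittaker_vector_def)
  \<comment> \<open>The balance condition: the enveloping algebra of \<open>N\<close> acts on
    multiples of \<open>v\<close> through the one-dimensional module.\<close>
  have act: "env_incl N L r \<odot>\<^bsub>env_module V\<^esub> (b \<odot>\<^bsub>V\<^esub> v) = (r \<odot>\<^bsub>B\<^esub> b) \<odot>\<^bsub>V\<^esub> v"
    if "r \<in> carrier (env N)" for r b
    using that
  proof (induction r rule: H.env_induct)
    case (scal c)
    then show ?case using vc
      by (simp add: env_incl_scal V.env_scal_smult_module B.env_scal_smult_module vs)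
  next
    case (add C D)
    then show ?case using vc B'.smult_l_distr[of C D b]
      by (simp add: ring_hom_add[OF env_incl_hom] E'.smult_l_distr env_incl_closed vs B_simps)
  next
    case (gen x C)
    have xL: "x \<in> carrier L" using gen(1) carrier_subset by blast
    have "env_incl N L (env_gen N x \<otimes>\<^bsub>env N\<^esub> C) \<odot>\<^bsub>env_module V\<^esub> (b \<odot>\<^bsub>V\<^esub> v)
      = env_gen L x \<odot>\<^bsub>env_module V\<^esub> ((C \<odot>\<^bsub>B\<^esub> b) \<odot>\<^bsub>V\<^esub> v)"
      using gen vc xL
      by (simp add: ring_hom_mult[OF env_incl_hom] E'.smult_assoc env_incl_gen env_incl_closed vs)
    also have "\<dots> = (C \<odot>\<^bsub>B\<^esub> b) \<odot>\<^bsub>V\<^esub> (\<phi> x \<odot>\<^bsub>V\<^esub> v)"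
      using vc xL gen(1) by (simp add: V.env_gen_smult_module vs V.lact_smult_right wv)
    also have "\<dots> = (\<phi> x * (C \<odot>\<^bsub>B\<^esub> b)) \<odot>\<^bsub>V\<^esub> v"
      using vc by (simp add: mult.commute flip: vs(5))
    also have "\<phi> x * (C \<odot>\<^bsub>B\<^esub> b) = (env_gen N x \<otimes>\<^bsub>env N\<^esub> C) \<odot>\<^bsub>B\<^esub> b"
      using gen by (simp add: B'.smult_assoc B_simps B.env_gen_smult_module)
    finally show ?case .
  qed
  \<comment> \<open>The generator is the tensor with second factor 1, which is why \<open>v\<close>
    appears as \<open>1\<close> times \<open>v\<close>.\<close>
  have "u \<odot>\<^bsub>env_module V\<^esub> (1 \<odot>\<^bsub>V\<^esub> v) = u' \<odot>\<^bsub>env_module V\<^esub> (1 \<odot>\<^bsub>V\<^esub> v)"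
  proof (rule E.tensor_lift[where f = "\<lambda>s b. s \<odot>\<^bsub>env_module V\<^esub> (b \<odot>\<^bsub>V\<^esub> v)"])
    show "abelian_group (env_module V)" ..
    show "E.tensor u 1 = E.tensor u' 1" using eq u by (simp add: smult_whittaker_gen)
  qed (use u vc in \<open>simp_all add: B_simps E'.smult_closed[simplified] E'.smult_l_distr[simplified]
      E'.smult_r_distr[simplified] E'.smult_assoc[simplified] env_incl_closed vs act\<close>)
  then show ?thesis using vc by (simp add: vs)
qed

end

section \<open>Straightening words\<close>

fun inversions :: "'q::linorder list \<Rightarrow> nat" where
  "inversions [] = 0"
| "inversions (x # xs) = length (filter (\<lambda>y. y < x) xs) + inversions xs"

text \<open>Swapping an adjacent descent removes this pair from the count and alters no other
  pair.\<close>

lemma inversions_swap: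
  "\<beta> < \<alpha> \<Longrightarrow> inversions (u @ \<beta> # \<alpha> # v) < inversions (u @ \<alpha> # \<beta> # v)"
  by (induction u) auto

text \<open>The leftmost adjacent descent, between its prefix and its suffix. Fixing one choice
  makes \<open>nf\<close> a function; \<open>nf_exchange\<close> shows afterwards that any other
  choice gives the same value.\<close>

fun first_inversion :: "'q::linorder list \<Rightarrow> ('q list \<times> 'q \<times> 'q \<times> 'q list) option" where
  "first_inversion (x # y # zs) = (if y < x then Some ([], x, y, zs)
     else map_option (\<lambda>(u, a, b, v). (x # u, a, b, v)) (first_inversion (y # zs)))"
| "first_inversion _ = None"

text \<open>Sortedness of \<open>u @ [a]\<close> records that the descent is the leftmost one; it
  later rules out a descent further to the left.\<close>

lemma first_inversion_Some:
  "first_inversion w = Some (u, a, b, v) \<Longrightarrow> w = u @ a # b # v \<and> b < a \<and> sorted (u @ [a])"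
proof (induction w arbitrary: u rule: first_inversion.induct)
  case (1 x y zs)
  show ?case
  proof (cases "y < x")
    case False
    then obtain u' where u': "first_inversion (y # zs) = Some (u', a, b, v)" "u = x # u'"
      using 1(2) by auto
    with 1(1)[OF False u'(1)] False show ?thesis by (cases u') auto
  qed (use 1 in auto)
qed auto

lemma first_inversion_None: "first_inversion w = None \<longleftrightarrow> sorted w"
  by (induction w rule: first_inversion.induct) auto

text \<open>
  Letters multiply like the \<open>x\<^sub>\<alpha>\<close>: the commutator of \<open>\<alpha>\<close> and \<open>\<beta>\<close> is \<open>c \<alpha> \<beta>\<close> times the letter
  \<open>\<alpha> + \<beta>\<close> plus a central element, by which \<open>st \<alpha> \<beta>\<close> multiplies the coefficients \<open>A\<close>. The value
  \<open>nf w a\<close> below is that at \<open>a\<close> times \<open>w\<close> of the functional on the enveloping algebra extending \<open>init\<close>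
  that sends a sorted word to the product of the \<open>ph\<close> of its letters, or to \<open>0\<close> if some letter is
  not in \<open>pos\<close>; that it is well defined takes the place of the Poincare--Birkhoff--Witt theorem.
\<close>

locale straightening =
  fixes c :: "'q::linordered_ab_group_add \<Rightarrow> 'q \<Rightarrow> complex"
    and A :: "'s set" and st :: "'q \<Rightarrow> 'q \<Rightarrow> 's \<Rightarrow> 's" and lin :: "('s \<Rightarrow> complex) \<Rightarrow> bool"
    and init :: "'s \<Rightarrow> complex" and pos :: "'q \<Rightarrow> bool" and ph :: "'q \<Rightarrow> complex"
  assumes c_antisym: "c \<beta> \<alpha> = - c \<alpha> \<beta>"
    and c_jacobi: "c \<alpha> \<beta> * c (\<alpha> + \<beta>) \<gamma> + c \<beta> \<gamma> * c (\<beta> + \<gamma>) \<alpha> + c \<gamma> \<alpha> * c (\<gamma> + \<alpha>) \<beta> = 0"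
    and st_closed: "a \<in> A \<Longrightarrow> st \<alpha> \<beta> a \<in> A"
    and st_commute: "a \<in> A \<Longrightarrow> st \<alpha> \<beta> (st \<gamma> \<delta> a) = st \<gamma> \<delta> (st \<alpha> \<beta> a)"
    and lin_init: "lin init"
    and lin_zero: "lin (\<lambda>_. 0)"
    and lin_add: "\<lbrakk>lin f; lin g\<rbrakk> \<Longrightarrow> lin (\<lambda>a. f a + g a)"
    and lin_mult: "lin f \<Longrightarrow> lin (\<lambda>a. d * f a)"
    and lin_st: "lin f \<Longrightarrow> lin (\<lambda>a. f (st \<alpha> \<beta> a))"
    and st_antisym: "\<lbrakk>lin f; a \<in> A\<rbrakk> \<Longrightarrow> f (st \<beta> \<alpha> a) = - f (st \<alpha> \<beta> a)"
    and st_jacobi: "\<lbrakk>lin f; a \<in> A\<rbrakk> \<Longrightarrow>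
      c \<alpha> \<beta> * f (st (\<alpha> + \<beta>) \<gamma> a) + c \<beta> \<gamma> * f (st (\<beta> + \<gamma>) \<alpha> a) + c \<gamma> \<alpha> * f (st (\<gamma> + \<alpha>) \<beta> a) = 0"
    and pos_mono: "\<lbrakk>pos \<alpha>; \<alpha> \<le> \<beta>\<rbrakk> \<Longrightarrow> pos \<beta>"
    and pos_add: "\<lbrakk>pos \<alpha>; pos \<beta>\<rbrakk> \<Longrightarrow> pos (\<alpha> + \<beta>)"
    and pos_st: "\<lbrakk>lin f; a \<in> A; pos \<alpha>; pos \<beta>\<rbrakk> \<Longrightarrow> f (st \<alpha> \<beta> a) = 0"
    and pos_c: "\<lbrakk>pos \<alpha>; pos \<beta>\<rbrakk> \<Longrightarrow> c \<alpha> \<beta> * ph (\<alpha> + \<beta>) = 0"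
begin

function nf :: "'q list \<Rightarrow> 's \<Rightarrow> complex" where
  "nf w a = (case first_inversion w of
     None \<Rightarrow> if list_all pos w then init a * prod_list (map ph w) else 0
   | Some (u, \<alpha>, \<beta>, v) \<Rightarrow>
       nf (u @ \<beta> # \<alpha> # v) a + c \<alpha> \<beta> * nf (u @ (\<alpha> + \<beta>) # v) a + nf (u @ v) (st \<alpha> \<beta> a))"
  by auto
termination
  \<comment> \<open>The word with merged letters and the word that has lost both letters are
    shorter; the swapped word has the same length and fewer inversions.\<close>
  by (relation "measures [\<lambda>(w, a). length w, \<lambda>(w, a). inversions w]")
    (auto dest!: first_inversion_Some intro: inversions_swap)

declare nf.simps [simp del]

lemma nf_sorted: "sorted w \<Longrightarrow> nf w a = (if list_all pos w then init a * prod_list (map ph w) else 0)"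
  by (subst nf.simps) (simp add: first_inversion_None[THEN iffD2])

lemma word_induct [case_names less]:
  assumes "\<And>w. (\<And>w'. length w' < length w \<or> length w' = length w \<and> inversions w' < inversions w \<Longrightarrow> P w') \<Longrightarrow> P w"
  shows "P (w :: 'q list)"
proof (induction w rule: wf_induct[of "measures [length, inversions]"])
  case (2 w)
  show ?case by (rule assms) (use 2 in auto)
qed simp

text \<open>The recursion builds \<open>nf w\<close> from operations that preserve
  \<open>lin\<close>. It is needed because the antisymmetry and Jacobi axioms for \<open>st\<close>
  are stated only for functions satisfying \<open>lin\<close>.\<close>

lemma lin_nf: "lin (nf w)"
proof (induction w rule: word_induct)
  case (less w)
  show ?case
  proof (cases "first_inversion w")
    case None
    then have "nf w = (\<lambda>a. (if list_all pos w then prod_list (map ph w) else 0) * init a)"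
      by (auto simp: nf_sorted first_inversion_None)
    then show ?thesis using lin_mult[OF lin_init] by metis
  next
    case (Some t)
    then obtain u \<alpha> \<beta> v where t: "first_inversion w = Some (u, \<alpha>, \<beta>, v)" by (cases t) auto
    note w = first_inversion_Some[OF t]
    have "nf w = (\<lambda>a. nf (u @ \<beta> # \<alpha> # v) a + c \<alpha> \<beta> * nf (u @ (\<alpha> + \<beta>) # v) a + nf (u @ v) (st \<alpha> \<beta> a))"
      by (subst nf.simps[abs_def]) (simp add: t)
    moreover have "lin (nf (u @ \<beta> # \<alpha> # v))" "lin (nf (u @ (\<alpha> + \<beta>) # v))" "lin (nf (u @ v))"
      using w inversions_swap[of \<beta> \<alpha> u v] by (auto intro!: less)
    ultimately show ?thesis by (simp add: lin_add lin_mult lin_st)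
  qed
qed

text \<open>The commutation relation of the enveloping algebra, imposed on \<open>nf\<close> at the
  place between \<open>u\<close> and \<open>v\<close>.\<close>

abbreviation exchange :: "'q list \<Rightarrow> 'q \<Rightarrow> 'q \<Rightarrow> 'q list \<Rightarrow> bool" where
  "exchange u \<alpha> \<beta> v \<equiv> \<forall>a\<in>A. nf (u @ \<alpha> # \<beta> # v) a =
     nf (u @ \<beta> # \<alpha> # v) a + c \<alpha> \<beta> * nf (u @ (\<alpha> + \<beta>) # v) a + nf (u @ v) (st \<alpha> \<beta> a)"

text \<open>Antisymmetry of \<open>c\<close> and \<open>st\<close> turns an ascent into a descent.
  For equal letters it makes both correction terms vanish.\<close>

lemma exchange_all:
  assumes "\<beta> < \<alpha> \<Longrightarrow> exchange u \<alpha> \<beta> v" "\<alpha> < \<beta> \<Longrightarrow> exchange u \<beta> \<alpha> v"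
  shows "exchange u \<alpha> \<beta> v"
proof (cases \<alpha> \<beta> rule: linorder_cases)
  case less
  then show ?thesis using assms(2) c_antisym[of \<alpha> \<beta>] st_antisym[OF lin_nf, of _ "u @ v" \<beta> \<alpha>]
    by (simp add: add.commute[of \<alpha> \<beta>])
next
  case equal
  have "nf (u @ v) (st \<alpha> \<alpha> a) = 0" if "a \<in> A" for a
    using st_antisym[OF lin_nf that, of "u @ v" \<alpha> \<alpha>] by simp
  then show ?thesis using equal c_antisym[of \<alpha> \<alpha>] by simp
qed (use assms in simp)

text \<open>As in the diamond lemma, overlapping inversions are resolved by the Jacobi identity.\<close>

lemma nf_exchange_inversion:
  assumes "\<beta> < \<alpha>"
  shows "exchange u \<alpha> \<beta> v"
proof -
  have "\<forall>u \<alpha> \<beta> v. w = u @ \<alpha> # \<beta> # v \<longrightarrow> \<beta> < \<alpha> \<longrightarrow> exchange u \<alpha> \<beta> v" for w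
  proof (induction w rule: word_induct)
    case (less w)
    \<comment> \<open>For words shorter than \<open>w\<close> the relation is available for all
      pairs of letters; at the length of \<open>w\<close>, by \<open>sw\<close>, for descents in
      words with fewer inversions.\<close>
    have sh: "exchange u \<alpha> \<beta> v" if "Suc (Suc (length u + length v)) < length w" for u \<alpha> \<beta> v
      by (rule exchange_all) (use less[of "u @ \<alpha> # \<beta> # v"] less[of "u @ \<beta> # \<alpha> # v"] that in auto)
    have sw: "exchange u \<alpha> \<beta> v" if "\<beta> < \<alpha>" "Suc (Suc (length u + length v)) = length w"
      "inversions (u @ \<alpha> # \<beta> # v) < inversions w" for u \<alpha> \<beta> v
      using less[of "u @ \<alpha> # \<beta> # v"] that by auto
    show ?case
    proof (intro allI impI ballI)
      fix u \<alpha> \<beta> v a assume w: "w = u @ \<alpha> # \<beta> # v" and lt: "\<beta> < \<alpha>" and a: "a \<in> A"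
      have "\<not> sorted w" using w lt by (auto simp: sorted_append)
      then obtain u' \<gamma> \<delta> v' where t: "first_inversion w = Some (u', \<gamma>, \<delta>, v')"
        using first_inversion_None[of w] by (cases "first_inversion w") auto
      note f = first_inversion_Some[OF t]
      have step: "nf w a = nf (u' @ \<delta> # \<gamma> # v') a + c \<gamma> \<delta> * nf (u' @ (\<gamma> + \<delta>) # v') a + nf (u' @ v') (st \<gamma> \<delta> a)" for a
        by (subst nf.simps) (simp add: t)
      have inv: "inversions (u' @ \<delta> # \<gamma> # v') < inversions w" "inversions (u @ \<beta> # \<alpha> # v) < inversions w"
        using f inversions_swap[of \<delta> \<gamma> u' v'] w lt inversions_swap[of \<beta> \<alpha> u v] by auto
      have eq: "u' @ \<gamma> # \<delta> # v' = u @ \<alpha> # \<beta> # v" using w f by simp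
      \<comment> \<open>A descent strictly to the left of the leftmost one would lie inside the
        sorted word \<open>u' @ [\<gamma>]\<close>.\<close>
      have len: "length u' \<le> length u"
      proof (rule ccontr)
        assume "\<not> ?thesis"
        then have "Suc (length u) \<le> length u'" by simp
        then have "take (Suc (Suc (length u))) (u' @ [\<gamma>]) = take (Suc (Suc (length u))) (u' @ \<gamma> # \<delta> # v')"
          by (cases "length u' = Suc (length u)") auto
        also have "\<dots> = u @ [\<alpha>, \<beta>]" unfolding eq by simp
        finally show False using f lt sorted_wrt_take[of "(\<le>)" "u' @ [\<gamma>]" "Suc (Suc (length u))"]
          by (auto simp: sorted_append)
      qed
      \<comment> \<open>The descent under consideration is the one that \<open>nf\<close> resolves,
        or shares one letter with it, or is disjoint from it.\<close>
      consider "u' = u" "\<gamma> = \<alpha>" "\<delta> = \<beta>" "v' = v"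
        | "u = u' @ [\<gamma>]" "\<delta> = \<alpha>" "v' = \<beta> # v"
        | u2 where "u = u' @ \<gamma> # \<delta> # u2" "v' = u2 @ \<alpha> # \<beta> # v"
      proof -
        obtain r where r: "u = u' @ r" "\<gamma> # \<delta> # v' = r @ \<alpha> # \<beta> # v"
          using eq len by (auto simp: append_eq_append_conv2)
        then show thesis using that by (cases r; cases "tl r") auto
      qed
      then show "nf (u @ \<alpha> # \<beta> # v) a =
        nf (u @ \<beta> # \<alpha> # v) a + c \<alpha> \<beta> * nf (u @ (\<alpha> + \<beta>) # v) a + nf (u @ v) (st \<alpha> \<beta> a)"
      proof cases
        case 1
        then show ?thesis using step[of a] w by simp
      next
        case 2
        \<comment> \<open>The overlap \<gamma> > \<alpha> > \<beta>. Both routes to the sorted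
          triple are expanded: \<open>e1\<close> to \<open>e3\<close> start with the left pair,
          \<open>e4\<close> and \<open>e5\<close> follow the exchange of the right pair. The triples
          agree in the end, and \<open>s1\<close> to \<open>s3\<close> reorder the two-letter terms
          that remain.\<close>
        have gt: "\<alpha> < \<gamma>" and bg: "\<beta> < \<gamma>" using f 2 lt by auto
        have w': "w = u' @ \<gamma> # \<alpha> # \<beta> # v" using w 2 by simp
        have i1: "inversions (u' @ \<alpha> # \<gamma> # \<beta> # v) < inversions w"
          using inv 2 by simp
        have i2: "inversions (u' @ \<alpha> # \<beta> # \<gamma> # v) < inversions w"
          using i1 inversions_swap[OF bg, of "u' @ [\<alpha>]" v] by simp
        have i3: "inversions (u' @ \<gamma> # \<beta> # \<alpha> # v) < inversions w" using inv(2) 2 by simp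
        have i4: "inversions (u' @ \<beta> # \<gamma> # \<alpha> # v) < inversions w"
          using i3 inversions_swap[OF bg, of u' "\<alpha> # v"] by simp
        have e1: "nf w a = nf (u' @ \<alpha> # \<gamma> # \<beta> # v) a + c \<gamma> \<alpha> * nf (u' @ (\<gamma> + \<alpha>) # \<beta> # v) a + nf (u' @ \<beta> # v) (st \<gamma> \<alpha> a)"
          using step[of a] 2 by simp
        have e2: "nf (u' @ \<alpha> # \<gamma> # \<beta> # v) a = nf (u' @ \<alpha> # \<beta> # \<gamma> # v) a + c \<gamma> \<beta> * nf (u' @ \<alpha> # (\<gamma> + \<beta>) # v) a + nf (u' @ \<alpha> # v) (st \<gamma> \<beta> a)"
          using sw[of \<beta> \<gamma> "u' @ [\<alpha>]" v] lt gt i1 a w' by auto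
        have e3: "nf (u' @ \<alpha> # \<beta> # \<gamma> # v) a = nf (u' @ \<beta> # \<alpha> # \<gamma> # v) a + c \<alpha> \<beta> * nf (u' @ (\<alpha> + \<beta>) # \<gamma> # v) a + nf (u' @ \<gamma> # v) (st \<alpha> \<beta> a)"
          using sw[of \<beta> \<alpha> u' "\<gamma> # v"] lt i2 a w' by auto
        have e4: "nf (u' @ \<gamma> # \<beta> # \<alpha> # v) a = nf (u' @ \<beta> # \<gamma> # \<alpha> # v) a + c \<gamma> \<beta> * nf (u' @ (\<gamma> + \<beta>) # \<alpha> # v) a + nf (u' @ \<alpha> # v) (st \<gamma> \<beta> a)"
          using sw[of \<beta> \<gamma> u' "\<alpha> # v"] lt gt i3 a w' by auto
        have e5: "nf (u' @ \<beta> # \<gamma> # \<alpha> # v) a = nf (u' @ \<beta> # \<alpha> # \<gamma> # v) a + c \<gamma> \<alpha> * nf (u' @ \<beta> # (\<gamma> + \<alpha>) # v) a + nf (u' @ \<beta> # v) (st \<gamma> \<alpha> a)"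
          using sw[of \<alpha> \<gamma> "u' @ [\<beta>]" v] gt i4 a w' by auto
        let ?S = "nf (u' @ (\<alpha> + \<beta> + \<gamma>) # v) a"
        have s1: "nf (u' @ (\<gamma> + \<alpha>) # \<beta> # v) a = nf (u' @ \<beta> # (\<gamma> + \<alpha>) # v) a + c (\<gamma> + \<alpha>) \<beta> * ?S + nf (u' @ v) (st (\<gamma> + \<alpha>) \<beta> a)"
          using sh[of u' v "\<gamma> + \<alpha>" \<beta>] a w' by (simp add: add.commute add.left_commute)
        have s2: "nf (u' @ (\<gamma> + \<beta>) # \<alpha> # v) a = nf (u' @ \<alpha> # (\<gamma> + \<beta>) # v) a + c (\<gamma> + \<beta>) \<alpha> * ?S + nf (u' @ v) (st (\<gamma> + \<beta>) \<alpha> a)"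
          using sh[of u' v "\<gamma> + \<beta>" \<alpha>] a w' by (simp add: add.commute add.left_commute)
        have s3: "nf (u' @ (\<alpha> + \<beta>) # \<gamma> # v) a = nf (u' @ \<gamma> # (\<alpha> + \<beta>) # v) a + c (\<alpha> + \<beta>) \<gamma> * ?S + nf (u' @ v) (st (\<alpha> + \<beta>) \<gamma> a)"
          using sh[of u' v "\<alpha> + \<beta>" \<gamma>] a w' by simp
        have anti: "c \<gamma> \<beta> = - c \<beta> \<gamma>" by (rule c_antisym)
        have comm: "\<gamma> + \<beta> = \<beta> + \<gamma>" by (rule add.commute)
        \<comment> \<open>What the two routes leave over are double brackets: their letter parts
          cancel by \<open>c_jacobi\<close>, their central parts by
          \<open>st_jacobi\<close>.\<close>
        have "c \<gamma> \<alpha> * (c (\<gamma> + \<alpha>) \<beta> * ?S + nf (u' @ v) (st (\<gamma> + \<alpha>) \<beta> a))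
            + c \<beta> \<gamma> * (c (\<beta> + \<gamma>) \<alpha> * ?S + nf (u' @ v) (st (\<beta> + \<gamma>) \<alpha> a))
            + c \<alpha> \<beta> * (c (\<alpha> + \<beta>) \<gamma> * ?S + nf (u' @ v) (st (\<alpha> + \<beta>) \<gamma> a))
          = (c \<alpha> \<beta> * c (\<alpha> + \<beta>) \<gamma> + c \<beta> \<gamma> * c (\<beta> + \<gamma>) \<alpha> + c \<gamma> \<alpha> * c (\<gamma> + \<alpha>) \<beta>) * ?S
          + (c \<alpha> \<beta> * nf (u' @ v) (st (\<alpha> + \<beta>) \<gamma> a) + c \<beta> \<gamma> * nf (u' @ v) (st (\<beta> + \<gamma>) \<alpha> a)
             + c \<gamma> \<alpha> * nf (u' @ v) (st (\<gamma> + \<alpha>) \<beta> a))"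
          by (simp add: algebra_simps)
        also have "\<dots> = 0" using c_jacobi[of \<alpha> \<beta> \<gamma>] st_jacobi[OF lin_nf a, of \<alpha> \<beta> _ \<gamma>] by simp
        finally have J: "c \<gamma> \<alpha> * (c (\<gamma> + \<alpha>) \<beta> * ?S + nf (u' @ v) (st (\<gamma> + \<alpha>) \<beta> a))
            + c \<beta> \<gamma> * (c (\<beta> + \<gamma>) \<alpha> * ?S + nf (u' @ v) (st (\<beta> + \<gamma>) \<alpha> a))
            + c \<alpha> \<beta> * (c (\<alpha> + \<beta>) \<gamma> * ?S + nf (u' @ v) (st (\<alpha> + \<beta>) \<gamma> a)) = 0" .
        have "nf w a - (nf (u' @ \<gamma> # \<beta> # \<alpha> # v) a + c \<alpha> \<beta> * nf (u' @ \<gamma> # (\<alpha> + \<beta>) # v) a + nf (u' @ \<gamma> # v) (st \<alpha> \<beta> a))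
          = c \<gamma> \<alpha> * (c (\<gamma> + \<alpha>) \<beta> * ?S + nf (u' @ v) (st (\<gamma> + \<alpha>) \<beta> a))
            + c \<beta> \<gamma> * (c (\<beta> + \<gamma>) \<alpha> * ?S + nf (u' @ v) (st (\<beta> + \<gamma>) \<alpha> a))
            + c \<alpha> \<beta> * (c (\<alpha> + \<beta>) \<gamma> * ?S + nf (u' @ v) (st (\<alpha> + \<beta>) \<gamma> a))"
          unfolding e1 e2 e3 e4 e5 s1 s3 s2[unfolded comm] anti comm by (simp add: algebra_simps)
        then have "nf w a = nf (u' @ \<gamma> # \<beta> # \<alpha> # v) a + c \<alpha> \<beta> * nf (u' @ \<gamma> # (\<alpha> + \<beta>) # v) a + nf (u' @ \<gamma> # v) (st \<alpha> \<beta> a)"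
          unfolding J by simp
        then show ?thesis using w 2 by simp
      next
        case 3
        \<comment> \<open>Disjoint descents: resolving them in either order gives the same nine
          terms, the last of them because the two shifts of the coefficient commute.\<close>
        have gd: "\<delta> < \<gamma>" using f by simp
        have w': "w = u' @ \<gamma> # \<delta> # u2 @ \<alpha> # \<beta> # v" using w 3 by simp
        have e1: "nf (u' @ \<delta> # \<gamma> # u2 @ \<alpha> # \<beta> # v) a =
          nf (u' @ \<delta> # \<gamma> # u2 @ \<beta> # \<alpha> # v) a + c \<alpha> \<beta> * nf (u' @ \<delta> # \<gamma> # u2 @ (\<alpha> + \<beta>) # v) a + nf (u' @ \<delta> # \<gamma> # u2 @ v) (st \<alpha> \<beta> a)"
          using sw[of \<beta> \<alpha> "u' @ \<delta> # \<gamma> # u2" v] lt inv(1) a 3 w' by auto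
        have e2: "nf (u' @ (\<gamma> + \<delta>) # u2 @ \<alpha> # \<beta> # v) a =
          nf (u' @ (\<gamma> + \<delta>) # u2 @ \<beta> # \<alpha> # v) a + c \<alpha> \<beta> * nf (u' @ (\<gamma> + \<delta>) # u2 @ (\<alpha> + \<beta>) # v) a + nf (u' @ (\<gamma> + \<delta>) # u2 @ v) (st \<alpha> \<beta> a)"
          using sh[of "u' @ (\<gamma> + \<delta>) # u2" v \<alpha> \<beta>] a w' by auto
        have e3: "nf (u' @ u2 @ \<alpha> # \<beta> # v) (st \<gamma> \<delta> a) =
          nf (u' @ u2 @ \<beta> # \<alpha> # v) (st \<gamma> \<delta> a) + c \<alpha> \<beta> * nf (u' @ u2 @ (\<alpha> + \<beta>) # v) (st \<gamma> \<delta> a) + nf (u' @ u2 @ v) (st \<alpha> \<beta> (st \<gamma> \<delta> a))"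
          using sh[of "u' @ u2" v \<alpha> \<beta>] st_closed[OF a] w' by auto
        have d1: "nf (u' @ \<gamma> # \<delta> # u2 @ \<beta> # \<alpha> # v) a =
          nf (u' @ \<delta> # \<gamma> # u2 @ \<beta> # \<alpha> # v) a + c \<gamma> \<delta> * nf (u' @ (\<gamma> + \<delta>) # u2 @ \<beta> # \<alpha> # v) a + nf (u' @ u2 @ \<beta> # \<alpha> # v) (st \<gamma> \<delta> a)"
          using sw[of \<delta> \<gamma> u' "u2 @ \<beta> # \<alpha> # v"] gd inv(2) a 3 w' by auto
        have d2: "nf (u' @ \<gamma> # \<delta> # u2 @ (\<alpha> + \<beta>) # v) a =
          nf (u' @ \<delta> # \<gamma> # u2 @ (\<alpha> + \<beta>) # v) a + c \<gamma> \<delta> * nf (u' @ (\<gamma> + \<delta>) # u2 @ (\<alpha> + \<beta>) # v) a + nf (u' @ u2 @ (\<alpha> + \<beta>) # v) (st \<gamma> \<delta> a)"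
          using sh[of u' "u2 @ (\<alpha> + \<beta>) # v" \<gamma> \<delta>] a w' by auto
        have d3: "nf (u' @ \<gamma> # \<delta> # u2 @ v) (st \<alpha> \<beta> a) =
          nf (u' @ \<delta> # \<gamma> # u2 @ v) (st \<alpha> \<beta> a) + c \<gamma> \<delta> * nf (u' @ (\<gamma> + \<delta>) # u2 @ v) (st \<alpha> \<beta> a) + nf (u' @ u2 @ v) (st \<gamma> \<delta> (st \<alpha> \<beta> a))"
          using sh[of u' "u2 @ v" \<gamma> \<delta>] st_closed[OF a] w' by auto
        have "nf w a = nf (u' @ \<delta> # \<gamma> # u2 @ \<alpha> # \<beta> # v) a + c \<gamma> \<delta> * nf (u' @ (\<gamma> + \<delta>) # u2 @ \<alpha> # \<beta> # v) a
            + nf (u' @ u2 @ \<alpha> # \<beta> # v) (st \<gamma> \<delta> a)"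
          using step[of a] 3 by simp
        also have "\<dots> = nf (u' @ \<gamma> # \<delta> # u2 @ \<beta> # \<alpha> # v) a + c \<alpha> \<beta> * nf (u' @ \<gamma> # \<delta> # u2 @ (\<alpha> + \<beta>) # v) a
            + nf (u' @ \<gamma> # \<delta> # u2 @ v) (st \<alpha> \<beta> a)"
          unfolding e1 e2 e3 d1 d2 d3 st_commute[OF a, of \<alpha> \<beta> \<gamma> \<delta>] by (simp add: algebra_simps)
        finally show ?thesis using w 3 by simp
      qed
    qed
  qed
  then show ?thesis using assms by blast
qed

lemma nf_exchange: "exchange u \<alpha> \<beta> v"
  by (rule exchange_all; rule nf_exchange_inversion)

text \<open>Positive letters form an upper set. A descent away from the end leaves the last letter
  in place; a descent at the end swaps it with a larger letter, which is positive as well, and then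
  neither the merged letter nor the central shift contributes. This is the source of the Whittaker
  property.\<close>

lemma nf_snoc:
  assumes "a \<in> A" "pos \<alpha>"
  shows "nf (u @ [\<alpha>]) a = ph \<alpha> * nf u a"
proof -
  have "\<forall>u \<alpha>. w = u @ [\<alpha>] \<longrightarrow> pos \<alpha> \<longrightarrow> (\<forall>a\<in>A. nf (u @ [\<alpha>]) a = ph \<alpha> * nf u a)" for w
  proof (induction w rule: word_induct)
    case (less w)
    show ?case
    proof (intro allI impI ballI)
      fix u \<alpha> a assume w: "w = u @ [\<alpha>]" and p: "pos \<alpha>" and a: "a \<in> A"
      have sh: "nf (u' @ [\<beta>]) b = ph \<beta> * nf u' b" if "length u' < length u" "pos \<beta>" "b \<in> A" for u' \<beta> b
        using less[of "u' @ [\<beta>]"] that w by auto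
      have sw: "nf (u' @ [\<beta>]) b = ph \<beta> * nf u' b" if "length u' = length u" "inversions (u' @ [\<beta>]) < inversions w" "pos \<beta>" "b \<in> A" for u' \<beta> b
        using less[of "u' @ [\<beta>]"] that w by auto
      show "nf (u @ [\<alpha>]) a = ph \<alpha> * nf u a"
      proof (cases "first_inversion w")
        case None
        then have "sorted (u @ [\<alpha>])" using w by (simp add: first_inversion_None)
        then show ?thesis using p by (simp add: nf_sorted sorted_append)
      next
        case (Some t)
        then obtain u' \<gamma> \<delta> v' where t: "first_inversion w = Some (u', \<gamma>, \<delta>, v')" by (cases t) auto
        note f = first_inversion_Some[OF t]
        have step: "nf w a = nf (u' @ \<delta> # \<gamma> # v') a + c \<gamma> \<delta> * nf (u' @ (\<gamma> + \<delta>) # v') a + nf (u' @ v') (st \<gamma> \<delta> a)"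
          by (subst nf.simps) (simp add: t)
        have inv: "inversions (u' @ \<delta> # \<gamma> # v') < inversions w" using f inversions_swap by auto
        show ?thesis
        proof (cases v' rule: rev_cases)
          case Nil
          then have u: "u = u' @ [\<gamma>]" "\<delta> = \<alpha>" using f w by auto
          have g: "pos \<gamma>" using f u p pos_mono[of \<alpha> \<gamma>] by auto
          have "nf (u' @ [\<alpha>, \<gamma>]) a = ph \<gamma> * (ph \<alpha> * nf u' a)"
            using sw[of "u' @ [\<alpha>]" \<gamma> a] sh[of u' \<alpha> a] inv u Nil g p a by simp
          \<comment> \<open>The merged letter is positive again, so its \<open>ph\<close> splits
            off, and \<open>pos_c\<close> kills the product with
            \<open>c \<gamma> \<alpha>\<close>.\<close>
          moreover have "c \<gamma> \<alpha> * nf (u' @ [\<gamma> + \<alpha>]) a = 0"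
            using sh[of u' "\<gamma> + \<alpha>" a] pos_add[OF g p] pos_c[OF g p] a u by auto
          moreover have "nf u' (st \<gamma> \<alpha> a) = 0" by (rule pos_st[OF lin_nf a g p])
          moreover have "nf (u' @ [\<gamma>]) a = ph \<gamma> * nf u' a" using sh[of u' \<gamma> a] g a u by simp
          ultimately show ?thesis using step u Nil w by simp
        next
          case (snoc v2 \<alpha>')
          then have u: "u = u' @ \<gamma> # \<delta> # v2" "v' = v2 @ [\<alpha>]" using f w by auto
          have "nf w a = ph \<alpha> * (nf (u' @ \<delta> # \<gamma> # v2) a + c \<gamma> \<delta> * nf (u' @ (\<gamma> + \<delta>) # v2) a + nf (u' @ v2) (st \<gamma> \<delta> a))"
            using step sw[of "u' @ \<delta> # \<gamma> # v2" \<alpha> a] sh[of "u' @ (\<gamma> + \<delta>) # v2" \<alpha> a]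
              sh[of "u' @ v2" \<alpha> "st \<gamma> \<delta> a"] inv u p a st_closed[OF a] by (simp add: algebra_simps)
          also have "\<dots> = ph \<alpha> * nf u a" using nf_exchange[of u' \<gamma> \<delta> v2] a u by simp
          finally show ?thesis using w by simp
        qed
      qed
    qed
  qed
  then show ?thesis using assms by blast
qed

text \<open>The recursion changes the coefficient only through \<open>st\<close>, so zeros of
  \<open>init\<close> on a set stable under \<open>st\<close> persist for every word. The set in
  question will be the maximal ideal.\<close>

lemma nf_vanish:
  assumes I: "\<And>a. a \<in> I \<Longrightarrow> init a = 0" "\<And>a \<alpha> \<beta>. a \<in> I \<Longrightarrow> st \<alpha> \<beta> a \<in> I"
  shows "a \<in> I \<Longrightarrow> nf w a = 0"
proof (induction w arbitrary: a rule: word_induct)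
  case (less w)
  show ?case
  proof (cases "first_inversion w")
    case None
    then show ?thesis using I(1)[OF less(2)] by (simp add: nf_sorted first_inversion_None)
  next
    case (Some t)
    then obtain u \<alpha> \<beta> v where t: "first_inversion w = Some (u, \<alpha>, \<beta>, v)" by (cases t) auto
    note w = first_inversion_Some[OF t]
    have "nf (u @ \<beta> # \<alpha> # v) a = 0" "nf (u @ (\<alpha> + \<beta>) # v) a = 0" "nf (u @ v) (st \<alpha> \<beta> a) = 0"
      using w inversions_swap[of \<beta> \<alpha> u v] less(2) I(2)[OF less(2)] by (auto intro!: less(1))
    then show ?thesis by (subst nf.simps) (simp add: t)
  qed
qed

lemma nf_Nil: "nf [] a = init a"
  by (simp add: nf_sorted)

end

section \<open>Homogeneous coordinates\<close>

text \<open>As \<open>v\<close> is nonzero, a basis consists of exactly one vector, and both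
  \<open>v\<close> and \<open>y\<close> are multiples of it.\<close>

lemma dim_at_most_one:
  assumes V: "vectorspace complex_ring V" and d: "dim_at_most 1 V"
    and v: "v \<in> carrier V" "v \<noteq> \<zero>\<^bsub>V\<^esub>" and y: "y \<in> carrier V"
  shows "\<exists>k. y = k \<odot>\<^bsub>V\<^esub> v"
proof -
  interpret vectorspace complex_ring V by fact
  note vs = complex_vectorspaceD[OF V]
  obtain \<beta> where b: "finite \<beta>" "basis \<beta>"
    using d finite_basis_exists by (auto simp: dim_at_most_def)
  then have bc: "\<beta> \<subseteq> carrier V" "span \<beta> = carrier V" "card \<beta> \<le> 1"
    using d dim_basis[OF b] by (auto simp: basis_def dim_at_most_def)
  have comb: "\<exists>a. lincomb a \<beta> = u" if "u \<in> carrier V" for u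
    using finite_in_span[OF b(1) bc(1), of u] that bc(2) by auto
  have "\<beta> \<noteq> {}"
    using comb[OF v(1)] v(2) by (auto simp: lincomb_def)
  then obtain e where e: "\<beta> = {e}"
    using bc(3) b(1) by (metis card_1_singletonE card_0_eq le_antisym less_one linorder_not_le)
  have ec: "e \<in> carrier V" using bc e by simp
  have "lincomb a \<beta> = a e \<odot>\<^bsub>V\<^esub> e" for a
    using ec by (simp add: lincomb_def e vs)
  then obtain k l where kl: "v = k \<odot>\<^bsub>V\<^esub> e" "y = l \<odot>\<^bsub>V\<^esub> e" using comb v(1) y by metis
  have "k \<noteq> 0" using kl(1) v(2) ec by (auto simp: vs)
  then have "y = (l / k) \<odot>\<^bsub>V\<^esub> v" using kl ec by (simp flip: vs(5))
  then show ?thesis by blast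
qed

section \<open>Graded subspaces and homogeneous components\<close>

context graded_lie_algebra
begin

lemma gr_closed: "y \<in> gr \<alpha> \<Longrightarrow> y \<in> carrier L"
  using gr_subspace[of \<alpha>] unfolding subspace_def submodule_def by blast

lemma gr_add: "\<lbrakk>y \<in> gr \<alpha>; z \<in> gr \<alpha>\<rbrakk> \<Longrightarrow> y \<oplus> z \<in> gr \<alpha>"
  using gr_subspace[of \<alpha>] unfolding subspace_def submodule_def by blast

lemma gr_zero: "\<zero> \<in> gr \<alpha>"
  using gr_subspace[of \<alpha>] unfolding subspace_def submodule_def by blast

lemma gr_smult: "y \<in> gr \<alpha> \<Longrightarrow> c \<odot> y \<in> gr \<alpha>"
  using gr_subspace[of \<alpha>] unfolding subspace_def submodule_def by simp

lemma graded_partI: "\<lbrakk>y \<in> gr \<alpha>; \<alpha> \<in> A\<rbrakk> \<Longrightarrow> y \<in> graded_part L gr A"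
proof -
  assume "y \<in> gr \<alpha>" "\<alpha> \<in> A"
  then have "y = (\<Oplus>\<beta>\<in>{\<alpha>}. y) \<and> finite {\<alpha>} \<and> {\<alpha>} \<subseteq> A \<and> (\<forall>\<beta>\<in>{\<alpha>}. y \<in> gr \<beta>)"
    using gr_closed by simp
  then show ?thesis unfolding graded_part_def mem_Collect_eq by blast
qed

lemma graded_part_induct [consumes 1, case_names zero homogeneous add]:
  assumes x: "x \<in> graded_part L gr A"
    and z: "P \<zero>" and h: "\<And>\<alpha> y. \<lbrakk>\<alpha> \<in> A; y \<in> gr \<alpha>\<rbrakk> \<Longrightarrow> P y"
    and a: "\<And>y z. \<lbrakk>y \<in> carrier L; z \<in> carrier L; P y; P z\<rbrakk> \<Longrightarrow> P (y \<oplus> z)"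
  shows "P x"
proof -
  obtain F f where F: "finite F" "F \<subseteq> A" "\<forall>\<alpha>\<in>F. f \<alpha> \<in> gr \<alpha>" "x = (\<Oplus>\<alpha>\<in>F. f \<alpha>)"
    using x unfolding graded_part_def by blast
  from F(1-3) have "P (\<Oplus>\<alpha>\<in>F. f \<alpha>)"
  proof (induction F)
    case (insert \<alpha> F)
    have f: "f \<in> F \<rightarrow> carrier L" using insert gr_closed by auto
    have "f \<alpha> \<in> gr \<alpha>" using insert by simp
    then show ?case using insert f gr_closed[of "f \<alpha>" \<alpha>] h[of \<alpha> "f \<alpha>"] a[of "f \<alpha>" "\<Oplus>\<alpha>\<in>F. f \<alpha>"]
      by (simp add: M.finsum_insert M.finsum_closed)
  qed (simp add: z)
  then show ?thesis using F(4) by simp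
qed

lemma graded_part_closed: "x \<in> graded_part L gr A \<Longrightarrow> x \<in> carrier L"
  by (induction rule: graded_part_induct) (auto intro: gr_closed)

lemma graded_part_zero: "\<zero> \<in> graded_part L gr A"
proof -
  have "\<zero> = (\<Oplus>\<alpha>\<in>{}. \<zero>) \<and> finite {} \<and> {} \<subseteq> A \<and> (\<forall>\<alpha>\<in>{}. \<zero> \<in> gr \<alpha>)" by simp
  then show ?thesis unfolding graded_part_def mem_Collect_eq by blast
qed

lemma graded_part_add:
  assumes "x \<in> graded_part L gr A" "y \<in> graded_part L gr A"
  shows "x \<oplus> y \<in> graded_part L gr A"
proof -
  obtain F f where F: "finite F" "F \<subseteq> A" "\<forall>\<alpha>\<in>F. f \<alpha> \<in> gr \<alpha>" "x = (\<Oplus>\<alpha>\<in>F. f \<alpha>)"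
    using assms(1) unfolding graded_part_def by blast
  obtain G g where G: "finite G" "G \<subseteq> A" "\<forall>\<alpha>\<in>G. g \<alpha> \<in> gr \<alpha>" "y = (\<Oplus>\<alpha>\<in>G. g \<alpha>)"
    using assms(2) unfolding graded_part_def by blast
  have fc: "\<And>\<alpha>. \<alpha> \<in> F \<Longrightarrow> f \<alpha> \<in> carrier L" "\<And>\<alpha>. \<alpha> \<in> G \<Longrightarrow> g \<alpha> \<in> carrier L"
    using F(3) G(3) gr_closed by blast+
  \<comment> \<open>Both families are extended by zero to the union of their index sets, so that the
    sums can be added termwise.\<close>
  let ?f = "\<lambda>\<alpha>. if \<alpha> \<in> F then f \<alpha> else \<zero>" and ?g = "\<lambda>\<alpha>. if \<alpha> \<in> G then g \<alpha> else \<zero>"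
  have "x = (\<Oplus>\<alpha>\<in>F \<union> G. ?f \<alpha>)"
    unfolding F(4) by (rule M.add.finprod_mono_neutral_cong_left) (use F(1) G(1) fc in auto)
  moreover have "y = (\<Oplus>\<alpha>\<in>F \<union> G. ?g \<alpha>)"
    unfolding G(4) by (rule M.add.finprod_mono_neutral_cong_left) (use F(1) G(1) fc in auto)
  ultimately have "x \<oplus> y = (\<Oplus>\<alpha>\<in>F \<union> G. ?f \<alpha> \<oplus> ?g \<alpha>)"
    by (simp add: M.finsum_addf Pi_iff fc)
  moreover have "\<forall>\<alpha>\<in>F \<union> G. ?f \<alpha> \<oplus> ?g \<alpha> \<in> gr \<alpha>"
    using F G by (auto intro!: gr_add gr_zero)
  ultimately show ?thesis unfolding graded_part_def mem_Collect_eq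
    using F(1,2) G(1,2) by (metis (no_types, lifting) finite_UnI le_sup_iff)
qed

lemma graded_part_smult:
  assumes "x \<in> graded_part L gr A"
  shows "c \<odot> x \<in> graded_part L gr A"
  using assms
  by (induction rule: graded_part_induct)
    (auto simp: L_vs intro: graded_part_zero graded_part_add graded_partI gr_smult)

lemma bracket_zero_left: "y \<in> carrier L \<Longrightarrow> bracket L \<zero> y = \<zero>"
  using bracket_smult_left[of "\<zero>" y 0] by (simp add: L_vs bracket_closed)

lemma bracket_zero_right: "y \<in> carrier L \<Longrightarrow> bracket L y \<zero> = \<zero>"
  using bracket_smult_right[of y "\<zero>" 0] by (simp add: L_vs bracket_closed)

lemma bracket_antisym:
  assumes "x \<in> carrier L" "y \<in> carrier L"
  shows "bracket L y x = (-1) \<odot> bracket L x y"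
proof -
  have "bracket L (x \<oplus> y) (x \<oplus> y) = bracket L x y \<oplus> bracket L y x"
    using assms by (simp add: bracket_add_left bracket_add_right bracket_self[of x] bracket_self[of y] bracket_closed M.a_comm)
  moreover have "bracket L (x \<oplus> y) (x \<oplus> y) = \<zero>" using assms by (intro bracket_self) simp
  ultimately have "bracket L y x \<oplus> bracket L x y = \<zero>"
    using assms by (metis M.a_comm bracket_closed)
  then show ?thesis using assms M.minus_equality by (simp add: L_vs bracket_closed)
qed

lemma graded_part_bracket:
  assumes A: "\<And>\<alpha> \<beta>. \<lbrakk>\<alpha> \<in> A; \<beta> \<in> A\<rbrakk> \<Longrightarrow> \<alpha> + \<beta> \<in> A"
    and x: "x \<in> graded_part L gr A" and y: "y \<in> graded_part L gr A"
  shows "bracket L x y \<in> graded_part L gr A"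
  using x
proof (induction rule: graded_part_induct)
  case (homogeneous \<alpha> x)
  from y show ?case
  proof (induction rule: graded_part_induct)
    case (homogeneous \<beta> y)
    then show ?case using \<open>\<alpha> \<in> A\<close> \<open>x \<in> gr \<alpha>\<close> gr_bracket A by (blast intro: graded_partI)
  qed (use homogeneous in \<open>auto simp: bracket_zero_right bracket_add_right gr_closed intro: graded_part_zero graded_part_add\<close>)
qed (use y in \<open>auto simp: bracket_zero_left bracket_add_left graded_part_closed intro: graded_part_zero graded_part_add\<close>)

lemma subspace_graded_part: "subspace complex_ring (graded_part L gr A) L"
  unfolding subspace_def submodule_def
  using graded_part_closed graded_part_zero graded_part_add graded_part_smult
  by (auto intro: vectorspace_axioms module_axioms)

definition component :: "'a \<Rightarrow> 'q \<Rightarrow> 'a" where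
  "component x = (THE f. (\<forall>\<alpha>. f \<alpha> \<in> gr \<alpha>) \<and> finite {\<alpha>. f \<alpha> \<noteq> \<zero>} \<and> x = (\<Oplus>\<alpha>\<in>{\<alpha>. f \<alpha> \<noteq> \<zero>}. f \<alpha>))"

lemma component:
  assumes "x \<in> carrier L"
  shows "component x \<alpha> \<in> gr \<alpha>" "finite {\<alpha>. component x \<alpha> \<noteq> \<zero>}"
    "x = (\<Oplus>\<alpha>\<in>{\<alpha>. component x \<alpha> \<noteq> \<zero>}. component x \<alpha>)"
  using theI'[OF gr_direct_sum[OF assms]] unfolding component_def by blast+

lemma component_closed: "x \<in> carrier L \<Longrightarrow> component x \<alpha> \<in> carrier L"
  using component(1) gr_closed by blast

lemma component_eqI:
  assumes f: "\<And>\<alpha>. f \<alpha> \<in> gr \<alpha>" and F: "finite F" "\<And>\<alpha>. \<alpha> \<notin> F \<Longrightarrow> f \<alpha> = \<zero>"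
    and x: "x = (\<Oplus>\<alpha>\<in>F. f \<alpha>)"
  shows "component x = f"
proof -
  have fin: "finite {\<alpha>. f \<alpha> \<noteq> \<zero>}" using F by (metis (mono_tags, lifting) finite_subset mem_Collect_eq subsetI)
  have x': "x = (\<Oplus>\<alpha>\<in>{\<alpha>. f \<alpha> \<noteq> \<zero>}. f \<alpha>)"
    unfolding x by (rule M.add.finprod_mono_neutral_cong_right) (use F f gr_closed in auto)
  have "x \<in> carrier L" unfolding x by (rule M.finsum_closed) (use f gr_closed in auto)
  from gr_direct_sum[OF this] show ?thesis
    unfolding component_def by (rule the1_equality) (use f fin x' in blast)
qed

lemma component_homogeneous:
  assumes y: "y \<in> gr \<beta>"
  shows "component y = (\<lambda>\<alpha>. if \<alpha> = \<beta> then y else \<zero>)"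
  by (rule component_eqI[of _ "{\<beta>}"]) (use y gr_zero gr_closed in auto)

lemma component_zero: "component \<zero> = (\<lambda>_. \<zero>)"
  using component_homogeneous[OF gr_zero] by auto

lemma component_add:
  assumes x: "x \<in> carrier L" and y: "y \<in> carrier L"
  shows "component (x \<oplus> y) = (\<lambda>\<alpha>. component x \<alpha> \<oplus> component y \<alpha>)"
proof (rule component_eqI)
  let ?F = "{\<alpha>. component x \<alpha> \<noteq> \<zero>} \<union> {\<alpha>. component y \<alpha> \<noteq> \<zero>}"
  show "component x \<alpha> \<oplus> component y \<alpha> \<in> gr \<alpha>" for \<alpha> using component x y by (blast intro: gr_add)
  show "finite ?F" using component x y by blast
  show "component x \<alpha> \<oplus> component y \<alpha> = \<zero>" if "\<alpha> \<notin> ?F" for \<alpha> using that by simp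
  have c: "component x \<alpha> \<in> carrier L" "component y \<alpha> \<in> carrier L" for \<alpha>
    using component(1) x y gr_closed by blast+
  have "x = (\<Oplus>\<alpha>\<in>?F. component x \<alpha>)"
    by (subst component(3)[OF x], rule M.add.finprod_mono_neutral_cong_left)
      (use component x y c in auto)
  moreover have "y = (\<Oplus>\<alpha>\<in>?F. component y \<alpha>)"
    by (subst component(3)[OF y], rule M.add.finprod_mono_neutral_cong_left)
      (use component x y c in auto)
  ultimately show "x \<oplus> y = (\<Oplus>\<alpha>\<in>?F. component x \<alpha> \<oplus> component y \<alpha>)"
    using M.finsum_addf[of "component x" ?F "component y"] c by (simp add: Pi_iff)
qed

lemma carrier_graded_part: "x \<in> carrier L \<longleftrightarrow> x \<in> graded_part L gr UNIV"
proof
  assume x: "x \<in> carrier L"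
  then have "finite {\<alpha>. component x \<alpha> \<noteq> \<zero>} \<and> {\<alpha>. component x \<alpha> \<noteq> \<zero>} \<subseteq> UNIV \<and>
    (\<forall>\<alpha>\<in>{\<alpha>. component x \<alpha> \<noteq> \<zero>}. component x \<alpha> \<in> gr \<alpha>)"
    using component by blast
  with component(3)[OF x] show "x \<in> graded_part L gr UNIV"
    unfolding graded_part_def by blast
qed (rule graded_part_closed)

lemma graded_induct [consumes 1, case_names homogeneous add]:
  assumes "x \<in> carrier L" "\<And>\<alpha> y. y \<in> gr \<alpha> \<Longrightarrow> P y"
    "\<And>y z. \<lbrakk>y \<in> carrier L; z \<in> carrier L; P y; P z\<rbrakk> \<Longrightarrow> P (y \<oplus> z)"
  shows "P x"
  using assms(1) unfolding carrier_graded_part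
  by (induction rule: graded_part_induct) (use assms gr_zero in auto)

lemma component_smult:
  assumes "x \<in> carrier L"
  shows "component (c \<odot> x) = (\<lambda>\<alpha>. c \<odot> component x \<alpha>)"
  using assms
proof (induction rule: graded_induct)
  case (homogeneous \<alpha> y)
  then show ?case
    using component_homogeneous[OF homogeneous] component_homogeneous[OF gr_smult[OF homogeneous]]
    by (auto simp: L_vs)
next
  case (add y z)
  then show ?case by (simp add: L_vs component_add component_closed)
qed

text \<open>Bracketing with a homogeneous \<open>h\<close> shifts every degree by \<beta>, so
  distinct components cannot interfere.\<close>

lemma component_bracket:
  assumes "x \<in> carrier L" and h: "h \<in> gr \<beta>"
  shows "component (bracket L x h) (\<alpha> + \<beta>) = bracket L (component x \<alpha>) h"
  using assms(1)
proof (induction rule: graded_induct)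
  case (homogeneous \<gamma> y)
  then show ?case using h gr_bracket[OF homogeneous h]
    by (simp add: component_homogeneous bracket_zero_left gr_closed)
next
  case (add y z)
  then show ?case using gr_closed[OF h]
    by (simp add: bracket_add_left component_add bracket_closed component_closed)
qed

text \<open>For homogeneous \<open>h\<close>, the bracket of a component of \<open>z\<close> with
  \<open>h\<close> is a component of \<open>bracket L z h\<close>, which is zero. Hence the centre
  is graded.\<close>

lemma component_center:
  assumes z: "z \<in> lie_center L"
  shows "component z \<alpha> \<in> lie_center L"
proof -
  have zc: "z \<in> carrier L" using z by (simp add: lie_center_def)
  then have c: "component z \<alpha> \<in> carrier L" using component(1) gr_closed by blast
  have "bracket L (component z \<alpha>) h = \<zero>" if "h \<in> carrier L" for h
    using that
  proof (induction rule: graded_induct)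
    case (homogeneous \<beta> h)
    then show ?case using component_bracket[OF zc homogeneous, of \<alpha>] z gr_closed
      by (simp add: lie_center_def component_zero)
  next
    case (add y z)
    then show ?case using c by (simp add: bracket_add_right)
  qed
  then show ?thesis using c by (simp add: lie_center_def)
qed

lemma component_graded_part: "x \<in> graded_part L gr A \<Longrightarrow> \<alpha> \<notin> A \<Longrightarrow> component x \<alpha> = \<zero>"
  by (induction rule: graded_part_induct) (auto simp: component_zero component_homogeneous component_add)

section \<open>The centre and the quotient by it\<close>

lemma lie_center_closed:
  "\<zero> \<in> lie_center L" "z \<in> lie_center L \<Longrightarrow> z \<in> carrier L"
  "\<lbrakk>y \<in> lie_center L; z \<in> lie_center L\<rbrakk> \<Longrightarrow> y \<oplus> z \<in> lie_center L"
  "z \<in> lie_center L \<Longrightarrow> c \<odot> z \<in> lie_center L"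
  by (auto simp: lie_center_def bracket_zero_left bracket_add_left bracket_smult_left L_vs)

lemma bracket_center:
  "\<lbrakk>z \<in> lie_center L; y \<in> carrier L\<rbrakk> \<Longrightarrow> bracket L z y = \<zero>"
  "\<lbrakk>z \<in> lie_center L; y \<in> carrier L\<rbrakk> \<Longrightarrow> bracket L y z = \<zero>"
  using bracket_antisym[of z y] by (auto simp: lie_center_def L_vs)

lemma subgroup_center: "subgroup (lie_center L) (add_monoid L)"
proof (rule group.subgroupI)
  show "group (add_monoid L)" by (rule M.a_group)
  fix a assume a: "a \<in> lie_center L"
  then have "\<ominus> a = (-1) \<odot> a" by (simp add: L_vs lie_center_closed)
  then show "inv\<^bsub>add_monoid L\<^esub> a \<in> lie_center L"
    using lie_center_closed(4)[OF a, of "-1"] by (simp add: a_inv_def)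
qed (use lie_center_closed in auto)

lemma center_quot_smult:
  "u \<in> carrier L \<Longrightarrow> c \<odot>\<^bsub>quot_module L (lie_center L)\<^esub> (lie_center L +> u) = lie_center L +> (c \<odot> u)"
  by (rule quot_class_smult[OF M.abelian_group_axioms subgroup_center])
    (simp_all add: L_vs lie_center_closed)

lemma vectorspace_center_quot: "vectorspace complex_ring (quot_module L (lie_center L))"
proof -
  have "left_module complex_ring L"
    by (intro left_module.intro left_module_axioms.intro M.abelian_group_axioms
        cring.axioms(1)[OF cring_complex_ring]) (simp_all add: L_vs)
  then have "left_module complex_ring (quot_module L (lie_center L))"
    by (rule left_module.left_module_quot_module[OF _ subgroup_center])
      (simp add: lie_center_closed)
  then interpret Q: left_module complex_ring "quot_module L (lie_center L)" .
  show ?thesis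
    using Q.smult_closed Q.smult_l_distr Q.smult_r_distr Q.smult_assoc Q.smult_one
    by (intro complex_vectorspaceI Q.M.abelian_group_axioms) (simp_all del: quot_module_simps)
qed

text \<open>With \<open>S\<close> a graded piece this is \<open>center_quot_gr\<close>, the space
  that the second dimension bound in \<open>Q_good\<close> is about.\<close>

lemma vectorspace_center_quot_subspace:
  assumes S: "subspace complex_ring S L"
  shows "vectorspace complex_ring ((quot_module L (lie_center L))\<lparr>carrier := (\<lambda>x. lie_center L +> x) ` S\<rparr>)"
proof (rule vectorspace.subspace_is_vs[OF vectorspace_center_quot])
  let ?Q = "quot_module L (lie_center L)"
  note q = quot_class_add[OF M.abelian_group_axioms subgroup_center]
    quot_class_closed[OF M.abelian_group_axioms subgroup_center]
  have s: "\<And>y. y \<in> S \<Longrightarrow> y \<in> carrier L" "\<And>y z. \<lbrakk>y \<in> S; z \<in> S\<rbrakk> \<Longrightarrow> y \<oplus> z \<in> S" "\<zero> \<in> S"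
    "\<And>c y. y \<in> S \<Longrightarrow> c \<odot> y \<in> S"
    using S unfolding subspace_def submodule_def by auto
  have z: "lie_center L +> \<zero> = \<zero>\<^bsub>?Q\<^esub>"
    using quot_class_eq_zero[OF M.abelian_group_axioms subgroup_center, of "\<zero>"] lie_center_closed by simp
  show "subspace complex_ring ((\<lambda>x. lie_center L +> x) ` S) ?Q"
    unfolding subspace_def submodule_def
  proof (intro conjI allI impI)
    show "vectorspace complex_ring ?Q" by (rule vectorspace_center_quot)
    show "Module.module complex_ring ?Q"
      using vectorspace_center_quot by (simp add: vectorspace_def)
    show "(\<lambda>x. lie_center L +> x) ` S \<subseteq> carrier ?Q" using q s by blast
    show "\<zero>\<^bsub>?Q\<^esub> \<in> (\<lambda>x. lie_center L +> x) ` S" using z s by (metis imageI)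
    fix v w assume "v \<in> (\<lambda>x. lie_center L +> x) ` S" "w \<in> (\<lambda>x. lie_center L +> x) ` S"
    then show "v \<oplus>\<^bsub>?Q\<^esub> w \<in> (\<lambda>x. lie_center L +> x) ` S" using q s by auto
  next
    fix c v assume "v \<in> (\<lambda>x. lie_center L +> x) ` S"
    then show "c \<odot>\<^bsub>?Q\<^esub> v \<in> (\<lambda>x. lie_center L +> x) ` S" using center_quot_smult s by auto
  qed
qed

end

section \<open>The setting of the theorem and coordinates with respect to the chosen vectors\<close>

locale whittaker_setting = graded_lie_algebra L gr
  for L :: "'g lie_algebra" (structure) and gr :: "'q::linordered_ab_group_add \<Rightarrow> 'g set" +
  fixes \<pi> :: "'q \<Rightarrow> int" and \<phi> :: "'g \<Rightarrow> complex" and x :: "'q \<Rightarrow> 'g"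
  assumes pi_add: "\<And>\<alpha> \<beta>. \<pi> (\<alpha> + \<beta>) = \<pi> \<alpha> + \<pi> \<beta>"
    and pi_mono: "\<And>\<alpha> \<beta>. \<alpha> \<le> \<beta> \<Longrightarrow> \<pi> \<alpha> \<le> \<pi> \<beta>"
    and good: "Q_good L gr \<pi>"
    and x_choice: "\<And>\<alpha>. \<alpha> \<in> gr_support L gr - central_degrees L gr \<pi> \<Longrightarrow>
      x \<alpha> \<in> gr \<alpha> \<and> x \<alpha> \<noteq> \<zero> \<and> x \<alpha> \<notin> carrier (lie_Z_minus L gr \<pi>)"
    and phi_hom: "\<phi> \<in> lie_hom (lie_n L gr \<pi>) complex_lie"
    and nonsing: "nonsingular L gr \<pi> x \<phi>"
begin

abbreviation "N \<equiv> lie_n L gr \<pi>"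
abbreviation "Z \<equiv> lie_Z_minus L gr \<pi>"

lemma N_simps [simp]:
  "carrier N = graded_part L gr {\<alpha>. \<pi> \<alpha> > 0}" "add N = add L" "module.smult N = module.smult L"
  "bracket N = bracket L" "\<zero>\<^bsub>N\<^esub> = \<zero>"
  by (simp_all add: lie_n_def)

lemma Z_simps [simp]:
  "carrier Z = lie_center L \<inter> graded_part L gr {\<alpha>. \<pi> \<alpha> \<le> 0}" "add Z = add L"
  "module.smult Z = module.smult L" "bracket Z = bracket L" "\<zero>\<^bsub>Z\<^esub> = \<zero>"
  by (simp_all add: lie_Z_minus_def lie_b_minus_def)

lemma lie_algebra_N: "lie_algebra N"
  unfolding lie_n_def
  by (rule lie_algebra_subalgebra[OF lie_algebra_axioms subspace_graded_part])
    (rule graded_part_bracket, auto simp: pi_add)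

lemma lie_algebra_Z: "lie_algebra Z"
  unfolding lie_Z_minus_def lie_b_minus_def
proof (rule lie_algebra_subalgebra[OF lie_algebra_axioms])
  show "subspace complex_ring (lie_center L \<inter> carrier (L\<lparr>carrier := graded_part L gr {\<alpha>. \<pi> \<alpha> \<le> 0}\<rparr>)) L"
    unfolding subspace_def submodule_def
    using lie_center_closed graded_part_zero graded_part_add graded_part_smult
    by (auto intro: vectorspace_axioms module_axioms)
qed (auto simp: bracket_center lie_center_closed graded_part_zero)

sublocale N: lie_character L N \<phi>
proof (intro lie_character.intro lie_subalgebra.intro lie_subalgebra_axioms.intro
    lie_character_axioms.intro lie_algebra_N lie_algebra_axioms)
  show "carrier N \<subseteq> carrier L" using graded_part_closed by auto
qed (use phi_hom in \<open>auto simp: lie_hom_def module_hom_def complex_lie_def\<close>)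

sublocale Z: lie_subalgebra L Z
  by (intro lie_subalgebra.intro lie_subalgebra_axioms.intro lie_algebra_Z lie_algebra_axioms)
    (auto dest: lie_center_closed(2))

text \<open>
  By \<open>Q\<close>-goodness a homogeneous \<open>y\<close> of degree \<open>\<alpha>\<close> is, in a unique way, \<open>coord \<alpha> y\<close> times \<open>x \<alpha>\<close> plus
  \<open>rest \<alpha> y\<close>, which is central and vanishes if \<open>\<pi> \<alpha> > 0\<close>. Where \<open>x \<alpha>\<close> is unspecified it is
  replaced by zero, with coordinate zero.
\<close>

definition "J = gr_support L gr - central_degrees L gr \<pi>"
definition "basis_vector \<alpha> = (if \<alpha> \<in> J then x \<alpha> else \<zero>)"
definition "residual \<alpha> = (if \<pi> \<alpha> > 0 then {\<zero>} else lie_center L \<inter> gr \<alpha>)"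
definition "decomposed \<alpha> y k w \<longleftrightarrow> w \<in> residual \<alpha> \<and> y = k \<odot> basis_vector \<alpha> \<oplus> w \<and> (\<alpha> \<notin> J \<longrightarrow> k = 0)"
definition "coord \<alpha> y = (THE k. \<exists>w. decomposed \<alpha> y k w)"
definition "rest \<alpha> y = (THE w. \<exists>k. decomposed \<alpha> y k w)"

lemma central_negative: "\<lbrakk>y \<in> gr \<alpha>; \<pi> \<alpha> \<le> 0\<rbrakk> \<Longrightarrow> y \<in> lie_center L \<longleftrightarrow> y \<in> carrier Z"
  by (auto intro: graded_partI)

lemma basis_vector_gr: "basis_vector \<alpha> \<in> gr \<alpha>"
  using x_choice[of \<alpha>] gr_zero by (auto simp: basis_vector_def J_def)

lemma basis_vector_closed: "basis_vector \<alpha> \<in> carrier L"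
  by (rule gr_closed[OF basis_vector_gr])

text \<open>In positive degree because \<open>x \<alpha>\<close> is nonzero; otherwise because it
  avoids Z'', where every central element of nonpositive degree lies. Uniqueness of coordinates
  rests on this.\<close>

lemma basis_vector_not_residual: "\<alpha> \<in> J \<Longrightarrow> basis_vector \<alpha> \<notin> residual \<alpha>"
  using x_choice[of \<alpha>] by (auto simp: basis_vector_def J_def residual_def intro: graded_partI)

lemma residual_closed:
  "\<zero> \<in> residual \<alpha>" "\<lbrakk>y \<in> residual \<alpha>; z \<in> residual \<alpha>\<rbrakk> \<Longrightarrow> y \<oplus> z \<in> residual \<alpha>"
  "y \<in> residual \<alpha> \<Longrightarrow> k \<odot> y \<in> residual \<alpha>" "y \<in> residual \<alpha> \<Longrightarrow> y \<in> carrier L"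
  "y \<in> residual \<alpha> \<Longrightarrow> y \<in> gr \<alpha>" "y \<in> residual \<alpha> \<Longrightarrow> y \<in> lie_center L" "y \<in> residual \<alpha> \<Longrightarrow> y \<in> carrier Z"
  by (auto simp: residual_def lie_center_closed gr_zero gr_add gr_smult L_vs graded_part_zero
      intro: graded_partI split: if_splits)

lemma decomposed_exists:
  assumes y: "y \<in> gr \<alpha>"
  shows "\<exists>k w. decomposed \<alpha> y k w"
proof (cases "\<alpha> \<in> J")
  case False
  \<comment> \<open>Outside \<open>J\<close> the graded piece is zero, or it is central and of
    nonpositive degree, so all of \<open>y\<close> counts as residual.\<close>
  have "y \<in> residual \<alpha>"
  proof (cases "\<alpha> \<in> gr_support L gr")
    case True
    then show ?thesis using False y by (auto simp: J_def central_degrees_def residual_def)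
  next
    case False
    then have "y = \<zero>" using y by (simp add: gr_support_def)
    then show ?thesis by (simp add: residual_closed)
  qed
  then have "decomposed \<alpha> y 0 y"
    using gr_closed[OF y] basis_vector_closed False by (simp add: decomposed_def L_vs)
  then show ?thesis by blast
next
  case True
  then have xa: "basis_vector \<alpha> = x \<alpha>" "x \<alpha> \<in> gr \<alpha>" "x \<alpha> \<noteq> \<zero>" "x \<alpha> \<notin> carrier Z"
    using x_choice[of \<alpha>] by (auto simp: basis_vector_def J_def simp del: Z_simps)
  show ?thesis
  proof (cases "\<pi> \<alpha> > 0")
    case pos: True
    have "dim_at_most 1 (L\<lparr>carrier := gr \<alpha>\<rparr>)" using good pos by (simp add: Q_good_def)
    then obtain k where "y = k \<odot> x \<alpha>"
      using dim_at_most_one[OF subspace_is_vs[OF gr_subspace], of \<alpha> "x \<alpha>" y] xa y by auto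
    then have "decomposed \<alpha> y k \<zero>"
      using pos xa True gr_closed[OF y] by (simp add: decomposed_def residual_def)
    then show ?thesis by blast
  next
    case neg: False
    \<comment> \<open>The dimension bound holds only modulo the centre, so \<open>y\<close> is a
      multiple of \<open>x \<alpha>\<close> up to some central \<open>w\<close>. That
      \<open>w\<close> is homogeneous follows since it is the difference of two elements of
      \<open>gr \<alpha>\<close>.\<close>
    let ?Q = "center_quot_gr L gr \<alpha>"
    have "dim_at_most 1 ?Q" using good neg by (simp add: Q_good_def)
    moreover have "lie_center L +> x \<alpha> \<noteq> \<zero>\<^bsub>?Q\<^esub>"
      using quot_class_eq_zero[OF M.abelian_group_axioms subgroup_center, of "x \<alpha>"] xa neg gr_closed[OF xa(2)] central_negative[OF xa(2)]
      by (simp add: center_quot_gr_def del: Z_simps)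
    ultimately obtain k where k: "lie_center L +> y = k \<odot>\<^bsub>?Q\<^esub> (lie_center L +> x \<alpha>)"
      using dim_at_most_one[OF vectorspace_center_quot_subspace[OF gr_subspace, of \<alpha>, folded center_quot_gr_def], of "lie_center L +> x \<alpha>" "lie_center L +> y"] xa y neg
      by (auto simp: center_quot_gr_def)
    have "k \<odot>\<^bsub>?Q\<^esub> (lie_center L +> x \<alpha>) = lie_center L +> (k \<odot> x \<alpha>)"
      using center_quot_smult gr_closed[OF xa(2)] by (simp add: center_quot_gr_def)
    then have "y \<in> lie_center L +> (k \<odot> x \<alpha>)"
      using k group.rcos_self[OF M.a_group, of y "lie_center L"] subgroup_center gr_closed[OF y] by (simp add: a_r_coset_def)
    then obtain w where w: "w \<in> lie_center L" "y = w \<oplus> k \<odot> x \<alpha>" by (auto simp: a_r_coset_def r_coset_def)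
    have kx: "k \<odot> x \<alpha> \<in> carrier L" using gr_closed[OF xa(2)] by (simp add: L_vs)
    have wc: "w \<in> carrier L" using w lie_center_closed by blast
    have "w = y \<oplus> (- k) \<odot> x \<alpha>"
      using w(2) wc kx gr_closed[OF xa(2)] L_vs(3)[of "x \<alpha>" k "- k"] by (simp add: M.a_assoc L_vs(2,7))
    then have "w \<in> gr \<alpha>" using y xa by (simp add: gr_add gr_smult)
    then have "decomposed \<alpha> y k w"
      using w neg True xa wc kx by (simp add: decomposed_def residual_def M.a_comm)
    then show ?thesis by blast
  qed
qed

text \<open>Two decompositions with different coordinates would put a nonzero multiple of
  \<open>basis_vector \<alpha>\<close>, and so the vector itself, into
  \<open>residual \<alpha>\<close>.\<close>

lemma decomposed_unique:
  assumes "decomposed \<alpha> y k w" "decomposed \<alpha> y k' w'"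
  shows "k = k' \<and> w = w'"
proof -
  let ?b = "basis_vector \<alpha>"
  have w: "w \<in> residual \<alpha>" "w' \<in> residual \<alpha>" and eq: "k \<odot> ?b \<oplus> w = k' \<odot> ?b \<oplus> w'"
    using assms by (auto simp: decomposed_def)
  note c = residual_closed(4)[OF w(1)] residual_closed(4)[OF w(2)] basis_vector_closed[of \<alpha>]
  have k: "k = k'"
  proof (cases "\<alpha> \<in> J")
    case True
    show ?thesis
    proof (rule ccontr)
      assume ne: "k \<noteq> k'"
      have "(k - k') \<odot> ?b = (k \<odot> ?b \<oplus> w) \<oplus> ((- k') \<odot> ?b \<oplus> (- 1) \<odot> w)"
        using c L_vs(3)[of ?b k "- k'"] L_vs(9)[of w] by (simp add: L_vs(2) M.a_ac M.r_neg2 M.r_neg)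
      also have "\<dots> = (k' \<odot> ?b \<oplus> w') \<oplus> ((- k') \<odot> ?b \<oplus> (- 1) \<odot> w)" using eq by simp
      also have "\<dots> = (k' \<odot> ?b \<oplus> (- k') \<odot> ?b) \<oplus> (w' \<oplus> (- 1) \<odot> w)"
        using c by (simp add: L_vs(2) M.a_ac)
      also have "\<dots> = w' \<oplus> (- 1) \<odot> w"
        using c L_vs(3)[of ?b k' "- k'"] by (simp add: L_vs(2,7))
      finally have "(1 / (k - k')) \<odot> ((k - k') \<odot> ?b) \<in> residual \<alpha>"
        using w by (simp add: residual_closed)
      moreover have "(1 / (k - k')) \<odot> ((k - k') \<odot> ?b) = ?b"
        using ne c by (simp add: L_vs(6) flip: L_vs(5))
      ultimately show False using basis_vector_not_residual[OF True] by simp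
    qed
  qed (use assms in \<open>auto simp: decomposed_def\<close>)
  then show ?thesis using eq c by (simp add: L_vs)
qed

lemma decomposed_iff:
  assumes "y \<in> gr \<alpha>"
  shows "decomposed \<alpha> y k w \<longleftrightarrow> coord \<alpha> y = k \<and> rest \<alpha> y = w"
proof -
  obtain k' w' where d: "decomposed \<alpha> y k' w'" using decomposed_exists[OF assms] by blast
  have "coord \<alpha> y = k'" unfolding coord_def using d decomposed_unique by blast
  moreover have "rest \<alpha> y = w'" unfolding rest_def using d decomposed_unique by blast
  ultimately show ?thesis using d decomposed_unique by blast
qed

lemma coord_rest:
  assumes "y \<in> gr \<alpha>"
  shows "y = coord \<alpha> y \<odot> basis_vector \<alpha> \<oplus> rest \<alpha> y" "rest \<alpha> y \<in> residual \<alpha>"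
  using decomposed_iff[OF assms, of "coord \<alpha> y" "rest \<alpha> y"] by (auto simp: decomposed_def)

lemma coord_eqI:
  assumes "y \<in> gr \<alpha>" "decomposed \<alpha> y k w"
  shows "coord \<alpha> y = k" "rest \<alpha> y = w"
  using decomposed_iff assms by blast+

lemma decomposed_coord: "y \<in> gr \<alpha> \<Longrightarrow> decomposed \<alpha> y (coord \<alpha> y) (rest \<alpha> y)"
  by (simp add: decomposed_iff)

lemma decomposed_add:
  assumes "decomposed \<alpha> y k w" "decomposed \<alpha> z l u"
  shows "decomposed \<alpha> (y \<oplus> z) (k + l) (w \<oplus> u)"
  using assms residual_closed(4)[of w \<alpha>] residual_closed(4)[of u \<alpha>] basis_vector_closed[of \<alpha>]
  unfolding decomposed_def by (auto simp: L_vs M.a_ac residual_closed)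

lemma decomposed_smult:
  assumes "decomposed \<alpha> y k w"
  shows "decomposed \<alpha> (c \<odot> y) (c * k) (c \<odot> w)"
  using assms residual_closed(3)[of w \<alpha> c] residual_closed(4)[of w \<alpha>] basis_vector_closed[of \<alpha>]
  unfolding decomposed_def by (auto simp: L_vs(2,4,5,7))

lemma coord_add: "\<lbrakk>y \<in> gr \<alpha>; z \<in> gr \<alpha>\<rbrakk> \<Longrightarrow> coord \<alpha> (y \<oplus> z) = coord \<alpha> y + coord \<alpha> z"
  and rest_add: "\<lbrakk>y \<in> gr \<alpha>; z \<in> gr \<alpha>\<rbrakk> \<Longrightarrow> rest \<alpha> (y \<oplus> z) = rest \<alpha> y \<oplus> rest \<alpha> z"
  using coord_eqI[OF gr_add decomposed_add[OF decomposed_coord decomposed_coord]] by blast+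

lemma coord_smult: "y \<in> gr \<alpha> \<Longrightarrow> coord \<alpha> (c \<odot> y) = c * coord \<alpha> y"
  and rest_smult: "y \<in> gr \<alpha> \<Longrightarrow> rest \<alpha> (c \<odot> y) = c \<odot> rest \<alpha> y"
  using coord_eqI[OF gr_smult decomposed_smult[OF decomposed_coord]] by blast+

lemma coord_residual:
  assumes "y \<in> residual \<alpha>"
  shows "coord \<alpha> y = 0" "rest \<alpha> y = y"
proof -
  have "decomposed \<alpha> y 0 y"
    using assms residual_closed(4)[OF assms] basis_vector_closed[of \<alpha>] by (simp add: decomposed_def L_vs)
  then show "coord \<alpha> y = 0" "rest \<alpha> y = y" using coord_eqI[OF residual_closed(5)[OF assms]] by blast+
qed

lemma rest_closed: "y \<in> gr \<alpha> \<Longrightarrow> rest \<alpha> y \<in> carrier L" "y \<in> gr \<alpha> \<Longrightarrow> rest \<alpha> y \<in> carrier Z"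
  by (rule residual_closed(4)[OF coord_rest(2)], assumption) (rule residual_closed(7)[OF coord_rest(2)])

lemma coord_zero: "coord \<alpha> \<zero> = 0" "rest \<alpha> \<zero> = \<zero>"
  using coord_residual[OF residual_closed(1)] by auto

lemma rest_positive: "\<lbrakk>y \<in> gr \<alpha>; \<pi> \<alpha> > 0\<rbrakk> \<Longrightarrow> rest \<alpha> y = \<zero>"
  using coord_rest(2) by (fastforce simp: residual_def)

text \<open>Structure constants: the bracket of \<open>basis_vector \<alpha>\<close> and
  \<open>basis_vector \<beta>\<close> is \<open>sc \<alpha> \<beta>\<close> times
  \<open>basis_vector (\<alpha> + \<beta>)\<close> plus the central element
  \<open>sz \<alpha> \<beta>\<close>.\<close>

definition "sc \<alpha> \<beta> = coord (\<alpha> + \<beta>) (bracket L (basis_vector \<alpha>) (basis_vector \<beta>))"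
definition "sz \<alpha> \<beta> = rest (\<alpha> + \<beta>) (bracket L (basis_vector \<alpha>) (basis_vector \<beta>))"

lemma bracket_basis_gr: "bracket L (basis_vector \<alpha>) (basis_vector \<beta>) \<in> gr (\<alpha> + \<beta>)"
  by (rule gr_bracket[OF basis_vector_gr basis_vector_gr])

lemma sz_residual: "sz \<alpha> \<beta> \<in> residual (\<alpha> + \<beta>)"
  unfolding sz_def by (rule coord_rest(2)[OF bracket_basis_gr])

text \<open>The rests of \<open>y\<close> and \<open>z\<close> are central and drop out, so only the
  two coordinates enter.\<close>

lemma bracket_homogeneous:
  assumes y: "y \<in> gr \<alpha>" and z: "z \<in> gr \<beta>"
  shows "bracket L y z = (coord \<alpha> y * coord \<beta> z) \<odot> bracket L (basis_vector \<alpha>) (basis_vector \<beta>)"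
proof -
  note c = basis_vector_closed[of \<alpha>] basis_vector_closed[of \<beta>] rest_closed(1)[OF y] rest_closed(1)[OF z]
    gr_closed[OF y] gr_closed[OF z]
  have r: "rest \<alpha> y \<in> lie_center L" "rest \<beta> z \<in> lie_center L"
    by (rule residual_closed(6)[OF coord_rest(2)[OF y]], rule residual_closed(6)[OF coord_rest(2)[OF z]])
  have "bracket L y z = bracket L (coord \<alpha> y \<odot> basis_vector \<alpha> \<oplus> rest \<alpha> y) z"
    using coord_rest(1)[OF y] by simp
  also have "\<dots> = coord \<alpha> y \<odot> bracket L (basis_vector \<alpha>) z"
    using c r by (simp add: bracket_add_left bracket_smult_left bracket_center L_vs(2) bracket_closed)
  also have "bracket L (basis_vector \<alpha>) z = bracket L (basis_vector \<alpha>) (coord \<beta> z \<odot> basis_vector \<beta> \<oplus> rest \<beta> z)"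
    using coord_rest(1)[OF z] by simp
  also have "\<dots> = coord \<beta> z \<odot> bracket L (basis_vector \<alpha>) (basis_vector \<beta>)"
    using c r by (simp add: bracket_add_right bracket_smult_right bracket_center L_vs(2) bracket_closed)
  finally show ?thesis using c by (simp add: L_vs(5) bracket_closed)
qed

lemma coord_bracket:
  assumes y: "y \<in> gr \<alpha>" and z: "z \<in> gr \<beta>"
  shows "coord (\<alpha> + \<beta>) (bracket L y z) = coord \<alpha> y * coord \<beta> z * sc \<alpha> \<beta>"
    "rest (\<alpha> + \<beta>) (bracket L y z) = (coord \<alpha> y * coord \<beta> z) \<odot> sz \<alpha> \<beta>"
  unfolding bracket_homogeneous[OF assms] sc_def sz_def
  by (rule coord_smult[OF bracket_basis_gr] rest_smult[OF bracket_basis_gr])+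

lemma coord_basis: "\<alpha> \<in> J \<Longrightarrow> coord \<alpha> (basis_vector \<alpha>) = 1" "rest \<alpha> (basis_vector \<alpha>) = \<zero>"
proof -
  have "decomposed \<alpha> (basis_vector \<alpha>) (if \<alpha> \<in> J then 1 else 0) \<zero>"
    using basis_vector_closed[of \<alpha>] by (cases "\<alpha> \<in> J") (auto simp: decomposed_def residual_closed L_vs basis_vector_def)
  from coord_eqI[OF basis_vector_gr this]
  show "\<alpha> \<in> J \<Longrightarrow> coord \<alpha> (basis_vector \<alpha>) = 1" "rest \<alpha> (basis_vector \<alpha>) = \<zero>" by auto
qed

lemma coord_outside: "\<lbrakk>y \<in> gr \<alpha>; \<alpha> \<notin> J\<rbrakk> \<Longrightarrow> coord \<alpha> y = 0"
  using decomposed_coord by (auto simp: decomposed_def)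

text \<open>For \<gamma> in \<open>J\<close> the second coordinate in \<open>coord_bracket\<close>
  is 1; outside \<open>J\<close> the basis vector is zero and the structure constants vanish along
  with it. The formula is thus uniform in \<gamma>.\<close>

lemma coord_bracket_basis:
  assumes y: "y \<in> gr \<alpha>"
  shows "coord (\<alpha> + \<gamma>) (bracket L y (basis_vector \<gamma>)) = coord \<alpha> y * sc \<alpha> \<gamma>"
    "rest (\<alpha> + \<gamma>) (bracket L y (basis_vector \<gamma>)) = coord \<alpha> y \<odot> sz \<alpha> \<gamma>"
proof -
  have "bracket L y (basis_vector \<gamma>) = coord \<alpha> y \<odot> bracket L (basis_vector \<alpha>) (basis_vector \<gamma>)"
  proof (cases "\<gamma> \<in> J")
    case True
    then show ?thesis using bracket_homogeneous[OF y basis_vector_gr] by (simp add: coord_basis)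
  next
    case False
    then show ?thesis using gr_closed[OF y] basis_vector_closed[of \<alpha>]
      by (simp add: basis_vector_def bracket_zero_right L_vs)
  qed
  then show "coord (\<alpha> + \<gamma>) (bracket L y (basis_vector \<gamma>)) = coord \<alpha> y * sc \<alpha> \<gamma>"
    "rest (\<alpha> + \<gamma>) (bracket L y (basis_vector \<gamma>)) = coord \<alpha> y \<odot> sz \<alpha> \<gamma>"
    by (simp_all add: sc_def sz_def coord_smult[OF bracket_basis_gr] rest_smult[OF bracket_basis_gr])
qed

lemma sc_antisym: "sc \<beta> \<alpha> = - sc \<alpha> \<beta>" and sz_antisym: "sz \<beta> \<alpha> = (-1) \<odot> sz \<alpha> \<beta>"
proof -
  have e: "bracket L (basis_vector \<beta>) (basis_vector \<alpha>) = (-1) \<odot> bracket L (basis_vector \<alpha>) (basis_vector \<beta>)"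
    by (rule bracket_antisym[OF basis_vector_closed basis_vector_closed])
  show "sc \<beta> \<alpha> = - sc \<alpha> \<beta>" "sz \<beta> \<alpha> = (-1) \<odot> sz \<alpha> \<beta>"
    unfolding sc_def sz_def add.commute[of \<beta> \<alpha>] e
    using coord_smult[OF bracket_basis_gr, of \<alpha> \<beta> "-1"] rest_smult[OF bracket_basis_gr, of \<alpha> \<beta> "-1"] by auto
qed

text \<open>Coordinate and rest of the Jacobi identity for three basis vectors; they supply
  \<open>c_jacobi\<close> and \<open>st_jacobi\<close>.\<close>

lemma structure_jacobi:
  "sc \<alpha> \<beta> * sc (\<alpha> + \<beta>) \<gamma> + sc \<beta> \<gamma> * sc (\<beta> + \<gamma>) \<alpha> + sc \<gamma> \<alpha> * sc (\<gamma> + \<alpha>) \<beta> = 0" (is ?A)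
  "sc \<alpha> \<beta> \<odot> sz (\<alpha> + \<beta>) \<gamma> \<oplus> sc \<beta> \<gamma> \<odot> sz (\<beta> + \<gamma>) \<alpha> \<oplus> sc \<gamma> \<alpha> \<odot> sz (\<gamma> + \<alpha>) \<beta> = \<zero>" (is ?B)
proof -
  let ?b = "\<lambda>\<alpha> \<beta> \<gamma>. bracket L (bracket L (basis_vector \<alpha>) (basis_vector \<beta>)) (basis_vector \<gamma>)"
  let ?\<delta> = "\<alpha> + \<beta> + \<gamma>"
  note c = basis_vector_closed bracket_closed[OF basis_vector_closed basis_vector_closed]
  have d: "\<beta> + \<gamma> + \<alpha> = ?\<delta>" "\<gamma> + \<alpha> + \<beta> = ?\<delta>" by (simp_all add: add_ac)
  have g: "?b \<alpha> \<beta> \<gamma> \<in> gr ?\<delta>" "?b \<beta> \<gamma> \<alpha> \<in> gr ?\<delta>" "?b \<gamma> \<alpha> \<beta> \<in> gr ?\<delta>"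
    using gr_bracket[OF bracket_basis_gr basis_vector_gr] d by metis+
  have j: "bracket L (basis_vector \<gamma>) (bracket L (basis_vector \<alpha>) (basis_vector \<beta>)) \<oplus>
      bracket L (basis_vector \<alpha>) (bracket L (basis_vector \<beta>) (basis_vector \<gamma>)) \<oplus>
      bracket L (basis_vector \<beta>) (bracket L (basis_vector \<gamma>) (basis_vector \<alpha>)) = \<zero>"
    by (rule jacobi[OF c(1) c(1) c(1)])
  \<comment> \<open>\<open>jacobi\<close> has the inner brackets on the right. Antisymmetry moves
    them to the left at the cost of a common factor -1.\<close>
  have "?b \<alpha> \<beta> \<gamma> \<oplus> ?b \<beta> \<gamma> \<alpha> \<oplus> ?b \<gamma> \<alpha> \<beta> = (-1) \<odot> (bracket L (basis_vector \<gamma>) (bracket L (basis_vector \<alpha>) (basis_vector \<beta>)) \<oplus>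
      bracket L (basis_vector \<alpha>) (bracket L (basis_vector \<beta>) (basis_vector \<gamma>)) \<oplus>
      bracket L (basis_vector \<beta>) (bracket L (basis_vector \<gamma>) (basis_vector \<alpha>)))"
    using bracket_antisym[OF c(1) c(2), of \<gamma> \<alpha> \<beta>] bracket_antisym[OF c(1) c(2), of \<alpha> \<beta> \<gamma>]
      bracket_antisym[OF c(1) c(2), of \<beta> \<gamma> \<alpha>] c by (simp add: L_vs(4) bracket_closed)
  also have "\<dots> = \<zero>" unfolding j by (simp add: L_vs)
  finally have s: "?b \<alpha> \<beta> \<gamma> \<oplus> ?b \<beta> \<gamma> \<alpha> \<oplus> ?b \<gamma> \<alpha> \<beta> = \<zero>" .
  have e: "coord ?\<delta> (?b \<alpha> \<beta> \<gamma>) = sc \<alpha> \<beta> * sc (\<alpha> + \<beta>) \<gamma>" "rest ?\<delta> (?b \<alpha> \<beta> \<gamma>) = sc \<alpha> \<beta> \<odot> sz (\<alpha> + \<beta>) \<gamma>"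
    "coord ?\<delta> (?b \<beta> \<gamma> \<alpha>) = sc \<beta> \<gamma> * sc (\<beta> + \<gamma>) \<alpha>" "rest ?\<delta> (?b \<beta> \<gamma> \<alpha>) = sc \<beta> \<gamma> \<odot> sz (\<beta> + \<gamma>) \<alpha>"
    "coord ?\<delta> (?b \<gamma> \<alpha> \<beta>) = sc \<gamma> \<alpha> * sc (\<gamma> + \<alpha>) \<beta>" "rest ?\<delta> (?b \<gamma> \<alpha> \<beta>) = sc \<gamma> \<alpha> \<odot> sz (\<gamma> + \<alpha>) \<beta>"
    using coord_bracket_basis[OF bracket_basis_gr, of \<alpha> \<beta> \<gamma>] coord_bracket_basis[OF bracket_basis_gr, of \<beta> \<gamma> \<alpha>]
      coord_bracket_basis[OF bracket_basis_gr, of \<gamma> \<alpha> \<beta>] unfolding d sc_def[symmetric] by auto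
  have "coord ?\<delta> (?b \<alpha> \<beta> \<gamma> \<oplus> ?b \<beta> \<gamma> \<alpha> \<oplus> ?b \<gamma> \<alpha> \<beta>) = 0" "rest ?\<delta> (?b \<alpha> \<beta> \<gamma> \<oplus> ?b \<beta> \<gamma> \<alpha> \<oplus> ?b \<gamma> \<alpha> \<beta>) = \<zero>"
    unfolding s by (rule coord_zero)+
  then show ?A ?B using g by (simp_all add: coord_add rest_add gr_add e)
qed

lemma phi_coord: "\<lbrakk>y \<in> gr \<alpha>; \<pi> \<alpha> > 0\<rbrakk> \<Longrightarrow> \<phi> y = coord \<alpha> y * \<phi> (basis_vector \<alpha>)"
  using coord_rest(1)[of y \<alpha>] rest_positive[of y \<alpha>] basis_vector_closed[of \<alpha>]
    N.phi_smult[of "basis_vector \<alpha>" "coord \<alpha> y"] graded_partI[OF basis_vector_gr, of \<alpha>]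
  by (simp add: L_vs)

text \<open>\<phi> vanishes on brackets within n, and in positive degree a bracket has no central
  rest that could compensate; this supplies \<open>pos_c\<close>.\<close>

lemma phi_structure:
  assumes "\<pi> \<alpha> > 0" "\<pi> \<beta> > 0"
  shows "sc \<alpha> \<beta> * \<phi> (basis_vector (\<alpha> + \<beta>)) = 0"
proof -
  have "\<phi> (bracket L (basis_vector \<alpha>) (basis_vector \<beta>)) = 0"
    using N.phi_bracket[of "basis_vector \<alpha>" "basis_vector \<beta>"] assms
    by (auto intro!: graded_partI[OF basis_vector_gr])
  then show ?thesis using phi_coord[OF bracket_basis_gr, of \<alpha> \<beta>] assms by (simp add: sc_def pi_add)
qed

end

section \<open>A Whittaker vector killed by a given maximal ideal\<close>

context whittaker_setting
begin

abbreviation "A \<equiv> carrier (sub_env Z L)"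

interpretation U: ring "env L" by (rule ring_env)
interpretation S: ring "sub_env Z L" by (rule Z.ring_sub_env)

lemma A_closed [simp]:
  "a \<in> A \<Longrightarrow> a \<in> carrier (env L)"
  "\<lbrakk>a \<in> A; b \<in> A\<rbrakk> \<Longrightarrow> a \<oplus>\<^bsub>env L\<^esub> b \<in> A"
  "\<lbrakk>a \<in> A; b \<in> A\<rbrakk> \<Longrightarrow> a \<otimes>\<^bsub>env L\<^esub> b \<in> A"
  "env_scal L c \<in> A" "z \<in> carrier Z \<Longrightarrow> env_gen L z \<in> A" "\<one>\<^bsub>env L\<^esub> \<in> A" "\<zero>\<^bsub>env L\<^esub> \<in> A"
  using Z.sub_env_closed[of a] S.a_closed[of a b] S.m_closed[of a b] Z.env_scal_sub_env[of c]
    Z.env_gen_sub_env[of z] S.one_closed S.zero_closed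
  by (simp_all del: Z.sub_env_simps(1) Z_simps(1))

declare Z.sub_env_simps(1) [simp del] Z_simps(1) [simp del]

lemma Z_closed: "z \<in> carrier Z \<Longrightarrow> z \<in> carrier L" "z \<in> carrier Z \<Longrightarrow> z \<in> lie_center L"
  using lie_center_closed(2) by (auto simp: Z_simps(1))

lemma Z_add_closed: "\<lbrakk>y \<in> carrier Z; z \<in> carrier Z\<rbrakk> \<Longrightarrow> y \<oplus> z \<in> carrier Z"
  by (auto simp: Z_simps(1) lie_center_closed graded_part_add)

text \<open>\<open>A\<close> is generated by scalars and by central elements of
  \<open>L\<close>.\<close>

lemma A_central: "\<lbrakk>a \<in> A; C \<in> carrier (env L)\<rbrakk> \<Longrightarrow> a \<otimes>\<^bsub>env L\<^esub> C = C \<otimes>\<^bsub>env L\<^esub> a"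
proof (induction a rule: Z.sub_env_induct)
  case (gen x a)
  then have x: "x \<in> carrier L" "x \<in> lie_center L" and a: "a \<in> carrier (env L)" by (auto simp: Z_closed)
  have "(env_gen L x \<otimes>\<^bsub>env L\<^esub> a) \<otimes>\<^bsub>env L\<^esub> C = env_gen L x \<otimes>\<^bsub>env L\<^esub> (C \<otimes>\<^bsub>env L\<^esub> a)"
    using x a gen by (simp add: U.m_assoc)
  also have "\<dots> = (C \<otimes>\<^bsub>env L\<^esub> a) \<otimes>\<^bsub>env L\<^esub> env_gen L x"
    using x a gen by (intro env_commute_center) auto
  also have "\<dots> = C \<otimes>\<^bsub>env L\<^esub> (env_gen L x \<otimes>\<^bsub>env L\<^esub> a)"
    using env_commute_center[OF x(2) a] x a gen by (simp add: U.m_assoc)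
  finally show ?case .
qed (simp_all add: env_scal_central U.l_distr U.r_distr)

lemma A_right_commute: "\<lbrakk>a \<in> A; b \<in> A; d \<in> A\<rbrakk> \<Longrightarrow>
  a \<otimes>\<^bsub>env L\<^esub> b \<otimes>\<^bsub>env L\<^esub> d = a \<otimes>\<^bsub>env L\<^esub> d \<otimes>\<^bsub>env L\<^esub> b"
  using A_central[of b d] by (simp add: U.m_assoc)

definition linear_on_A :: "(('g list \<Rightarrow> complex) set \<Rightarrow> complex) \<Rightarrow> bool" where
  "linear_on_A f \<longleftrightarrow> (\<forall>a\<in>A. \<forall>b\<in>A. f (a \<oplus>\<^bsub>env L\<^esub> b) = f a + f b) \<and>
     (\<forall>a\<in>A. \<forall>c. f (env_scal L c \<otimes>\<^bsub>env L\<^esub> a) = c * f a)"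

lemma linear_on_A_shift:
  assumes f: "linear_on_A f" and b: "b \<in> A"
  shows "linear_on_A (\<lambda>a. f (a \<otimes>\<^bsub>env L\<^esub> b))"
  using assms unfolding linear_on_A_def
  by (auto simp: U.l_distr U.m_assoc)

text \<open>By Zorn's lemma \<open>m\<close> lies in a maximal complex subspace that avoids the unit; this is a hyperplane,
  hence the kernel of a functional.\<close>

lemma exists_functional:
  assumes m: "ideal m (sub_env Z L)" "m \<noteq> A"
  obtains lam where "linear_on_A lam" "\<And>a. a \<in> m \<Longrightarrow> lam a = 0" "lam \<one>\<^bsub>env L\<^esub> \<noteq> 0"
proof -
  interpret m: ideal m "sub_env Z L" by (rule m(1))
  let ?P = "\<lambda>H. m \<subseteq> H \<and> H \<subseteq> A \<and> (\<forall>a\<in>H. \<forall>b\<in>H. a \<oplus>\<^bsub>env L\<^esub> b \<in> H) \<and>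
    (\<forall>a\<in>H. \<forall>c. env_scal L c \<otimes>\<^bsub>env L\<^esub> a \<in> H) \<and> \<one>\<^bsub>env L\<^esub> \<notin> H"
  have one: "\<one>\<^bsub>env L\<^esub> \<notin> m" using m m.one_imp_carrier by auto
  have P_m: "?P m"
    using one m.a_closed m.I_l_closed m.a_subset by (auto simp: subset_iff)
  have "\<exists>H\<in>Collect ?P. \<forall>H'\<in>Collect ?P. H \<subseteq> H' \<longrightarrow> H' = H"
  proof (rule subset_Zorn)
    fix \<C> assume C: "subset.chain (Collect ?P) \<C>"
    show "\<exists>H\<in>Collect ?P. \<forall>H'\<in>\<C>. H' \<subseteq> H"
    proof (cases "\<C> = {}")
      case True
      then show ?thesis using CollectI[of ?P, OF P_m] by auto
    next
      case False
      have Ch: "\<And>H. H \<in> \<C> \<Longrightarrow> ?P H" and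
        total: "\<And>H1 H2. \<lbrakk>H1 \<in> \<C>; H2 \<in> \<C>\<rbrakk> \<Longrightarrow> H1 \<subseteq> H2 \<or> H2 \<subseteq> H1"
        using C unfolding subset_chain_def by blast+
      have "?P (\<Union>\<C>)"
      proof (intro conjI)
        obtain H where "H \<in> \<C>" using False by blast
        then show "m \<subseteq> \<Union>\<C>" using Ch[of H] by blast
        show "\<Union>\<C> \<subseteq> A" using Ch by (intro Union_least) simp
        show "\<forall>a\<in>\<Union>\<C>. \<forall>b\<in>\<Union>\<C>. a \<oplus>\<^bsub>env L\<^esub> b \<in> \<Union>\<C>"
        proof (intro ballI)
          fix a b assume "a \<in> \<Union>\<C>" "b \<in> \<Union>\<C>"
          then obtain H1 H2 where H: "H1 \<in> \<C>" "a \<in> H1" "H2 \<in> \<C>" "b \<in> H2" by blast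
          then obtain H where H': "H \<in> \<C>" "a \<in> H" "b \<in> H" using total[OF H(1,3)] by blast
          have "a \<oplus>\<^bsub>env L\<^esub> b \<in> H" using Ch[OF H'(1)] H'(2,3) by simp
          then show "a \<oplus>\<^bsub>env L\<^esub> b \<in> \<Union>\<C>" using H'(1) by (rule UnionI[rotated])
        qed
        show "\<forall>a\<in>\<Union>\<C>. \<forall>c. env_scal L c \<otimes>\<^bsub>env L\<^esub> a \<in> \<Union>\<C>"
        proof (intro ballI allI)
          fix a c assume "a \<in> \<Union>\<C>"
          then obtain H where H: "H \<in> \<C>" "a \<in> H" by blast
          have "env_scal L c \<otimes>\<^bsub>env L\<^esub> a \<in> H" using Ch[OF H(1)] H(2) by simp
          then show "env_scal L c \<otimes>\<^bsub>env L\<^esub> a \<in> \<Union>\<C>" using H(1) by (rule UnionI[rotated])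
        qed
        show "\<one>\<^bsub>env L\<^esub> \<notin> \<Union>\<C>" using Ch by auto
      qed
      then show ?thesis by (intro bexI[of _ "\<Union>\<C>"] ballI Union_upper CollectI)
    qed
  qed
  then obtain H where HP: "H \<in> Collect ?P" and Hmax: "\<forall>H'\<in>Collect ?P. H \<subseteq> H' \<longrightarrow> H' = H" by (rule bexE)
  have H: "?P H" using HP by (rule CollectD)
  have max: "H' = H" if "?P H'" "H \<subseteq> H'" for H'
    using bspec[OF Hmax CollectI[of ?P, OF that(1)]] that(2) by (rule mp)
  have HA: "a \<in> A" if "a \<in> H" for a using H that by blast
  have H0: "\<zero>\<^bsub>env L\<^esub> \<in> H" using H m.zero_closed by auto
  have Hadd: "\<And>a b. \<lbrakk>a \<in> H; b \<in> H\<rbrakk> \<Longrightarrow> a \<oplus>\<^bsub>env L\<^esub> b \<in> H"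
    and Hs: "\<And>c a. a \<in> H \<Longrightarrow> env_scal L c \<otimes>\<^bsub>env L\<^esub> a \<in> H" and H1: "\<one>\<^bsub>env L\<^esub> \<notin> H"
    using H by simp_all
  \<comment> \<open>Maximality in use: if \<open>a\<close> is not in \<open>H\<close>, then the span
    of \<open>H\<close> and \<open>a\<close> can no longer avoid the unit.\<close>
  have ex: "\<exists>c. \<exists>h\<in>H. a = env_scal L c \<oplus>\<^bsub>env L\<^esub> h" if a: "a \<in> A" for a
  proof (cases "a \<in> H")
    case True
    then have "a = env_scal L 0 \<oplus>\<^bsub>env L\<^esub> a" using a by (simp add: env_scal_zero)
    then show ?thesis using True by blast
  next
    case False
    let ?H = "{env_scal L c \<otimes>\<^bsub>env L\<^esub> a \<oplus>\<^bsub>env L\<^esub> h | c h. h \<in> H}"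
    have nP: "\<not> ?P ?H"
    proof
      assume P: "?P ?H"
      have "H \<subseteq> ?H"
      proof
        fix h assume h: "h \<in> H"
        then have "h = env_scal L 0 \<otimes>\<^bsub>env L\<^esub> a \<oplus>\<^bsub>env L\<^esub> h" using a HA by (simp add: env_scal_zero)
        then show "h \<in> ?H" using h by blast
      qed
      then have "?H = H" using max[OF P] by blast
      moreover have "a = env_scal L 1 \<otimes>\<^bsub>env L\<^esub> a \<oplus>\<^bsub>env L\<^esub> \<zero>\<^bsub>env L\<^esub>" using a by (simp add: env_class_one)
      ultimately show False using False H0 by blast
    qed
    have H1': "m \<subseteq> ?H"
    proof
      fix h assume "h \<in> m"
      then have h: "h \<in> H" using H by blast
      then have "h = env_scal L 0 \<otimes>\<^bsub>env L\<^esub> a \<oplus>\<^bsub>env L\<^esub> h" using a HA by (simp add: env_scal_zero)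
      then show "h \<in> ?H" using h by blast
    qed
    have H2': "?H \<subseteq> A" using a HA by auto
    have H3': "\<forall>b\<in>?H. \<forall>d\<in>?H. b \<oplus>\<^bsub>env L\<^esub> d \<in> ?H"
    proof (intro ballI)
      fix b d assume "b \<in> ?H" "d \<in> ?H"
      then obtain c h c' h' where b: "b = env_scal L c \<otimes>\<^bsub>env L\<^esub> a \<oplus>\<^bsub>env L\<^esub> h" "h \<in> H"
        and d: "d = env_scal L c' \<otimes>\<^bsub>env L\<^esub> a \<oplus>\<^bsub>env L\<^esub> h'" "h' \<in> H" by blast
      have "b \<oplus>\<^bsub>env L\<^esub> d = env_scal L (c + c') \<otimes>\<^bsub>env L\<^esub> a \<oplus>\<^bsub>env L\<^esub> (h \<oplus>\<^bsub>env L\<^esub> h')"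
        using a b d HA by (simp add: env_scal_add U.l_distr U.a_ac)
      then show "b \<oplus>\<^bsub>env L\<^esub> d \<in> ?H" using Hadd[OF b(2) d(2)] by blast
    qed
    have H4': "\<forall>b\<in>?H. \<forall>c. env_scal L c \<otimes>\<^bsub>env L\<^esub> b \<in> ?H"
    proof (intro ballI allI)
      fix b c assume "b \<in> ?H"
      then obtain c' h where b: "b = env_scal L c' \<otimes>\<^bsub>env L\<^esub> a \<oplus>\<^bsub>env L\<^esub> h" "h \<in> H" by blast
      have "env_scal L c \<otimes>\<^bsub>env L\<^esub> b = env_scal L (c * c') \<otimes>\<^bsub>env L\<^esub> a \<oplus>\<^bsub>env L\<^esub> env_scal L c \<otimes>\<^bsub>env L\<^esub> h"
        using a b HA by (simp add: env_scal_mult U.r_distr U.m_assoc)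
      then show "env_scal L c \<otimes>\<^bsub>env L\<^esub> b \<in> ?H" using Hs[OF b(2)] by blast
    qed
    have "\<one>\<^bsub>env L\<^esub> \<in> ?H"
      by (rule ccontr) (rule notE[OF nP], intro conjI H1' H2' H3' H4')
    \<comment> \<open>Here \<open>c\<close> is nonzero because the unit is not in \<open>H\<close>,
      and the equation can be solved for \<open>a\<close>, giving the scalar
      \<open>1/c\<close>.\<close>
    then obtain c h where h: "\<one>\<^bsub>env L\<^esub> = env_scal L c \<otimes>\<^bsub>env L\<^esub> a \<oplus>\<^bsub>env L\<^esub> h" "h \<in> H" by blast
    have hc: "h \<in> carrier (env L)" "env_scal L (-(1/c)) \<otimes>\<^bsub>env L\<^esub> h \<in> carrier (env L)" using h HA by auto
    have c: "c \<noteq> 0" using h H1 a hc by (auto simp: env_scal_zero)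
    have "env_scal L (1/c) \<otimes>\<^bsub>env L\<^esub> \<one>\<^bsub>env L\<^esub> = env_scal L (1/c) \<otimes>\<^bsub>env L\<^esub> (env_scal L c \<otimes>\<^bsub>env L\<^esub> a \<oplus>\<^bsub>env L\<^esub> h)"
      using h(1) by simp
    then have e: "env_scal L (1/c) = a \<oplus>\<^bsub>env L\<^esub> env_scal L (1/c) \<otimes>\<^bsub>env L\<^esub> h"
      using a hc c by (simp add: U.r_distr U.m_assoc[symmetric] env_scal_mult[symmetric] env_class_one)
    have "env_scal L (1/c) \<oplus>\<^bsub>env L\<^esub> env_scal L (-(1/c)) \<otimes>\<^bsub>env L\<^esub> h
      = a \<oplus>\<^bsub>env L\<^esub> (env_scal L (1/c) \<otimes>\<^bsub>env L\<^esub> h \<oplus>\<^bsub>env L\<^esub> env_scal L (-(1/c)) \<otimes>\<^bsub>env L\<^esub> h)"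
      using a hc by (subst e) (simp add: U.a_assoc)
    also have "\<dots> = a \<oplus>\<^bsub>env L\<^esub> env_scal L (1/c + -(1/c)) \<otimes>\<^bsub>env L\<^esub> h"
      using a hc(1) by (simp only: env_scal_add U.l_distr env_scal_closed)
    also have "\<dots> = a" using a hc by (simp add: env_scal_zero)
    finally show ?thesis using Hs[OF h(2)] by metis
  qed
  \<comment> \<open>Two different scalars would put a nonzero scalar into \<open>H\<close>, and with
    it the unit.\<close>
  have uniq: "c = c'" if "env_scal L c \<oplus>\<^bsub>env L\<^esub> h = env_scal L c' \<oplus>\<^bsub>env L\<^esub> h'" "h \<in> H" "h' \<in> H" for c c' h h'
  proof (rule ccontr)
    assume ne: "c \<noteq> c'"
    have hc: "h \<in> carrier (env L)" "h' \<in> carrier (env L)" using that HA by auto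
    have "env_scal L (- c') \<oplus>\<^bsub>env L\<^esub> (env_scal L c \<oplus>\<^bsub>env L\<^esub> h) = env_scal L (- c') \<oplus>\<^bsub>env L\<^esub> (env_scal L c' \<oplus>\<^bsub>env L\<^esub> h')"
      using that(1) by simp
    then have "env_scal L (- c' + c) \<oplus>\<^bsub>env L\<^esub> h = env_scal L (- c' + c') \<oplus>\<^bsub>env L\<^esub> h'"
      using hc by (simp only: env_scal_add U.a_assoc env_scal_closed)
    then have "env_scal L (- c' + c) \<oplus>\<^bsub>env L\<^esub> h = h'" using hc by (simp add: env_scal_zero)
    then have "env_scal L (c - c') \<oplus>\<^bsub>env L\<^esub> (h \<oplus>\<^bsub>env L\<^esub> env_scal L (-1) \<otimes>\<^bsub>env L\<^esub> h) = h' \<oplus>\<^bsub>env L\<^esub> env_scal L (-1) \<otimes>\<^bsub>env L\<^esub> h"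
      using hc by (simp add: U.a_assoc[symmetric])
    moreover have "h \<oplus>\<^bsub>env L\<^esub> env_scal L (-1) \<otimes>\<^bsub>env L\<^esub> h = env_scal L (1 + -1) \<otimes>\<^bsub>env L\<^esub> h"
      using hc by (simp only: env_scal_add U.l_distr env_scal_closed env_class_one U.l_one U.one_closed)
    ultimately have "env_scal L (c - c') \<in> H"
      using hc Hadd[OF that(3) Hs[OF that(2)], of "-1"] by (simp add: env_scal_zero)
    then have "env_scal L (1 / (c - c')) \<otimes>\<^bsub>env L\<^esub> env_scal L (c - c') \<in> H" by (rule Hs)
    then show False using ne H1 by (simp add: env_scal_mult[symmetric] env_class_one)
  qed
  define lam where "lam a = (THE c. \<exists>h\<in>H. a = env_scal L c \<oplus>\<^bsub>env L\<^esub> h)" for a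
  have lam: "lam a = c" if "a = env_scal L c \<oplus>\<^bsub>env L\<^esub> h" "h \<in> H" for a c h
    unfolding lam_def using that uniq by blast
  show thesis
  proof (rule that)
    show "linear_on_A lam"
      unfolding linear_on_A_def
    proof (intro conjI ballI allI)
      fix a assume "a \<in> A"
      then obtain c h where a: "a = env_scal L c \<oplus>\<^bsub>env L\<^esub> h" "h \<in> H" using ex by blast
      have hc: "h \<in> carrier (env L)" using a HA by auto
      show "lam (a \<oplus>\<^bsub>env L\<^esub> b) = lam a + lam b" if "b \<in> A" for b
      proof -
        obtain d k where b: "b = env_scal L d \<oplus>\<^bsub>env L\<^esub> k" "k \<in> H" using ex \<open>b \<in> A\<close> by blast
        have "a \<oplus>\<^bsub>env L\<^esub> b = env_scal L (c + d) \<oplus>\<^bsub>env L\<^esub> (h \<oplus>\<^bsub>env L\<^esub> k)"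
          using a b hc HA by (simp add: env_scal_add U.a_ac)
        then show ?thesis using lam[OF _ Hadd[OF a(2) b(2)]] lam[OF a] lam[OF b] by simp
      qed
      fix d
      have "env_scal L d \<otimes>\<^bsub>env L\<^esub> a = env_scal L (d * c) \<oplus>\<^bsub>env L\<^esub> env_scal L d \<otimes>\<^bsub>env L\<^esub> h"
        using a hc by (simp add: env_scal_mult U.r_distr)
      then show "lam (env_scal L d \<otimes>\<^bsub>env L\<^esub> a) = d * lam a" using lam[OF _ Hs[OF a(2)]] lam[OF a] by simp
    qed
    show "lam a = 0" if "a \<in> m" for a
    proof -
      have "a \<in> H" using H that by blast
      then show ?thesis using lam[of a 0 a] HA by (simp add: env_scal_zero)
    qed
    have "lam \<one>\<^bsub>env L\<^esub> = 1" using lam[OF _ H0, of "\<one>\<^bsub>env L\<^esub>" 1] by (simp add: env_class_one)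
    then show "lam \<one>\<^bsub>env L\<^esub> \<noteq> 0" by simp
  qed
qed

end

section \<open>The functional on the enveloping algebra\<close>

locale whittaker_functional = whittaker_setting +
  fixes lam :: "('a list \<Rightarrow> complex) set \<Rightarrow> complex"
  assumes linear_lam: "linear_on_A lam"
begin

interpretation U: ring "env L" by (rule ring_env)

text \<open>The central part of a bracket is absorbed by the coefficient; this is the
  \<open>st\<close> of \<open>straightening\<close>.\<close>

definition "shift \<alpha> \<beta> a = a \<otimes>\<^bsub>env L\<^esub> env_gen L (sz \<alpha> \<beta>)"

lemma sz_Z: "sz \<alpha> \<beta> \<in> carrier Z"
  by (rule residual_closed(7)[OF sz_residual])

lemma linear_on_gen:
  assumes f: "linear_on_A f" and a: "a \<in> A"
  shows "\<lbrakk>y \<in> carrier Z; z \<in> carrier Z\<rbrakk> \<Longrightarrow>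
      f (a \<otimes>\<^bsub>env L\<^esub> env_gen L (y \<oplus> z)) = f (a \<otimes>\<^bsub>env L\<^esub> env_gen L y) + f (a \<otimes>\<^bsub>env L\<^esub> env_gen L z)"
    and "z \<in> carrier Z \<Longrightarrow> f (a \<otimes>\<^bsub>env L\<^esub> env_gen L (c \<odot> z)) = c * f (a \<otimes>\<^bsub>env L\<^esub> env_gen L z)"
    and "f (a \<otimes>\<^bsub>env L\<^esub> env_gen L \<zero>) = 0"
proof -
  show "f (a \<otimes>\<^bsub>env L\<^esub> env_gen L (y \<oplus> z)) = f (a \<otimes>\<^bsub>env L\<^esub> env_gen L y) + f (a \<otimes>\<^bsub>env L\<^esub> env_gen L z)"
    if "y \<in> carrier Z" "z \<in> carrier Z"
    using f a that unfolding linear_on_A_def by (simp add: env_gen_add Z_closed U.r_distr)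
  show *: "f (a \<otimes>\<^bsub>env L\<^esub> env_gen L (c \<odot> z)) = c * f (a \<otimes>\<^bsub>env L\<^esub> env_gen L z)"
    if z: "z \<in> carrier Z" for c z
  proof -
    have "a \<otimes>\<^bsub>env L\<^esub> env_gen L (c \<odot> z) = env_scal L c \<otimes>\<^bsub>env L\<^esub> (a \<otimes>\<^bsub>env L\<^esub> env_gen L z)"
      using a z env_scal_central[of a c] by (simp add: env_gen_smult Z_closed U.m_assoc[symmetric])
    then show ?thesis using f a z unfolding linear_on_A_def by simp
  qed
  have "\<zero> \<in> carrier Z" by (simp add: Z_simps(1) lie_center_closed graded_part_zero)
  then show "f (a \<otimes>\<^bsub>env L\<^esub> env_gen L \<zero>) = 0" using *[of "\<zero>" 0] by (simp add: L_vs)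
qed

text \<open>Antisymmetry and Jacobi come from the Lie algebra, commuting shifts from the centrality
  of \<open>A\<close>, \<open>pos_mono\<close> from the monotonicity of \<pi>, \<open>pos_c\<close>
  from \<phi> vanishing on brackets, and \<open>pos_st\<close> from the absence of central rests in
  positive degree.\<close>

lemma straightening:
  "straightening sc A shift linear_on_A lam (\<lambda>\<alpha>. \<pi> \<alpha> > 0) (\<lambda>\<alpha>. \<phi> (basis_vector \<alpha>))"
proof (unfold_locales, goal_cases)
  case 1 show ?case by (rule sc_antisym)
next
  case 2 show ?case by (rule structure_jacobi(1))
next
  case 3 then show ?case by (simp add: shift_def sz_Z)
next
  case 4 then show ?case unfolding shift_def by (intro A_right_commute A_closed(5) sz_Z)
next
  case 5 show ?case by (rule linear_lam)
next
  case 6 show ?case by (simp add: linear_on_A_def)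
next
  case 7 then show ?case by (simp add: linear_on_A_def algebra_simps)
next
  case 8 then show ?case by (simp add: linear_on_A_def algebra_simps)
next
  case 9 then show ?case unfolding shift_def by (rule linear_on_A_shift) (simp add: sz_Z)
next
  case (10 f a \<beta> \<alpha>)
  then show ?case using linear_on_gen(2)[OF 10, of "sz \<alpha> \<beta>" "-1"] sz_antisym[of \<beta> \<alpha>] by (simp add: shift_def sz_Z)
next
  case (11 f a \<alpha> \<beta> \<gamma>)
  have z: "c \<odot> sz \<alpha> \<beta> \<in> carrier Z" for c \<alpha> \<beta>
    using residual_closed(7)[OF residual_closed(3)[OF sz_residual]] .
  have "f (a \<otimes>\<^bsub>env L\<^esub> env_gen L (sc \<alpha> \<beta> \<odot> sz (\<alpha> + \<beta>) \<gamma> \<oplus> sc \<beta> \<gamma> \<odot> sz (\<beta> + \<gamma>) \<alpha> \<oplus> sc \<gamma> \<alpha> \<odot> sz (\<gamma> + \<alpha>) \<beta>)) = 0"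
    unfolding structure_jacobi(2) by (rule linear_on_gen(3)[OF 11])
  then show ?case by (simp add: linear_on_gen[OF 11] z sz_Z Z_add_closed shift_def)
next
  case (12 \<alpha> \<beta>) then show ?case using pi_mono[of \<alpha> \<beta>] by simp
next
  case (13 \<alpha> \<beta>) then show ?case by (simp add: pi_add)
next
  case (14 f a \<alpha> \<beta>)
  have "sz \<alpha> \<beta> = \<zero>" unfolding sz_def by (rule rest_positive[OF bracket_basis_gr]) (use 14 in \<open>simp add: pi_add\<close>)
  then show ?case using linear_on_gen(3)[OF 14(1,2)] by (simp add: shift_def)
next
  case 15 then show ?case by (rule phi_structure)
qed

interpretation nf: straightening sc A shift linear_on_A lam "\<lambda>\<alpha>. \<pi> \<alpha> > 0" "\<lambda>\<alpha>. \<phi> (basis_vector \<alpha>)"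
  by (rule straightening)

text \<open>The multilinear extension of \<open>nf\<close> from words of basis vectors to words of elements: \<open>u\<close> collects
  the letters already expanded, and central summands are moved into the coefficient \<open>a\<close>.\<close>

fun expand :: "'a list \<Rightarrow> 'b list \<Rightarrow> ('a list \<Rightarrow> complex) set \<Rightarrow> complex" where
  "expand [] u a = nf.nf u a"
| "expand (g # s) u a = (\<Sum>\<alpha> | component g \<alpha> \<noteq> \<zero>. coord \<alpha> (component g \<alpha>) * expand s (u @ [\<alpha>]) a
      + expand s u (a \<otimes>\<^bsub>env L\<^esub> env_gen L (rest \<alpha> (component g \<alpha>))))"

abbreviation summand :: "'b \<Rightarrow> 'a \<Rightarrow> 'a list \<Rightarrow> 'b list \<Rightarrow> ('a list \<Rightarrow> complex) set \<Rightarrow> complex" where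
  "summand \<alpha> y s u a \<equiv> coord \<alpha> y * expand s (u @ [\<alpha>]) a + expand s u (a \<otimes>\<^bsub>env L\<^esub> env_gen L (rest \<alpha> y))"

lemma rest_component_Z: "g \<in> carrier L \<Longrightarrow> rest \<alpha> (component g \<alpha>) \<in> carrier Z"
  by (rule rest_closed(2)[OF component(1)])

lemma linear_expand: "set s \<subseteq> carrier L \<Longrightarrow> linear_on_A (expand s u)"
proof (induction s arbitrary: u)
  case Nil
  have "expand [] u = nf.nf u" by auto
  then show ?case using nf.lin_nf by simp
next
  case (Cons g s)
  have "linear_on_A (\<lambda>a. expand s u (a \<otimes>\<^bsub>env L\<^esub> env_gen L (rest \<alpha> (component g \<alpha>))))" for \<alpha>
    by (rule linear_on_A_shift) (use Cons rest_component_Z in auto)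
  then show ?case using Cons.IH Cons.prems unfolding linear_on_A_def
    by (simp add: sum.distrib sum_distrib_left algebra_simps)
qed

lemma summand_zero: "\<lbrakk>set s \<subseteq> carrier L; a \<in> A\<rbrakk> \<Longrightarrow> summand \<alpha> \<zero> s u a = 0"
  by (simp add: coord_zero linear_on_gen(3)[OF linear_expand])

lemma summand_add:
  "\<lbrakk>set s \<subseteq> carrier L; a \<in> A; y \<in> gr \<alpha>; z \<in> gr \<alpha>\<rbrakk> \<Longrightarrow>
    summand \<alpha> (y \<oplus> z) s u a = summand \<alpha> y s u a + summand \<alpha> z s u a"
  by (simp add: coord_add rest_add linear_on_gen(1)[OF linear_expand] rest_closed algebra_simps)

lemma summand_smult:
  "\<lbrakk>set s \<subseteq> carrier L; a \<in> A; y \<in> gr \<alpha>\<rbrakk> \<Longrightarrow> summand \<alpha> (c \<odot> y) s u a = c * summand \<alpha> y s u a"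
  by (simp add: coord_smult rest_smult linear_on_gen(2)[OF linear_expand] rest_closed algebra_simps)

lemma expand_Cons_superset:
  assumes s: "set s \<subseteq> carrier L" "a \<in> A" and F: "finite F" "{\<alpha>. component g \<alpha> \<noteq> \<zero>} \<subseteq> F"
  shows "expand (g # s) u a = (\<Sum>\<alpha>\<in>F. summand \<alpha> (component g \<alpha>) s u a)"
  unfolding expand.simps
  by (rule sum.mono_neutral_left) (use F summand_zero[OF s] in auto)

lemma expand_Cons_homogeneous:
  assumes s: "set s \<subseteq> carrier L" "a \<in> A" and y: "y \<in> gr \<alpha>"
  shows "expand (y # s) u a = summand \<alpha> y s u a"
proof -
  have "{\<alpha>. component y \<alpha> \<noteq> \<zero>} \<subseteq> {\<alpha>}" by (auto simp: component_homogeneous[OF y])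
  then show ?thesis using expand_Cons_superset[OF s, of "{\<alpha>}" y u]
    by (simp add: component_homogeneous[OF y] del: expand.simps)
qed

lemma expand_Cons_add:
  assumes s: "set s \<subseteq> carrier L" "a \<in> A" and y: "y \<in> carrier L" and z: "z \<in> carrier L"
  shows "expand ((y \<oplus> z) # s) u a = expand (y # s) u a + expand (z # s) u a"
proof -
  let ?F = "{\<alpha>. component y \<alpha> \<noteq> \<zero>} \<union> {\<alpha>. component z \<alpha> \<noteq> \<zero>}"
  have F: "finite ?F" using component(2) y z by blast
  have "{\<alpha>. component (y \<oplus> z) \<alpha> \<noteq> \<zero>} \<subseteq> ?F" using y z by (auto simp: component_add)
  then have "expand ((y \<oplus> z) # s) u a = (\<Sum>\<alpha>\<in>?F. summand \<alpha> (component y \<alpha> \<oplus> component z \<alpha>) s u a)"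
    using expand_Cons_superset[OF s F] y z by (simp add: component_add del: expand.simps)
  also have "\<dots> = (\<Sum>\<alpha>\<in>?F. summand \<alpha> (component y \<alpha>) s u a + summand \<alpha> (component z \<alpha>) s u a)"
    by (intro sum.cong refl summand_add s component(1) y z)
  also have "\<dots> = expand (y # s) u a + expand (z # s) u a"
    using expand_Cons_superset[OF s F, of y u] expand_Cons_superset[OF s F, of z u]
    by (simp add: sum.distrib del: expand.simps)
  finally show ?thesis .
qed

lemma expand_Cons_smult:
  assumes s: "set s \<subseteq> carrier L" "a \<in> A" and y: "y \<in> carrier L"
  shows "expand ((c \<odot> y) # s) u a = c * expand (y # s) u a"
proof -
  let ?F = "{\<alpha>. component y \<alpha> \<noteq> \<zero>}"
  have F: "finite ?F" using component(2) y by blast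
  have "{\<alpha>. component (c \<odot> y) \<alpha> \<noteq> \<zero>} \<subseteq> ?F" using y by (auto simp: component_smult L_vs)
  then have "expand ((c \<odot> y) # s) u a = (\<Sum>\<alpha>\<in>?F. summand \<alpha> (c \<odot> component y \<alpha>) s u a)"
    using expand_Cons_superset[OF s F] y by (simp add: component_smult del: expand.simps)
  also have "\<dots> = (\<Sum>\<alpha>\<in>?F. c * summand \<alpha> (component y \<alpha>) s u a)"
    by (intro sum.cong refl summand_smult s component(1) y)
  also have "\<dots> = c * expand (y # s) u a" by (simp add: sum_distrib_left)
  finally show ?thesis .
qed

text \<open>The letters of the prefix only change \<open>u\<close> and \<open>a\<close>, over which
  the relation between the suffixes is quantified. The two coefficients make one lemma serve
  additivity, scalar multiples and the bracket relation.\<close>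

lemma expand_prefix:
  assumes s: "set s \<subseteq> carrier L" and
    t: "\<And>u a. a \<in> A \<Longrightarrow> expand t1 u a = c2 * expand t2 u a + c3 * expand t3 u a"
  shows "a \<in> A \<Longrightarrow> expand (s @ t1) u a = c2 * expand (s @ t2) u a + c3 * expand (s @ t3) u a"
  using s
proof (induction s arbitrary: u a)
  case Nil
  then show ?case using t by simp
next
  case (Cons g s)
  have "a \<otimes>\<^bsub>env L\<^esub> env_gen L (rest \<alpha> (component g \<alpha>)) \<in> A" for \<alpha>
    using Cons rest_component_Z by simp
  then show ?case using Cons
    by (simp add: sum_distrib_left algebra_simps flip: sum.distrib)
qed

text \<open>The letters of \<open>s\<close> are appended behind \<open>v\<close>, away from the
  exchanged pair, and the central factors they produce commute with \<open>shift\<close>. So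
  \<open>nf_exchange\<close> carries over.\<close>

lemma expand_exchange:
  assumes s: "set s \<subseteq> carrier L"
  shows "a \<in> A \<Longrightarrow> expand s (u @ \<alpha> # \<beta> # v) a =
    expand s (u @ \<beta> # \<alpha> # v) a + sc \<alpha> \<beta> * expand s (u @ (\<alpha> + \<beta>) # v) a + expand s (u @ v) (shift \<alpha> \<beta> a)"
  using s
proof (induction s arbitrary: v a)
  case Nil
  then show ?case using bspec[OF nf.nf_exchange[of u \<alpha> \<beta> v] Nil(1)] by simp
next
  case (Cons g s)
  have "expand s (u @ \<alpha> # \<beta> # v @ [\<gamma>]) a =
    expand s (u @ \<beta> # \<alpha> # v @ [\<gamma>]) a + sc \<alpha> \<beta> * expand s (u @ (\<alpha> + \<beta>) # v @ [\<gamma>]) a + expand s (u @ v @ [\<gamma>]) (shift \<alpha> \<beta> a)" for \<gamma>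
    using Cons by simp
  moreover have "expand s (u @ \<alpha> # \<beta> # v) (a \<otimes>\<^bsub>env L\<^esub> env_gen L r) =
    expand s (u @ \<beta> # \<alpha> # v) (a \<otimes>\<^bsub>env L\<^esub> env_gen L r) + sc \<alpha> \<beta> * expand s (u @ (\<alpha> + \<beta>) # v) (a \<otimes>\<^bsub>env L\<^esub> env_gen L r)
     + expand s (u @ v) (shift \<alpha> \<beta> a \<otimes>\<^bsub>env L\<^esub> env_gen L r)" if r: "r \<in> carrier Z" for r
  proof -
    have "shift \<alpha> \<beta> (a \<otimes>\<^bsub>env L\<^esub> env_gen L r) = shift \<alpha> \<beta> a \<otimes>\<^bsub>env L\<^esub> env_gen L r"
      unfolding shift_def by (rule A_right_commute) (use Cons r sz_Z in auto)
    then show ?thesis using Cons r by simp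
  qed
  ultimately show ?case using Cons.prems rest_component_Z
    by (simp add: sum_distrib_left algebra_simps flip: sum.distrib)
qed

text \<open>Each of the two longer words expands into four terms. Those that involve a central rest
  agree on both sides and cancel; the remaining pair is \<open>expand_exchange\<close>.\<close>

lemma expand_bracket_homogeneous:
  assumes s: "set s \<subseteq> carrier L" and a: "a \<in> A" and y: "y \<in> gr \<alpha>" and z: "z \<in> gr \<beta>"
  shows "expand (bracket L y z # s) u a = expand (y # z # s) u a - expand (z # y # s) u a"
proof -
  let ?k = "coord \<alpha> y" and ?l = "coord \<beta> z" and ?r = "env_gen L (rest \<alpha> y)" and ?q = "env_gen L (rest \<beta> z)"
  note lin = linear_expand[OF s]
  have c: "?r \<in> A" "?q \<in> A" "set (z # s) \<subseteq> carrier L" "set (y # s) \<subseteq> carrier L"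
    using rest_closed y z gr_closed s by auto
  have rq: "a \<otimes>\<^bsub>env L\<^esub> ?r \<otimes>\<^bsub>env L\<^esub> ?q = a \<otimes>\<^bsub>env L\<^esub> ?q \<otimes>\<^bsub>env L\<^esub> ?r"
    by (rule A_right_commute) (use a c in auto)
  have 1: "expand (y # z # s) u a = ?k * (?l * expand s (u @ [\<alpha>, \<beta>]) a + expand s (u @ [\<alpha>]) (a \<otimes>\<^bsub>env L\<^esub> ?q))
     + (?l * expand s (u @ [\<beta>]) (a \<otimes>\<^bsub>env L\<^esub> ?r) + expand s u (a \<otimes>\<^bsub>env L\<^esub> ?r \<otimes>\<^bsub>env L\<^esub> ?q))"
    using a c by (simp add: expand_Cons_homogeneous[OF _ _ y] expand_Cons_homogeneous[OF s _ z] del: expand.simps)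
  have 2: "expand (z # y # s) u a = ?l * (?k * expand s (u @ [\<beta>, \<alpha>]) a + expand s (u @ [\<beta>]) (a \<otimes>\<^bsub>env L\<^esub> ?r))
     + (?k * expand s (u @ [\<alpha>]) (a \<otimes>\<^bsub>env L\<^esub> ?q) + expand s u (a \<otimes>\<^bsub>env L\<^esub> ?q \<otimes>\<^bsub>env L\<^esub> ?r))"
    using a c by (simp add: expand_Cons_homogeneous[OF _ _ z] expand_Cons_homogeneous[OF s _ y] del: expand.simps)
  have 3: "expand (bracket L y z # s) u a = ?k * ?l * sc \<alpha> \<beta> * expand s (u @ [\<alpha> + \<beta>]) a + ?k * ?l * expand s u (shift \<alpha> \<beta> a)"
    by (simp add: expand_Cons_homogeneous[OF s a gr_bracket[OF y z]] coord_bracket[OF y z]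
        linear_on_gen(2)[OF lin a sz_Z] shift_def del: expand.simps)
  have 4: "expand s (u @ [\<alpha>, \<beta>]) a = expand s (u @ [\<beta>, \<alpha>]) a + sc \<alpha> \<beta> * expand s (u @ [\<alpha> + \<beta>]) a + expand s u (shift \<alpha> \<beta> a)"
    using expand_exchange[OF s a, of u \<alpha> \<beta> "[]"] by simp
  show ?thesis unfolding 1 2 3 4 rq by (simp add: algebra_simps)
qed

lemma expand_bracket:
  assumes s: "set s \<subseteq> carrier L" and a: "a \<in> A" and y: "y \<in> carrier L" and z: "z \<in> carrier L"
  shows "expand (bracket L y z # s) u a = expand (y # z # s) u a - expand (z # y # s) u a"
  using y
proof (induction y rule: graded_induct)
  case (homogeneous \<alpha> y)
  from z show ?case
  proof (induction z rule: graded_induct)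
    case (homogeneous \<beta> z)
    then show ?case using expand_bracket_homogeneous[OF s a \<open>y \<in> gr \<alpha>\<close>] by blast
  next
    case (add z z')
    have yc: "y \<in> carrier L" using homogeneous gr_closed by blast
    have "expand (y # (z \<oplus> z') # s) u a = expand (y # z # s) u a + expand (y # z' # s) u a"
      using expand_prefix[of "[y]" "(z \<oplus> z') # s" 1 "z # s" 1 "z' # s" a u] yc add a s
      by (simp add: expand_Cons_add del: expand.simps)
    then show ?case using add a s yc
      by (simp add: bracket_add_right expand_Cons_add bracket_closed del: expand.simps)
  qed
next
  case (add y y')
  have "expand (z # (y \<oplus> y') # s) u a = expand (z # y # s) u a + expand (z # y' # s) u a"
    using expand_prefix[of "[z]" "(y \<oplus> y') # s" 1 "y # s" 1 "y' # s" a u] z add a s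
    by (simp add: expand_Cons_add del: expand.simps)
  then show ?case using add a s z
    by (simp add: bracket_add_left expand_Cons_add bracket_closed del: expand.simps)
qed

text \<open>The last letter is expanded last and ends up at the end of the word handed to
  \<open>nf\<close>, where \<open>nf_snoc\<close> applies.\<close>

lemma expand_positive:
  assumes y: "y \<in> carrier N"
  shows "\<lbrakk>a \<in> A; set s \<subseteq> carrier L\<rbrakk> \<Longrightarrow> expand (s @ [y]) u a = \<phi> y * expand s u a"
proof (induction s arbitrary: u a)
  case Nil
  from y have "y \<in> graded_part L gr {\<alpha>. \<pi> \<alpha> > 0}" by simp
  \<comment> \<open>Membership in \<open>N\<close> is carried through the induction because
    additivity of \<phi> is known only there.\<close>
  then have "expand [y] u a = \<phi> y * expand [] u a \<and> y \<in> carrier N"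
  proof (induction rule: graded_part_induct)
    case zero
    have "\<zero> \<in> carrier N" by (simp add: graded_part_zero)
    moreover from this have "\<phi> \<zero> = 0" using N.phi_smult[of "\<zero>" 0] by (simp add: L_vs)
    ultimately show ?case by (simp add: component_zero)
  next
    case (homogeneous \<alpha> y)
    have "rest \<alpha> y = \<zero>" using homogeneous by (intro rest_positive) auto
    then have "expand [y] u a = coord \<alpha> y * nf.nf (u @ [\<alpha>]) a"
      using expand_Cons_homogeneous[of "[]" a y \<alpha> u] homogeneous Nil
        linear_on_gen(3)[OF linear_expand[of "[]" u], of a] by (simp del: expand.simps(2))
    also have "\<dots> = \<phi> y * nf.nf u a"
      using homogeneous Nil nf.nf_snoc[of a \<alpha> u] phi_coord[of y \<alpha>] by simp
    finally show ?case using homogeneous by (auto intro: graded_partI)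
  next
    case (add y z)
    then show ?case using Nil
      by (simp add: expand_Cons_add N.phi_add graded_part_add algebra_simps del: expand.simps)
  qed
  then show ?case by simp
next
  case (Cons g s)
  have "a \<otimes>\<^bsub>env L\<^esub> env_gen L (rest \<alpha> (component g \<alpha>)) \<in> A" for \<alpha>
    using Cons rest_component_Z by simp
  then show ?case using Cons by (simp add: sum_distrib_left algebra_simps)
qed

lemma sum_finsum:
  assumes f: "\<And>y z. \<lbrakk>y \<in> carrier Z; z \<in> carrier Z\<rbrakk> \<Longrightarrow> f (y \<oplus> z) = f y + f z" "f \<zero> = (0::complex)"
    and F: "finite F" "\<And>\<alpha>. \<alpha> \<in> F \<Longrightarrow> g \<alpha> \<in> carrier Z"
  shows "f (\<Oplus>\<alpha>\<in>F. g \<alpha>) = (\<Sum>\<alpha>\<in>F. f (g \<alpha>)) \<and> (\<Oplus>\<alpha>\<in>F. g \<alpha>) \<in> carrier Z"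
  using F
proof (induction F)
  case empty
  then show ?case using f by (simp add: Z_simps(1) lie_center_closed graded_part_zero)
next
  case (insert \<alpha> F)
  then show ?case using f Z_closed by (simp add: M.finsum_insert Pi_iff Z_add_closed)
qed

text \<open>The components of an element of Z'' are central and of nonpositive degree, hence
  residual: their coordinates vanish, and only the coefficient changes.\<close>

lemma expand_center_Cons:
  assumes z: "z \<in> carrier Z" and a: "a \<in> A" and s: "set s \<subseteq> carrier L"
  shows "expand (z # s) u a = expand s u (a \<otimes>\<^bsub>env L\<^esub> env_gen L z)"
proof -
  let ?F = "{\<alpha>. component z \<alpha> \<noteq> \<zero>}"
  have zc: "z \<in> carrier L" "z \<in> lie_center L" using z Z_closed by auto
  have res: "component z \<alpha> \<in> residual \<alpha>" for \<alpha>
    using component(1)[OF zc(1)] component_center[OF zc(2)] z component_graded_part[of z "{\<alpha>. \<pi> \<alpha> \<le> 0}" \<alpha>]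
    by (auto simp: residual_def Z_simps(1))
  have "expand (z # s) u a = (\<Sum>\<alpha>\<in>?F. expand s u (a \<otimes>\<^bsub>env L\<^esub> env_gen L (component z \<alpha>)))"
    by (simp add: coord_residual[OF res])
  also have "\<dots> = expand s u (a \<otimes>\<^bsub>env L\<^esub> env_gen L (\<Oplus>\<alpha>\<in>?F. component z \<alpha>))"
    by (rule conjunct1[OF sum_finsum, symmetric])
      (use linear_on_gen[OF linear_expand[OF s] a] component(2)[OF zc(1)] residual_closed(7)[OF res] in auto)
  finally show ?thesis using component(3)[OF zc(1)] by simp
qed

lemma expand_center:
  assumes z: "z \<in> carrier Z" and t: "set t \<subseteq> carrier L"
  shows "\<lbrakk>a \<in> A; set s \<subseteq> carrier L\<rbrakk> \<Longrightarrow> expand (s @ z # t) u a = expand (s @ t) u (a \<otimes>\<^bsub>env L\<^esub> env_gen L z)"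
proof (induction s arbitrary: u a)
  case Nil
  then show ?case using expand_center_Cons[OF z _ t] by simp
next
  case (Cons g s)
  have "a \<otimes>\<^bsub>env L\<^esub> env_gen L (rest \<alpha> (component g \<alpha>)) \<in> A" for \<alpha>
    using Cons rest_component_Z by simp
  moreover have "a \<otimes>\<^bsub>env L\<^esub> env_gen L (rest \<alpha> (component g \<alpha>)) \<otimes>\<^bsub>env L\<^esub> env_gen L z
    = a \<otimes>\<^bsub>env L\<^esub> env_gen L z \<otimes>\<^bsub>env L\<^esub> env_gen L (rest \<alpha> (component g \<alpha>))" for \<alpha>
    by (rule A_right_commute) (use Cons rest_component_Z z in auto)
  ultimately show ?case using Cons by simp
qed

lemma expand_vanish:
  assumes I: "\<And>a. a \<in> I \<Longrightarrow> lam a = 0" "\<And>a z. \<lbrakk>a \<in> I; z \<in> carrier Z\<rbrakk> \<Longrightarrow> a \<otimes>\<^bsub>env L\<^esub> env_gen L z \<in> I"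
  shows "\<lbrakk>a \<in> I; set s \<subseteq> carrier L\<rbrakk> \<Longrightarrow> expand s u a = 0"
proof (induction s arbitrary: u a)
  case Nil
  show ?case using nf.nf_vanish[of I a u] I Nil sz_Z by (simp add: shift_def)
next
  case (Cons g s)
  then show ?case using rest_component_Z I(2) by simp
qed

lemma expand_Nil: "expand [] [] a = lam a"
  by (simp add: nf.nf_Nil)

end

text \<open>The full linear dual of the enveloping algebra, as multilinear functions on words; the Lie algebra
  acts through right multiplication.\<close>

definition dual_module :: "('g, 'c) lie_algebra_scheme \<Rightarrow> ('g, 'g list \<Rightarrow> complex) lie_module" where
  "dual_module L = \<lparr>carrier = {h. (\<forall>s. \<not> set s \<subseteq> carrier L \<longrightarrow> h s = 0) \<and>
       (\<forall>s t y z. set s \<subseteq> carrier L \<and> set t \<subseteq> carrier L \<and> y \<in> carrier L \<and> z \<in> carrier L \<longrightarrow>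
          h (s @ (y \<oplus>\<^bsub>L\<^esub> z) # t) = h (s @ y # t) + h (s @ z # t) \<and>
          h (s @ bracket L y z # t) = h (s @ y # z # t) - h (s @ z # y # t)) \<and>
       (\<forall>s t y c. set s \<subseteq> carrier L \<and> set t \<subseteq> carrier L \<and> y \<in> carrier L \<longrightarrow>
          h (s @ (c \<odot>\<^bsub>L\<^esub> y) # t) = c * h (s @ y # t))},
     monoid.mult = undefined, one = undefined, ring.zero = (\<lambda>_. 0), add = (\<lambda>h k s. h s + k s),
     module.smult = (\<lambda>c h s. c * h s), lact = (\<lambda>x h s. h (s @ [x]))\<rparr>"

context lie_algebra
begin

lemma dual_module_simps [simp]:
  "\<zero>\<^bsub>dual_module L\<^esub> = (\<lambda>_. 0)" "add (dual_module L) = (\<lambda>h k s. h s + k s)"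
  "module.smult (dual_module L) = (\<lambda>c h s. c * h s)" "lact (dual_module L) = (\<lambda>x h s. h (s @ [x]))"
  by (simp_all add: dual_module_def)

lemma dual_module_carrier: "h \<in> carrier (dual_module L) \<longleftrightarrow>
  (\<forall>s. \<not> set s \<subseteq> carrier L \<longrightarrow> h s = 0) \<and>
       (\<forall>s t y z. set s \<subseteq> carrier L \<and> set t \<subseteq> carrier L \<and> y \<in> carrier L \<and> z \<in> carrier L \<longrightarrow>
          h (s @ (y \<oplus> z) # t) = h (s @ y # t) + h (s @ z # t) \<and>
          h (s @ bracket L y z # t) = h (s @ y # z # t) - h (s @ z # y # t)) \<and>
       (\<forall>s t y c. set s \<subseteq> carrier L \<and> set t \<subseteq> carrier L \<and> y \<in> carrier L \<longrightarrow>
          h (s @ (c \<odot> y) # t) = c * h (s @ y # t))"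
  by (simp add: dual_module_def)

lemma dual_module_closed:
  "(\<lambda>_. 0) \<in> carrier (dual_module L)"
  "\<lbrakk>h \<in> carrier (dual_module L); k \<in> carrier (dual_module L)\<rbrakk> \<Longrightarrow> (\<lambda>s. h s + k s) \<in> carrier (dual_module L)"
  "h \<in> carrier (dual_module L) \<Longrightarrow> (\<lambda>s. c * h s) \<in> carrier (dual_module L)"
  "\<lbrakk>h \<in> carrier (dual_module L); x \<in> carrier L\<rbrakk> \<Longrightarrow> (\<lambda>s. h (s @ [x])) \<in> carrier (dual_module L)"
  by (auto simp: dual_module_carrier algebra_simps)[2]
    (auto simp: dual_module_carrier distrib_left right_diff_distrib mult.left_commute)

lemma vectorspace_dual_module: "vectorspace complex_ring (dual_module L)"
proof (rule complex_vectorspaceI)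
  show "abelian_group (dual_module L)"
  proof (rule abelian_groupI)
    fix h assume "h \<in> carrier (dual_module L)"
    then have "(\<lambda>s. (-1) * h s) \<in> carrier (dual_module L)" by (rule dual_module_closed)
    then show "\<exists>k\<in>carrier (dual_module L). k \<oplus>\<^bsub>dual_module L\<^esub> h = \<zero>\<^bsub>dual_module L\<^esub>"
      by (intro bexI[of _ "\<lambda>s. (-1) * h s"]) auto
  qed (auto simp: dual_module_closed algebra_simps)
qed (auto simp: dual_module_closed algebra_simps)

lemma dual_module_minus:
  assumes "k \<in> carrier (dual_module L)"
  shows "h \<ominus>\<^bsub>dual_module L\<^esub> k = (\<lambda>s. h s - k s)"
  using complex_vectorspaceD(9)[OF vectorspace_dual_module assms, symmetric] by (simp add: a_minus_def)

lemma lie_module_dual_module: "lie_module L (dual_module L)"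
proof (intro lie_module.intro lie_module_axioms.intro lie_algebra_axioms vectorspace_dual_module, goal_cases)
  case (1 x v)
  then show ?case by (simp add: dual_module_closed)
next
  case (2 x y v)
  have "v (s @ [x \<oplus> y]) = v (s @ [x]) + v (s @ [y])" for s
    using 2 unfolding dual_module_carrier by (cases "set s \<subseteq> carrier L") auto
  then show ?case by simp
next
  case (4 x v c)
  have "v (s @ [c \<odot> x]) = c * v (s @ [x])" for s
    using 4 unfolding dual_module_carrier by (cases "set s \<subseteq> carrier L") auto
  then show ?case by simp
next
  case (6 x y v)
  have "v (s @ [bracket L x y]) = v (s @ [x, y]) - v (s @ [y, x])" for s
    using 6 unfolding dual_module_carrier by (cases "set s \<subseteq> carrier L") auto
  moreover have "(\<lambda>s. v (s @ [y, x])) \<in> carrier (dual_module L)"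
    using dual_module_closed(4)[OF dual_module_closed(4)[OF 6(3,1)] 6(2)] by simp
  ultimately show ?case by (simp add: dual_module_minus)
qed simp_all

end

context whittaker_functional
begin

interpretation U: ring "env L" by (rule ring_env)
interpretation D: lie_module L "dual_module L" by (rule lie_module_dual_module)
interpretation DU: left_module "env L" "env_module (dual_module L)" by (rule D.left_module_env_module)

text \<open>The Whittaker vector sought is the one for \<open>b\<close> equal to the unit. The
  parameter is kept since the action of \<open>A\<close> moves it, and the value off the words over
  the carrier is the one that \<open>dual_module\<close> prescribes.\<close>

definition dual_vector :: "('a list \<Rightarrow> complex) set \<Rightarrow> 'a list \<Rightarrow> complex" where
  "dual_vector b = (\<lambda>s. if set s \<subseteq> carrier L then expand s [] b else 0)"

lemma dual_vector_closed:
  assumes b: "b \<in> A"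
  shows "dual_vector b \<in> carrier (dual_module L)"
proof -
  have 1: "expand (s @ (y \<oplus> z) # t) [] b = expand (s @ y # t) [] b + expand (s @ z # t) [] b"
    if "set s \<subseteq> carrier L" "set t \<subseteq> carrier L" "y \<in> carrier L" "z \<in> carrier L" for s t y z
    using expand_prefix[of s "(y \<oplus> z) # t" 1 "y # t" 1 "z # t" b "[]"] that b
    by (simp add: expand_Cons_add del: expand.simps)
  have 2: "expand (s @ bracket L y z # t) [] b = expand (s @ y # z # t) [] b - expand (s @ z # y # t) [] b"
    if "set s \<subseteq> carrier L" "set t \<subseteq> carrier L" "y \<in> carrier L" "z \<in> carrier L" for s t y z
    using expand_prefix[of s "bracket L y z # t" 1 "y # z # t" "-1" "z # y # t" b "[]"] that b
    by (simp add: expand_bracket del: expand.simps)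
  have 3: "expand (s @ (c \<odot> y) # t) [] b = c * expand (s @ y # t) [] b"
    if "set s \<subseteq> carrier L" "set t \<subseteq> carrier L" "y \<in> carrier L" for s t y c
    using expand_prefix[of s "(c \<odot> y) # t" c "y # t" 0 "y # t" b "[]"] that b
    by (simp add: expand_Cons_smult del: expand.simps)
  show ?thesis unfolding dual_module_carrier dual_vector_def
    using 1 2 3 by (simp add: L_vs bracket_closed)
qed

lemma whittaker_dual_vector: "b \<in> A \<Longrightarrow> whittaker_vector N \<phi> (dual_module L) (dual_vector b)"
  unfolding whittaker_vector_def
  using dual_vector_closed expand_positive[of _ b _ "[]"] graded_part_closed
  by (auto simp: dual_vector_def fun_eq_iff)

text \<open>A letter from Z'' acts by being appended to the word, and \<open>expand_center\<close>
  turns it into a factor of the coefficient. An ideal on which the functional vanishes therefore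
  kills the vector.\<close>

lemma smult_dual_vector:
  assumes "a \<in> A" and b: "b \<in> A"
  shows "a \<odot>\<^bsub>env_module (dual_module L)\<^esub> dual_vector b = dual_vector (b \<otimes>\<^bsub>env L\<^esub> a)"
  using assms(1)
proof (induction a rule: Z.sub_env_induct)
  case (scal c)
  have "dual_vector (b \<otimes>\<^bsub>env L\<^esub> env_scal L c) = (\<lambda>s. c * dual_vector b s)"
    using linear_expand b unfolding linear_on_A_def dual_vector_def
    by (auto simp: fun_eq_iff simp flip: env_scal_central)
  then show ?case using dual_vector_closed[OF b] by (simp add: D.env_scal_smult_module)
next
  case (add C D)
  have "dual_vector (b \<otimes>\<^bsub>env L\<^esub> (C \<oplus>\<^bsub>env L\<^esub> D)) = (\<lambda>s. dual_vector (b \<otimes>\<^bsub>env L\<^esub> C) s + dual_vector (b \<otimes>\<^bsub>env L\<^esub> D) s)"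
    using linear_expand b add(1,2) unfolding linear_on_A_def dual_vector_def
    by (auto simp: fun_eq_iff U.r_distr)
  then show ?case using dual_vector_closed[OF b] add by (simp add: DU.smult_l_distr)
next
  case (gen z C)
  have z: "z \<in> carrier L" using gen Z_closed by blast
  have "(env_gen L z \<otimes>\<^bsub>env L\<^esub> C) \<odot>\<^bsub>env_module (dual_module L)\<^esub> dual_vector b
    = env_gen L z \<odot>\<^bsub>env_module (dual_module L)\<^esub> dual_vector (b \<otimes>\<^bsub>env L\<^esub> C)"
    using gen z dual_vector_closed[OF b] by (simp add: DU.smult_assoc)
  also have "\<dots> = (\<lambda>s. dual_vector (b \<otimes>\<^bsub>env L\<^esub> C) (s @ [z]))"
    using gen z dual_vector_closed[of "b \<otimes>\<^bsub>env L\<^esub> C"] b by (simp add: D.env_gen_smult_module)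
  also have "\<dots> = dual_vector (b \<otimes>\<^bsub>env L\<^esub> C \<otimes>\<^bsub>env L\<^esub> env_gen L z)"
    using expand_center[OF gen(1), of "[]" "b \<otimes>\<^bsub>env L\<^esub> C" _ "[]"] gen b z
    by (auto simp: dual_vector_def fun_eq_iff)
  also have "b \<otimes>\<^bsub>env L\<^esub> C \<otimes>\<^bsub>env L\<^esub> env_gen L z = b \<otimes>\<^bsub>env L\<^esub> (env_gen L z \<otimes>\<^bsub>env L\<^esub> C)"
    using A_central[of "env_gen L z" C] gen b by (simp add: U.m_assoc)
  finally show ?case .
qed

end

section \<open>Passing between modules over the Lie algebra and over its enveloping algebra\<close>

context lie_algebra
begin

lemma lie_module_of_env_simps [simp]:
  "carrier (lie_module_of_env L M) = carrier M" "add (lie_module_of_env L M) = add M"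
  "\<zero>\<^bsub>lie_module_of_env L M\<^esub> = \<zero>\<^bsub>M\<^esub>"
  "module.smult (lie_module_of_env L M) = (\<lambda>c v. env_scal L c \<odot>\<^bsub>M\<^esub> v)"
  "lact (lie_module_of_env L M) = (\<lambda>x v. env_gen L x \<odot>\<^bsub>M\<^esub> v)"
  by (simp_all add: lie_module_of_env_def)

lemma lie_module_lie_module_of_env:
  fixes M :: "(('a list \<Rightarrow> complex) set, 'v, 'd) module_scheme"
  assumes "left_module (env L) M"
  shows "lie_module L (lie_module_of_env L M)"
proof -
  interpret M: left_module "env L" M by fact
  have ag: "abelian_group (lie_module_of_env L M)"
    by (rule abelian_group_cong[OF M.M.abelian_group_axioms]) simp_all
  have vs: "vectorspace complex_ring (lie_module_of_env L M)"
    by (rule complex_vectorspaceI[OF ag])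
      (simp_all add: M.smult_closed M.smult_l_distr M.smult_r_distr M.smult_assoc M.smult_one
        env_scal_add env_scal_mult env_class_one)
  have mi: "v \<ominus>\<^bsub>lie_module_of_env L M\<^esub> w = v \<ominus>\<^bsub>M\<^esub> w" if "w \<in> carrier M" for v w
  proof -
    have "\<ominus>\<^bsub>lie_module_of_env L M\<^esub> w = \<ominus>\<^bsub>M\<^esub> w"
      by (rule abelian_group.minus_equality[OF ag]) (use that M.M.l_neg in simp_all)
    then show ?thesis by (simp add: a_minus_def)
  qed
  show ?thesis
    by (intro lie_module.intro lie_module_axioms.intro lie_algebra_axioms vs)
      (simp_all add: M.smult_closed M.smult_l_distr M.smult_r_distr M.smult_assoc[symmetric] M.smult_l_diff
        env_gen_add env_gen_smult env_gen_bracket env_scal_central mi)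
qed

text \<open>Scalars and generators suffice, by \<open>env_induct\<close>. \<open>V\<close> and
  \<open>M\<close> are separate records with the same vectors and compatible actions.\<close>

lemma lie_submodule_env_closed:
  fixes M :: "(('a list \<Rightarrow> complex) set, 'v, 'd) module_scheme"
    and V :: "('a, 'v, 'e) lie_module_scheme"
  assumes M: "left_module (env L) M" and W: "lie_submodule L W V"
    and V: "carrier V = carrier M" "add V = add M"
      "\<And>c v. v \<in> carrier M \<Longrightarrow> c \<odot>\<^bsub>V\<^esub> v = env_scal L c \<odot>\<^bsub>M\<^esub> v"
      "\<And>x v. \<lbrakk>x \<in> carrier L; v \<in> carrier M\<rbrakk> \<Longrightarrow> lact V x v = env_gen L x \<odot>\<^bsub>M\<^esub> v"
    and u: "u \<in> carrier (env L)" and v: "v \<in> W"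
  shows "u \<odot>\<^bsub>M\<^esub> v \<in> W"
proof -
  interpret M: left_module "env L" M by fact
  have Wc: "W \<subseteq> carrier M" and Wadd: "\<And>y z. \<lbrakk>y \<in> W; z \<in> W\<rbrakk> \<Longrightarrow> y \<oplus>\<^bsub>M\<^esub> z \<in> W"
    and Ws: "\<And>c y. y \<in> W \<Longrightarrow> c \<odot>\<^bsub>V\<^esub> y \<in> W" and Wl: "\<And>x y. \<lbrakk>x \<in> carrier L; y \<in> W\<rbrakk> \<Longrightarrow> lact V x y \<in> W"
    using W V(1,2) unfolding lie_submodule_def submodule_def by auto
  show ?thesis
    using u
  proof (induction u rule: env_induct)
    case (scal c)
    then show ?case using Ws[OF v, of c] V(3) v Wc by auto
  next
    case (add C D)
    then show ?case using Wadd v Wc by (auto simp: M.smult_l_distr)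
  next
    case (gen x C)
    have c: "v \<in> carrier M" "C \<odot>\<^bsub>M\<^esub> v \<in> carrier M" using v gen(3) Wc by auto
    show ?case using Wl[OF gen(1,3)] V(4)[OF gen(1) c(2)] c gen by (simp add: M.smult_assoc)
  qed
qed

text \<open>Stability under \<open>env L\<close> covers scalars and the Lie action at once. The
  lemma is applied with \<open>M\<close> as \<open>env_module V\<close> for a given
  \<open>V\<close>, and with \<open>V\<close> obtained from \<open>M\<close> by
  \<open>lie_module_of_env\<close>.\<close>

lemma lie_submoduleI:
  fixes M :: "(('a list \<Rightarrow> complex) set, 'v, 'd) module_scheme"
    and V :: "('a, 'v, 'e) lie_module_scheme"
  assumes V: "lie_module L V" "carrier V = carrier M" "add V = add M" "\<zero>\<^bsub>V\<^esub> = \<zero>\<^bsub>M\<^esub>"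
      "\<And>c v. v \<in> carrier M \<Longrightarrow> c \<odot>\<^bsub>V\<^esub> v = env_scal L c \<odot>\<^bsub>M\<^esub> v"
      "\<And>x v. \<lbrakk>x \<in> carrier L; v \<in> carrier M\<rbrakk> \<Longrightarrow> lact V x v = env_gen L x \<odot>\<^bsub>M\<^esub> v"
    and W: "W \<subseteq> carrier M" "\<zero>\<^bsub>M\<^esub> \<in> W" "\<And>y z. \<lbrakk>y \<in> W; z \<in> W\<rbrakk> \<Longrightarrow> y \<oplus>\<^bsub>M\<^esub> z \<in> W"
      "\<And>u y. \<lbrakk>u \<in> carrier (env L); y \<in> W\<rbrakk> \<Longrightarrow> u \<odot>\<^bsub>M\<^esub> y \<in> W"
  shows "lie_submodule L W V"
proof -
  interpret V: lie_module L V by fact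
  have s: "c \<odot>\<^bsub>V\<^esub> y \<in> W" if "y \<in> W" for c y
  proof -
    have "y \<in> carrier M" using W(1) that by blast
    then show ?thesis using V(5) W(4)[OF env_scal_closed that] by simp
  qed
  have l: "lact V x y \<in> W" if "x \<in> carrier L" "y \<in> W" for x y
  proof -
    have "y \<in> carrier M" using W(1) that by blast
    then show ?thesis using V(6) W(4)[OF env_gen_closed that(2)] that(1) by simp
  qed
  have "Module.module complex_ring V" using V.V.vectorspace_axioms by (simp add: vectorspace_def)
  then show ?thesis
    unfolding lie_submodule_def submodule_def using V(2,3,4) W s l by auto
qed

end

section \<open>The submodule generated by an ideal of central elements\<close>

context whittaker_setting
begin

interpretation U: ring "env L" by (rule ring_env)
interpretation M: left_module "env L" N.M by (rule N.left_module_whittaker_M)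

abbreviation "maximal_span m \<equiv> ideal_smult m N.M"

lemma maximal_span_subgroup:
  assumes m: "m \<subseteq> A"
  shows "subgroup (maximal_span m) (add_monoid N.M)"
  unfolding ideal_smult_def
  by (rule group.generate_is_subgroup[OF M.M.a_group]) (use m M.smult_closed in auto)

text \<open>Elements of \<open>m\<close> are central, so \<open>u\<close> moves past them onto the
  vector.\<close>

lemma maximal_span_smult:
  assumes m: "m \<subseteq> A" and u: "u \<in> carrier (env L)" and v: "v \<in> maximal_span m"
  shows "u \<odot>\<^bsub>N.M\<^esub> v \<in> maximal_span m"
proof -
  interpret S: subgroup "maximal_span m" "add_monoid N.M" by (rule maximal_span_subgroup[OF m])
  have *: "u \<odot>\<^bsub>N.M\<^esub> (a \<odot>\<^bsub>N.M\<^esub> y) \<in> maximal_span m" if "a \<in> m" "y \<in> carrier N.M" for a y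
  proof -
    have a: "a \<in> A" using that m by blast
    then have "u \<odot>\<^bsub>N.M\<^esub> (a \<odot>\<^bsub>N.M\<^esub> y) = a \<odot>\<^bsub>N.M\<^esub> (u \<odot>\<^bsub>N.M\<^esub> y)"
      using A_central[OF a u] that u by (simp add: M.smult_assoc[symmetric])
    moreover have "u \<odot>\<^bsub>N.M\<^esub> y \<in> carrier N.M" using u that M.smult_closed by blast
    ultimately show ?thesis unfolding ideal_smult_def using that(1) by (auto intro: generate.incl)
  qed
  from v show ?thesis unfolding ideal_smult_def[of m]
  proof (induction rule: generate.induct)
    case one
    then show ?case using S.one_closed u by (simp add: M.smult_r_zero ideal_smult_def)
  next
    case (incl h)
    then show ?case using * by (auto simp: ideal_smult_def)
  next
    case (inv h)
    then obtain a y where h: "h = a \<odot>\<^bsub>N.M\<^esub> y" "a \<in> m" "y \<in> carrier N.M" by blast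
    have hc: "h \<in> carrier N.M" using h m M.smult_closed by auto
    have "u \<odot>\<^bsub>N.M\<^esub> (inv\<^bsub>add_monoid N.M\<^esub> h) = inv\<^bsub>add_monoid N.M\<^esub> (u \<odot>\<^bsub>N.M\<^esub> h)"
      using M.smult_r_minus[OF u hc] by (simp add: a_inv_def)
    then show ?case using S.m_inv_closed *[OF h(2,3)] h(1) by (simp add: ideal_smult_def)
  next
    case (eng h1 h2)
    have "h1 \<in> carrier N.M" "h2 \<in> carrier N.M"
      using S.subset eng(1,2) by (auto simp: ideal_smult_def)
    then show ?case using S.m_closed eng u by (simp add: M.smult_r_distr ideal_smult_def)
  qed
qed

text \<open>Universal property of the quotient by the span. Since \<open>a\<close> in
  \<open>m\<close> is central and kills \<open>v\<close>, the element \<open>a \<otimes> u0\<close>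
  kills \<open>v\<close> too; so each vector of the span comes from the generator by some element
  that kills \<open>v\<close>, and \<open>whittaker_M_universal\<close> compares that element with
  \<open>u\<close>.\<close>

lemma maximal_span_universal:
  assumes m: "m \<subseteq> A"
    and V: "lie_module L V" and v: "whittaker_vector N \<phi> V v"
    and kill: "\<And>a. a \<in> m \<Longrightarrow> a \<odot>\<^bsub>env_module V\<^esub> v = \<zero>\<^bsub>V\<^esub>"
    and u: "u \<in> carrier (env L)" and uw: "u \<odot>\<^bsub>N.M\<^esub> N.whittaker_gen \<in> maximal_span m"
  shows "u \<odot>\<^bsub>env_module V\<^esub> v = \<zero>\<^bsub>V\<^esub>"
proof -
  interpret V: lie_module L V by fact
  interpret E: left_module "env L" "env_module V" by (rule V.left_module_env_module)
  let ?w = N.whittaker_gen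
  have vc: "v \<in> carrier (env_module V)" using v by (simp add: whittaker_vector_def)
  note univ = N.whittaker_M_universal[OF V v]
  interpret S: subgroup "maximal_span m" "add_monoid N.M" by (rule maximal_span_subgroup[OF m])
  have wc: "?w \<in> carrier N.M" by (rule N.whittaker_gen_closed)
  have *: "\<exists>u'\<in>carrier (env L). a \<odot>\<^bsub>N.M\<^esub> y = u' \<odot>\<^bsub>N.M\<^esub> ?w \<and> u' \<odot>\<^bsub>env_module V\<^esub> v = \<zero>\<^bsub>V\<^esub>"
    if a: "a \<in> m" and y: "y \<in> carrier N.M" for a y
  proof -
    obtain u0 where u0: "u0 \<in> carrier (env L)" "y = u0 \<odot>\<^bsub>N.M\<^esub> ?w" using N.whittaker_M_cyclic[OF y] .
    have aA: "a \<in> A" using a m by blast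
    have "(a \<otimes>\<^bsub>env L\<^esub> u0) \<odot>\<^bsub>env_module V\<^esub> v = u0 \<odot>\<^bsub>env_module V\<^esub> (a \<odot>\<^bsub>env_module V\<^esub> v)"
      using aA u0 vc by (subst A_central[OF aA u0(1)]) (simp add: E.smult_assoc)
    also have "\<dots> = \<zero>\<^bsub>V\<^esub>" using kill[OF a] E.smult_r_zero[OF u0(1)] by simp
    finally show ?thesis
      using u0 aA wc by (intro bexI[of _ "a \<otimes>\<^bsub>env L\<^esub> u0"]) (simp_all add: M.smult_assoc)
  qed
  \<comment> \<open>The element \<open>u'\<close> is built along the generation of the span; it may
    differ from \<open>u\<close> although both send the generator to the same vector.\<close>
  have "\<exists>u'\<in>carrier (env L). y = u' \<odot>\<^bsub>N.M\<^esub> ?w \<and> u' \<odot>\<^bsub>env_module V\<^esub> v = \<zero>\<^bsub>V\<^esub>"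
    if "y \<in> maximal_span m" for y
    using that unfolding ideal_smult_def
  proof (induction rule: generate.induct)
    case one
    then show ?case using wc vc
      by (intro bexI[of _ "\<zero>\<^bsub>env L\<^esub>"]) (simp_all add: M.smult_l_zero E.smult_l_zero[simplified])
  next
    case (incl h)
    then show ?case using * by blast
  next
    case (inv h)
    then obtain u' where u': "u' \<in> carrier (env L)" "h = u' \<odot>\<^bsub>N.M\<^esub> ?w" "u' \<odot>\<^bsub>env_module V\<^esub> v = \<zero>\<^bsub>V\<^esub>"
      using * by blast
    have "\<ominus>\<^bsub>env_module V\<^esub> \<zero>\<^bsub>env_module V\<^esub> = \<zero>\<^bsub>env_module V\<^esub>"
      using E.smult_l_minus[of "\<zero>\<^bsub>env L\<^esub>" v] E.smult_l_zero[OF vc] vc by simp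
    then have "(\<ominus>\<^bsub>env L\<^esub> u') \<odot>\<^bsub>env_module V\<^esub> v = \<zero>\<^bsub>V\<^esub>"
      using E.smult_l_minus[OF u'(1) vc] u'(3) by simp
    then show ?case using u' wc M.smult_l_minus[OF u'(1) wc] U.a_inv_closed[OF u'(1)]
      by (intro bexI[of _ "\<ominus>\<^bsub>env L\<^esub> u'"]) (simp_all add: a_inv_def)
  next
    case (eng h1 h2)
    then obtain u1 u2 where u1: "u1 \<in> carrier (env L)" "h1 = u1 \<odot>\<^bsub>N.M\<^esub> ?w" "u1 \<odot>\<^bsub>env_module V\<^esub> v = \<zero>\<^bsub>V\<^esub>"
      and u2: "u2 \<in> carrier (env L)" "h2 = u2 \<odot>\<^bsub>N.M\<^esub> ?w" "u2 \<odot>\<^bsub>env_module V\<^esub> v = \<zero>\<^bsub>V\<^esub>" by blast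
    have "(u1 \<oplus>\<^bsub>env L\<^esub> u2) \<odot>\<^bsub>env_module V\<^esub> v = \<zero>\<^bsub>V\<^esub>"
      using E.smult_l_distr[OF u1(1) u2(1) vc] u1(3) u2(3) E.M.zero_closed E.M.l_zero[of "\<zero>\<^bsub>V\<^esub>"] by simp
    then show ?case using u1 u2 wc
      by (intro bexI[of _ "u1 \<oplus>\<^bsub>env L\<^esub> u2"]) (simp_all add: M.smult_l_distr)
  qed
  then obtain u' where u': "u' \<in> carrier (env L)" "u \<odot>\<^bsub>N.M\<^esub> ?w = u' \<odot>\<^bsub>N.M\<^esub> ?w"
    "u' \<odot>\<^bsub>env_module V\<^esub> v = \<zero>\<^bsub>V\<^esub>" using uw by blast
  then show ?thesis using univ[OF u u'(1,2)] by simp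
qed

text \<open>Otherwise the unit would kill the dual vector, whose value at the empty word is the
  nonzero number \<open>lam\<close> takes at the unit.\<close>

lemma whittaker_gen_not_in_span:
  assumes m: "ideal m (sub_env Z L)" "m \<noteq> A"
  shows "N.whittaker_gen \<notin> maximal_span m"
proof
  assume in_span: "N.whittaker_gen \<in> maximal_span m"
  interpret m: ideal m "sub_env Z L" by (rule m(1))
  obtain lam where lam: "linear_on_A lam" "\<And>a. a \<in> m \<Longrightarrow> lam a = 0" "lam \<one>\<^bsub>env L\<^esub> \<noteq> 0"
    using exists_functional[OF m] by blast
  interpret F: whittaker_functional L gr \<pi> \<phi> x lam
    by unfold_locales (rule lam)
  interpret D: lie_module L "dual_module L" by (rule lie_module_dual_module)
  interpret DU: left_module "env L" "env_module (dual_module L)" by (rule D.left_module_env_module)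
  have mA: "m \<subseteq> A" using m.a_subset by simp
  let ?v = "F.dual_vector \<one>\<^bsub>env L\<^esub>"
  have kill: "a \<odot>\<^bsub>env_module (dual_module L)\<^esub> ?v = \<zero>\<^bsub>dual_module L\<^esub>" if a: "a \<in> m" for a
  proof -
    have aA: "a \<in> A" using a mA by blast
    have "F.expand s [] a = 0" if "set s \<subseteq> carrier L" for s
      by (rule F.expand_vanish[of m]) (use lam a that m.I_r_closed in auto)
    then show ?thesis using F.smult_dual_vector[OF aA A_closed(6)] aA
      by (simp add: F.dual_vector_def fun_eq_iff)
  qed
  have "\<one>\<^bsub>env L\<^esub> \<odot>\<^bsub>env_module (dual_module L)\<^esub> ?v = \<zero>\<^bsub>dual_module L\<^esub>"
    by (rule maximal_span_universal[OF mA lie_module_dual_module F.whittaker_dual_vector kill])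
      (use in_span M.smult_one[OF N.whittaker_gen_closed] in simp_all)
  then have "?v = (\<lambda>_. 0)" using DU.smult_one[of ?v] F.dual_vector_closed[of "\<one>\<^bsub>env L\<^esub>"] by simp
  then have "?v [] = 0" by metis
  then show False using lam(3) by (simp add: F.dual_vector_def F.expand_Nil del: F.expand.simps)
qed

end

section \<open>The weight filtration of a cyclic Whittaker module\<close>

lemma (in abelian_group) add_minus_cancel:
  assumes "a \<in> carrier G" "b \<in> carrier G"
  shows "b \<oplus> (a \<ominus> b) = a"
  using assms by (simp add: a_minus_def a_lcomm[of b a "\<ominus> b"] r_neg)

text \<open>Two instances follow: the quotient of the universal module by the span of
  \<open>m\<close>, and a given simple Whittaker module viewed over the enveloping algebra.\<close>

locale whittaker_cyclic = whittaker_setting L gr \<pi> \<phi> x + V: left_module "env L" V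
  for L :: "'a lie_algebra" (structure) and gr :: "'b::linordered_ab_group_add \<Rightarrow> 'a set"
    and \<pi> \<phi> x and V :: "(('a list \<Rightarrow> complex) set, 'v, 'd) module_scheme" +
  fixes w :: 'v
  assumes w_closed: "w \<in> carrier V"
    and w_vector: "y \<in> carrier N \<Longrightarrow> env_gen L y \<odot>\<^bsub>V\<^esub> w = env_scal L (\<phi> y) \<odot>\<^bsub>V\<^esub> w"
    and cyclic: "v \<in> carrier V \<Longrightarrow> \<exists>u\<in>carrier (env L). v = u \<odot>\<^bsub>V\<^esub> w"
begin

text \<open>\<open>top_degree\<close> is alpha_phi and \<open>letters\<close> is K'' - R''. In
  \<open>word s\<close> the head of \<open>s\<close> acts last.\<close>

definition "top_degree = (THE \<alpha>. maximal_in {\<alpha> \<in> gr_support L gr. \<pi> \<alpha> > 0 \<and> \<phi> (x \<alpha>) \<noteq> 0} \<alpha>)"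
definition "height = \<pi> top_degree"
definition "letters = {\<beta> \<in> J. \<pi> \<beta> \<le> 0}"
definition "shifted y = env_gen L y \<ominus>\<^bsub>env L\<^esub> env_scal L (\<phi> y)"
definition "word s = foldr (\<lambda>\<beta> v. env_gen L (basis_vector \<beta>) \<odot>\<^bsub>V\<^esub> v) s w"
definition "weight s = (\<Sum>\<beta>\<leftarrow>s. height - \<pi> \<beta>)"

lemma top_maximal: "maximal_in {\<alpha> \<in> gr_support L gr. \<pi> \<alpha> > 0 \<and> \<phi> (x \<alpha>) \<noteq> 0} top_degree"
proof -
  have "\<exists>!\<alpha>. maximal_in {\<alpha> \<in> gr_support L gr. \<pi> \<alpha> > 0 \<and> \<phi> (x \<alpha>) \<noteq> 0} \<alpha>"
    using nonsing unfolding nonsingular_def Let_def by (rule conjunct1)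
  then show ?thesis unfolding top_degree_def by (rule theI')
qed

lemma height_pos: "height > 0"
  using top_maximal by (simp add: maximal_in_def height_def)

lemma nonsingular_witness:
  assumes "\<beta> \<in> letters"
  shows "\<exists>y\<in>gr (top_degree - \<beta>). \<phi> (bracket L y (basis_vector \<beta>)) \<noteq> 0"
  using nonsing assms unfolding nonsingular_def Let_def top_degree_def[symmetric] letters_def basis_vector_def J_def
  by auto

lemma pi_diff: "\<pi> (\<alpha> - \<beta>) = \<pi> \<alpha> - \<pi> \<beta>"
  using pi_add[of "\<alpha> - \<beta>" \<beta>] by simp

text \<open>Otherwise \<gamma> would belong to the set of which \<open>top_degree\<close> is a
  maximal element, and by totality of the order lie above it.\<close>

lemma phi_above_top:
  assumes z: "z \<in> gr \<gamma>" and p: "\<pi> \<gamma> > 0" and gt: "\<not> \<gamma> \<le> top_degree"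
  shows "\<phi> z = 0"
proof (rule ccontr)
  assume nz: "\<phi> z \<noteq> 0"
  then have b: "\<phi> (basis_vector \<gamma>) \<noteq> 0" using phi_coord[OF z p] by auto
  have "\<phi> \<zero> = 0" using N.phi_smult[of "\<zero>" 0] by (simp add: L_vs graded_part_zero)
  with b have "\<gamma> \<in> J" by (auto simp: basis_vector_def split: if_splits)
  then have "\<gamma> \<in> {\<alpha> \<in> gr_support L gr. \<pi> \<alpha> > 0 \<and> \<phi> (x \<alpha>) \<noteq> 0}"
    using b p by (simp add: J_def basis_vector_def)
  then show False using top_maximal gt by (auto simp: maximal_in_def)
qed

lemma shifted_closed: "y \<in> carrier L \<Longrightarrow> shifted y \<in> carrier (env L)"
  by (simp add: shifted_def)

lemma N_closed: "y \<in> carrier N \<Longrightarrow> y \<in> carrier L"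
  by (rule subsetD[OF N.carrier_subset])

lemma shifted_smult:
  "\<lbrakk>y \<in> carrier L; v \<in> carrier V\<rbrakk> \<Longrightarrow>
    shifted y \<odot>\<^bsub>V\<^esub> v = env_gen L y \<odot>\<^bsub>V\<^esub> v \<ominus>\<^bsub>V\<^esub> env_scal L (\<phi> y) \<odot>\<^bsub>V\<^esub> v"
  by (simp add: shifted_def V.smult_l_diff)

lemma shifted_zero_iff:
  "\<lbrakk>y \<in> carrier L; v \<in> carrier V\<rbrakk> \<Longrightarrow>
    shifted y \<odot>\<^bsub>V\<^esub> v = \<zero>\<^bsub>V\<^esub> \<longleftrightarrow> env_gen L y \<odot>\<^bsub>V\<^esub> v = env_scal L (\<phi> y) \<odot>\<^bsub>V\<^esub> v"
  by (simp add: shifted_smult V.M.minus_eq_zero_iff V.smult_closed)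

lemma shifted_w: "y \<in> carrier N \<Longrightarrow> shifted y \<odot>\<^bsub>V\<^esub> w = \<zero>\<^bsub>V\<^esub>"
  using shifted_zero_iff[OF N_closed w_closed] w_vector by blast

lemma gen_commute:
  assumes y: "y \<in> carrier L" and z: "z \<in> carrier L" and v: "v \<in> carrier V"
  shows "env_gen L y \<odot>\<^bsub>V\<^esub> (env_gen L z \<odot>\<^bsub>V\<^esub> v) =
    env_gen L z \<odot>\<^bsub>V\<^esub> (env_gen L y \<odot>\<^bsub>V\<^esub> v) \<oplus>\<^bsub>V\<^esub> env_gen L (bracket L y z) \<odot>\<^bsub>V\<^esub> v"
proof -
  have "env_gen L y \<otimes>\<^bsub>env L\<^esub> env_gen L z =
    env_gen L z \<otimes>\<^bsub>env L\<^esub> env_gen L y \<oplus>\<^bsub>env L\<^esub> env_gen L (bracket L y z)"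
    using y z by (simp add: env_gen_bracket V.R.add_minus_cancel)
  then show ?thesis using y z v
    by (metis V.smult_assoc V.smult_l_distr V.R.m_closed bracket_closed env_gen_closed)
qed

text \<open>The number \<open>\<phi> y\<close> commutes with everything, so the commutator is that
  of \<open>y\<close> itself.\<close>

lemma shifted_commute:
  assumes y: "y \<in> carrier L" and z: "z \<in> carrier L" and v: "v \<in> carrier V"
  shows "shifted y \<odot>\<^bsub>V\<^esub> (env_gen L z \<odot>\<^bsub>V\<^esub> v) =
    env_gen L z \<odot>\<^bsub>V\<^esub> (shifted y \<odot>\<^bsub>V\<^esub> v) \<oplus>\<^bsub>V\<^esub> env_gen L (bracket L y z) \<odot>\<^bsub>V\<^esub> v"
proof -
  have c: "env_scal L (\<phi> y) \<odot>\<^bsub>V\<^esub> (env_gen L z \<odot>\<^bsub>V\<^esub> v) = env_gen L z \<odot>\<^bsub>V\<^esub> (env_scal L (\<phi> y) \<odot>\<^bsub>V\<^esub> v)"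
    using z v by (simp add: env_scal_central V.smult_assoc[symmetric])
  let ?p = "env_gen L z \<odot>\<^bsub>V\<^esub> (env_gen L y \<odot>\<^bsub>V\<^esub> v)" and ?q = "env_gen L (bracket L y z) \<odot>\<^bsub>V\<^esub> v"
    and ?r = "env_gen L z \<odot>\<^bsub>V\<^esub> (env_scal L (\<phi> y) \<odot>\<^bsub>V\<^esub> v)"
  have cl: "?p \<in> carrier V" "?q \<in> carrier V" "?r \<in> carrier V"
    using y z v by (simp_all add: V.smult_closed bracket_closed)
  have "shifted y \<odot>\<^bsub>V\<^esub> (env_gen L z \<odot>\<^bsub>V\<^esub> v) = (?p \<oplus>\<^bsub>V\<^esub> ?q) \<ominus>\<^bsub>V\<^esub> ?r"
    using y z v c by (simp add: shifted_def V.smult_l_diff V.smult_closed gen_commute[OF y z v])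
  also have "\<dots> = (?p \<ominus>\<^bsub>V\<^esub> ?r) \<oplus>\<^bsub>V\<^esub> ?q" using cl by (simp add: a_minus_def V.M.a_ac)
  also have "?p \<ominus>\<^bsub>V\<^esub> ?r = env_gen L z \<odot>\<^bsub>V\<^esub> (shifted y \<odot>\<^bsub>V\<^esub> v)"
    using y z v by (simp add: shifted_def V.smult_l_diff V.smult_r_diff V.smult_closed)
  finally show ?thesis .
qed

lemma word_simps [simp]: "word [] = w" "word (\<beta> # s) = env_gen L (basis_vector \<beta>) \<odot>\<^bsub>V\<^esub> word s"
  by (simp_all add: word_def)

lemma weight_simps [simp]: "weight [] = 0" "weight (\<beta> # s) = height - \<pi> \<beta> + weight s"
  by (simp_all add: weight_def)

lemma word_closed [simp]: "word s \<in> carrier V"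
  by (induction s) (simp_all add: w_closed V.smult_closed basis_vector_closed)

lemma A_smult_closed [simp]: "\<lbrakk>c \<in> A; v \<in> carrier V\<rbrakk> \<Longrightarrow> c \<odot>\<^bsub>V\<^esub> v \<in> carrier V"
  by (simp add: V.smult_closed)

lemma A_smult_commute:
  "\<lbrakk>c \<in> A; u \<in> carrier (env L); v \<in> carrier V\<rbrakk> \<Longrightarrow> u \<odot>\<^bsub>V\<^esub> (c \<odot>\<^bsub>V\<^esub> v) = c \<odot>\<^bsub>V\<^esub> (u \<odot>\<^bsub>V\<^esub> v)"
  by (simp add: A_central[of c u] V.smult_assoc[symmetric])

lemma weight_nonneg: "set s \<subseteq> letters \<Longrightarrow> weight s \<ge> 0"
  by (induction s) (use height_pos in \<open>auto simp: letters_def\<close>)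

lemma weight_pos: "\<lbrakk>set s \<subseteq> letters; s \<noteq> []\<rbrakk> \<Longrightarrow> weight s > 0"
  using weight_nonneg[of "tl s"] height_pos by (cases s) (auto simp: letters_def)

text \<open>The \<open>A\<close>-span of the words of weight at most \<open>q\<close>. Coefficients
  carry no weight, and words may be in any order.\<close>

inductive_set filt :: "int \<Rightarrow> 'v set" for q where
  zero: "\<zero>\<^bsub>V\<^esub> \<in> filt q"
| add: "\<lbrakk>c \<in> A; set s \<subseteq> letters; weight s \<le> q; v \<in> filt q\<rbrakk> \<Longrightarrow> c \<odot>\<^bsub>V\<^esub> word s \<oplus>\<^bsub>V\<^esub> v \<in> filt q"

lemma filt_closed: "v \<in> filt q \<Longrightarrow> v \<in> carrier V"
  by (induction rule: filt.induct) simp_all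

lemma filt_mono: "\<lbrakk>v \<in> filt q; q \<le> q'\<rbrakk> \<Longrightarrow> v \<in> filt q'"
  by (induction rule: filt.induct) (auto intro: filt.intros)

text \<open>Weights of words are nonnegative, so the filtration starts at 0; this is where the
  descents below stop.\<close>

lemma filt_negative: "\<lbrakk>v \<in> filt q; q < 0\<rbrakk> \<Longrightarrow> v = \<zero>\<^bsub>V\<^esub>"
  by (induction rule: filt.induct) (use weight_nonneg in force)+

lemma filt_word: "\<lbrakk>c \<in> A; set s \<subseteq> letters; weight s \<le> q\<rbrakk> \<Longrightarrow> c \<odot>\<^bsub>V\<^esub> word s \<in> filt q"
  using filt.add[OF _ _ _ filt.zero, of c s q] by simp

lemma filt_add: "\<lbrakk>v \<in> filt q; v' \<in> filt q\<rbrakk> \<Longrightarrow> v \<oplus>\<^bsub>V\<^esub> v' \<in> filt q"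
proof (induction rule: filt.induct)
  case (add c s v)
  then show ?case using filt.add[of c s q "v \<oplus>\<^bsub>V\<^esub> v'"] by (simp add: V.M.a_assoc filt_closed)
qed (simp add: filt_closed)

text \<open>Coefficients are central and can be pulled out, so the effect of \<open>u\<close> on
  words decides its effect on the filtration.\<close>

lemma filt_op:
  assumes u: "u \<in> carrier (env L)" and h: "\<And>s. set s \<subseteq> letters \<Longrightarrow> u \<odot>\<^bsub>V\<^esub> word s \<in> filt (weight s + d)"
  shows "v \<in> filt q \<Longrightarrow> u \<odot>\<^bsub>V\<^esub> v \<in> filt (q + d)"
proof (induction rule: filt.induct)
  case zero
  then show ?case using u by (simp add: V.smult_r_zero filt.zero)
next
  case (add c s v)
  \<comment> \<open>Stability under \<open>A\<close> is shown inside this proof, since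
    \<open>filt_A\<close> is itself a consequence of the lemma.\<close>
  have "c \<odot>\<^bsub>V\<^esub> v' \<in> filt r" if "v' \<in> filt r" for v' r
    using that
  proof (induction rule: filt.induct)
    case zero
    then show ?case using add by (simp add: V.smult_r_zero filt.zero)
  next
    case (add c' s' v')
    then show ?case using filt.add[of "c \<otimes>\<^bsub>env L\<^esub> c'" s' r "c \<odot>\<^bsub>V\<^esub> v'"] \<open>c \<in> A\<close>
      by (simp add: V.smult_r_distr V.smult_assoc filt_closed)
  qed
  moreover have "u \<odot>\<^bsub>V\<^esub> word s \<in> filt (q + d)"
    using filt_mono[OF h[OF add(2)]] add(3) by simp
  ultimately have "c \<odot>\<^bsub>V\<^esub> (u \<odot>\<^bsub>V\<^esub> word s) \<in> filt (q + d)" by blast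
  then show ?case using add u
    by (simp add: V.smult_r_distr filt_closed A_smult_commute filt_add)
qed

lemma filt_A: "\<lbrakk>c \<in> A; v \<in> filt q\<rbrakk> \<Longrightarrow> c \<odot>\<^bsub>V\<^esub> v \<in> filt q"
  using filt_op[of c 0 v q] filt_word by simp

lemma filt_basis_vector:
  "\<lbrakk>\<beta> \<in> letters; v \<in> filt q\<rbrakk> \<Longrightarrow> env_gen L (basis_vector \<beta>) \<odot>\<^bsub>V\<^esub> v \<in> filt (q + (height - \<pi> \<beta>))"
proof (rule filt_op)
  fix s assume "\<beta> \<in> letters" "set s \<subseteq> letters"
  then show "env_gen L (basis_vector \<beta>) \<odot>\<^bsub>V\<^esub> word s \<in> filt (weight s + (height - \<pi> \<beta>))"
    using filt_word[of "\<one>\<^bsub>env L\<^esub>" "\<beta> # s"] V.smult_one[of "word (\<beta> # s)"] word_closed[of "\<beta> # s"]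
    by (simp add: algebra_simps del: word_closed)
qed (simp_all add: basis_vector_closed)

text \<open>Up to a central summand, \<open>z\<close> is a multiple of a letter, which adds exactly
  this weight; the central summand adds none.\<close>

lemma gen_word_negative:
  assumes z: "z \<in> gr \<gamma>" and \<gamma>: "\<pi> \<gamma> \<le> 0" and s: "set s \<subseteq> letters"
  shows "env_gen L z \<odot>\<^bsub>V\<^esub> word s \<in> filt (weight s + (height - \<pi> \<gamma>))"
proof -
  note c = basis_vector_closed[of \<gamma>] rest_closed(1)[OF z]
  have "env_gen L z = env_scal L (coord \<gamma> z) \<otimes>\<^bsub>env L\<^esub> env_gen L (basis_vector \<gamma>) \<oplus>\<^bsub>env L\<^esub> env_gen L (rest \<gamma> z)"
    using arg_cong[OF coord_rest(1)[OF z], of "env_gen L"] c by (simp add: env_gen_add env_gen_smult L_vs)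
  then have eq: "env_gen L z \<odot>\<^bsub>V\<^esub> word s = env_scal L (coord \<gamma> z) \<odot>\<^bsub>V\<^esub> (env_gen L (basis_vector \<gamma>) \<odot>\<^bsub>V\<^esub> word s)
      \<oplus>\<^bsub>V\<^esub> env_gen L (rest \<gamma> z) \<odot>\<^bsub>V\<^esub> word s"
    using c by (simp add: V.smult_l_distr V.smult_assoc)
  have 1: "env_scal L (coord \<gamma> z) \<odot>\<^bsub>V\<^esub> (env_gen L (basis_vector \<gamma>) \<odot>\<^bsub>V\<^esub> word s) \<in> filt (weight s + (height - \<pi> \<gamma>))"
  proof (cases "\<gamma> \<in> J")
    case True
    then have g: "\<gamma> \<in> letters" using \<gamma> by (simp add: letters_def)
    then show ?thesis using filt_word[of "env_scal L (coord \<gamma> z)" "\<gamma> # s"] s by simp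
  next
    case False
    then show ?thesis using coord_outside[OF z False] c
      by (simp add: env_scal_zero V.smult_l_zero V.smult_closed filt.zero)
  qed
  have 2: "env_gen L (rest \<gamma> z) \<odot>\<^bsub>V\<^esub> word s \<in> filt (weight s + (height - \<pi> \<gamma>))"
    using filt_word[OF A_closed(5)[OF rest_closed(2)[OF z]] s] height_pos \<gamma> by simp
  show ?thesis unfolding eq by (rule filt_add[OF 1 2])
qed

text \<open>In positive degree \<open>z\<close> is moved through the word to \<open>w\<close>. Each
  commutator stays below the bound by \<open>height\<close>, and at \<open>w\<close> a nonzero
  \<open>\<phi> z\<close> forces \<gamma> to be at most \<open>top_degree\<close>, so that the bound
  is not negative.\<close>

lemma gen_word:
  "\<lbrakk>z \<in> gr \<gamma>; set s \<subseteq> letters\<rbrakk> \<Longrightarrow> env_gen L z \<odot>\<^bsub>V\<^esub> word s \<in> filt (weight s + (height - \<pi> \<gamma>))"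
proof (induction s arbitrary: z \<gamma>)
  case Nil
  show ?case
  proof (cases "\<pi> \<gamma> > 0")
    case pos: True
    have zN: "z \<in> carrier N" using Nil pos by (auto intro: graded_partI)
    show ?thesis
    proof (cases "\<phi> z = 0")
      case True
      then show ?thesis using w_vector[OF zN] w_closed by (simp add: env_scal_zero V.smult_l_zero filt.zero)
    next
      case False
      then have "\<pi> \<gamma> \<le> height" using phi_above_top[OF Nil(1) pos] pi_mono height_def by auto
      then show ?thesis using w_vector[OF zN] filt_word[of "env_scal L (\<phi> z)" "[]"] by simp
    qed
  qed (use gen_word_negative[OF Nil(1), of "[]"] in simp)
next
  case (Cons \<delta> s)
  have d: "\<delta> \<in> letters" "set s \<subseteq> letters" using Cons by auto
  note zc = gr_closed[OF Cons(2)]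
  show ?case
  proof (cases "\<pi> \<gamma> > 0")
    case pos: True
    have "env_gen L (basis_vector \<delta>) \<odot>\<^bsub>V\<^esub> (env_gen L z \<odot>\<^bsub>V\<^esub> word s) \<in> filt (weight s + (height - \<pi> \<gamma>) + (height - \<pi> \<delta>))"
      by (rule filt_basis_vector[OF d(1) Cons.IH[OF Cons(2) d(2)]])
    moreover have "env_gen L (bracket L z (basis_vector \<delta>)) \<odot>\<^bsub>V\<^esub> word s \<in> filt (weight s + (height - \<pi> (\<gamma> + \<delta>)))"
      by (rule Cons.IH[OF gr_bracket[OF Cons(2) basis_vector_gr] d(2)])
    then have "env_gen L (bracket L z (basis_vector \<delta>)) \<odot>\<^bsub>V\<^esub> word s \<in> filt (weight s + (height - \<pi> \<gamma>) + (height - \<pi> \<delta>))"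
      by (rule filt_mono) (use height_pos in \<open>simp add: pi_add\<close>)
    ultimately show ?thesis using filt_add zc
      by (simp add: gen_commute[OF zc basis_vector_closed[of \<delta>] word_closed[of s]] algebra_simps)
  qed (use gen_word_negative[OF Cons(2) _ Cons(3)] in simp)
qed

lemma filt_gen: "\<lbrakk>z \<in> gr \<gamma>; v \<in> filt q\<rbrakk> \<Longrightarrow> env_gen L z \<odot>\<^bsub>V\<^esub> v \<in> filt (q + (height - \<pi> \<gamma>))"
  by (rule filt_op) (simp_all add: gen_word gr_closed)

text \<open>Subtracting \<open>\<phi> z\<close> removes the term that reaches \<open>w\<close>, so
  only commutators are left. Each trades a letter of weight \<open>height - \<pi> \<delta>\<close>
  for a bracket that raises the filtration by at most
  \<open>height - \<pi> (\<gamma> + \<delta>)\<close>.\<close>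

lemma shifted_word:
  assumes z: "z \<in> gr \<gamma>" and p: "\<pi> \<gamma> > 0"
  shows "set s \<subseteq> letters \<Longrightarrow> shifted z \<odot>\<^bsub>V\<^esub> word s \<in> filt (weight s + - \<pi> \<gamma>)"
proof (induction s)
  case Nil
  have "z \<in> carrier N" using z p by (auto intro: graded_partI)
  then show ?case using shifted_w by (simp add: filt.zero)
next
  case (Cons \<delta> s)
  have d: "\<delta> \<in> letters" "set s \<subseteq> letters" using Cons by auto
  have "env_gen L (basis_vector \<delta>) \<odot>\<^bsub>V\<^esub> (shifted z \<odot>\<^bsub>V\<^esub> word s) \<in> filt (weight s + - \<pi> \<gamma> + (height - \<pi> \<delta>))"
    by (rule filt_basis_vector[OF d(1) Cons.IH[OF d(2)]])
  moreover have "env_gen L (bracket L z (basis_vector \<delta>)) \<odot>\<^bsub>V\<^esub> word s \<in> filt (weight s + (height - \<pi> (\<gamma> + \<delta>)))"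
    by (rule gen_word[OF gr_bracket[OF z basis_vector_gr] d(2)])
  then have "env_gen L (bracket L z (basis_vector \<delta>)) \<odot>\<^bsub>V\<^esub> word s \<in> filt (weight s + - \<pi> \<gamma> + (height - \<pi> \<delta>))"
    by (simp add: pi_add algebra_simps)
  ultimately show ?case using filt_add gr_closed[OF z]
    by (simp add: shifted_commute basis_vector_closed algebra_simps)
qed

lemma filt_shifted: "\<lbrakk>z \<in> gr \<gamma>; \<pi> \<gamma> > 0; v \<in> filt q\<rbrakk> \<Longrightarrow> shifted z \<odot>\<^bsub>V\<^esub> v \<in> filt (q + - \<pi> \<gamma>)"
  by (rule filt_op[OF shifted_closed[OF gr_closed] shifted_word])

text \<open>Congruence modulo \<open>filt q\<close>, written with an added error term so that no
  subtraction is involved.\<close>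

definition equal_upto :: "int \<Rightarrow> 'v \<Rightarrow> 'v \<Rightarrow> bool" where
  "equal_upto q v v' \<longleftrightarrow> v' \<in> carrier V \<and> (\<exists>e\<in>filt q. v = v' \<oplus>\<^bsub>V\<^esub> e)"

lemma equal_upto_refl: "v \<in> carrier V \<Longrightarrow> equal_upto q v v"
  unfolding equal_upto_def by (auto intro!: bexI[OF _ filt.zero])

lemma equal_upto_mono: "\<lbrakk>equal_upto q v v'; q \<le> q'\<rbrakk> \<Longrightarrow> equal_upto q' v v'"
  unfolding equal_upto_def using filt_mono by blast

lemma equal_upto_add_filt: "\<lbrakk>equal_upto q v v'; e \<in> filt q\<rbrakk> \<Longrightarrow> equal_upto q (v \<oplus>\<^bsub>V\<^esub> e) v'"
  unfolding equal_upto_def using filt_add filt_closed V.M.a_assoc by metis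

lemma equal_upto_trans:
  assumes "equal_upto q v v'" "equal_upto q v' v''"
  shows "equal_upto q v v''"
proof -
  obtain e where "e \<in> filt q" "v = v' \<oplus>\<^bsub>V\<^esub> e" using assms(1) unfolding equal_upto_def by blast
  then show ?thesis using equal_upto_add_filt[OF assms(2)] by simp
qed

lemma equal_upto_add:
  assumes "equal_upto q v v'" "equal_upto q u u'"
  shows "equal_upto q (v \<oplus>\<^bsub>V\<^esub> u) (v' \<oplus>\<^bsub>V\<^esub> u')"
proof -
  obtain e d where e: "e \<in> filt q" "v = v' \<oplus>\<^bsub>V\<^esub> e" "d \<in> filt q" "u = u' \<oplus>\<^bsub>V\<^esub> d" "v' \<in> carrier V" "u' \<in> carrier V"
    using assms unfolding equal_upto_def by blast
  then have "v \<oplus>\<^bsub>V\<^esub> u = (v' \<oplus>\<^bsub>V\<^esub> u') \<oplus>\<^bsub>V\<^esub> (e \<oplus>\<^bsub>V\<^esub> d)"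
    using filt_closed[OF e(1)] filt_closed[OF e(3)] by (simp add: V.M.a_ac)
  then show ?thesis unfolding equal_upto_def using filt_add[OF e(1,3)] e(5,6) by blast
qed

lemma equal_upto_op:
  assumes c: "equal_upto q v v'" and u: "u \<in> carrier (env L)" and f: "\<And>e. e \<in> filt q \<Longrightarrow> u \<odot>\<^bsub>V\<^esub> e \<in> filt q'"
  shows "equal_upto q' (u \<odot>\<^bsub>V\<^esub> v) (u \<odot>\<^bsub>V\<^esub> v')"
proof -
  obtain e where e: "e \<in> filt q" "v = v' \<oplus>\<^bsub>V\<^esub> e" "v' \<in> carrier V" using c unfolding equal_upto_def by blast
  then have "u \<odot>\<^bsub>V\<^esub> v = u \<odot>\<^bsub>V\<^esub> v' \<oplus>\<^bsub>V\<^esub> u \<odot>\<^bsub>V\<^esub> e" using u filt_closed[OF e(1)] by (simp add: V.smult_r_distr)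
  then show ?thesis using f[OF e(1)] e(3) u V.smult_closed unfolding equal_upto_def by blast
qed

lemma equal_upto_basis_vector:
  "\<lbrakk>equal_upto q v v'; \<beta> \<in> letters\<rbrakk> \<Longrightarrow>
    equal_upto (q + (height - \<pi> \<beta>)) (env_gen L (basis_vector \<beta>) \<odot>\<^bsub>V\<^esub> v) (env_gen L (basis_vector \<beta>) \<odot>\<^bsub>V\<^esub> v')"
  by (erule equal_upto_op) (simp_all add: basis_vector_closed filt_basis_vector)

lemma equal_upto_A: "\<lbrakk>equal_upto q v v'; c \<in> A\<rbrakk> \<Longrightarrow> equal_upto q (c \<odot>\<^bsub>V\<^esub> v) (c \<odot>\<^bsub>V\<^esub> v')"
  by (erule equal_upto_op) (simp_all add: filt_A)

lemma equal_upto_zero: "v \<in> filt q \<Longrightarrow> equal_upto q v \<zero>\<^bsub>V\<^esub>"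
  using filt_closed[of v q] by (auto simp: equal_upto_def intro!: bexI[of _ v])

lemma equal_upto_zeroD: "equal_upto q v \<zero>\<^bsub>V\<^esub> \<Longrightarrow> v \<in> filt q"
  unfolding equal_upto_def using filt_closed by force

text \<open>Every letter that \<delta> passes costs a bracket. The error bound is the weight of
  \<open>\<delta> # s\<close> minus \<open>height\<close>.\<close>

lemma word_insort:
  "\<lbrakk>\<delta> \<in> letters; set s \<subseteq> letters\<rbrakk> \<Longrightarrow> equal_upto (weight s - \<pi> \<delta>) (word (\<delta> # s)) (word (insort \<delta> s))"
proof (induction s)
  case (Cons \<epsilon> s)
  show ?case
  proof (cases "\<delta> \<le> \<epsilon>")
    case False
    have d: "\<epsilon> \<in> letters" "set s \<subseteq> letters" using Cons by auto
    have "equal_upto (weight (\<epsilon> # s) - \<pi> \<delta>) (env_gen L (basis_vector \<epsilon>) \<odot>\<^bsub>V\<^esub> word (\<delta> # s)) (word (insort \<delta> (\<epsilon> # s)))"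
      using equal_upto_basis_vector[OF Cons.IH[OF Cons(2) d(2)] d(1)] False by (simp add: algebra_simps)
    moreover have "env_gen L (bracket L (basis_vector \<delta>) (basis_vector \<epsilon>)) \<odot>\<^bsub>V\<^esub> word s \<in> filt (weight (\<epsilon> # s) - \<pi> \<delta>)"
      using gen_word[OF bracket_basis_gr d(2), of \<delta> \<epsilon>] by (simp add: pi_add algebra_simps)
    ultimately show ?thesis using equal_upto_add_filt
      by (simp add: gen_commute[OF basis_vector_closed[of \<delta>] basis_vector_closed[of \<epsilon>] word_closed[of s]])
  qed (simp add: equal_upto_refl V.smult_closed basis_vector_closed w_closed)
qed (simp add: equal_upto_refl V.smult_closed basis_vector_closed w_closed)

lemma weight_insort: "weight (insort \<delta> s) = weight (\<delta> # s)"
  by (induction s) auto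

lemma weight_sort: "weight (sort s) = weight s"
  by (induction s) (simp_all add: weight_insort)

lemma word_sort: "set s \<subseteq> letters \<Longrightarrow> equal_upto (weight s - height) (word s) (word (sort s))"
proof (induction s)
  case (Cons \<delta> s)
  then have d: "\<delta> \<in> letters" "set s \<subseteq> letters" by auto
  have "equal_upto (weight (\<delta> # s) - height) (word (\<delta> # s)) (word (\<delta> # sort s))"
    using equal_upto_basis_vector[OF Cons.IH[OF d(2)] d(1)] by (simp add: algebra_simps)
  moreover have "equal_upto (weight (\<delta> # s) - height) (word (\<delta> # sort s)) (word (sort (\<delta> # s)))"
    using word_insort[OF d(1), of "sort s"] d(2) by (simp add: weight_sort algebra_simps)
  ultimately show ?case by (rule equal_upto_trans)
qed (simp add: equal_upto_refl w_closed)

text \<open>On the leading part, \<open>y - \<phi> y\<close> acts as the derivative along the least letter, up to a nonzero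
  scalar.\<close>

lemma shifted_word_sorted:
  assumes y: "y \<in> gr (top_degree - \<beta>)" and b: "\<beta> \<in> letters"
  shows "\<lbrakk>sorted (\<beta> # s); set s \<subseteq> letters\<rbrakk> \<Longrightarrow>
    equal_upto (weight s - 2 * height + \<pi> \<beta>) (shifted y \<odot>\<^bsub>V\<^esub> word s)
      (env_scal L (of_nat (count_list s \<beta>) * \<phi> (bracket L y (basis_vector \<beta>))) \<odot>\<^bsub>V\<^esub> word (tl s))"
proof (induction s)
  case Nil
  have "y \<in> carrier N" using y b height_pos by (auto simp: letters_def height_def pi_diff intro: graded_partI)
  then show ?case using shifted_w w_closed by (simp add: env_scal_zero V.smult_l_zero equal_upto_refl)
next
  case (Cons \<delta> s)
  let ?k = "\<phi> (bracket L y (basis_vector \<beta>))"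
  have d: "\<delta> \<in> letters" "set s \<subseteq> letters" and srt: "sorted (\<beta> # s)" "sorted (\<delta> # s)" "\<beta> \<le> \<delta>"
    using Cons by auto
  note IH = equal_upto_basis_vector[OF Cons.IH[OF srt(1) d(2)] d(1)]
  \<comment> \<open>The error bound is the weight of the word after the loss of one \<beta>, lowered
    by a further \<open>height\<close>.\<close>
  have wt: "weight s - 2 * height + \<pi> \<beta> + (height - \<pi> \<delta>) = weight (\<delta> # s) - 2 * height + \<pi> \<beta>"
    by simp
  have split: "shifted y \<odot>\<^bsub>V\<^esub> word (\<delta> # s) = env_gen L (basis_vector \<delta>) \<odot>\<^bsub>V\<^esub> (shifted y \<odot>\<^bsub>V\<^esub> word s)
      \<oplus>\<^bsub>V\<^esub> env_gen L (bracket L y (basis_vector \<delta>)) \<odot>\<^bsub>V\<^esub> word s"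
    using shifted_commute[OF gr_closed[OF y] basis_vector_closed word_closed] by simp
  have br: "bracket L y (basis_vector \<delta>) \<in> gr (top_degree - \<beta> + \<delta>)" by (rule gr_bracket[OF y basis_vector_gr])
  \<comment> \<open>Since \<beta> is at most \<delta>, the bracket of \<open>y\<close> with the
    letter \<delta> has degree at least \<open>top_degree\<close>, hence lies in n. The shifted
    element is then of lower order, and the number \<phi> of the bracket is all that counts.\<close>
  have top_le: "top_degree \<le> top_degree - \<beta> + \<delta>" using srt(3) by (simp add: algebra_simps)
  then have p: "\<pi> (top_degree - \<beta> + \<delta>) > 0" using pi_mono[OF top_le] height_pos by (simp add: height_def)
  have shb: "shifted (bracket L y (basis_vector \<delta>)) \<odot>\<^bsub>V\<^esub> word s \<in> filt (weight (\<delta> # s) - 2 * height + \<pi> \<beta>)"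
    using shifted_word[OF br p d(2)] by (simp add: pi_add pi_diff height_def algebra_simps)
  have gen_eq: "env_gen L z \<odot>\<^bsub>V\<^esub> v = env_scal L (\<phi> z) \<odot>\<^bsub>V\<^esub> v \<oplus>\<^bsub>V\<^esub> shifted z \<odot>\<^bsub>V\<^esub> v"
    if "z \<in> carrier L" "v \<in> carrier V" for z v
    using that by (simp add: shifted_smult V.smult_closed V.M.add_minus_cancel)
  have brc: "equal_upto (weight (\<delta> # s) - 2 * height + \<pi> \<beta>) (env_gen L (bracket L y (basis_vector \<delta>)) \<odot>\<^bsub>V\<^esub> word s)
      (env_scal L (\<phi> (bracket L y (basis_vector \<delta>))) \<odot>\<^bsub>V\<^esub> word s)"
    using gen_eq[OF gr_closed[OF br] word_closed] shb by (simp add: equal_upto_add_filt equal_upto_refl)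
  show ?case
  proof (cases "\<delta> = \<beta>")
    case True
    \<comment> \<open>If \<beta> occurs in the sorted word \<open>s\<close>, it is the head, and the
      new letter replaces the one that \<open>tl\<close> took away; otherwise both sides are
      zero.\<close>
    have 1: "env_gen L (basis_vector \<beta>) \<odot>\<^bsub>V\<^esub> (env_scal L (of_nat (count_list s \<beta>) * ?k) \<odot>\<^bsub>V\<^esub> word (tl s))
      = env_scal L (of_nat (count_list s \<beta>) * ?k) \<odot>\<^bsub>V\<^esub> word s"
    proof (cases "count_list s \<beta> = 0")
      case True
      then show ?thesis by (simp add: env_scal_zero V.smult_l_zero V.smult_r_zero basis_vector_closed)
    next
      case False
      then have "\<beta> \<in> set s" by (simp add: count_list_0_iff)
      then have "s = \<beta> # tl s" using srt(1) by (cases s) auto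
      then have "word s = env_gen L (basis_vector \<beta>) \<odot>\<^bsub>V\<^esub> word (tl s)" by (metis word_simps(2))
      then show ?thesis
        using A_smult_commute[OF A_closed(4) env_gen_closed[OF basis_vector_closed] word_closed] by simp
    qed
    have "equal_upto (weight (\<delta> # s) - 2 * height + \<pi> \<beta>) (shifted y \<odot>\<^bsub>V\<^esub> word (\<delta> # s))
      (env_scal L (of_nat (count_list s \<beta>) * ?k) \<odot>\<^bsub>V\<^esub> word s \<oplus>\<^bsub>V\<^esub> env_scal L ?k \<odot>\<^bsub>V\<^esub> word s)"
      unfolding split using equal_upto_add[OF IH[unfolded wt] brc] True 1 by simp
    moreover have "env_scal L (of_nat (count_list s \<beta>) * ?k) \<odot>\<^bsub>V\<^esub> word s \<oplus>\<^bsub>V\<^esub> env_scal L ?k \<odot>\<^bsub>V\<^esub> word s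
      = env_scal L (of_nat (count_list (\<delta> # s) \<beta>) * ?k) \<odot>\<^bsub>V\<^esub> word (tl (\<delta> # s))"
      using True by (simp add: V.smult_l_distr[symmetric] env_scal_add[symmetric] algebra_simps)
    ultimately show ?thesis by simp
  next
    case False
    \<comment> \<open>Now \<beta> does not occur in the word, and the bracket lies strictly above
      \<open>top_degree\<close>, so every contribution is of lower order.\<close>
    then have lt: "\<beta> < \<delta>" using srt by simp
    then have "\<beta> \<notin> set s" using srt(2) by auto
    then have n: "count_list s \<beta> = 0" "count_list (\<delta> # s) \<beta> = 0" using False by (simp_all add: count_list_0_iff)
    have "\<phi> (bracket L y (basis_vector \<delta>)) = 0"
      by (rule phi_above_top[OF br p]) (use lt in \<open>simp add: algebra_simps not_le\<close>)
    then have "env_gen L (bracket L y (basis_vector \<delta>)) \<odot>\<^bsub>V\<^esub> word s \<in> filt (weight (\<delta> # s) - 2 * height + \<pi> \<beta>)"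
      using brc by (intro equal_upto_zeroD) (simp add: env_scal_zero V.smult_l_zero)
    moreover have "env_gen L (basis_vector \<delta>) \<odot>\<^bsub>V\<^esub> (shifted y \<odot>\<^bsub>V\<^esub> word s) \<in> filt (weight (\<delta> # s) - 2 * height + \<pi> \<beta>)"
      using IH[unfolded wt] n basis_vector_closed[of \<delta>]
      by (intro equal_upto_zeroD) (simp add: env_scal_zero V.smult_l_zero V.smult_r_zero)
    ultimately show ?thesis unfolding split n
      by (simp add: env_scal_zero V.smult_l_zero equal_upto_zero filt_add)
  qed
qed

text \<open>Leading parts are kept as formal \<open>A\<close>-combinations of words, because the
  words are not known to be independent over \<open>A\<close> in \<open>V\<close>.\<close>

definition "evaluate ps = foldr (\<lambda>(c, s) v. c \<odot>\<^bsub>V\<^esub> word s \<oplus>\<^bsub>V\<^esub> v) ps \<zero>\<^bsub>V\<^esub>"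

lemma evaluate_simps [simp]:
  "evaluate [] = \<zero>\<^bsub>V\<^esub>" "evaluate ((c, s) # ps) = c \<odot>\<^bsub>V\<^esub> word s \<oplus>\<^bsub>V\<^esub> evaluate ps"
  by (simp_all add: evaluate_def)

definition homogeneous :: "int \<Rightarrow> (('a list \<Rightarrow> complex) set \<times> 'b list) list \<Rightarrow> bool" where
  "homogeneous q ps \<longleftrightarrow> distinct (map snd ps) \<and>
     (\<forall>(c, s)\<in>set ps. c \<in> A \<and> sorted s \<and> set s \<subseteq> letters \<and> weight s = q)"

lemma evaluate_closed [simp]: "fst ` set ps \<subseteq> A \<Longrightarrow> evaluate ps \<in> carrier V"
  by (induction ps) auto

lemma homogeneous_fst: "homogeneous q ps \<Longrightarrow> fst ` set ps \<subseteq> A"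
  by (auto simp: homogeneous_def)

text \<open>A word that already occurs has its coefficient increased, which keeps the words
  distinct.\<close>

lemma evaluate_insert:
  assumes c: "c \<in> A"
  shows "\<lbrakk>fst ` set ps \<subseteq> A; distinct (map snd ps)\<rbrakk> \<Longrightarrow> \<exists>ps'. distinct (map snd ps') \<and> fst ` set ps' \<subseteq> A \<and>
    snd ` set ps' = insert s (snd ` set ps) \<and> evaluate ps' = c \<odot>\<^bsub>V\<^esub> word s \<oplus>\<^bsub>V\<^esub> evaluate ps"
proof (induction ps)
  case Nil
  show ?case using c by (intro exI[of _ "[(c, s)]"]) simp
next
  case (Cons p ps)
  obtain d t where p: "p = (d, t)" by (cases p)
  show ?case
  proof (cases "t = s")
    case True
    then show ?thesis using Cons.prems p c
      by (intro exI[of _ "(c \<oplus>\<^bsub>env L\<^esub> d, t) # ps"]) (simp add: V.smult_l_distr V.M.a_assoc)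
  next
    case False
    obtain ps' where "distinct (map snd ps')" "fst ` set ps' \<subseteq> A"
      "snd ` set ps' = insert s (snd ` set ps)" "evaluate ps' = c \<odot>\<^bsub>V\<^esub> word s \<oplus>\<^bsub>V\<^esub> evaluate ps"
      using Cons by auto
    then show ?thesis using Cons.prems p c False
      by (intro exI[of _ "p # ps'"]) (auto simp: V.M.a_ac)
  qed
qed

text \<open>Words of weight below \<open>q\<close> join the error term. Those of weight
  \<open>q\<close> are sorted at the cost of a lower term and then collected.\<close>

lemma filt_leading_part: "v \<in> filt q \<Longrightarrow> \<exists>ps. homogeneous q ps \<and> equal_upto (q - 1) v (evaluate ps)"
proof (induction rule: filt.induct)
  case zero
  show ?case by (intro exI[of _ "[]"]) (simp add: homogeneous_def equal_upto_refl)
next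
  case (add c s v)
  then obtain ps where ps: "homogeneous q ps" "equal_upto (q - 1) v (evaluate ps)" by blast
  show ?case
  proof (cases "weight s < q")
    case True
    have "equal_upto (q - 1) (c \<odot>\<^bsub>V\<^esub> word s \<oplus>\<^bsub>V\<^esub> v) (\<zero>\<^bsub>V\<^esub> \<oplus>\<^bsub>V\<^esub> evaluate ps)"
      by (rule equal_upto_add[OF equal_upto_zero[OF filt_word] ps(2)]) (use add True in auto)
    then show ?thesis using ps homogeneous_fst[OF ps(1)] by auto
  next
    case False
    then have w: "weight s = q" using add by simp
    have "equal_upto (q - 1) (c \<odot>\<^bsub>V\<^esub> word s) (c \<odot>\<^bsub>V\<^esub> word (sort s))"
      by (rule equal_upto_A[OF equal_upto_mono[OF word_sort]]) (use add w height_pos in auto)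
    then have 1: "equal_upto (q - 1) (c \<odot>\<^bsub>V\<^esub> word s \<oplus>\<^bsub>V\<^esub> v) (c \<odot>\<^bsub>V\<^esub> word (sort s) \<oplus>\<^bsub>V\<^esub> evaluate ps)"
      using ps(2) by (rule equal_upto_add)
    obtain ps' where ps': "distinct (map snd ps')" "fst ` set ps' \<subseteq> A"
      "snd ` set ps' = insert (sort s) (snd ` set ps)" "evaluate ps' = c \<odot>\<^bsub>V\<^esub> word (sort s) \<oplus>\<^bsub>V\<^esub> evaluate ps"
      using evaluate_insert[OF add(1) homogeneous_fst[OF ps(1)], of "sort s"] ps(1) by (auto simp: homogeneous_def)
    have "homogeneous q ps'"
      unfolding homogeneous_def
    proof (intro conjI ps' ballI, clarify)
      fix d t assume dt: "(d, t) \<in> set ps'"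
      then have "t \<in> insert (sort s) (snd ` set ps)" using ps'(3) by force
      then consider "t = sort s" | a where "(a, t) \<in> set ps" by auto
      then have "sorted t \<and> set t \<subseteq> letters \<and> weight t = q"
      proof cases
        case 1
        then show ?thesis using add(2) w by (simp add: weight_sort)
      next
        case 2
        then show ?thesis using ps(1) unfolding homogeneous_def by blast
      qed
      moreover have "d \<in> A" using ps'(2) dt by force
      ultimately show "d \<in> A \<and> sorted t \<and> set t \<subseteq> letters \<and> weight t = q" by blast
    qed
    then show ?thesis using 1 ps'(4) by metis
  qed
qed

text \<open>Being central, \<open>c\<close> passes through all letters to \<open>w\<close>.\<close>

lemma A_smult_word_zero: "\<lbrakk>c \<in> A; c \<odot>\<^bsub>V\<^esub> w = \<zero>\<^bsub>V\<^esub>\<rbrakk> \<Longrightarrow> c \<odot>\<^bsub>V\<^esub> word s = \<zero>\<^bsub>V\<^esub>"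
proof (induction s)
  case (Cons \<beta> s)
  then show ?case using A_smult_commute[of c "env_gen L (basis_vector \<beta>)" "word s"]
    by (simp add: basis_vector_closed V.smult_r_zero)
qed simp

lemma evaluate_filter:
  "fst ` set ps \<subseteq> A \<Longrightarrow> evaluate (filter (\<lambda>(c, s). c \<odot>\<^bsub>V\<^esub> w \<noteq> \<zero>\<^bsub>V\<^esub>) ps) = evaluate ps"
  by (induction ps) (auto simp: A_smult_word_zero)

lemma exists_leading_part:
  "\<lbrakk>v \<in> filt q; v \<noteq> \<zero>\<^bsub>V\<^esub>\<rbrakk> \<Longrightarrow> \<exists>p ps. homogeneous p ps \<and> ps \<noteq> [] \<and> (\<forall>(c, s)\<in>set ps. c \<odot>\<^bsub>V\<^esub> w \<noteq> \<zero>\<^bsub>V\<^esub>) \<and>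
    equal_upto (p - 1) v (evaluate ps)"
\<comment> \<open>With \<open>q + 1\<close> the base case is that of negative \<open>q\<close>,
  where \<open>filt q\<close> contains only zero.\<close>
proof (induction "nat (q + 1)" arbitrary: q)
  case 0
  then show ?case using filt_negative[of v q] by simp
next
  case (Suc n)
  obtain ps where ps: "homogeneous q ps" "equal_upto (q - 1) v (evaluate ps)"
    using filt_leading_part[OF Suc(3)] by blast
  let ?ps = "filter (\<lambda>(c, s). c \<odot>\<^bsub>V\<^esub> w \<noteq> \<zero>\<^bsub>V\<^esub>) ps"
  have ev: "evaluate ?ps = evaluate ps" by (rule evaluate_filter[OF homogeneous_fst[OF ps(1)]])
  have hom: "homogeneous q ?ps" using ps(1) by (auto simp: homogeneous_def distinct_map_filter)
  show ?case
  proof (cases "?ps = []")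
    case True
    then have "v \<in> filt (q - 1)" using ps(2) ev by (simp add: equal_upto_zeroD)
    then show ?thesis using Suc(1)[of "q - 1"] Suc(2,4) by simp
  next
    case False
    show ?thesis using hom False ps(2) unfolding ev[symmetric] by (intro exI[of _ q] exI[of _ ?ps]) auto
  qed
qed

text \<open>Termwise from \<open>shifted_word_sorted\<close>. A sorted word that does not begin with
  \<beta> does not contain it, so its count is zero and it may be filtered out.\<close>

lemma shifted_evaluate:
  assumes y: "y \<in> gr (top_degree - \<beta>)" and b: "\<beta> \<in> letters" and k: "k = \<phi> (bracket L y (basis_vector \<beta>))"
  shows "\<lbrakk>fst ` set ps \<subseteq> A; \<forall>(c, s)\<in>set ps. s \<noteq> [] \<and> sorted (\<beta> # s) \<and> set s \<subseteq> letters \<and> weight s = p\<rbrakk> \<Longrightarrow>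
    equal_upto (p - 2 * height + \<pi> \<beta>) (shifted y \<odot>\<^bsub>V\<^esub> evaluate ps)
      (evaluate (map (\<lambda>(c, s). (c \<otimes>\<^bsub>env L\<^esub> env_scal L (of_nat (count_list s \<beta>) * k), tl s)) (filter (\<lambda>(c, s). hd s = \<beta>) ps)))"
proof (induction ps)
  case Nil
  then show ?case using shifted_closed[OF gr_closed[OF y]] by (simp add: V.smult_r_zero equal_upto_refl)
next
  case (Cons q ps)
  obtain c s where q: "q = (c, s)" by (cases q)
  have cs: "c \<in> A" "s \<noteq> []" "sorted (\<beta> # s)" "set s \<subseteq> letters" "weight s = p" using Cons.prems q by auto
  note yc = shifted_closed[OF gr_closed[OF y]]
  let ?r = "(c \<otimes>\<^bsub>env L\<^esub> env_scal L (of_nat (count_list s \<beta>) * k)) \<odot>\<^bsub>V\<^esub> word (tl s)"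
  let ?ps = "map (\<lambda>(c, s). (c \<otimes>\<^bsub>env L\<^esub> env_scal L (of_nat (count_list s \<beta>) * k), tl s)) (filter (\<lambda>(c, s). hd s = \<beta>) ps)"
  have dA: "d \<in> A" if "(d, t) \<in> set ps" for d t
    using subsetD[OF Cons.prems(1) imageI[of "(d, t)"]] that by simp
  have cl: "fst ` set ?ps \<subseteq> A" by (auto dest: dA)
  have "equal_upto (p - 2 * height + \<pi> \<beta>) (c \<odot>\<^bsub>V\<^esub> (shifted y \<odot>\<^bsub>V\<^esub> word s)) ?r"
    using equal_upto_A[OF shifted_word_sorted[OF y b cs(3,4)] cs(1)] cs(1,5) k by (simp add: V.smult_assoc)
  then have "equal_upto (p - 2 * height + \<pi> \<beta>) (shifted y \<odot>\<^bsub>V\<^esub> (c \<odot>\<^bsub>V\<^esub> word s) \<oplus>\<^bsub>V\<^esub> shifted y \<odot>\<^bsub>V\<^esub> evaluate ps)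
      (?r \<oplus>\<^bsub>V\<^esub> evaluate ?ps)"
    using Cons yc cs(1) by (intro equal_upto_add) (simp_all add: A_smult_commute)
  moreover have "?r \<oplus>\<^bsub>V\<^esub> evaluate ?ps = evaluate ?ps" if "hd s \<noteq> \<beta>"
  proof -
    have "\<beta> \<notin> set s" using cs(2,3) that by (cases s) auto
    then have "count_list s \<beta> = 0" by (simp add: count_list_0_iff)
    then show ?thesis using cs(1) cl by (simp add: env_scal_zero V.smult_l_zero)
  qed
  ultimately show ?case using q Cons.prems yc cs(1) by (auto simp: V.smult_r_distr)
qed

text \<open>In the second alternative \<open>v\<close> is not a Whittaker vector, as \<open>shifted y\<close> kills those.\<close>

lemma reduce_leading_part:
  "\<lbrakk>homogeneous p ps; ps \<noteq> []; \<forall>(c, s)\<in>set ps. c \<odot>\<^bsub>V\<^esub> w \<noteq> \<zero>\<^bsub>V\<^esub>; equal_upto (p - 1) v (evaluate ps); v \<in> carrier V\<rbrakk> \<Longrightarrow>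
    (\<exists>c\<in>A. c \<odot>\<^bsub>V\<^esub> w \<noteq> \<zero>\<^bsub>V\<^esub> \<and> v = c \<odot>\<^bsub>V\<^esub> w) \<or>
    (\<exists>c\<in>A. \<exists>y\<in>carrier N. \<exists>u\<in>carrier (env L). c \<odot>\<^bsub>V\<^esub> w \<noteq> \<zero>\<^bsub>V\<^esub> \<and> u \<odot>\<^bsub>V\<^esub> (shifted y \<odot>\<^bsub>V\<^esub> v) = c \<odot>\<^bsub>V\<^esub> w)"
proof (induction "nat p" arbitrary: p ps v rule: less_induct)
  case less
  have el: "c \<in> A" "sorted s" "set s \<subseteq> letters" "weight s = p" "c \<odot>\<^bsub>V\<^esub> w \<noteq> \<zero>\<^bsub>V\<^esub>" if "(c, s) \<in> set ps" for c s
    using that less(2,4) by (auto simp: homogeneous_def)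
  obtain c0 s0 where p0: "(c0, s0) \<in> set ps" using less(3) by (cases ps) auto
  have p_nonneg: "p \<ge> 0" using weight_nonneg el[OF p0] by blast
  show ?case
  proof (cases "p = 0")
    case True
    \<comment> \<open>Only the empty word has weight 0, and as the words are distinct a single term
      remains; the error lies in negative filtration and vanishes.\<close>
    have s: "s = []" if "(c, s) \<in> set ps" for c s
      using el(3,4)[OF that] weight_pos[of s] True by auto
    then have "map snd ps = map (\<lambda>_. []) ps" by (intro map_cong) auto
    then have "map snd ps = replicate (length ps) []" by (simp add: map_replicate_const)
    moreover have "distinct (map snd ps)" using less(2) by (simp add: homogeneous_def)
    ultimately obtain q where "ps = [q]" using less(3) by (cases ps; cases "tl ps") auto
    then have ps: "ps = [(c0, [])]" using p0 s[OF p0] by auto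
    obtain e where e: "e \<in> filt (- 1)" "v = evaluate ps \<oplus>\<^bsub>V\<^esub> e" using less(5) True unfolding equal_upto_def by auto
    then have "v = c0 \<odot>\<^bsub>V\<^esub> w" using filt_negative[OF e(1)] ps el(1)[OF p0] w_closed by simp
    then show ?thesis using el(1,5)[OF p0] by blast
  next
    case False
    then have ne: "s \<noteq> []" if "(c, s) \<in> set ps" for c s using el(4)[OF that] by auto
    let ?H = "(\<lambda>(c, s). hd s) ` set ps"
    \<comment> \<open>The words are sorted, so the least head is the least letter that occurs
      anywhere.\<close>
    define \<beta> where "\<beta> = Min ?H"
    have H: "finite ?H" "?H \<noteq> {}" using less(3) by auto
    have "\<beta> \<in> ?H" unfolding \<beta>_def by (rule Min_in[OF H])
    then obtain c1 s1 where p1: "(c1, s1) \<in> set ps" "hd s1 = \<beta>" by auto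
    have b: "\<beta> \<in> letters" using ne[OF p1(1)] el(3)[OF p1(1)] p1(2) by (metis hd_in_set subsetD)
    have srt: "sorted (\<beta> # s)" if "(c, s) \<in> set ps" for c s
    proof -
      have "\<beta> \<le> hd s" unfolding \<beta>_def using H(1) that by (intro Min_le) force+
      then show ?thesis using ne[OF that] el(2)[OF that] by (cases s) auto
    qed
    obtain y where y: "y \<in> gr (top_degree - \<beta>)" "\<phi> (bracket L y (basis_vector \<beta>)) \<noteq> 0" using nonsingular_witness[OF b] by blast
    define k where "k = \<phi> (bracket L y (basis_vector \<beta>))"
    have pos: "\<pi> (top_degree - \<beta>) > 0" using b height_pos by (simp add: letters_def pi_diff height_def)
    have yN: "y \<in> carrier N" using y(1) pos by (auto intro: graded_partI)
    note yc = shifted_closed[OF gr_closed[OF y(1)]]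
    let ?f = "\<lambda>(c, s). (c \<otimes>\<^bsub>env L\<^esub> env_scal L (of_nat (count_list s \<beta>) * k), tl s)"
    let ?ps = "map ?f (filter (\<lambda>(c, s). hd s = \<beta>) ps)"
    \<comment> \<open>The weight after one \<beta>, of weight \<open>height - \<pi> \<beta>\<close>,
      has been removed.\<close>
    let ?p = "p - height + \<pi> \<beta>"
    have "\<forall>(c, s)\<in>set ps. s \<noteq> [] \<and> sorted (\<beta> # s) \<and> set s \<subseteq> letters \<and> weight s = p"
    proof
      fix q assume qs: "q \<in> set ps"
      obtain c s where q1: "q = (c, s)" by (cases q)
      then have q: "q = (c, s)" "(c, s) \<in> set ps" using qs by simp_all
      show "case q of (c, s) \<Rightarrow> s \<noteq> [] \<and> sorted (\<beta> # s) \<and> set s \<subseteq> letters \<and> weight s = p"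
        using ne[OF q(2)] srt[OF q(2)] el(3,4)[OF q(2)] q(1) by simp
    qed
    then have "equal_upto (p - 2 * height + \<pi> \<beta>) (shifted y \<odot>\<^bsub>V\<^esub> evaluate ps) (evaluate ?ps)"
      by (rule shifted_evaluate[OF y(1) b k_def homogeneous_fst[OF less(2)]])
    \<comment> \<open>The error provided lies \<open>height\<close> below \<open>?p\<close>, and
      \<open>height\<close> is at least 1.\<close>
    then have 1: "equal_upto (?p - 1) (shifted y \<odot>\<^bsub>V\<^esub> evaluate ps) (evaluate ?ps)"
      by (rule equal_upto_mono) (use height_pos in simp)
    have "equal_upto (?p - 1) (shifted y \<odot>\<^bsub>V\<^esub> v) (shifted y \<odot>\<^bsub>V\<^esub> evaluate ps)"
      by (rule equal_upto_op[OF less(5) yc])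
        (use filt_shifted[OF y(1) pos, of _ "p - 1"] in \<open>simp add: pi_diff height_def algebra_simps\<close>)
    then have 2: "equal_upto (?p - 1) (shifted y \<odot>\<^bsub>V\<^esub> v) (evaluate ?ps)" using 1 by (rule equal_upto_trans)
    have hom: "homogeneous ?p ?ps"
      unfolding homogeneous_def
    proof (intro conjI ballI)
      have "distinct (map snd (filter (\<lambda>(c, s). hd s = \<beta>) ps))"
        using less(2) by (simp add: homogeneous_def distinct_map_filter)
      \<comment> \<open>All words kept begin with \<beta>, so they remain distinct without their
        heads.\<close>
      moreover have "inj_on tl (set (map snd (filter (\<lambda>(c, s). hd s = \<beta>) ps)))"
        by (rule inj_onI) (use ne in \<open>auto intro: list.expand\<close>)
      ultimately have "distinct (map tl (map snd (filter (\<lambda>(c, s). hd s = \<beta>) ps)))" by (simp only: distinct_map simp_thms)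
      moreover have "map snd ?ps = map tl (map snd (filter (\<lambda>(c, s). hd s = \<beta>) ps))" by auto
      ultimately show "distinct (map snd ?ps)" by (simp only:)
      fix q assume "q \<in> set ?ps"
      then obtain c s where q: "q = ?f (c, s)" "(c, s) \<in> set ps" "hd s = \<beta>" by auto
      have "s = \<beta> # tl s" using ne[OF q(2)] q(3) by (cases s) auto
      then have "weight s = height - \<pi> \<beta> + weight (tl s)" by (metis weight_simps(2))
      moreover have "set (tl s) \<subseteq> letters" using el(3)[OF q(2)] ne[OF q(2)] by (meson list.set_sel(2) subset_iff)
      ultimately show "case q of (c, s) \<Rightarrow> c \<in> A \<and> sorted s \<and> set s \<subseteq> letters \<and> weight s = ?p"
        using q el[OF q(2)] by (simp add: sorted_tl)
    qed
    \<comment> \<open>The factor is a positive count times the value of \<phi> that nonsingularity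
      makes nonzero, so it can be divided out.\<close>
    have nz: "\<forall>(c, s)\<in>set ?ps. c \<odot>\<^bsub>V\<^esub> w \<noteq> \<zero>\<^bsub>V\<^esub>"
    proof (intro ballI, clarify)
      fix c' t assume ct: "(c', t) \<in> set ?ps" and z: "c' \<odot>\<^bsub>V\<^esub> w = \<zero>\<^bsub>V\<^esub>"
      obtain c s where q: "c' = c \<otimes>\<^bsub>env L\<^esub> env_scal L (of_nat (count_list s \<beta>) * k)" "(c, s) \<in> set ps" "hd s = \<beta>"
        using ct by auto
      let ?k = "of_nat (count_list s \<beta>) * k"
      have "\<beta> \<in> set s" using ne[OF q(2)] q(3) by (metis hd_in_set)
      then have "?k \<noteq> 0" using y(2) by (simp add: k_def count_list_0_iff)
      moreover have cU: "c \<in> carrier (env L)" using el(1)[OF q(2)] by simp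
      have "c' = env_scal L ?k \<otimes>\<^bsub>env L\<^esub> c" unfolding q(1) by (rule env_scal_central[OF cU, symmetric])
      then have "env_scal L (1 / ?k) \<odot>\<^bsub>V\<^esub> (c' \<odot>\<^bsub>V\<^esub> w) = (env_scal L (1 / ?k) \<otimes>\<^bsub>env L\<^esub> env_scal L ?k) \<odot>\<^bsub>V\<^esub> (c \<odot>\<^bsub>V\<^esub> w)"
        using cU w_closed by (simp add: V.smult_assoc V.smult_closed)
      then have "env_scal L (1 / ?k) \<odot>\<^bsub>V\<^esub> (c' \<odot>\<^bsub>V\<^esub> w) = env_scal L (1 / ?k * ?k) \<odot>\<^bsub>V\<^esub> (c \<odot>\<^bsub>V\<^esub> w)"
        by (simp only: env_scal_mult)
      ultimately have "c \<odot>\<^bsub>V\<^esub> w = \<zero>\<^bsub>V\<^esub>" using z el(1)[OF q(2)] w_closed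
        by (simp add: V.smult_r_zero env_class_one V.smult_one)
      then show False using el(5)[OF q(2)] by simp
    qed
    have "nat ?p < nat p" using height_pos b p_nonneg False by (simp add: letters_def)
    moreover have "?ps \<noteq> []" using p1 by (auto simp: filter_empty_conv)
    ultimately have "(\<exists>c\<in>A. c \<odot>\<^bsub>V\<^esub> w \<noteq> \<zero>\<^bsub>V\<^esub> \<and> shifted y \<odot>\<^bsub>V\<^esub> v = c \<odot>\<^bsub>V\<^esub> w) \<or>
      (\<exists>c\<in>A. \<exists>y'\<in>carrier N. \<exists>u\<in>carrier (env L). c \<odot>\<^bsub>V\<^esub> w \<noteq> \<zero>\<^bsub>V\<^esub> \<and> u \<odot>\<^bsub>V\<^esub> (shifted y' \<odot>\<^bsub>V\<^esub> (shifted y \<odot>\<^bsub>V\<^esub> v)) = c \<odot>\<^bsub>V\<^esub> w)"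
      using less(1)[of ?p ?ps "shifted y \<odot>\<^bsub>V\<^esub> v"] hom nz 2 V.smult_closed[OF yc less(6)] by blast
    then show ?thesis
    proof (elim disjE bexE conjE)
      fix c assume "c \<in> A" "c \<odot>\<^bsub>V\<^esub> w \<noteq> \<zero>\<^bsub>V\<^esub>" "shifted y \<odot>\<^bsub>V\<^esub> v = c \<odot>\<^bsub>V\<^esub> w"
      then show ?thesis using yN V.smult_one[of "c \<odot>\<^bsub>V\<^esub> w"] w_closed
        by (intro disjI2 bexI[of _ c] bexI[of _ y] bexI[of _ "\<one>\<^bsub>env L\<^esub>"]) simp_all
    next
      fix c y' u assume *: "c \<in> A" "y' \<in> carrier N" "u \<in> carrier (env L)" "c \<odot>\<^bsub>V\<^esub> w \<noteq> \<zero>\<^bsub>V\<^esub>"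
        "u \<odot>\<^bsub>V\<^esub> (shifted y' \<odot>\<^bsub>V\<^esub> (shifted y \<odot>\<^bsub>V\<^esub> v)) = c \<odot>\<^bsub>V\<^esub> w"
      have y'c: "shifted y' \<in> carrier (env L)" using *(2) N.carrier_subset shifted_closed by blast
      then have "(u \<otimes>\<^bsub>env L\<^esub> shifted y') \<odot>\<^bsub>V\<^esub> (shifted y \<odot>\<^bsub>V\<^esub> v) = c \<odot>\<^bsub>V\<^esub> w"
        using *(3,5) yc less(6) by (simp add: V.smult_assoc V.smult_closed)
      then show ?thesis using *(1,3,4) yN y'c
        by (intro disjI2 bexI[of _ c] bexI[of _ y] bexI[of _ "u \<otimes>\<^bsub>env L\<^esub> shifted y'"] conjI V.R.m_closed) auto
    qed
  qed
qed

text \<open>An element of \<open>L\<close> is a finite sum of homogeneous ones, each with its own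
  shift of the filtration; the larger index serves for a sum. Cyclicity then reaches all of
  \<open>V\<close>.\<close>

lemma exhaustive: "v \<in> carrier V \<Longrightarrow> \<exists>q. v \<in> filt q"
proof -
  have gen: "\<exists>q'. env_gen L z \<odot>\<^bsub>V\<^esub> v \<in> filt q'" if "z \<in> carrier L" and v: "v \<in> filt q" for z v q
    using that(1)
  proof (induction z rule: graded_induct)
    case (homogeneous \<alpha> y)
    then show ?case using filt_gen v by blast
  next
    case (add y z)
    then obtain q1 q2 where "env_gen L y \<odot>\<^bsub>V\<^esub> v \<in> filt q1" "env_gen L z \<odot>\<^bsub>V\<^esub> v \<in> filt q2" by blast
    then have "env_gen L y \<odot>\<^bsub>V\<^esub> v \<oplus>\<^bsub>V\<^esub> env_gen L z \<odot>\<^bsub>V\<^esub> v \<in> filt (max q1 q2)"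
      by (intro filt_add) (auto intro: filt_mono)
    then show ?case using add filt_closed[OF v] by (auto simp: env_gen_add V.smult_l_distr)
  qed
  have "\<exists>q. u \<odot>\<^bsub>V\<^esub> w \<in> filt q" if "u \<in> carrier (env L)" for u
    using that
  proof (induction u rule: env_induct)
    case (scal c)
    then show ?case using filt_word[of "env_scal L c" "[]" 0] by auto
  next
    case (add C D)
    then obtain q1 q2 where "C \<odot>\<^bsub>V\<^esub> w \<in> filt q1" "D \<odot>\<^bsub>V\<^esub> w \<in> filt q2" by blast
    then have "C \<odot>\<^bsub>V\<^esub> w \<oplus>\<^bsub>V\<^esub> D \<odot>\<^bsub>V\<^esub> w \<in> filt (max q1 q2)"
      by (intro filt_add) (auto intro: filt_mono)
    then show ?case using add w_closed by (auto simp: V.smult_l_distr)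
  next
    case (gen z C)
    then show ?case using \<open>\<And>z v q. \<lbrakk>z \<in> carrier L; v \<in> filt q\<rbrakk> \<Longrightarrow> \<exists>q'. env_gen L z \<odot>\<^bsub>V\<^esub> v \<in> filt q'\<close> w_closed
      by (auto simp: V.smult_assoc)
  qed
  then show "v \<in> carrier V \<Longrightarrow> \<exists>q. v \<in> filt q" using cyclic by metis
qed

text \<open>In the first alternative of \<open>reduce_leading_part\<close> the unit serves as
  operator, in the second the product of \<open>u\<close> with \<open>shifted y\<close>.\<close>

lemma reaches_generator:
  assumes "v \<in> carrier V" "v \<noteq> \<zero>\<^bsub>V\<^esub>"
  obtains u c where "u \<in> carrier (env L)" "c \<in> A" "c \<odot>\<^bsub>V\<^esub> w \<noteq> \<zero>\<^bsub>V\<^esub>" "u \<odot>\<^bsub>V\<^esub> v = c \<odot>\<^bsub>V\<^esub> w"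
proof -
  obtain q where "v \<in> filt q" using exhaustive assms by blast
  then obtain p ps where ps: "homogeneous p ps" "ps \<noteq> []" "\<forall>(c, s)\<in>set ps. c \<odot>\<^bsub>V\<^esub> w \<noteq> \<zero>\<^bsub>V\<^esub>"
    "equal_upto (p - 1) v (evaluate ps)" using exists_leading_part assms(2) by blast
  from reduce_leading_part[OF ps assms(1)] show thesis
  proof (elim disjE bexE conjE)
    fix c assume "c \<in> A" "c \<odot>\<^bsub>V\<^esub> w \<noteq> \<zero>\<^bsub>V\<^esub>" "v = c \<odot>\<^bsub>V\<^esub> w"
    then show thesis using that[of "\<one>\<^bsub>env L\<^esub>" c] V.smult_one[OF assms(1)] by simp
  next
    fix c y u assume *: "c \<in> A" "y \<in> carrier N" "u \<in> carrier (env L)" "c \<odot>\<^bsub>V\<^esub> w \<noteq> \<zero>\<^bsub>V\<^esub>"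
      "u \<odot>\<^bsub>V\<^esub> (shifted y \<odot>\<^bsub>V\<^esub> v) = c \<odot>\<^bsub>V\<^esub> w"
    have "shifted y \<in> carrier (env L)" using *(2) N.carrier_subset shifted_closed by blast
    then show thesis using that[of "u \<otimes>\<^bsub>env L\<^esub> shifted y" c] * assms(1) by (simp add: V.smult_assoc)
  qed
qed

text \<open>Every \<open>shifted y\<close> kills \<open>v\<close>, so the second alternative of
  \<open>reduce_leading_part\<close> would make a nonzero \<open>c w\<close> equal to zero.\<close>

lemma whittaker_vectors:
  assumes v: "v \<in> carrier V"
    and wh: "\<And>y. y \<in> carrier N \<Longrightarrow> env_gen L y \<odot>\<^bsub>V\<^esub> v = env_scal L (\<phi> y) \<odot>\<^bsub>V\<^esub> v"
  shows "\<exists>c\<in>A. v = c \<odot>\<^bsub>V\<^esub> w"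
proof (cases "v = \<zero>\<^bsub>V\<^esub>")
  case True
  then show ?thesis using w_closed by (intro bexI[of _ "\<zero>\<^bsub>env L\<^esub>"]) (simp_all add: V.smult_l_zero)
next
  case False
  obtain q where "v \<in> filt q" using exhaustive v by blast
  then obtain p ps where ps: "homogeneous p ps" "ps \<noteq> []" "\<forall>(c, s)\<in>set ps. c \<odot>\<^bsub>V\<^esub> w \<noteq> \<zero>\<^bsub>V\<^esub>"
    "equal_upto (p - 1) v (evaluate ps)" using exists_leading_part False by blast
  have sh: "shifted y \<odot>\<^bsub>V\<^esub> v = \<zero>\<^bsub>V\<^esub>" if "y \<in> carrier N" for y
    using wh[OF that] shifted_zero_iff[OF N_closed[OF that] v] by blast
  from reduce_leading_part[OF ps v] show ?thesis
  proof (elim disjE bexE conjE)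
    fix c y u assume *: "c \<in> A" "y \<in> carrier N" "u \<in> carrier (env L)" "c \<odot>\<^bsub>V\<^esub> w \<noteq> \<zero>\<^bsub>V\<^esub>"
      "u \<odot>\<^bsub>V\<^esub> (shifted y \<odot>\<^bsub>V\<^esub> v) = c \<odot>\<^bsub>V\<^esub> w"
    then show ?thesis using sh[OF *(2)] V.smult_r_zero by simp
  qed blast
qed

end

section \<open>Simple Whittaker modules\<close>

lemma (in left_module) smult_eq_iff:
  "\<lbrakk>a \<in> carrier R; b \<in> carrier R; v \<in> carrier M\<rbrakk> \<Longrightarrow>
    (a \<ominus>\<^bsub>R\<^esub> b) \<odot>\<^bsub>M\<^esub> v = \<zero>\<^bsub>M\<^esub> \<longleftrightarrow> a \<odot>\<^bsub>M\<^esub> v = b \<odot>\<^bsub>M\<^esub> v"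
  by (simp add: smult_l_diff M.minus_eq_zero_iff smult_closed)

context whittaker_setting
begin

interpretation U: ring "env L" by (rule ring_env)
interpretation M: left_module "env L" N.M by (rule N.left_module_whittaker_M)

lemma cring_sub_env: "cring (sub_env Z L)"
proof -
  interpret S: ring "sub_env Z L" by (rule Z.ring_sub_env)
  show ?thesis
    by (intro cring.intro comm_monoid.intro comm_monoid_axioms.intro Z.ring_sub_env S.monoid_axioms)
      (simp add: A_central)
qed

text \<open>The ideal generated by \<open>m\<close> and \<open>c\<close> is strictly larger than
  \<open>m\<close>, hence contains the unit.\<close>

lemma maximal_ideal_inverse:
  assumes m: "maximalideal m (sub_env Z L)" and c: "c \<in> A" "c \<notin> m"
  shows "\<exists>i\<in>m. \<exists>d\<in>A. \<one>\<^bsub>env L\<^esub> = i \<oplus>\<^bsub>env L\<^esub> d \<otimes>\<^bsub>env L\<^esub> c"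
proof -
  interpret S: cring "sub_env Z L" by (rule cring_sub_env)
  interpret m: maximalideal m "sub_env Z L" by (rule m)
  let ?J = "m <+>\<^bsub>sub_env Z L\<^esub> (PIdl\<^bsub>sub_env Z L\<^esub> c)"
  have J: "ideal ?J (sub_env Z L)"
    by (rule S.add_ideals[OF m.is_ideal S.cgenideal_ideal[OF c(1)]])
  have mJ: "m \<subseteq> ?J"
  proof
    fix i assume i: "i \<in> m"
    have "\<zero>\<^bsub>sub_env Z L\<^esub> \<in> PIdl\<^bsub>sub_env Z L\<^esub> c"
      using additive_subgroup.zero_closed[OF ideal.axioms(1)[OF S.cgenideal_ideal[OF c(1)]]] .
    moreover have "i = i \<oplus>\<^bsub>sub_env Z L\<^esub> \<zero>\<^bsub>sub_env Z L\<^esub>" using m.a_subset i by auto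
    ultimately show "i \<in> ?J" using i unfolding set_add_def' by blast
  qed
  have "c = \<zero>\<^bsub>sub_env Z L\<^esub> \<oplus>\<^bsub>sub_env Z L\<^esub> c" using c by simp
  then have "c \<in> ?J" using m.zero_closed S.cgenideal_self[OF c(1)] unfolding set_add_def' by blast
  then have "?J = A" using m.I_maximal[OF J mJ] additive_subgroup.a_subset[OF ideal.axioms(1)[OF J]] c(2) by blast
  then have "\<one>\<^bsub>sub_env Z L\<^esub> \<in> ?J" using S.one_closed by blast
  then show ?thesis unfolding set_add_def' cgenideal_def by auto
qed

section \<open>The quotient of the universal Whittaker module by the span of an ideal\<close>

context
  fixes m assumes mA: "m \<subseteq> A"
begin

abbreviation "Q \<equiv> quot_module N.M (maximal_span m)"
abbreviation "quot_gen \<equiv> maximal_span m +>\<^bsub>N.M\<^esub> N.whittaker_gen"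

lemma left_module_Q: "left_module (env L) Q"
  by (rule M.left_module_quot_module[OF maximal_span_subgroup[OF mA] maximal_span_smult[OF mA]])

lemma smult_quot_class:
  "\<lbrakk>u \<in> carrier (env L); v \<in> carrier N.M\<rbrakk> \<Longrightarrow>
    u \<odot>\<^bsub>Q\<^esub> (maximal_span m +>\<^bsub>N.M\<^esub> v) = maximal_span m +>\<^bsub>N.M\<^esub> (u \<odot>\<^bsub>N.M\<^esub> v)"
  by (rule quot_class_smult[OF M.M.abelian_group_axioms maximal_span_subgroup[OF mA]])
    (simp_all add: M.smult_r_distr M.smult_closed maximal_span_smult[OF mA])

lemma smult_quot_gen_zero_iff:
  "u \<in> carrier (env L) \<Longrightarrow> u \<odot>\<^bsub>Q\<^esub> quot_gen = \<zero>\<^bsub>Q\<^esub> \<longleftrightarrow> u \<odot>\<^bsub>N.M\<^esub> N.whittaker_gen \<in> maximal_span m"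
  using quot_class_eq_zero[OF M.M.abelian_group_axioms maximal_span_subgroup[OF mA] M.smult_closed[OF _ N.whittaker_gen_closed]]
  by (simp add: smult_quot_class N.whittaker_gen_closed)

lemma quot_gen_killed: "a \<in> m \<Longrightarrow> a \<odot>\<^bsub>Q\<^esub> quot_gen = \<zero>\<^bsub>Q\<^esub>"
  using mA N.whittaker_gen_closed
  by (subst smult_quot_gen_zero_iff) (auto simp: ideal_smult_def intro!: generate.incl)

lemma whittaker_cyclic_Q: "whittaker_cyclic L gr \<pi> \<phi> x Q quot_gen"
proof (intro whittaker_cyclic.intro whittaker_cyclic_axioms.intro whittaker_setting_axioms left_module_Q)
  note wc = N.whittaker_gen_closed
  show "quot_gen \<in> carrier Q"
    by (rule quot_class_closed[OF M.M.abelian_group_axioms maximal_span_subgroup[OF mA] wc])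
  show "env_gen L y \<odot>\<^bsub>Q\<^esub> quot_gen = env_scal L (\<phi> y) \<odot>\<^bsub>Q\<^esub> quot_gen" if "y \<in> carrier N" for y
    using that subsetD[OF N.carrier_subset that] wc
    by (simp add: smult_quot_class N.whittaker_gen_vector del: N_simps)
  show "\<exists>u\<in>carrier (env L). v = u \<odot>\<^bsub>Q\<^esub> quot_gen" if v: "v \<in> carrier Q" for v
  proof -
    obtain v' where v': "v' \<in> carrier N.M" "v = maximal_span m +>\<^bsub>N.M\<^esub> v'"
      using quot_class_cases[OF M.M.abelian_group_axioms maximal_span_subgroup[OF mA] v] .
    obtain u where "u \<in> carrier (env L)" "v' = u \<odot>\<^bsub>N.M\<^esub> N.whittaker_gen" using N.whittaker_M_cyclic[OF v'(1)] .
    then show ?thesis using v'(2) wc smult_quot_class[of u N.whittaker_gen] by metis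
  qed
qed

lemma whittaker_L_eq: "whittaker_L L N \<phi> m = lie_module_of_env L Q"
  by (simp add: whittaker_L_def Let_def)

end

lemma simple_whittaker_L:
  assumes m: "maximalideal m (sub_env Z L)"
  shows "simple_lie_module L (whittaker_L L N \<phi> m)"
proof -
  interpret m: maximalideal m "sub_env Z L" by (rule m)
  have mA: "m \<subseteq> A" using m.a_subset by simp
  let ?Q = "Q m" and ?q = "quot_gen m"
  interpret Q: whittaker_cyclic L gr \<pi> \<phi> x ?Q ?q by (rule whittaker_cyclic_Q[OF mA])
  note lm = lie_module_lie_module_of_env[OF left_module_Q[OF mA]]
  have q0: "?q \<noteq> \<zero>\<^bsub>?Q\<^esub>"
    using whittaker_gen_not_in_span[OF m.is_ideal] m.I_notcarr N.whittaker_gen_closed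
      quot_class_eq_zero[OF M.M.abelian_group_axioms maximal_span_subgroup[OF mA], of N.whittaker_gen] by auto
  have "W = {\<zero>\<^bsub>?Q\<^esub>} \<or> W = carrier ?Q" if W: "lie_submodule L W (lie_module_of_env L ?Q)" for W
  proof (subst disj_commute, rule disjCI)
    assume ne: "W \<noteq> {\<zero>\<^bsub>?Q\<^esub>}"
    have sub: "\<zero>\<^bsub>?Q\<^esub> \<in> W" "W \<subseteq> carrier ?Q" "\<And>y z. \<lbrakk>y \<in> W; z \<in> W\<rbrakk> \<Longrightarrow> y \<oplus>\<^bsub>?Q\<^esub> z \<in> W"
      using W unfolding lie_submodule_def submodule_def by (simp_all del: quot_module_simps)
    have cl: "u \<odot>\<^bsub>?Q\<^esub> v \<in> W" if "u \<in> carrier (env L)" "v \<in> W" for u v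
      by (rule lie_submodule_env_closed[OF left_module_Q[OF mA] W _ _ _ _ that]) simp_all
    obtain v where v: "v \<in> W" "v \<noteq> \<zero>\<^bsub>?Q\<^esub>" using sub(1) ne by blast
    obtain u c where uc: "u \<in> carrier (env L)" "c \<in> A" "c \<odot>\<^bsub>?Q\<^esub> ?q \<noteq> \<zero>\<^bsub>?Q\<^esub>" "u \<odot>\<^bsub>?Q\<^esub> v = c \<odot>\<^bsub>?Q\<^esub> ?q"
      using Q.reaches_generator[of v] v sub(2) by blast
    have "c \<notin> m" using quot_gen_killed[OF mA] uc(3) by blast
    then obtain i d where id: "i \<in> m" "d \<in> A" "\<one>\<^bsub>env L\<^esub> = i \<oplus>\<^bsub>env L\<^esub> d \<otimes>\<^bsub>env L\<^esub> c"
      using maximal_ideal_inverse[OF m uc(2)] by blast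
    have iA: "i \<in> A" using id(1) mA by blast
    \<comment> \<open>As \<open>i\<close> kills the generator, the decomposition of the unit says
      that \<open>d\<close> undoes \<open>c\<close> on it.\<close>
    have "?q = i \<odot>\<^bsub>?Q\<^esub> ?q \<oplus>\<^bsub>?Q\<^esub> d \<odot>\<^bsub>?Q\<^esub> (c \<odot>\<^bsub>?Q\<^esub> ?q)"
      using Q.V.smult_one[OF Q.w_closed] id(2,3) iA uc(2) Q.w_closed
      by (simp add: Q.V.smult_l_distr Q.V.smult_assoc del: quot_module_simps)
    also have "\<dots> = d \<odot>\<^bsub>?Q\<^esub> (u \<odot>\<^bsub>?Q\<^esub> v)"
      using quot_gen_killed[OF mA id(1)] uc(4) id(2) uc(2) Q.w_closed Q.V.smult_closed
      by (simp del: quot_module_simps)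
    also have "\<dots> \<in> W" using cl[OF A_closed(1)[OF id(2)] cl[OF uc(1) v(1)]] .
    finally have "?q \<in> W" .
    then have "carrier ?Q \<subseteq> W" using Q.cyclic cl by blast
    then show "W = carrier ?Q" using sub(2) by blast
  qed
  moreover have "carrier ?Q \<noteq> {\<zero>\<^bsub>?Q\<^esub>}" using q0 Q.w_closed by blast
  ultimately show ?thesis
    unfolding simple_lie_module_def whittaker_L_eq[OF mA] using lm by (simp del: quot_module_simps)
qed

lemma simple_whittaker_module:
  fixes V :: "('g, 'v) lie_module"
  assumes wh: "whittaker_module L N \<phi> V" and simple: "simple_lie_module L V"
  shows "\<exists>m. maximalideal m (sub_env Z L) \<and> lie_module_iso L V (whittaker_L L N \<phi> m)"
proof -
  obtain v where lmV: "lie_module L V" and wv: "whittaker_vector N \<phi> V v"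
    and gen: "\<And>W. \<lbrakk>lie_submodule L W V; v \<in> W\<rbrakk> \<Longrightarrow> W = carrier V"
    using wh unfolding whittaker_module_def by blast
  interpret V: lie_module L V by (rule lmV)
  interpret E: left_module "env L" "env_module V" by (rule V.left_module_env_module)
  let ?E = "env_module V"
  have simpleD: "W = {\<zero>\<^bsub>V\<^esub>} \<or> W = carrier V" if "lie_submodule L W V" for W
    using simple that unfolding simple_lie_module_def by blast
  have nz: "carrier V \<noteq> {\<zero>\<^bsub>V\<^esub>}" using simple unfolding simple_lie_module_def by blast
  have subI: "lie_submodule L W V" if "W \<subseteq> carrier V" "\<zero>\<^bsub>V\<^esub> \<in> W" "\<And>y z. \<lbrakk>y \<in> W; z \<in> W\<rbrakk> \<Longrightarrow> y \<oplus>\<^bsub>V\<^esub> z \<in> W"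
    "\<And>u y. \<lbrakk>u \<in> carrier (env L); y \<in> W\<rbrakk> \<Longrightarrow> u \<odot>\<^bsub>?E\<^esub> y \<in> W" for W
    by (rule lie_submoduleI[OF lmV, of ?E]) (use that in \<open>simp_all add: V.env_scal_smult_module V.env_gen_smult_module\<close>)
  have vc: "v \<in> carrier ?E" using wv by (simp add: whittaker_vector_def)
  have Ez: "\<zero>\<^bsub>V\<^esub> \<in> carrier V" using E.M.zero_closed by simp
  have v0: "v \<noteq> \<zero>\<^bsub>V\<^esub>"
  proof
    assume "v = \<zero>\<^bsub>V\<^esub>"
    moreover have "lie_submodule L {\<zero>\<^bsub>V\<^esub>} V"
      by (rule subI) (use Ez E.smult_r_zero E.M.l_zero[OF E.M.zero_closed] in auto)
    ultimately show False using gen[of "{\<zero>\<^bsub>V\<^esub>}"] nz by simp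
  qed
  have cyc: "\<exists>u\<in>carrier (env L). y = u \<odot>\<^bsub>?E\<^esub> v" if "y \<in> carrier V" for y
  proof -
    let ?W = "{u \<odot>\<^bsub>?E\<^esub> v | u. u \<in> carrier (env L)}"
    have "lie_submodule L ?W V"
    proof (rule subI)
      show "?W \<subseteq> carrier V" using E.smult_closed[OF _ vc] by auto
      show "\<zero>\<^bsub>V\<^esub> \<in> ?W" using E.smult_l_zero[OF vc] by force
      fix y assume "y \<in> ?W"
      then obtain u where u: "u \<in> carrier (env L)" "y = u \<odot>\<^bsub>?E\<^esub> v" by blast
      show "y \<oplus>\<^bsub>V\<^esub> z \<in> ?W" if "z \<in> ?W" for z
      proof -
        obtain t where t: "t \<in> carrier (env L)" "z = t \<odot>\<^bsub>?E\<^esub> v" using \<open>z \<in> ?W\<close> by blast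
        have "y \<oplus>\<^bsub>V\<^esub> z = (u \<oplus>\<^bsub>env L\<^esub> t) \<odot>\<^bsub>?E\<^esub> v" using E.smult_l_distr[OF u(1) t(1) vc] u t by simp
        then show ?thesis using u t by blast
      qed
      show "t \<odot>\<^bsub>?E\<^esub> y \<in> ?W" if t: "t \<in> carrier (env L)" for t
        using E.smult_assoc[OF t u(1) vc] u t by (metis (mono_tags, lifting) U.m_closed mem_Collect_eq)
    qed
    moreover have "v \<in> ?W" using E.smult_one[OF vc] by force
    ultimately have "?W = carrier V" by (rule gen)
    then show ?thesis using that by blast
  qed
  interpret C: whittaker_cyclic L gr \<pi> \<phi> x ?E v
  proof (intro whittaker_cyclic.intro whittaker_cyclic_axioms.intro whittaker_setting_axioms E.left_module_axioms vc)
    show "env_gen L y \<odot>\<^bsub>?E\<^esub> v = env_scal L (\<phi> y) \<odot>\<^bsub>?E\<^esub> v" if "y \<in> carrier N" for y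
      using wv that subsetD[OF N.carrier_subset that]
      by (simp add: whittaker_vector_def V.env_gen_smult_module V.env_scal_smult_module)
  qed (use cyc in simp)
  define m where "m = {a \<in> A. a \<odot>\<^bsub>?E\<^esub> v = \<zero>\<^bsub>V\<^esub>}"
  have mA: "m \<subseteq> A" by (auto simp: m_def)
  interpret S: cring "sub_env Z L" by (rule cring_sub_env)
  have m_ideal: "ideal m (sub_env Z L)"
  proof (rule idealI[OF Z.ring_sub_env])
    show "subgroup m (add_monoid (sub_env Z L))"
    proof (rule group.subgroupI)
      show "group (add_monoid (sub_env Z L))" by (rule S.a_group)
      show "m \<subseteq> carrier (add_monoid (sub_env Z L))" using mA by simp
      show "m \<noteq> {}" using E.smult_l_zero[OF vc] by (auto simp: m_def)
      show "a \<otimes>\<^bsub>add_monoid (sub_env Z L)\<^esub> b \<in> m" if "a \<in> m" "b \<in> m" for a b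
        using that E.smult_l_distr[OF _ _ vc, of a b] E.M.l_zero[OF E.M.zero_closed] by (simp add: m_def)
      show "inv\<^bsub>add_monoid (sub_env Z L)\<^esub> a \<in> m" if a: "a \<in> m" for a
      proof -
        have aA: "a \<in> A" "\<ominus>\<^bsub>sub_env Z L\<^esub> a \<in> A" using a mA S.a_inv_closed[of a] by auto
        have "(\<ominus>\<^bsub>sub_env Z L\<^esub> a) \<oplus>\<^bsub>env L\<^esub> a = \<zero>\<^bsub>env L\<^esub>" using S.l_neg[OF aA(1)] by simp
        then have "(\<ominus>\<^bsub>sub_env Z L\<^esub> a) \<odot>\<^bsub>?E\<^esub> v \<oplus>\<^bsub>V\<^esub> a \<odot>\<^bsub>?E\<^esub> v = \<zero>\<^bsub>V\<^esub>"
          using E.smult_l_distr[of "\<ominus>\<^bsub>sub_env Z L\<^esub> a" a v] aA vc E.smult_l_zero[OF vc] by simp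
        then have "(\<ominus>\<^bsub>sub_env Z L\<^esub> a) \<odot>\<^bsub>?E\<^esub> v = \<zero>\<^bsub>V\<^esub>"
          using a E.M.r_zero[OF E.smult_closed[OF A_closed(1)[OF aA(2)] vc]] by (simp add: m_def)
        then show ?thesis using aA by (simp add: m_def a_inv_def)
      qed
    qed
    fix a b assume a: "a \<in> m" and b: "b \<in> carrier (sub_env Z L)"
    have "(b \<otimes>\<^bsub>env L\<^esub> a) \<odot>\<^bsub>?E\<^esub> v = \<zero>\<^bsub>V\<^esub>"
      using a b E.smult_assoc[of b a v] vc E.smult_r_zero[of b] by (simp add: m_def)
    then show "b \<otimes>\<^bsub>sub_env Z L\<^esub> a \<in> m" "a \<otimes>\<^bsub>sub_env Z L\<^esub> b \<in> m"
      using a b A_central[of a b] by (simp_all add: m_def)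
  qed
  have one_m: "\<one>\<^bsub>env L\<^esub> \<notin> m" using v0 E.smult_one[OF vc] by (simp add: m_def)
  have inverse: "\<exists>c\<in>A. \<one>\<^bsub>env L\<^esub> \<ominus>\<^bsub>env L\<^esub> a \<otimes>\<^bsub>env L\<^esub> c \<in> m" if a: "a \<in> A" "a \<notin> m" for a
  proof -
    have ac: "a \<in> carrier (env L)" using a by simp
    \<comment> \<open>A Schur argument: \<open>a\<close> is central, so its image and its kernel are
      submodules, and by simplicity they are everything and zero.\<close>
    let ?W = "{a \<odot>\<^bsub>?E\<^esub> y | y. y \<in> carrier V}" and ?K = "{y \<in> carrier V. a \<odot>\<^bsub>?E\<^esub> y = \<zero>\<^bsub>V\<^esub>}"
    have ecl: "u \<odot>\<^bsub>?E\<^esub> y \<in> carrier V" if "u \<in> carrier (env L)" "y \<in> carrier V" for u y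
      using E.smult_closed that by simp
    have com: "u \<odot>\<^bsub>?E\<^esub> (a \<odot>\<^bsub>?E\<^esub> y) = a \<odot>\<^bsub>?E\<^esub> (u \<odot>\<^bsub>?E\<^esub> y)" if "u \<in> carrier (env L)" "y \<in> carrier V" for u y
      using C.A_smult_commute[OF a(1)] that by simp
    have distr: "a \<odot>\<^bsub>?E\<^esub> (y \<oplus>\<^bsub>V\<^esub> z) = a \<odot>\<^bsub>?E\<^esub> y \<oplus>\<^bsub>V\<^esub> a \<odot>\<^bsub>?E\<^esub> z" if "y \<in> carrier V" "z \<in> carrier V" for y z
      using E.smult_r_distr[OF ac] that by simp
    have acl: "y \<oplus>\<^bsub>V\<^esub> z \<in> carrier V" if "y \<in> carrier V" "z \<in> carrier V" for y z
      using E.M.a_closed that by simp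
    have a0: "a \<odot>\<^bsub>?E\<^esub> \<zero>\<^bsub>V\<^esub> = \<zero>\<^bsub>V\<^esub>" using E.smult_r_zero[OF ac] by simp
    have zz: "\<zero>\<^bsub>V\<^esub> \<oplus>\<^bsub>V\<^esub> \<zero>\<^bsub>V\<^esub> = \<zero>\<^bsub>V\<^esub>" using E.M.l_zero[OF E.M.zero_closed] by simp
    have av: "a \<odot>\<^bsub>?E\<^esub> v \<noteq> \<zero>\<^bsub>V\<^esub>" using a by (simp add: m_def)
    have vV: "v \<in> carrier V" using vc by simp
    have "lie_submodule L ?W V"
    proof (rule subI)
      show "?W \<subseteq> carrier V" using ecl[OF ac] by blast
      show "\<zero>\<^bsub>V\<^esub> \<in> ?W" using a0 Ez by force
      show "y \<oplus>\<^bsub>V\<^esub> z \<in> ?W" if "y \<in> ?W" "z \<in> ?W" for y z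
        using that distr acl by (clarify) (metis (mono_tags, lifting))
      show "u \<odot>\<^bsub>?E\<^esub> y \<in> ?W" if "u \<in> carrier (env L)" "y \<in> ?W" for u y
        using that com ecl by blast
    qed
    moreover have "a \<odot>\<^bsub>?E\<^esub> v \<in> ?W" using vV by blast
    ultimately have "?W = carrier V" using simpleD[of ?W] av by blast
    then obtain y where y: "y \<in> carrier V" "v = a \<odot>\<^bsub>?E\<^esub> y" using vV by blast
    have "lie_submodule L ?K V"
    proof (rule subI)
      show "?K \<subseteq> carrier V" by blast
      show "\<zero>\<^bsub>V\<^esub> \<in> ?K" using a0 Ez by simp
      show "y \<oplus>\<^bsub>V\<^esub> z \<in> ?K" if "y \<in> ?K" "z \<in> ?K" for y z
        using that distr acl zz by simp
      show "u \<odot>\<^bsub>?E\<^esub> y \<in> ?K" if u: "u \<in> carrier (env L)" and y: "y \<in> ?K" for u y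
        using com[OF u, of y] y ecl[OF u] E.smult_r_zero[OF u] by simp
    qed
    then have K0: "?K = {\<zero>\<^bsub>V\<^esub>}" using simpleD[of ?K] av vV by blast
    have "env_gen L n \<odot>\<^bsub>?E\<^esub> y = env_scal L (\<phi> n) \<odot>\<^bsub>?E\<^esub> y" if n: "n \<in> carrier N" for n
    proof -
      have nL: "n \<in> carrier L" by (rule subsetD[OF N.carrier_subset n])
      have yE: "y \<in> carrier ?E" using y by simp
      \<comment> \<open>\<open>a\<close> commutes with \<open>shifted n\<close> and sends
        \<open>y\<close> to \<open>v\<close>, which \<open>shifted n\<close> kills; injectivity of
        \<open>a\<close> then shows that \<open>y\<close> is a Whittaker vector.\<close>
      have "a \<odot>\<^bsub>?E\<^esub> (C.shifted n \<odot>\<^bsub>?E\<^esub> y) = C.shifted n \<odot>\<^bsub>?E\<^esub> v"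
        using com[OF C.shifted_closed[OF nL] y(1)] y(2) by simp
      also have "\<dots> = \<zero>\<^bsub>V\<^esub>" using C.shifted_w[OF n] by simp
      finally have "C.shifted n \<odot>\<^bsub>?E\<^esub> y \<in> ?K" using ecl[OF C.shifted_closed[OF nL] y(1)] by simp
      then have "C.shifted n \<odot>\<^bsub>?E\<^esub> y = \<zero>\<^bsub>?E\<^esub>" using K0 by simp
      then show ?thesis using C.shifted_zero_iff[OF nL yE] by blast
    qed
    then obtain c where c: "c \<in> A" "y = c \<odot>\<^bsub>?E\<^esub> v" using C.whittaker_vectors[of y] y(1) by auto
    have "\<one>\<^bsub>env L\<^esub> \<odot>\<^bsub>?E\<^esub> v = (a \<otimes>\<^bsub>env L\<^esub> c) \<odot>\<^bsub>?E\<^esub> v"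
      unfolding E.smult_assoc[OF ac A_closed(1)[OF c(1)] vc] c(2)[symmetric] y(2)[symmetric] by (rule E.smult_one[OF vc])
    then have "(\<one>\<^bsub>env L\<^esub> \<ominus>\<^bsub>env L\<^esub> a \<otimes>\<^bsub>env L\<^esub> c) \<odot>\<^bsub>?E\<^esub> v = \<zero>\<^bsub>?E\<^esub>"
      using E.smult_eq_iff[OF _ _ vc, of "\<one>\<^bsub>env L\<^esub>" "a \<otimes>\<^bsub>env L\<^esub> c"] ac c(1) by simp
    \<comment> \<open>The difference is rewritten with the scalar -1, because membership in
      \<open>A\<close> is at hand for sums, products and scalars.\<close>
    moreover have "\<one>\<^bsub>env L\<^esub> \<ominus>\<^bsub>env L\<^esub> a \<otimes>\<^bsub>env L\<^esub> c = \<one>\<^bsub>env L\<^esub> \<oplus>\<^bsub>env L\<^esub> env_scal L (-1) \<otimes>\<^bsub>env L\<^esub> (a \<otimes>\<^bsub>env L\<^esub> c)"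
    proof -
      let ?p = "a \<otimes>\<^bsub>env L\<^esub> c"
      have pc: "?p \<in> carrier (env L)" using ac c(1) by simp
      have "env_scal L (-1) \<otimes>\<^bsub>env L\<^esub> ?p \<oplus>\<^bsub>env L\<^esub> ?p = env_scal L (-1 + 1) \<otimes>\<^bsub>env L\<^esub> ?p"
        using pc by (simp only: env_scal_add U.l_distr env_scal_closed env_class_one U.l_one U.one_closed)
      then have "\<ominus>\<^bsub>env L\<^esub> ?p = env_scal L (-1) \<otimes>\<^bsub>env L\<^esub> ?p"
        using pc by (intro U.minus_equality) (simp_all add: env_scal_zero)
      then show ?thesis by (simp add: a_minus_def)
    qed
    then have "\<one>\<^bsub>env L\<^esub> \<ominus>\<^bsub>env L\<^esub> a \<otimes>\<^bsub>env L\<^esub> c \<in> A" using a(1) c(1) by simp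
    ultimately show ?thesis using c(1) by (auto simp: m_def)
  qed
  have max: "maximalideal m (sub_env Z L)"
  proof (rule maximalidealI[OF m_ideal])
    show "carrier (sub_env Z L) \<noteq> m" using one_m A_closed(6) by blast
    fix I assume I: "ideal I (sub_env Z L)" "m \<subseteq> I" "I \<subseteq> carrier (sub_env Z L)"
    interpret I: ideal I "sub_env Z L" by (rule I(1))
    show "I = m \<or> I = carrier (sub_env Z L)"
    proof (subst disj_commute, rule disjCI)
      assume "I \<noteq> m"
      then obtain a where a: "a \<in> I" "a \<notin> m" using I(2) by blast
      then obtain c where c: "c \<in> A" "\<one>\<^bsub>env L\<^esub> \<ominus>\<^bsub>env L\<^esub> a \<otimes>\<^bsub>env L\<^esub> c \<in> m"
        using inverse I(3) by blast
      have ac: "a \<otimes>\<^bsub>env L\<^esub> c \<in> I" using I.I_r_closed[OF a(1) c(1)] by simp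
      have "a \<otimes>\<^bsub>env L\<^esub> c \<oplus>\<^bsub>env L\<^esub> (\<one>\<^bsub>env L\<^esub> \<ominus>\<^bsub>env L\<^esub> a \<otimes>\<^bsub>env L\<^esub> c) \<in> I"
        using I.a_closed[OF ac subsetD[OF I(2) c(2)]] by simp
      moreover have "a \<in> A" using a(1) I(3) by blast
      ultimately have "\<one>\<^bsub>sub_env Z L\<^esub> \<in> I" using c(1) by (simp add: U.add_minus_cancel)
      then show "I = carrier (sub_env Z L)" by (rule I.one_imp_carrier)
    qed
  qed
  let ?Q = "Q m" and ?q = "quot_gen m"
  interpret Q: whittaker_cyclic L gr \<pi> \<phi> x ?Q ?q by (rule whittaker_cyclic_Q[OF mA])
  have Q_V: "u \<odot>\<^bsub>?E\<^esub> v = \<zero>\<^bsub>V\<^esub>" if "u \<in> carrier (env L)" "u \<odot>\<^bsub>?Q\<^esub> ?q = \<zero>\<^bsub>?Q\<^esub>" for u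
    by (rule maximal_span_universal[OF mA lmV wv])
      (use that smult_quot_gen_zero_iff[OF mA, of u] in \<open>auto simp: m_def\<close>)
  \<comment> \<open>The converse of \<open>Q_V\<close>. The multiples \<open>t q\<close> with
    \<open>t\<close> killing \<open>v\<close> form a submodule of the simple quotient; it misses the
    generator, as otherwise \<open>v\<close> would be zero, and so it is zero.\<close>
  have V_Q: "u \<odot>\<^bsub>?Q\<^esub> ?q = \<zero>\<^bsub>?Q\<^esub>" if u: "u \<in> carrier (env L)" "u \<odot>\<^bsub>?E\<^esub> v = \<zero>\<^bsub>V\<^esub>" for u
  proof -
    let ?W = "{t \<odot>\<^bsub>?Q\<^esub> ?q | t. t \<in> carrier (env L) \<and> t \<odot>\<^bsub>?E\<^esub> v = \<zero>\<^bsub>V\<^esub>}"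
    have "lie_submodule L ?W (lie_module_of_env L ?Q)"
    proof (rule lie_submoduleI[OF lie_module_lie_module_of_env[OF left_module_Q[OF mA]], of ?Q])
      show "?W \<subseteq> carrier ?Q" using Q.V.smult_closed[OF _ Q.w_closed] by blast
      show "\<zero>\<^bsub>?Q\<^esub> \<in> ?W" using Q.V.smult_l_zero[OF Q.w_closed] E.smult_l_zero[OF vc] U.zero_closed
        by (intro CollectI exI[of _ "\<zero>\<^bsub>env L\<^esub>"] conjI) (simp_all del: quot_module_simps)
      fix y assume "y \<in> ?W"
      then obtain t where t: "y = t \<odot>\<^bsub>?Q\<^esub> ?q" "t \<in> carrier (env L)" "t \<odot>\<^bsub>?E\<^esub> v = \<zero>\<^bsub>V\<^esub>" by blast
      show "y \<oplus>\<^bsub>?Q\<^esub> z \<in> ?W" if z: "z \<in> ?W" for z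
      proof -
        obtain t' where t': "z = t' \<odot>\<^bsub>?Q\<^esub> ?q" "t' \<in> carrier (env L)" "t' \<odot>\<^bsub>?E\<^esub> v = \<zero>\<^bsub>V\<^esub>" using z by blast
        have "y \<oplus>\<^bsub>?Q\<^esub> z = (t \<oplus>\<^bsub>env L\<^esub> t') \<odot>\<^bsub>?Q\<^esub> ?q"
          using Q.V.smult_l_distr[OF t(2) t'(2) Q.w_closed] t(1) t'(1) by simp
        moreover have "(t \<oplus>\<^bsub>env L\<^esub> t') \<odot>\<^bsub>?E\<^esub> v = \<zero>\<^bsub>V\<^esub>"
          using E.smult_l_distr[OF t(2) t'(2) vc] t(3) t'(3) E.M.l_zero[OF E.M.zero_closed] by simp
        ultimately show ?thesis using U.a_closed[OF t(2) t'(2)] by blast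
      qed
      show "u \<odot>\<^bsub>?Q\<^esub> y \<in> ?W" if u: "u \<in> carrier (env L)" for u
      proof -
        have "u \<odot>\<^bsub>?Q\<^esub> y = (u \<otimes>\<^bsub>env L\<^esub> t) \<odot>\<^bsub>?Q\<^esub> ?q"
          using Q.V.smult_assoc[OF u t(2) Q.w_closed] t(1) by simp
        moreover have "(u \<otimes>\<^bsub>env L\<^esub> t) \<odot>\<^bsub>?E\<^esub> v = \<zero>\<^bsub>V\<^esub>"
          using E.smult_assoc[OF u t(2) vc] t(3) E.smult_r_zero[OF u] by simp
        ultimately show ?thesis using U.m_closed[OF u t(2)] by blast
      qed
    qed simp_all
    then have "?W = {\<zero>\<^bsub>?Q\<^esub>} \<or> ?W = carrier ?Q"
      using simple_whittaker_L[OF max] unfolding simple_lie_module_def whittaker_L_eq[OF mA]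
      by (simp del: quot_module_simps)
    moreover have "?q \<notin> ?W"
    proof
      assume "?q \<in> ?W"
      then obtain t where t: "?q = t \<odot>\<^bsub>?Q\<^esub> ?q" "t \<in> carrier (env L)" "t \<odot>\<^bsub>?E\<^esub> v = \<zero>\<^bsub>V\<^esub>" by blast
      have "(\<one>\<^bsub>env L\<^esub> \<ominus>\<^bsub>env L\<^esub> t) \<odot>\<^bsub>?Q\<^esub> ?q = \<zero>\<^bsub>?Q\<^esub>"
        using Q.V.smult_eq_iff[OF U.one_closed t(2) Q.w_closed] t(1) Q.V.smult_one[OF Q.w_closed] by simp
      then have "(\<one>\<^bsub>env L\<^esub> \<ominus>\<^bsub>env L\<^esub> t) \<odot>\<^bsub>?E\<^esub> v = \<zero>\<^bsub>?E\<^esub>" using Q_V t(2) by simp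
      then have "v = t \<odot>\<^bsub>?E\<^esub> v"
        using E.smult_eq_iff[OF U.one_closed t(2) vc] E.smult_one[OF vc] by simp
      then show False using t(3) v0 by simp
    qed
    ultimately have "?W = {\<zero>\<^bsub>?Q\<^esub>}" using Q.w_closed by blast
    then show ?thesis using u by blast
  qed
  have eq_iff: "u \<odot>\<^bsub>?E\<^esub> v = t \<odot>\<^bsub>?E\<^esub> v \<longleftrightarrow> u \<odot>\<^bsub>?Q\<^esub> ?q = t \<odot>\<^bsub>?Q\<^esub> ?q"
    if "u \<in> carrier (env L)" "t \<in> carrier (env L)" for u t
  proof -
    have "u \<odot>\<^bsub>?E\<^esub> v = t \<odot>\<^bsub>?E\<^esub> v \<longleftrightarrow> (u \<ominus>\<^bsub>env L\<^esub> t) \<odot>\<^bsub>?E\<^esub> v = \<zero>\<^bsub>V\<^esub>"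
      using E.smult_eq_iff[OF that vc] by simp
    also have "\<dots> \<longleftrightarrow> (u \<ominus>\<^bsub>env L\<^esub> t) \<odot>\<^bsub>?Q\<^esub> ?q = \<zero>\<^bsub>?Q\<^esub>"
      using Q_V V_Q U.minus_closed[OF that] by blast
    also have "\<dots> \<longleftrightarrow> u \<odot>\<^bsub>?Q\<^esub> ?q = t \<odot>\<^bsub>?Q\<^esub> ?q" by (rule Q.V.smult_eq_iff[OF that Q.w_closed])
    finally show ?thesis .
  qed
  \<comment> \<open>The choice of \<open>u\<close> is immaterial: by \<open>eq_iff\<close> two
    candidates agree on the generator of the quotient as soon as they agree on
    \<open>v\<close>.\<close>
  define f where "f y = (SOME u. u \<in> carrier (env L) \<and> y = u \<odot>\<^bsub>?E\<^esub> v) \<odot>\<^bsub>?Q\<^esub> ?q" for y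
  have f: "f (u \<odot>\<^bsub>?E\<^esub> v) = u \<odot>\<^bsub>?Q\<^esub> ?q" if u: "u \<in> carrier (env L)" for u
  proof -
    have "\<exists>t. t \<in> carrier (env L) \<and> u \<odot>\<^bsub>?E\<^esub> v = t \<odot>\<^bsub>?E\<^esub> v" using u by blast
    note s = someI_ex[OF this]
    show ?thesis unfolding f_def using iffD1[OF eq_iff[OF u conjunct1[OF s]] conjunct2[OF s]] by (rule sym)
  qed
  have f_act: "f (t \<odot>\<^bsub>?E\<^esub> y) = t \<odot>\<^bsub>?Q\<^esub> f y" if t: "t \<in> carrier (env L)" and y: "y \<in> carrier V" for t y
  proof -
    obtain u where u: "u \<in> carrier (env L)" "y = u \<odot>\<^bsub>?E\<^esub> v" using cyc y by blast
    show ?thesis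
      using f[OF U.m_closed[OF t u(1)]]
      unfolding u(2) f[OF u(1)] E.smult_assoc[OF t u(1) vc] Q.V.smult_assoc[OF t u(1) Q.w_closed] .
  qed
  have f_closed: "f y \<in> carrier ?Q" if y: "y \<in> carrier V" for y
  proof -
    obtain u where u: "u \<in> carrier (env L)" "y = u \<odot>\<^bsub>?E\<^esub> v" using cyc y by blast
    show ?thesis unfolding u(2) f[OF u(1)] by (rule Q.V.smult_closed[OF u(1) Q.w_closed])
  qed
  have f_add: "f (y \<oplus>\<^bsub>V\<^esub> z) = f y \<oplus>\<^bsub>?Q\<^esub> f z" if y: "y \<in> carrier V" and z: "z \<in> carrier V" for y z
  proof -
    obtain u where u: "u \<in> carrier (env L)" "y = u \<odot>\<^bsub>?E\<^esub> v" using cyc y by blast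
    obtain t where t: "t \<in> carrier (env L)" "z = t \<odot>\<^bsub>?E\<^esub> v" using cyc z by blast
    have "y \<oplus>\<^bsub>V\<^esub> z = (u \<oplus>\<^bsub>env L\<^esub> t) \<odot>\<^bsub>?E\<^esub> v" using E.smult_l_distr[OF u(1) t(1) vc] u(2) t(2) by simp
    then have "f (y \<oplus>\<^bsub>V\<^esub> z) = (u \<oplus>\<^bsub>env L\<^esub> t) \<odot>\<^bsub>?Q\<^esub> ?q" using f[OF U.a_closed[OF u(1) t(1)]] by (rule ssubst)
    also have "\<dots> = f y \<oplus>\<^bsub>?Q\<^esub> f z"
      unfolding u(2) t(2) f[OF u(1)] f[OF t(1)] by (rule Q.V.smult_l_distr[OF u(1) t(1) Q.w_closed])
    finally show ?thesis .
  qed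
  have inj: "y = z" if y: "y \<in> carrier V" and z: "z \<in> carrier V" and e: "f y = f z" for y z
  proof -
    obtain u where u: "u \<in> carrier (env L)" "y = u \<odot>\<^bsub>?E\<^esub> v" using cyc y by blast
    obtain t where t: "t \<in> carrier (env L)" "z = t \<odot>\<^bsub>?E\<^esub> v" using cyc z by blast
    show ?thesis using e unfolding u(2) t(2) f[OF u(1)] f[OF t(1)] by (rule iffD2[OF eq_iff[OF u(1) t(1)]])
  qed
  have surj: "y \<in> f ` carrier V" if y: "y \<in> carrier ?Q" for y
  proof -
    obtain u where u: "u \<in> carrier (env L)" "y = u \<odot>\<^bsub>?Q\<^esub> ?q" using Q.cyclic[OF y] by blast
    have "u \<odot>\<^bsub>?E\<^esub> v \<in> carrier V" using E.smult_closed[OF u(1) vc] by simp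
    then show ?thesis unfolding u(2) f[OF u(1), symmetric] by (rule imageI)
  qed
  have "lie_module_iso L V (lie_module_of_env L ?Q)"
    unfolding lie_module_iso_def
  proof (intro bexI[of _ f] conjI ballI)
    show "f \<in> module_hom complex_ring V (lie_module_of_env L ?Q)"
      unfolding module_hom_def
      using f_closed f_add f_act[OF env_scal_closed]
      by (auto simp: V.env_scal_smult_module simp del: quot_module_simps)
    show "bij_betw f (carrier V) (carrier (lie_module_of_env L ?Q))"
      unfolding bij_betw_def inj_on_def using inj f_closed surj
      by (auto simp del: quot_module_simps)
    show "f (lact V y z) = lact (lie_module_of_env L ?Q) y (f z)" if "y \<in> carrier L" "z \<in> carrier V" for y z
      using f_act[OF env_gen_closed] that by (simp add: V.env_gen_smult_module del: quot_module_simps)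
  qed
  then show ?thesis using max whittaker_L_eq[OF mA] by metis
qed

end

theorem corollary4p2p3:
  fixes \<gg> :: "'g lie_algebra"
    and gr :: "'q::linordered_ab_group_add \<Rightarrow> 'g set"
    and \<pi> :: "'q \<Rightarrow> int"
    and \<phi> :: "'g \<Rightarrow> complex"
    and x :: "'q \<Rightarrow> 'g"
  assumes Q_free: "\<exists>B :: 'q set. (additive_group :: 'q monoid) \<cong> free_Abelian_group B"
    and pi_add: "\<And>\<alpha> \<beta>. \<pi> (\<alpha> + \<beta>) = \<pi> \<alpha> + \<pi> \<beta>"
    and pi_mono: "\<And>\<alpha> \<beta>. \<alpha> \<le> \<beta> \<Longrightarrow> \<pi> \<alpha> \<le> \<pi> \<beta>"
    and graded: "graded_lie_algebra \<gg> gr"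
    and good: "Q_good \<gg> gr \<pi>"
    and x_choice: "\<And>\<alpha>. \<alpha> \<in> gr_support \<gg> gr - central_degrees \<gg> gr \<pi> \<Longrightarrow>
      x \<alpha> \<in> gr \<alpha> \<and> x \<alpha> \<noteq> \<zero>\<^bsub>\<gg>\<^esub> \<and> x \<alpha> \<notin> carrier (lie_Z_minus \<gg> gr \<pi>)"
    and phi_hom: "\<phi> \<in> lie_hom (lie_n \<gg> gr \<pi>) complex_lie"
    and nonsing: "nonsingular \<gg> gr \<pi> x \<phi>"
  shows "(\<forall>m. maximalideal m (sub_env (lie_Z_minus \<gg> gr \<pi>) \<gg>) \<longrightarrow>
            simple_lie_module \<gg> (whittaker_L \<gg> (lie_n \<gg> gr \<pi>) \<phi> m))
       \<and> (\<forall>V :: ('g, 'v) lie_module.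
            whittaker_module \<gg> (lie_n \<gg> gr \<pi>) \<phi> V \<and> simple_lie_module \<gg> V \<longrightarrow>
            (\<exists>m. maximalideal m (sub_env (lie_Z_minus \<gg> gr \<pi>) \<gg>) \<and>
                 lie_module_iso \<gg> V (whittaker_L \<gg> (lie_n \<gg> gr \<pi>) \<phi> m)))"
proof -
  interpret whittaker_setting \<gg> gr \<pi> \<phi> x
    by (intro whittaker_setting.intro whittaker_setting_axioms.intro graded pi_add pi_mono good x_choice phi_hom nonsing)
  show ?thesis using simple_whittaker_L simple_whittaker_module by blast
qed

end
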